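(* Let $k$ be a field, $G$ a group, $\Phi: G\times G\times G\to k^*$ a (normalized) 3-cocycle, $R=\sum_{C\in\mathcal{C}}R_C C$ a ramification datum of $G$, and $Q=Q(G,R)$ the associated Hopf quiver. Then the set of graded Majid algebra structures on the path coalgebra $kQ$ with $kQ_0\cong(kG,\Phi,\mathcal{S},\alpha,\beta)$ as a sub Majid algebra is in one-to-one correspondence with the set of collections $(M_C)_{C\in\mathcal{C}}$ where $M_C$ is a $\tilde{\Phi}_C$-representation of $Z_C$ of dimension $R_C$.
   Context: Tensor products are over $k$; $\epsilon$ is the unit of $G$. A (normalized) 3-cocycle satisfies $\Phi(e,f,g)\Phi(e,fg,h)\Phi(f,g,h)=\Phi(ef,g,h)\Phi(e,f,gh)$ and $\Phi(\epsilon,e,f)=\Phi(e,\epsilon,f)=\Phi(e,f,\epsilon)=1$ for all $e,f,g,h\in G$. A Majid algebra (dual quasi-Hopf algebra) is a coalgebra $(H,\Delta,\varepsilon)$ with a coalgebra map $H\otimes H\to H$ (product), a group-like unit $1$, a convolution-invertible linear map $\Phi:H^{\otimes3}\to k$ (reassociator), a coalgebra antimorphism $\mathcal{S}:H\to H$ and linear maps $\alpha,\beta:H\to k$ (quasi-antipode $(\mathcal{S},\alpha,\beta)$) such that for all $a,b,c,d\in H$ (Sweedler notation): $1a=a=a1$; $a_1(b_1c_1)\Phi(a_2,b_2,c_2)=\Phi(a_1,b_1,c_1)(a_2b_2)c_2$; $\Phi(a_1,b_1,c_1d_1)\Phi(a_2b_2,c_2,d_2)=\Phi(b_1,c_1,d_1)\Phi(a_1,b_2c_2,d_2)\Phi(a_2,b_3,c_3)$;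 $\Phi(a,1,b)=\varepsilon(a)\varepsilon(b)$; $\mathcal{S}(a_1)\alpha(a_2)a_3=\alpha(a)1$; $a_1\beta(a_2)\mathcal{S}(a_3)=\beta(a)1$; $\Phi(a_1,\mathcal{S}(a_3),a_5)\beta(a_2)\alpha(a_4)=\varepsilon(a)=\Phi^{-1}(\mathcal{S}(a_1),a_3,\mathcal{S}(a_5))\alpha(a_2)\beta(a_4)$. A sub Majid algebra is a subcoalgebra containing $1$, closed under product and $\mathcal{S}$, with the restricted structure. A Majid algebra is graded if $H=\bigoplus_{n\ge0}H_n$ is a graded coalgebra and all structure maps are homogeneous of degree $0$ ($k$ being in degree $0$; so $\Phi,\alpha,\beta$ vanish on components of positive degree). The group algebra $kG$ with $\Phi$ extended linearly is a Majid algebra $(kG,\Phi,\mathcal{S},\alpha,\beta)$ with $\mathcal{S}(g)=g^{-1}$, $\alpha(g)=1$, $\beta(g)=1/\Phi(g,g^{-1},g)$ for $g\in G$. $\mathcal{C}$ is the set of conjugacy classes of $G$. A ramification datum is a formal sum $R=\sum_{C\in\mathcal{C}}R_CC$ with non-negative integers $R_C$. The Hopf quiver $Q(G,R)$ has vertex set $G$ and, for each $x\in G$, $C\in\mathcal{C}$ and $c\in C$, exactly $R_C$ arrows from $x$ to $cx$. The path coalgebra $kQ$ has basis all paths, graded by length, with $\Delta(a_n\cdots a_1)=\sum_{i=0}^{n}(a_n\cdots a_{i+1})\otimes(a_i\cdots a_1)$ (empty products being the appropriate vertices; paths are composed right to left) and counit $1$ on vertices and $0$ on longer paths; $kQ_0$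 is the span of the vertices. For each $C\in\mathcal{C}$ fix $g(C)\in C$; $Z_C$ is the centralizer of $g(C)$ in $G$ and $\tilde{\Phi}_C$ is the 2-cocycle on $Z_C$ given by $\tilde{\Phi}_C(e,f)=\tilde{\Phi}(e,f,g(C))$ for $e,f\in Z_C$, where $$\tilde{\Phi}(e,f,g)=\frac{\Phi(e,f,g)\,\Phi(ef,f^{-1},e^{-1})\,\Phi(e,fg,f^{-1})}{\Phi(efg,f^{-1},e^{-1})\,\Phi(e,f,f^{-1})}.$$ A $\tilde{\Phi}_C$-representation of $Z_C$ is a vector space $V$ with a map $\rho:Z_C\to GL(V)$ satisfying $\rho(\epsilon)=\mathrm{Id}_V$ and $\rho(e)\rho(f)=\tilde{\Phi}_C(e,f)\rho(ef)$ for all $e,f\in Z_C$. *)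

theory Defs
  imports
    "HOL-Library.Poly_Mapping"
    "HOL-Algebra.Group_Action"
    "Graph_Theory.Arc_Walk"
begin

section \<open>Vector spaces with a chosen basis\<close>

text \<open>
  A vector space with basis \<open>B\<close> over a field \<open>'k\<close> is the set \<open>free_space B\<close> of finitely supported
  functions on the basis type with support in \<open>B\<close>.  Since every vector space has a basis, nothing
  is lost by defining coalgebras and Majid algebras on such spaces.  The tensor product of the
  spaces with bases \<open>B\<close> and \<open>B'\<close> is the space with basis \<open>B \<times> B'\<close>.
\<close>

definition pscale :: "'k::field \<Rightarrow> ('b \<Rightarrow>\<^sub>0 'k) \<Rightarrow> ('b \<Rightarrow>\<^sub>0 'k)" where
  "pscale c = Poly_Mapping.map ((*) c)"

lemma lookup_pscale [simp]: "Poly_Mapping.lookup (pscale c v) x = c * Poly_Mapping.lookup v x"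
  by (simp add: pscale_def Poly_Mapping.map.rep_eq when_def)

global_interpretation fs: vector_space "pscale :: 'k::field \<Rightarrow> ('b \<Rightarrow>\<^sub>0 'k) \<Rightarrow> ('b \<Rightarrow>\<^sub>0 'k)"
  by unfold_locales (auto intro!: poly_mapping_eqI simp: lookup_add algebra_simps)

definition free_space :: "'b set \<Rightarrow> ('b \<Rightarrow>\<^sub>0 'k::field) set" where
  "free_space B = {v. Poly_Mapping.keys v \<subseteq> B}"

abbreviation bvec :: "'b \<Rightarrow> ('b \<Rightarrow>\<^sub>0 'k::field)" where
  "bvec b \<equiv> Poly_Mapping.single b 1"

text \<open>
  Linear extension of a map given on basis vectors.  The scalar multiplication \<open>s\<close> of the target is
  a parameter, so that linear forms are covered too (with \<open>s = (*)\<close>).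
\<close>

definition ext :: "('k::field \<Rightarrow> 'v \<Rightarrow> 'v) \<Rightarrow> ('b \<Rightarrow> 'v) \<Rightarrow> ('b \<Rightarrow>\<^sub>0 'k) \<Rightarrow> 'v::ab_group_add" where
  "ext s F v = (\<Sum>b\<in>Poly_Mapping.keys v. s (Poly_Mapping.lookup v b) (F b))"

definition tens :: "('b \<Rightarrow>\<^sub>0 'k::field) \<Rightarrow> ('c \<Rightarrow>\<^sub>0 'k) \<Rightarrow> ('b \<times> 'c \<Rightarrow>\<^sub>0 'k)" where
  "tens u v = ext pscale (\<lambda>b. ext pscale (\<lambda>c. bvec (b, c)) v) u"

definition lin_on :: "('k::field \<Rightarrow> 'v \<Rightarrow> 'v) \<Rightarrow> ('b \<Rightarrow>\<^sub>0 'k) set \<Rightarrow> (('b \<Rightarrow>\<^sub>0 'k) \<Rightarrow> 'v::ab_group_add)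
    \<Rightarrow> 'v set \<Rightarrow> bool" where
  "lin_on s V f W \<longleftrightarrow> f ` V \<subseteq> W \<and> (\<forall>u\<in>V. \<forall>v\<in>V. f (u + v) = f u + f v)
     \<and> (\<forall>c. \<forall>v\<in>V. f (pscale c v) = s c (f v))"

definition bilin_on :: "('k::field \<Rightarrow> 'v \<Rightarrow> 'v) \<Rightarrow> ('b \<Rightarrow>\<^sub>0 'k) set
    \<Rightarrow> (('b \<Rightarrow>\<^sub>0 'k) \<Rightarrow> ('b \<Rightarrow>\<^sub>0 'k) \<Rightarrow> 'v::ab_group_add) \<Rightarrow> 'v set \<Rightarrow> bool" where
  "bilin_on s V f W \<longleftrightarrow>
     (\<forall>u\<in>V. lin_on s V (\<lambda>v. f u v) W) \<and> (\<forall>v\<in>V. lin_on s V (\<lambda>u. f u v) W)"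

definition trilin_on :: "('k::field \<Rightarrow> 'v \<Rightarrow> 'v) \<Rightarrow> ('b \<Rightarrow>\<^sub>0 'k) set
    \<Rightarrow> (('b \<Rightarrow>\<^sub>0 'k) \<Rightarrow> ('b \<Rightarrow>\<^sub>0 'k) \<Rightarrow> ('b \<Rightarrow>\<^sub>0 'k) \<Rightarrow> 'v::ab_group_add) \<Rightarrow> 'v set \<Rightarrow> bool" where
  "trilin_on s V f W \<longleftrightarrow>
     (\<forall>u\<in>V. bilin_on s V (\<lambda>v w. f u v w) W) \<and> (\<forall>w\<in>V. bilin_on s V (\<lambda>u v. f u v w) W)"

text \<open>
  \<open>dim\<close> of the library is \<open>0\<close> for infinite-dimensional spaces, hence the explicit finite basis.
\<close>

definition has_dim :: "('b \<Rightarrow>\<^sub>0 'k::field) set \<Rightarrow> nat \<Rightarrow> bool" where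
  "has_dim V n \<longleftrightarrow> (\<exists>B. finite B \<and> card B = n \<and> fs.independent B \<and> fs.span B = V)"


section \<open>Majid algebras\<close>

text \<open>
  Structure maps are total functions; only their values on the underlying space
  \<open>free_space (basis H)\<close> are meaningful.  Multilinear maps are curried.
\<close>

record (overloaded) ('b, 'k) coalg =
  basis :: "'b set"
  comult :: "('b \<Rightarrow>\<^sub>0 'k::field) \<Rightarrow> ('b \<times> 'b \<Rightarrow>\<^sub>0 'k)"
  counit :: "('b \<Rightarrow>\<^sub>0 'k) \<Rightarrow> 'k"

record (overloaded) ('b, 'k) majid = "('b, 'k::field) coalg" +
  mprod :: "('b \<Rightarrow>\<^sub>0 'k) \<Rightarrow> ('b \<Rightarrow>\<^sub>0 'k) \<Rightarrow> ('b \<Rightarrow>\<^sub>0 'k)" (infixl "\<odot>\<index>" 70)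
  munit :: "'b \<Rightarrow>\<^sub>0 'k"
  reass :: "('b \<Rightarrow>\<^sub>0 'k) \<Rightarrow> ('b \<Rightarrow>\<^sub>0 'k) \<Rightarrow> ('b \<Rightarrow>\<^sub>0 'k) \<Rightarrow> 'k"
  antip :: "('b \<Rightarrow>\<^sub>0 'k) \<Rightarrow> ('b \<Rightarrow>\<^sub>0 'k)"
  malpha :: "('b \<Rightarrow>\<^sub>0 'k) \<Rightarrow> 'k"
  mbeta :: "('b \<Rightarrow>\<^sub>0 'k) \<Rightarrow> 'k"

abbreviation space_of :: "('b, 'k::field, 'm) coalg_scheme \<Rightarrow> ('b \<Rightarrow>\<^sub>0 'k) set" where
  "space_of H \<equiv> free_space (basis H)"

text \<open>
  Sweedler notation: \<open>sw s \<Delta> a (\<lambda>a1 a2. F a1 a2)\<close> is the value at \<open>\<Delta> a\<close> of the linear map on the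
  tensor square induced by the bilinear \<open>F\<close>; \<open>s\<close> is the scalar multiplication of the target.
  The variants \<open>swv\<close> and \<open>swk\<close> are for vector and scalar values.
\<close>

definition sw :: "('k::field \<Rightarrow> 'v \<Rightarrow> 'v) \<Rightarrow> (('b \<Rightarrow>\<^sub>0 'k) \<Rightarrow> ('b \<times> 'b \<Rightarrow>\<^sub>0 'k)) \<Rightarrow> ('b \<Rightarrow>\<^sub>0 'k)
    \<Rightarrow> (('b \<Rightarrow>\<^sub>0 'k) \<Rightarrow> ('b \<Rightarrow>\<^sub>0 'k) \<Rightarrow> 'v) \<Rightarrow> 'v::ab_group_add" where
  "sw s \<Delta> a F = ext s (\<lambda>(x, y). F (bvec x) (bvec y)) (\<Delta> a)"

abbreviation "swv H \<equiv> sw pscale (comult H)"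
abbreviation "swk H \<equiv> sw (*) (comult H)"

abbreviation "swv3 H a F \<equiv> swv H a (\<lambda>a1 r. swv H r (\<lambda>a2 a3. F a1 a2 a3))"
abbreviation "swk3 H a F \<equiv> swk H a (\<lambda>a1 r. swk H r (\<lambda>a2 a3. F a1 a2 a3))"
abbreviation "swk5 H a F \<equiv>
  swk H a (\<lambda>a1 r1. swk H r1 (\<lambda>a2 r2. swk H r2 (\<lambda>a3 r3. swk H r3 (\<lambda>a4 a5. F a1 a2 a3 a4 a5))))"

locale coalgebra =
  fixes H :: "('b, 'k::field, 'm) coalg_scheme" (structure)
  assumes comult_lin: "lin_on pscale (space_of H) (comult H) (free_space (basis H \<times> basis H))"
    and counit_lin: "lin_on (*) (space_of H) (counit H) UNIV"
    and coassoc: "a \<in> space_of H \<Longrightarrow>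
      swv H a (\<lambda>a1 a2. swv H a1 (\<lambda>a11 a12. tens a11 (tens a12 a2)))
      = swv H a (\<lambda>a1 a2. swv H a2 (\<lambda>a21 a22. tens a1 (tens a21 a22)))"
    and counit_left: "a \<in> space_of H \<Longrightarrow> swv H a (\<lambda>a1 a2. pscale (counit H a1) a2) = a"
    and counit_right: "a \<in> space_of H \<Longrightarrow> swv H a (\<lambda>a1 a2. pscale (counit H a2) a1) = a"

locale majid_algebra = coalgebra H
  for H :: "('b, 'k::field, 'm) majid_scheme" (structure) +
  assumes mprod_bilin: "bilin_on pscale (space_of H) (mprod H) (space_of H)"
    and munit_in: "munit H \<in> space_of H"
    and reass_trilin: "trilin_on (*) (space_of H) (reass H) UNIV"
    and antip_lin: "lin_on pscale (space_of H) (antip H) (space_of H)"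
    and malpha_lin: "lin_on (*) (space_of H) (malpha H) UNIV"
    and mbeta_lin: "lin_on (*) (space_of H) (mbeta H) UNIV"
    and mprod_comult: "\<lbrakk>a \<in> space_of H; b \<in> space_of H\<rbrakk> \<Longrightarrow>
      comult H (a \<odot> b) = swv H a (\<lambda>a1 a2. swv H b (\<lambda>b1 b2. tens (a1 \<odot> b1) (a2 \<odot> b2)))"
    and mprod_counit: "\<lbrakk>a \<in> space_of H; b \<in> space_of H\<rbrakk> \<Longrightarrow>
      counit H (a \<odot> b) = counit H a * counit H b"
    and munit_grouplike: "comult H (munit H) = tens (munit H) (munit H)" "counit H (munit H) = 1"
    and antip_comult: "a \<in> space_of H \<Longrightarrow>
      comult H (antip H a) = swv H a (\<lambda>a1 a2. tens (antip H a2) (antip H a1))"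
    and antip_counit: "a \<in> space_of H \<Longrightarrow> counit H (antip H a) = counit H a"
    and munit_left: "a \<in> space_of H \<Longrightarrow> munit H \<odot> a = a"
    and munit_right: "a \<in> space_of H \<Longrightarrow> a \<odot> munit H = a"
    and quasi_assoc: "\<lbrakk>a \<in> space_of H; b \<in> space_of H; c \<in> space_of H\<rbrakk> \<Longrightarrow>
      swv H a (\<lambda>a1 a2. swv H b (\<lambda>b1 b2. swv H c (\<lambda>c1 c2.
        pscale (reass H a2 b2 c2) (a1 \<odot> (b1 \<odot> c1)))))
      = swv H a (\<lambda>a1 a2. swv H b (\<lambda>b1 b2. swv H c (\<lambda>c1 c2.
        pscale (reass H a1 b1 c1) ((a2 \<odot> b2) \<odot> c2))))"
    and pentagon: "\<lbrakk>a \<in> space_of H; b \<in> space_of H; c \<in> space_of H; d \<in> space_of H\<rbrakk> \<Longrightarrow>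
      swk H a (\<lambda>a1 a2. swk H b (\<lambda>b1 b2. swk H c (\<lambda>c1 c2. swk H d (\<lambda>d1 d2.
        reass H a1 b1 (c1 \<odot> d1) * reass H (a2 \<odot> b2) c2 d2))))
      = swk H a (\<lambda>a1 a2. swk3 H b (\<lambda>b1 b2 b3. swk3 H c (\<lambda>c1 c2 c3. swk H d (\<lambda>d1 d2.
        reass H b1 c1 d1 * reass H a1 (b2 \<odot> c2) d2 * reass H a2 b3 c3))))"
    and reass_unit: "\<lbrakk>a \<in> space_of H; b \<in> space_of H\<rbrakk> \<Longrightarrow>
      reass H a (munit H) b = counit H a * counit H b"
    and antip_alpha: "a \<in> space_of H \<Longrightarrow>
      swv3 H a (\<lambda>a1 a2 a3. pscale (malpha H a2) (antip H a1 \<odot> a3)) = pscale (malpha H a) (munit H)"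
    and antip_beta: "a \<in> space_of H \<Longrightarrow>
      swv3 H a (\<lambda>a1 a2 a3. pscale (mbeta H a2) (a1 \<odot> antip H a3)) = pscale (mbeta H a) (munit H)"
    and antip_reass: "a \<in> space_of H \<Longrightarrow>
      swk5 H a (\<lambda>a1 a2 a3 a4 a5. reass H a1 (antip H a3) a5 * mbeta H a2 * malpha H a4) = counit H a"
    \<comment> \<open>\<open>\<Psi>\<close> is the convolution inverse of the reassociator, which is unique\<close>
    and reass_inverse: "\<exists>\<Psi>. trilin_on (*) (space_of H) \<Psi> UNIV
      \<and> (\<forall>a\<in>space_of H. \<forall>b\<in>space_of H. \<forall>c\<in>space_of H.
          swk H a (\<lambda>a1 a2. swk H b (\<lambda>b1 b2. swk H c (\<lambda>c1 c2. reass H a1 b1 c1 * \<Psi> a2 b2 c2)))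
            = counit H a * counit H b * counit H c
        \<and> swk H a (\<lambda>a1 a2. swk H b (\<lambda>b1 b2. swk H c (\<lambda>c1 c2. \<Psi> a1 b1 c1 * reass H a2 b2 c2)))
            = counit H a * counit H b * counit H c)
      \<and> (\<forall>a\<in>space_of H.
          swk5 H a (\<lambda>a1 a2 a3 a4 a5. \<Psi> (antip H a1) a3 (antip H a5) * malpha H a2 * mbeta H a4)
            = counit H a)"

text \<open>
  A grading is given by assigning a degree to each basis vector, i.e. by a homogeneous basis.
\<close>

definition homog :: "('b, 'k::field, 'm) coalg_scheme \<Rightarrow> ('b \<Rightarrow> nat) \<Rightarrow> nat \<Rightarrow> ('b \<Rightarrow>\<^sub>0 'k) set" where
  "homog H deg n = free_space {b \<in> basis H. deg b = n}"

locale graded_majid_algebra = majid_algebra H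
  for H :: "('b, 'k::field, 'm) majid_scheme" (structure) and deg :: "'b \<Rightarrow> nat" +
  assumes comult_homog: "a \<in> homog H deg n \<Longrightarrow>
      comult H a \<in> free_space {(x, y) \<in> basis H \<times> basis H. deg x + deg y = n}"
    and counit_homog: "\<lbrakk>a \<in> homog H deg n; n > 0\<rbrakk> \<Longrightarrow> counit H a = 0"
    and mprod_homog: "\<lbrakk>a \<in> homog H deg m; b \<in> homog H deg n\<rbrakk> \<Longrightarrow> a \<odot> b \<in> homog H deg (m + n)"
    and munit_homog: "munit H \<in> homog H deg 0"
    and reass_homog: "\<lbrakk>a \<in> homog H deg l; b \<in> homog H deg m; c \<in> homog H deg n; l + m + n > 0\<rbrakk> \<Longrightarrow>
      reass H a b c = 0"
    and antip_homog: "a \<in> homog H deg n \<Longrightarrow> antip H a \<in> homog H deg n"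
    and malpha_homog: "\<lbrakk>a \<in> homog H deg n; n > 0\<rbrakk> \<Longrightarrow> malpha H a = 0"
    and mbeta_homog: "\<lbrakk>a \<in> homog H deg n; n > 0\<rbrakk> \<Longrightarrow> mbeta H a = 0"

definition sub_majid_algebra :: "('b, 'k::field, 'm) majid_scheme \<Rightarrow> ('b \<Rightarrow>\<^sub>0 'k) set \<Rightarrow> bool" where
  "sub_majid_algebra H W \<longleftrightarrow> fs.subspace W \<and> W \<subseteq> space_of H
     \<and> (\<forall>a\<in>W. comult H a \<in> fs.span {tens u v | u v. u \<in> W \<and> v \<in> W})
     \<and> munit H \<in> W
     \<and> (\<forall>a\<in>W. \<forall>b\<in>W. mprod H a b \<in> W)
     \<and> (\<forall>a\<in>W. antip H a \<in> W)"

definition majid_hom :: "('b, 'k::field, 'm) majid_scheme \<Rightarrow> ('c, 'k, 'n) majid_scheme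
    \<Rightarrow> (('b \<Rightarrow>\<^sub>0 'k) \<Rightarrow> ('c \<Rightarrow>\<^sub>0 'k)) \<Rightarrow> bool" where
  "majid_hom K H f \<longleftrightarrow> lin_on pscale (space_of K) f (space_of H)
     \<and> (\<forall>a\<in>space_of K. comult H (f a) = swv K a (\<lambda>a1 a2. tens (f a1) (f a2)))
     \<and> (\<forall>a\<in>space_of K. counit H (f a) = counit K a)
     \<and> (\<forall>a\<in>space_of K. \<forall>b\<in>space_of K. f (mprod K a b) = mprod H (f a) (f b))
     \<and> f (munit K) = munit H
     \<and> (\<forall>a\<in>space_of K. \<forall>b\<in>space_of K. \<forall>c\<in>space_of K. reass H (f a) (f b) (f c) = reass K a b c)
     \<and> (\<forall>a\<in>space_of K. f (antip K a) = antip H (f a))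
     \<and> (\<forall>a\<in>space_of K. malpha H (f a) = malpha K a)
     \<and> (\<forall>a\<in>space_of K. mbeta H (f a) = mbeta K a)"


section \<open>Groups with a 3-cocycle\<close>

definition normalized_3cocycle :: "('g, 'm) monoid_scheme \<Rightarrow> ('g \<Rightarrow> 'g \<Rightarrow> 'g \<Rightarrow> 'k::field) \<Rightarrow> bool"
  where "normalized_3cocycle G \<Phi> \<longleftrightarrow>
     (\<forall>e\<in>carrier G. \<forall>f\<in>carrier G. \<forall>g\<in>carrier G. \<Phi> e f g \<noteq> 0)
     \<and> (\<forall>e\<in>carrier G. \<forall>f\<in>carrier G. \<forall>g\<in>carrier G. \<forall>h\<in>carrier G.
          \<Phi> e f g * \<Phi> e (f \<otimes>\<^bsub>G\<^esub> g) h * \<Phi> f g h = \<Phi> (e \<otimes>\<^bsub>G\<^esub> f) g h * \<Phi> e f (g \<otimes>\<^bsub>G\<^esub> h))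
     \<and> (\<forall>e\<in>carrier G. \<forall>f\<in>carrier G.
          \<Phi> \<one>\<^bsub>G\<^esub> e f = 1 \<and> \<Phi> e \<one>\<^bsub>G\<^esub> f = 1 \<and> \<Phi> e f \<one>\<^bsub>G\<^esub> = 1)"

definition group_majid :: "('g, 'm) monoid_scheme \<Rightarrow> ('g \<Rightarrow> 'g \<Rightarrow> 'g \<Rightarrow> 'k::field) \<Rightarrow> ('g, 'k) majid"
  where "group_majid G \<Phi> =
    \<lparr> basis = carrier G,
      comult = ext pscale (\<lambda>g. bvec (g, g)),
      counit = ext (*) (\<lambda>g. 1),
      mprod = (\<lambda>u v. ext pscale (\<lambda>g. ext pscale (\<lambda>h. bvec (g \<otimes>\<^bsub>G\<^esub> h)) v) u),
      munit = bvec \<one>\<^bsub>G\<^esub>,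
      reass = (\<lambda>u v w. ext (*) (\<lambda>e. ext (*) (\<lambda>f. ext (*) (\<lambda>g. \<Phi> e f g) w) v) u),
      antip = ext pscale (\<lambda>g. bvec (inv\<^bsub>G\<^esub> g)),
      malpha = ext (*) (\<lambda>g. 1),
      mbeta = ext (*) (\<lambda>g. 1 / \<Phi> g (inv\<^bsub>G\<^esub> g) g) \<rparr>"

definition conj_action :: "('g, 'm) monoid_scheme \<Rightarrow> 'g \<Rightarrow> 'g \<Rightarrow> 'g" where
  "conj_action G = (\<lambda>z. \<lambda>x\<in>carrier G. z \<otimes>\<^bsub>G\<^esub> x \<otimes>\<^bsub>G\<^esub> inv\<^bsub>G\<^esub> z)"

definition conj_classes :: "('g, 'm) monoid_scheme \<Rightarrow> 'g set set" where
  "conj_classes G = orbits G (carrier G) (conj_action G)"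

definition centralizer :: "('g, 'm) monoid_scheme \<Rightarrow> 'g \<Rightarrow> 'g set" where
  "centralizer G x = {z \<in> carrier G. z \<otimes>\<^bsub>G\<^esub> x = x \<otimes>\<^bsub>G\<^esub> z}"

definition Phi_tilde :: "('g, 'm) monoid_scheme \<Rightarrow> ('g \<Rightarrow> 'g \<Rightarrow> 'g \<Rightarrow> 'k::field) \<Rightarrow> 'g \<Rightarrow> 'g \<Rightarrow> 'g \<Rightarrow> 'k"
  where "Phi_tilde G \<Phi> e f g =
    (\<Phi> e f g * \<Phi> (e \<otimes>\<^bsub>G\<^esub> f) (inv\<^bsub>G\<^esub> f) (inv\<^bsub>G\<^esub> e) * \<Phi> e (f \<otimes>\<^bsub>G\<^esub> g) (inv\<^bsub>G\<^esub> f))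
    / (\<Phi> (e \<otimes>\<^bsub>G\<^esub> f \<otimes>\<^bsub>G\<^esub> g) (inv\<^bsub>G\<^esub> f) (inv\<^bsub>G\<^esub> e) * \<Phi> e f (inv\<^bsub>G\<^esub> f))"


section \<open>Path coalgebras and Hopf quivers\<close>

text \<open>
  The path \<open>a\<^sub>n \<cdots> a\<^sub>1\<close> starting at the vertex \<open>u\<close> is the pair \<open>(u, [a\<^sub>1, \<dots>, a\<^sub>n])\<close>: arrows are
  listed in the order in which they are traversed.  The vertex \<open>u\<close> itself is the path \<open>(u, [])\<close>.
\<close>

definition paths :: "('v, 'e) pre_digraph \<Rightarrow> ('v \<times> 'e list) set" where
  "paths Q = {(u, p). \<exists>v. pre_digraph.awalk Q u p v}"

definition path_length :: "'v \<times> 'e list \<Rightarrow> nat" where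
  "path_length = (\<lambda>(u, p). length p)"

definition path_comult :: "('v, 'e) pre_digraph \<Rightarrow> 'v \<times> 'e list
    \<Rightarrow> (('v \<times> 'e list) \<times> ('v \<times> 'e list) \<Rightarrow>\<^sub>0 'k::field)" where
  "path_comult Q = (\<lambda>(u, p). \<Sum>i\<le>length p.
     bvec ((pre_digraph.awlast Q u (take i p), drop i p), (u, take i p)))"

definition path_coalg :: "('v, 'e) pre_digraph \<Rightarrow> ('v \<times> 'e list, 'k::field) coalg" where
  "path_coalg Q =
    \<lparr> basis = paths Q,
      comult = ext pscale (path_comult Q),
      counit = ext (*) (\<lambda>p. if path_length p = 0 then 1 else 0) \<rparr>"

text \<open>The \<open>i\<close>-th arrow from \<open>x\<close> to \<open>c x\<close> is the triple \<open>(x, c, i)\<close>.\<close>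

definition hopf_quiver :: "('g, 'm) monoid_scheme \<Rightarrow> ('g set \<Rightarrow> nat) \<Rightarrow> ('g, 'g \<times> 'g \<times> nat) pre_digraph"
  where "hopf_quiver G R =
    \<lparr> verts = carrier G,
      arcs = {(x, c, i) | x c i C. x \<in> carrier G \<and> C \<in> conj_classes G \<and> c \<in> C \<and> i < R C},
      tail = (\<lambda>(x, c, i). x),
      head = (\<lambda>(x, c, i). c \<otimes>\<^bsub>G\<^esub> x) \<rparr>"

type_synonym 'g hpath = "'g \<times> ('g \<times> 'g \<times> nat) list"

definition vertex_embedding :: "('g \<Rightarrow>\<^sub>0 'k::field) \<Rightarrow> ('g hpath \<Rightarrow>\<^sub>0 'k)" where
  "vertex_embedding = ext pscale (\<lambda>g. bvec (g, []))"

definition vertex_space :: "('g, 'm) monoid_scheme \<Rightarrow> ('g hpath \<Rightarrow>\<^sub>0 'k::field) set" where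
  "vertex_space G = free_space {(x, []) | x. x \<in> carrier G}"

text \<open>
  The identification of the span of the vertices with the group algebra is the one given by the
  labels of the vertices.
\<close>

definition graded_majid_structures :: "('g, 'm) monoid_scheme \<Rightarrow> ('g \<Rightarrow> 'g \<Rightarrow> 'g \<Rightarrow> 'k::field)
    \<Rightarrow> ('g set \<Rightarrow> nat) \<Rightarrow> ('g hpath, 'k) majid set" where
  "graded_majid_structures G \<Phi> R =
    {H. coalg.truncate H = path_coalg (hopf_quiver G R)
      \<and> graded_majid_algebra H path_length
      \<and> sub_majid_algebra H (vertex_space G)
      \<and> majid_hom (group_majid G \<Phi>) H vertex_embedding
      \<and> bij_betw vertex_embedding (space_of (group_majid G \<Phi>)) (vertex_space G)}"

text \<open>
  Two structures are identified if they are isomorphic as graded Majid algebras by an isomorphism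
  restricting to the identity on the group algebra \<open>kQ\<^sub>0 = kG\<close>.
\<close>

definition structure_iso :: "('g, 'm) monoid_scheme \<Rightarrow> ('g \<Rightarrow> 'g \<Rightarrow> 'g \<Rightarrow> 'k::field)
    \<Rightarrow> ('g set \<Rightarrow> nat) \<Rightarrow> (('g hpath, 'k) majid \<times> ('g hpath, 'k) majid) set" where
  "structure_iso G \<Phi> R =
    {(H, H'). H \<in> graded_majid_structures G \<Phi> R \<and> H' \<in> graded_majid_structures G \<Phi> R
      \<and> (\<exists>\<theta>. majid_hom H H' \<theta> \<and> bij_betw \<theta> (space_of H) (space_of H')
            \<and> (\<forall>n. \<theta> ` homog H path_length n = homog H' path_length n)
            \<and> (\<forall>v\<in>vertex_space G. \<theta> v = v))}"


section \<open>Projective representations\<close>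

type_synonym ('g, 'b, 'k) prep = "('b \<Rightarrow>\<^sub>0 'k) set \<times> ('g \<Rightarrow> ('b \<Rightarrow>\<^sub>0 'k) \<Rightarrow> ('b \<Rightarrow>\<^sub>0 'k))"

definition proj_rep :: "('g, 'm) monoid_scheme \<Rightarrow> 'g set \<Rightarrow> ('g \<Rightarrow> 'g \<Rightarrow> 'k::field)
    \<Rightarrow> ('g, 'b, 'k) prep \<Rightarrow> bool" where
  "proj_rep G Z \<sigma> = (\<lambda>(V, \<rho>). fs.subspace V
     \<and> (\<forall>e\<in>Z. lin_on pscale V (\<rho> e) V \<and> bij_betw (\<rho> e) V V)
     \<and> (\<forall>v\<in>V. \<rho> \<one>\<^bsub>G\<^esub> v = v)
     \<and> (\<forall>e\<in>Z. \<forall>f\<in>Z. \<forall>v\<in>V. \<rho> e (\<rho> f v) = pscale (\<sigma> e f) (\<rho> (e \<otimes>\<^bsub>G\<^esub> f) v)))"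

definition prep_iso :: "'g set \<Rightarrow> ('g, 'b, 'k::field) prep \<Rightarrow> ('g, 'c, 'k) prep \<Rightarrow> bool" where
  "prep_iso Z = (\<lambda>(V, \<rho>) (W, \<sigma>). \<exists>f. lin_on pscale V f W \<and> bij_betw f V W
     \<and> (\<forall>e\<in>Z. \<forall>v\<in>V. f (\<rho> e v) = \<sigma> e (f v)))"

text \<open>
  The underlying spaces of the representations are subspaces of the space of finitely supported
  functions on \<open>nat\<close>; every finite-dimensional space is isomorphic to one of these.  Collections
  are compared up to isomorphism, so their values outside the conjugacy classes are irrelevant.
\<close>

definition rep_collections :: "('g, 'm) monoid_scheme \<Rightarrow> ('g \<Rightarrow> 'g \<Rightarrow> 'g \<Rightarrow> 'k::field)
    \<Rightarrow> ('g set \<Rightarrow> 'g) \<Rightarrow> ('g set \<Rightarrow> nat) \<Rightarrow> ('g set \<Rightarrow> ('g, nat, 'k) prep) set" where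
  "rep_collections G \<Phi> g R =
    {M. \<forall>C\<in>conj_classes G.
       proj_rep G (centralizer G (g C)) (\<lambda>e f. Phi_tilde G \<Phi> e f (g C)) (M C)
       \<and> has_dim (fst (M C)) (R C)}"

definition collection_iso :: "('g, 'm) monoid_scheme \<Rightarrow> ('g \<Rightarrow> 'g \<Rightarrow> 'g \<Rightarrow> 'k::field)
    \<Rightarrow> ('g set \<Rightarrow> 'g) \<Rightarrow> ('g set \<Rightarrow> nat)
    \<Rightarrow> (('g set \<Rightarrow> ('g, nat, 'k) prep) \<times> ('g set \<Rightarrow> ('g, nat, 'k) prep)) set" where
  "collection_iso G \<Phi> g R =
    {(M, M'). M \<in> rep_collections G \<Phi> g R \<and> M' \<in> rep_collections G \<Phi> g R
      \<and> (\<forall>C\<in>conj_classes G. prep_iso (centralizer G (g C)) (M C) (M' C))}"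


section \<open>The correspondence\<close>

text \<open>
  A structure \<open>H\<close> on the path coalgebra gives, for each class \<open>C\<close>, an action of the centralizer of
  \<open>g C\<close> on the span of the arrows from the unit to \<open>g C\<close>, namely \<open>e \<cdot> m = (e m) e\<^sup>-\<^sup>1\<close>.
\<close>

definition arrow_rep :: "('g, 'm) monoid_scheme \<Rightarrow> ('g set \<Rightarrow> 'g) \<Rightarrow> ('g set \<Rightarrow> nat)
    \<Rightarrow> ('g hpath, 'k::field) majid \<Rightarrow> 'g set \<Rightarrow> ('g, 'g hpath, 'k) prep" where
  "arrow_rep G g R H C =
    (free_space {(u, p). pre_digraph.awalk (hopf_quiver G R) u p (g C) \<and> u = \<one>\<^bsub>G\<^esub> \<and> length p = 1},
     \<lambda>e m. mprod H (mprod H (bvec (e, [])) m) (bvec (inv\<^bsub>G\<^esub> e, [])))"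

text \<open>
  The induced map sends an isomorphism class of structures to the class of all collections whose
  members are isomorphic to the representations on the arrows.
\<close>

definition majid_rep_correspondence :: "('g, 'm) monoid_scheme \<Rightarrow> ('g \<Rightarrow> 'g \<Rightarrow> 'g \<Rightarrow> 'k::field)
    \<Rightarrow> ('g set \<Rightarrow> 'g) \<Rightarrow> ('g set \<Rightarrow> nat) \<Rightarrow> ('g hpath, 'k) majid set
    \<Rightarrow> ('g set \<Rightarrow> ('g, nat, 'k) prep) set" where
  "majid_rep_correspondence G \<Phi> g R X =
    {M \<in> rep_collections G \<Phi> g R. \<exists>H\<in>X. \<forall>C\<in>conj_classes G.
       prep_iso (centralizer G (g C)) (arrow_rep G g R H C) (M C)}"

end

theory Submission
  imports Defs
begin

text \<open>
  Let \<open>H\<close> be a graded Majid algebra on the path coalgebra \<open>kQ\<close> whose vertices form \<open>(kG, \<Phi>)\<close>.  Products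
  of vertices and arrows make the span of the arrows a bimodule over \<open>kG\<close> whose three associativity
  laws hold up to values of \<open>\<Phi>\<close> at the ends of the arrow.  The proof passes through these quasi-bimodules:
  they correspond to the Majid algebra structures on one side and to the collections of projective
  representations on the other.

  \<^emph>\<open>Structures and quasi-bimodules.\<close>  The path coalgebra is cofree: a graded coalgebra map into it is
  determined by its components of degree \<open>0\<close> and \<open>1\<close> (\<open>coalg_map_eqI\<close>), and these can be prescribed as
  long as they respect the ends (\<open>graded_coalg_map_cofree_ext\<close>).  The product is a coalgebra map
  \<open>kQ \<otimes> kQ \<rightarrow> kQ\<close> and the antipode a coalgebra map from the opposite coalgebra, so both are determined by
  the bimodule, and a bimodule isomorphism extends to an isomorphism of structures
  (\<open>majid_hom_theta\<close>).  Conversely a bimodule prescribes a product and an antipode in degree \<open>1\<close>, which are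
  extended to \<open>kQ\<close>.  Quasi-associativity becomes an equality of two coalgebra maps after rescaling by
  \<open>\<Phi>\<close> at the sources and targets, so it follows from its degree \<open>1\<close> part, the bimodule axioms
  (\<open>path_prod_quasi_assoc\<close>).  The antipode identities hold in degree \<open>1\<close> by the choice of the antipode
  there, and follow by induction on the degree (\<open>left_conv_pos\<close>, \<open>right_conv_pos\<close>).

  \<^emph>\<open>Quasi-bimodules and projective representations.\<close>  Every arrow goes from some \<open>x\<close> to some \<open>c x\<close>.
  Right multiplication by \<open>x\<close> identifies the arrows \<open>\<epsilon> \<rightarrow> c\<close> with the arrows \<open>x \<rightarrow> c x\<close>, and the quasi-conjugation
  \<open>e \<cdot> m = (e m) e\<^sup>-\<^sup>1\<close> identifies the arrows \<open>\<epsilon> \<rightarrow> g(C)\<close> with the arrows \<open>\<epsilon> \<rightarrow> c\<close> for every \<open>c \<in> C\<close>.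
  Quasi-conjugation composes up to the factor \<open>\<Phi>~(e, f, c)\<close> (\<open>conj_conj\<close>), so the centralizer of \<open>g(C)\<close>
  acts on the arrows \<open>\<epsilon> \<rightarrow> g(C)\<close> by a \<open>\<Phi>~\<^sub>C\<close>-representation.  In terms of these identifications both
  actions of the bimodule are given by this representation and by explicit scalars (\<open>ract_spread\<close>,
  \<open>lact_spread\<close>).  Hence isomorphisms of the representations extend to isomorphisms of bimodules
  (\<open>structure_iso_of_arrow_reps\<close>), and the same formulas turn an arbitrary collection of representations
  into a bimodule (\<open>path_bimodule_rep\<close>).  The axioms then require identities between values of \<open>\<Phi>\<close>, such
  as the twisted cocycle law of \<open>\<Phi>~\<close>; they hold because both sides are scalars in a bimodule
  that is known to exist, the free one on a single arrow (\<open>quasi_bimodule_symbol\<close>).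

  \<^emph>\<open>Conclusion.\<close>  Relate a structure to a collection if the representations on the arrows out of the
  unit are isomorphic to the members of the collection.  This relation is total on both sides, and two
  structures (or two collections) related to a common partner are exactly the isomorphic ones; such
  a relation induces a bijection of the quotients (\<open>bij_betw_quotients\<close>).
\<close>

section \<open>Linear maps on spaces with a basis\<close>

abbreviation lin :: "('k::field \<Rightarrow> 'v \<Rightarrow> 'v) \<Rightarrow> (('b \<Rightarrow>\<^sub>0 'k) \<Rightarrow> 'v::ab_group_add) \<Rightarrow> bool" where
  "lin s f \<equiv> lin_on s UNIV f UNIV"

lemma vector_space_pscale: "vector_space (pscale :: 'k::field \<Rightarrow> ('b \<Rightarrow>\<^sub>0 'k) \<Rightarrow> _)"
  by (rule fs.vector_space_axioms)

lemma vector_space_mult: "vector_space ((*) :: 'k::field \<Rightarrow> 'k \<Rightarrow> 'k)"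
  by unfold_locales (auto simp: algebra_simps)

lemma free_space_iff: "v \<in> free_space B \<longleftrightarrow> (\<forall>x. x \<notin> B \<longrightarrow> Poly_Mapping.lookup v x = 0)"
  by (auto simp: free_space_def in_keys_iff)

lemma subspace_free_space: "fs.subspace (free_space B)"
  by (auto simp: fs.subspace_def free_space_iff lookup_add)

lemma free_space_zero [simp]: "0 \<in> free_space B"
  and free_space_add: "u \<in> free_space B \<Longrightarrow> v \<in> free_space B \<Longrightarrow> u + v \<in> free_space B"
  and free_space_diff: "u \<in> free_space B \<Longrightarrow> v \<in> free_space B \<Longrightarrow> u - v \<in> free_space B"
  and free_space_pscale: "v \<in> free_space B \<Longrightarrow> pscale c v \<in> free_space B"
  and free_space_sum: "(\<And>i. i \<in> I \<Longrightarrow> f i \<in> free_space B) \<Longrightarrow> sum f I \<in> free_space B"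
  by (auto simp: free_space_iff lookup_add lookup_minus lookup_sum)

lemma free_space_bvec [simp]: "bvec b \<in> free_space B \<longleftrightarrow> b \<in> B"
  by (auto simp: free_space_def)

lemma free_space_mono: "v \<in> free_space B \<Longrightarrow> B \<subseteq> C \<Longrightarrow> v \<in> free_space C"
  by (auto simp: free_space_def)

text \<open>
  A sum over any finite superset of the support replaces the sum over the support, whose dependence on the
  vector would obstruct additivity.
\<close>

lemma ext_superset:
  assumes "vector_space s" "finite A" "Poly_Mapping.keys v \<subseteq> A"
  shows "ext s F v = (\<Sum>b\<in>A. s (Poly_Mapping.lookup v b) (F b))"
proof -
  interpret vector_space s by fact
  show ?thesis unfolding ext_def
    by (rule sum.mono_neutral_left) (use assms in \<open>auto simp: in_keys_iff\<close>)
qed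

lemma lin_onD:
  assumes "lin_on s V f W"
  shows "v \<in> V \<Longrightarrow> f v \<in> W" "u \<in> V \<Longrightarrow> v \<in> V \<Longrightarrow> f (u + v) = f u + f v"
    "v \<in> V \<Longrightarrow> f (pscale c v) = s c (f v)"
  using assms by (auto simp: lin_on_def)

lemma lin_onI:
  assumes "\<And>v. v \<in> V \<Longrightarrow> f v \<in> W" "\<And>u v. u \<in> V \<Longrightarrow> v \<in> V \<Longrightarrow> f (u + v) = f u + f v"
    "\<And>c v. v \<in> V \<Longrightarrow> f (pscale c v) = s c (f v)"
  shows "lin_on s V f W"
  using assms by (auto simp: lin_on_def)

lemma lin_on_subset: "lin s f \<Longrightarrow> (\<And>v. v \<in> V \<Longrightarrow> f v \<in> W) \<Longrightarrow> lin_on s V f W"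
  by (auto simp: lin_on_def)

lemma lin_on_mono: "lin_on s V f W \<Longrightarrow> V' \<subseteq> V \<Longrightarrow> (\<And>v. v \<in> V' \<Longrightarrow> f v \<in> W') \<Longrightarrow> lin_on s V' f W'"
  by (rule lin_onI) (simp_all add: subset_iff lin_onD(2,3)[of s V f W])

lemma lin_on_zero:
  assumes "lin_on s V f W" "fs.subspace V"
  shows "f 0 = 0"
proof -
  have "0 \<in> V" using assms(2) by (simp add: fs.subspace_def)
  then have "f (0 + 0) = f 0 + f 0" using lin_onD(2)[OF assms(1)] by blast
  then show ?thesis by simp
qed

lemma lin_on_sum:
  assumes "lin_on s V f W" "fs.subspace V" "\<And>i. i \<in> I \<Longrightarrow> g i \<in> V"
  shows "f (\<Sum>i\<in>I. g i) = (\<Sum>i\<in>I. f (g i))"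
proof (cases "finite I")
  case True
  then show ?thesis using assms(3)
    by (induction I)
      (auto simp: lin_on_zero[OF assms(1,2)] lin_onD(2)[OF assms(1)] fs.subspace_sum[OF assms(2)])
qed (simp add: lin_on_zero[OF assms(1,2)])

lemma lin_on_diff:
  assumes "lin_on s V f W" "fs.subspace V" "u \<in> V" "v \<in> V"
  shows "f (u - v) = f u - f v"
proof -
  have "f (u - v + v) = f (u - v) + f v"
    by (rule lin_onD(2)[OF assms(1)]) (auto intro: fs.subspace_diff assms)
  then show ?thesis by simp
qed

lemma basis_expansion: "(v :: 'b \<Rightarrow>\<^sub>0 'k::field) = (\<Sum>b\<in>Poly_Mapping.keys v. pscale (Poly_Mapping.lookup v b) (bvec b))"
proof (rule poly_mapping_eqI)
  fix x
  have "(\<Sum>b\<in>Poly_Mapping.keys v. Poly_Mapping.lookup v b * Poly_Mapping.lookup (bvec b) x)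
      = (\<Sum>b\<in>Poly_Mapping.keys v. if b = x then Poly_Mapping.lookup v x else 0)"
    by (rule sum.cong) (auto simp: lookup_single when_def)
  also have "\<dots> = Poly_Mapping.lookup v x"
    by (simp add: in_keys_iff)
  finally show "Poly_Mapping.lookup v x
      = Poly_Mapping.lookup (\<Sum>b\<in>Poly_Mapping.keys v. pscale (Poly_Mapping.lookup v b) (bvec b)) x"
    by (simp add: lookup_sum)
qed

lemma lin_on_ext:
  assumes "lin_on s (free_space B) f W" "v \<in> free_space B"
  shows "f v = ext s (\<lambda>b. f (bvec b)) v"
proof -
  have k: "b \<in> Poly_Mapping.keys v \<Longrightarrow> b \<in> B" for b using assms(2) by (auto simp: free_space_def)
  have "f v = f (\<Sum>b\<in>Poly_Mapping.keys v. pscale (Poly_Mapping.lookup v b) (bvec b))"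
    by (rule arg_cong[OF basis_expansion])
  also have "\<dots> = (\<Sum>b\<in>Poly_Mapping.keys v. f (pscale (Poly_Mapping.lookup v b) (bvec b)))"
    by (rule lin_on_sum[OF assms(1) subspace_free_space]) (simp add: free_space_pscale k)
  also have "\<dots> = ext s (\<lambda>b. f (bvec b)) v" unfolding ext_def
    by (rule sum.cong) (simp_all add: lin_onD(3)[OF assms(1)] k)
  finally show ?thesis .
qed

lemma ext_cong: "(\<And>b. b \<in> Poly_Mapping.keys v \<Longrightarrow> F b = F' b) \<Longrightarrow> ext s F v = ext s F' v"
  unfolding ext_def by (rule sum.cong) auto

lemma lin_on_eqI:
  assumes "v \<in> free_space B" "lin_on s (free_space B) f W" "lin_on s (free_space B) f' W'"
    "\<And>b. b \<in> B \<Longrightarrow> f (bvec b) = f' (bvec b)"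
  shows "f v = f' v"
proof -
  have "ext s (\<lambda>b. f (bvec b)) v = ext s (\<lambda>b. f' (bvec b)) v"
    using assms(1,4) by (intro ext_cong) (auto simp: free_space_def)
  then show ?thesis using lin_on_ext[OF assms(2,1)] lin_on_ext[OF assms(3,1)] by simp
qed

lemma lin_eqI:
  assumes "v \<in> free_space B" "lin s f" "lin s f'" "\<And>b. b \<in> B \<Longrightarrow> f (bvec b) = f' (bvec b)"
  shows "f v = f' v"
  by (rule lin_on_eqI[OF assms(1) lin_on_subset[OF assms(2)] lin_on_subset[OF assms(3)] assms(4)]) auto

text \<open>
  Values on the basis decide whether a linear map sends a free space into a given subspace.
\<close>

lemma lin_on_freeI:
  fixes f :: "('b \<Rightarrow>\<^sub>0 'k::field) \<Rightarrow> ('c \<Rightarrow>\<^sub>0 'k)"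
  assumes "lin pscale f" "fs.subspace W" "\<And>b. b \<in> B \<Longrightarrow> f (bvec b) \<in> W"
  shows "lin_on pscale (free_space B) f W"
proof (rule lin_on_subset[OF assms(1)])
  fix v :: "'b \<Rightarrow>\<^sub>0 'k" assume v: "v \<in> free_space B"
  have "f v = ext pscale (\<lambda>b. f (bvec b)) v"
    by (rule lin_on_ext[OF lin_on_subset[OF assms(1)] v, of UNIV]) auto
  also have "\<dots> \<in> W" unfolding ext_def
    using v by (intro fs.subspace_sum[OF assms(2)] fs.subspace_scale[OF assms(2)] assms(3))
      (auto simp: free_space_def)
  finally show "f v \<in> W" .
qed

lemma ext_bvec [simp]: "vector_space s \<Longrightarrow> ext s F (bvec b) = F b"
  by (simp add: ext_def vector_space.vector_space_assms(4))

text \<open>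
  Rules that prove the linearity of a composite expression in one of its arguments by its syntactic shape;
  they discharge the side conditions when an identity is checked on basis vectors only.
\<close>

named_theorems lin_intros

declare vector_space_pscale [lin_intros] vector_space_mult [lin_intros]

lemma lin_ext:
  fixes s :: "'k::field \<Rightarrow> 'v \<Rightarrow> 'v::ab_group_add" and F :: "'b \<Rightarrow> 'v"
  assumes "vector_space s"
  shows "lin s (ext s F)"
proof (rule lin_onI)
  interpret vector_space s by fact
  fix u v :: "'b \<Rightarrow>\<^sub>0 'k" and c
  let ?A = "Poly_Mapping.keys u \<union> Poly_Mapping.keys v"
  have "Poly_Mapping.keys (u + v) \<subseteq> ?A" by (rule keys_add)
  then show "ext s F (u + v) = ext s F u + ext s F v"
    by (simp add: ext_superset[OF assms, of ?A] lookup_add scale_left_distrib sum.distrib)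
  have "Poly_Mapping.keys (pscale c v) \<subseteq> Poly_Mapping.keys v" by (auto simp: in_keys_iff)
  then show "ext s F (pscale c v) = s c (ext s F v)"
    by (simp add: ext_superset[OF assms, of "Poly_Mapping.keys v"] scale_sum_right)
qed auto

lemma lin_comp: "lin s f \<Longrightarrow> lin pscale g \<Longrightarrow> lin s (\<lambda>v. f (g v))"
  by (auto simp: lin_on_def)

lemma lin_ext_comp [lin_intros]: "vector_space s \<Longrightarrow> lin pscale g \<Longrightarrow> lin s (\<lambda>v. ext s F (g v))"
  by (rule lin_comp[OF lin_ext])

lemma lin_ident [lin_intros]: "lin pscale (\<lambda>v. v)"
  by (auto simp: lin_on_def)

lemma lin_sum [lin_intros]:
  assumes "vector_space s" "\<And>i. i \<in> I \<Longrightarrow> lin s (f i)"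
  shows "lin s (\<lambda>v. \<Sum>i\<in>I. f i v)"
proof -
  interpret vector_space s by fact
  show ?thesis using assms(2) by (auto simp: lin_on_def sum.distrib scale_sum_right)
qed

lemma lin_scale:
  assumes "vector_space s" "lin s f" shows "lin s (\<lambda>v. s c (f v))"
proof -
  interpret vector_space s by fact
  show ?thesis using assms(2) by (auto simp: lin_on_def scale_right_distrib mult.commute)
qed

lemma lin_pscale_left [lin_intros]: "lin (*) f \<Longrightarrow> lin pscale (\<lambda>v. pscale (f v) w)"
  by (auto simp: lin_on_def fs.scale_left_distrib)

lemma lin_mult_right [lin_intros]: "lin (*) f \<Longrightarrow> lin (*) (\<lambda>v. f v * c)"
  by (auto simp: lin_on_def algebra_simps)

lemma lin_ext_family:
  assumes "vector_space s" "\<And>b. lin s (\<lambda>v. F v b)"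
  shows "lin s (\<lambda>v. ext s (F v) w)"
  unfolding ext_def by (intro lin_sum lin_scale assms)

lemma lin_sw:
  "vector_space s \<Longrightarrow> lin pscale \<Delta> \<Longrightarrow> lin pscale g \<Longrightarrow> lin s (\<lambda>a. sw s \<Delta> (g a) F)"
  unfolding sw_def by (intro lin_ext_comp lin_comp[of pscale \<Delta> g])

lemma lin_sw_family:
  assumes "vector_space s" "\<And>x y. lin s (\<lambda>v. F v (bvec x) (bvec y))"
  shows "lin s (\<lambda>v. sw s \<Delta> a (F v))"
  unfolding sw_def using assms by (intro lin_ext_family) (auto split: prod.splits)

lemma lookup_ext: "Poly_Mapping.lookup (ext pscale F v) x = ext (*) (\<lambda>b. Poly_Mapping.lookup (F b) x) v"
  by (simp add: ext_def lookup_sum)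

lemma ext_mult_right: "ext (*) (\<lambda>b. F b * c) v = ext (*) F v * (c::'k::field)"
  by (simp add: ext_def sum_distrib_right mult.assoc)

lemma ext_lookup: "ext (*) (\<lambda>b. Poly_Mapping.lookup (bvec b) x) v = Poly_Mapping.lookup v x"
proof -
  have "Poly_Mapping.lookup v x = Poly_Mapping.lookup
      (\<Sum>b\<in>Poly_Mapping.keys v. pscale (Poly_Mapping.lookup v b) (bvec b)) x"
    by (rule arg_cong[OF basis_expansion])
  also have "\<dots> = ext (*) (\<lambda>b. Poly_Mapping.lookup (bvec b) x) v"
    by (simp add: ext_def lookup_sum)
  finally show ?thesis by simp
qed

lemma lookup_tens [simp]:
  "Poly_Mapping.lookup (tens u v) (x, y) = Poly_Mapping.lookup u x * Poly_Mapping.lookup v y"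
proof -
  have "ext (*) (\<lambda>c. Poly_Mapping.lookup (bvec (b, c)) (x, y)) v
      = Poly_Mapping.lookup v y * Poly_Mapping.lookup (bvec b) x" for b
  proof -
    have "ext (*) (\<lambda>c. Poly_Mapping.lookup (bvec (b, c)) (x, y)) v
        = ext (*) (\<lambda>c. Poly_Mapping.lookup (bvec c) y * Poly_Mapping.lookup (bvec b) x) v"
      by (rule ext_cong) (auto simp: lookup_single when_def)
    then show ?thesis by (simp add: ext_mult_right ext_lookup)
  qed
  then have "Poly_Mapping.lookup (tens u v) (x, y)
      = ext (*) (\<lambda>b. Poly_Mapping.lookup (bvec b) x * Poly_Mapping.lookup v y) u"
    by (simp add: tens_def lookup_ext mult.commute)
  then show ?thesis by (simp add: ext_mult_right ext_lookup)
qed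

lemma tens_bvec [simp]: "tens (bvec x) (bvec y) = bvec (x, y)"
  by (rule poly_mapping_eqI) (auto simp: lookup_single when_def split: if_splits)

lemma tens_eqI:
  "(\<And>x y. Poly_Mapping.lookup u (x, y) = Poly_Mapping.lookup v (x, y)) \<Longrightarrow> u = v"
  by (rule poly_mapping_eqI) auto

lemma lin_tens_left: "lin pscale (\<lambda>u. tens u v)"
  by (auto simp: lin_on_def lookup_add algebra_simps intro!: tens_eqI)

lemma lin_tens_right: "lin pscale (tens u)"
  by (auto simp: lin_on_def lookup_add algebra_simps intro!: tens_eqI)

lemma lin_tens_left_comp [lin_intros]: "lin pscale g \<Longrightarrow> lin pscale (\<lambda>u. tens (g u) v)"
  by (rule lin_comp[OF lin_tens_left])

lemma lin_tens_right_comp [lin_intros]: "lin pscale g \<Longrightarrow> lin pscale (\<lambda>v. tens u (g v))"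
  by (rule lin_comp[OF lin_tens_right])

lemma tens_pscale: "tens (pscale a u) (pscale b v) = pscale (a * b) (tens u v)"
  by (rule tens_eqI) simp

lemma tens_free_space: "u \<in> free_space B \<Longrightarrow> v \<in> free_space C \<Longrightarrow> tens u v \<in> free_space (B \<times> C)"
  by (auto simp: free_space_iff)

text \<open>
  A bilinear function of two vectors depends linearly on their tensor product.  This turns the
  bilinear structure maps of a Majid algebra into linear maps out of a tensor product.
\<close>

lemma ext_tens:
  assumes "vector_space s" "\<And>v. v \<in> free_space C \<Longrightarrow> lin_on s (free_space B) (\<lambda>u. F u v) W"
    "\<And>u. u \<in> free_space B \<Longrightarrow> lin_on s (free_space C) (F u) W'"
    "u \<in> free_space B" "v \<in> free_space C"
  shows "ext s (\<lambda>(x, y). F (bvec x) (bvec y)) (tens u v) = F u v"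
proof -
  have l: "lin s (ext s (\<lambda>(x, y). F (bvec x) (bvec y)))" by (rule lin_ext[OF assms(1)])
  have 1: "ext s (\<lambda>(x, y). F (bvec x) (bvec y)) (tens (bvec b) v) = F (bvec b) v" if "b \<in> B" for b
    by (rule lin_on_eqI[OF assms(5) lin_on_subset[OF lin_comp[OF l lin_tens_right]] assms(3)])
      (auto simp: assms(1) that)
  show ?thesis
    by (rule lin_on_eqI[OF assms(4) lin_on_subset[OF lin_comp[OF l lin_tens_left]] assms(2)])
      (auto simp: 1 assms(5))
qed

section \<open>Splitting systems and their coalgebras\<close>

text \<open>
  A coalgebra whose comultiplication sends a basis element to a sum of distinct pairs of basis elements is
  described by combinatorial data: \<open>splits b\<close> is the set of pairs \<open>(x, y)\<close> with \<open>b = x y\<close>, the part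
  \<open>y\<close> being traversed first.  Every element has a unique decomposition with a right factor of degree \<open>0\<close>,
  its source, and one with a left factor of degree \<open>0\<close>, its target.  Path coalgebras, their tensor products
  and their opposites are all of this form.
\<close>

record 'b splitting =
  sbasis :: "'b set"
  sdeg :: "'b \<Rightarrow> nat"
  splits :: "'b \<Rightarrow> ('b \<times> 'b) set"
  ssrc :: "'b \<Rightarrow> 'b"
  stgt :: "'b \<Rightarrow> 'b"

locale splitting_system =
  fixes S :: "'b splitting"
  assumes finite_splits: "finite (splits S b)"
    and splits_basis: "b \<in> sbasis S \<Longrightarrow> (x, y) \<in> splits S b \<Longrightarrow> x \<in> sbasis S \<and> y \<in> sbasis S"
    and splits_join: "(x, y) \<in> splits S b \<Longrightarrow> (x, y) \<in> splits S b' \<Longrightarrow> b = b'"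
    and splits_coassoc: "(\<exists>w. (w, z) \<in> splits S b \<and> (x, y) \<in> splits S w)
      \<longleftrightarrow> (\<exists>w. (x, w) \<in> splits S b \<and> (y, z) \<in> splits S w)"
    and splits_deg: "(x, y) \<in> splits S b \<Longrightarrow> sdeg S b = sdeg S x + sdeg S y"
    and splits_src: "(b, ssrc S b) \<in> splits S b" "sdeg S (ssrc S b) = 0"
    and splits_tgt: "(stgt S b, b) \<in> splits S b" "sdeg S (stgt S b) = 0"
    and splits_deg0_right: "(x, y) \<in> splits S b \<Longrightarrow> sdeg S y = 0 \<Longrightarrow> x = b \<and> y = ssrc S b"
    and splits_deg0_left: "(x, y) \<in> splits S b \<Longrightarrow> sdeg S x = 0 \<Longrightarrow> y = b \<and> x = stgt S b"
    and splits_ends: "(x, y) \<in> splits S b \<Longrightarrow> ssrc S y = ssrc S b \<and> stgt S x = stgt S b \<and> ssrc S x = stgt S y"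
begin

lemma ends_deg0: assumes "sdeg S b = 0" shows "ssrc S b = b" "stgt S b = b"
  using splits_deg0_right[OF splits_tgt(1)] splits_deg0_left[OF splits_src(1)] assms by metis+

lemma splits_of_deg0:
  assumes "sdeg S b = 0" shows "splits S b = {(b, b)}"
proof (intro equalityI subsetI)
  fix z assume z: "z \<in> splits S b"
  then have "sdeg S (snd z) = 0" using splits_deg[of "fst z" "snd z" b] assms by simp
  then show "z \<in> {(b, b)}"
    using splits_deg0_right[of "fst z" "snd z" b] z ends_deg0[OF assms] by (cases z) auto
qed (use splits_src(1)[of b] ends_deg0[OF assms] in auto)

lemma ends_idem [simp]: "ssrc S (ssrc S b) = ssrc S b" "stgt S (stgt S b) = stgt S b"
  "ssrc S (stgt S b) = stgt S b" "stgt S (ssrc S b) = ssrc S b"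
  by (simp_all add: ends_deg0 splits_src splits_tgt)

lemma ends_basis: assumes "b \<in> sbasis S" shows "ssrc S b \<in> sbasis S" "stgt S b \<in> sbasis S"
  using splits_basis[OF assms] splits_src splits_tgt by blast+

lemma splits_of_deg1:
  assumes "sdeg S b = 1"
  shows "splits S b = {(b, ssrc S b), (stgt S b, b)}"
proof (intro equalityI subsetI)
  fix z assume z: "z \<in> splits S b"
  obtain x y where [simp]: "z = (x, y)" by force
  have "sdeg S x = 0 \<or> sdeg S y = 0" using splits_deg[of x y b] z assms by auto
  then show "z \<in> {(b, ssrc S b), (stgt S b, b)}"
    using splits_deg0_right[of x y b] splits_deg0_left[of x y b] z by auto
qed (auto simp: splits_src splits_tgt)

text \<open>
  Both sums run over the decompositions of \<open>b\<close> into three factors: the intermediate factor is determined by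
  its two parts, so each iterated sum is a sum over the same set of triples.
\<close>

lemma sum_coassoc:
  "(\<Sum>(w, z)\<in>splits S b. \<Sum>(x, y)\<in>splits S w. f x y z)
   = (\<Sum>(x, w)\<in>splits S b. \<Sum>(y, z)\<in>splits S w. (f x y z :: 'a::comm_monoid_add))"
proof -
  let ?A = "SIGMA p:splits S b. splits S (fst p)" and ?B = "SIGMA p:splits S b. splits S (snd p)"
  let ?T = "{(x, y, z). \<exists>w. (w, z) \<in> splits S b \<and> (x, y) \<in> splits S w}"
  let ?h = "\<lambda>r. (fst (snd r), snd (snd r), snd (fst r))"
  let ?k = "\<lambda>r. (fst (fst r), fst (snd r), snd (snd r))"
  let ?f = "\<lambda>t. f (fst t) (fst (snd t)) (snd (snd t))"
  have h: "bij_betw ?h ?A ?T"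
    unfolding bij_betw_def by (intro conjI, force simp: inj_on_def dest: splits_join, force)
  have T: "?T = {(x, y, z). \<exists>w. (x, w) \<in> splits S b \<and> (y, z) \<in> splits S w}"
    using splits_coassoc by blast
  have k: "bij_betw ?k ?B ?T"
    unfolding bij_betw_def T by (intro conjI, force simp: inj_on_def dest: splits_join, force)
  have "(\<Sum>(w, z)\<in>splits S b. \<Sum>(x, y)\<in>splits S w. f x y z) = (\<Sum>r\<in>?A. ?f (?h r))"
    by (simp add: sum.Sigma finite_splits case_prod_beta)
  also have "\<dots> = (\<Sum>r\<in>?B. ?f (?k r))"
    using sum.reindex_bij_betw[OF h, of ?f] sum.reindex_bij_betw[OF k, of ?f] by simp
  also have "\<dots> = (\<Sum>(x, w)\<in>splits S b. \<Sum>(y, z)\<in>splits S w. f x y z)"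
    by (simp add: sum.Sigma finite_splits case_prod_beta)
  finally show ?thesis .
qed

end

definition scomult :: "'b splitting \<Rightarrow> ('b \<Rightarrow>\<^sub>0 'k::field) \<Rightarrow> ('b \<times> 'b \<Rightarrow>\<^sub>0 'k)" where
  "scomult S = ext pscale (\<lambda>b. \<Sum>z\<in>splits S b. bvec z)"

definition graded_coalg_map :: "'b splitting \<Rightarrow> 'c splitting \<Rightarrow> ('b \<Rightarrow> ('c \<Rightarrow>\<^sub>0 'k::field)) \<Rightarrow> bool" where
  "graded_coalg_map S T X \<longleftrightarrow> (\<forall>b\<in>sbasis S.
     X b \<in> free_space {c \<in> sbasis T. sdeg T c = sdeg S b}
     \<and> scomult T (X b) = (\<Sum>(x, y)\<in>splits S b. tens (X x) (X y)))"

lemma graded_coalg_mapD: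
  assumes "graded_coalg_map S T X" "b \<in> sbasis S"
  shows "X b \<in> free_space {c \<in> sbasis T. sdeg T c = sdeg S b}" "X b \<in> free_space (sbasis T)"
    "scomult T (X b) = (\<Sum>(x, y)\<in>splits S b. tens (X x) (X y))"
  using assms by (auto simp: graded_coalg_map_def elim: free_space_mono)

lemma ext_pscale_sum: "ext pscale F (\<Sum>i\<in>I. v i) = (\<Sum>i\<in>I. ext pscale F (v i))"
  by (rule lin_on_sum[OF lin_ext[OF vector_space_pscale]]) auto

lemma ext_pscale_tens:
  "ext pscale (\<lambda>(x, y). tens (F x) (G y)) (tens u v) = tens (ext pscale F u) (ext pscale G v)"
proof -
  have "ext pscale (\<lambda>(x, y). tens (F x) (G y)) (tens u v)
      = ext pscale (\<lambda>(x, y). tens (ext pscale F (bvec x)) (ext pscale G (bvec y))) (tens u v)"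
    by (simp add: vector_space_pscale)
  also have "\<dots> = tens (ext pscale F u) (ext pscale G v)"
    by (rule ext_tens[where B = UNIV and C = UNIV])
      (auto simp: free_space_def vector_space_pscale intro!: lin_on_subset lin_intros)
  finally show ?thesis .
qed

lemma graded_coalg_map_comp:
  assumes X: "graded_coalg_map S T X" and Y: "graded_coalg_map T U Y"
    and S: "splitting_system S"
  shows "graded_coalg_map S U (\<lambda>b. ext pscale Y (X b))"
  unfolding graded_coalg_map_def
proof (intro ballI conjI)
  fix b assume b: "b \<in> sbasis S"
  show "ext pscale Y (X b) \<in> free_space {c \<in> sbasis U. sdeg U c = sdeg S b}"
    unfolding ext_def
  proof (intro free_space_sum free_space_pscale)
    fix i assume "i \<in> Poly_Mapping.keys (X b)"
    then have "i \<in> sbasis T" "sdeg T i = sdeg S b"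
      using graded_coalg_mapD(1)[OF X b] by (auto simp: free_space_def)
    then show "Y i \<in> free_space {c \<in> sbasis U. sdeg U c = sdeg S b}"
      using graded_coalg_mapD(1)[OF Y] by metis
  qed
  have "scomult U (ext pscale Y v) = ext pscale (\<lambda>(x, y). tens (Y x) (Y y)) (scomult T v)"
    if "v \<in> free_space (sbasis T)" for v
    unfolding scomult_def
    by (rule lin_eqI[OF that])
      (use graded_coalg_mapD(3)[OF Y, unfolded scomult_def] in
        \<open>auto simp: vector_space_pscale ext_pscale_sum case_prod_beta intro!: lin_intros\<close>)
  from this[OF graded_coalg_mapD(2)[OF X b]]
  show "scomult U (ext pscale Y (X b))
      = (\<Sum>(x, y)\<in>splits S b. tens (ext pscale Y (X x)) (ext pscale Y (X y)))"
    by (simp add: graded_coalg_mapD(3)[OF X b] ext_pscale_sum case_prod_beta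
        flip: ext_pscale_tens)
qed

lemma graded_coalg_map_ident: "splitting_system S \<Longrightarrow> graded_coalg_map S S bvec"
  by (simp add: graded_coalg_map_def scomult_def vector_space_pscale case_prod_beta)

text \<open>
  Rescaling by a function of the source and dividing by the same function of the target preserves
  coalgebra maps, because the contributions of the intermediate ends cancel.
\<close>

lemma (in splitting_system) graded_coalg_map_rescale:
  assumes X: "graded_coalg_map S T X" and c: "\<And>b. b \<in> sbasis S \<Longrightarrow> c b \<noteq> 0"
  shows "graded_coalg_map S T (\<lambda>b. pscale (c (ssrc S b) / c (stgt S b)) (X b))"
  unfolding graded_coalg_map_def
proof (intro ballI conjI)
  fix b assume b: "b \<in> sbasis S"
  show "pscale (c (ssrc S b) / c (stgt S b)) (X b) \<in> free_space {x \<in> sbasis T. sdeg T x = sdeg S b}"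
    by (rule free_space_pscale[OF graded_coalg_mapD(1)[OF X b]])
  let ?c = "c (ssrc S b) / c (stgt S b)"
  let ?Y = "\<lambda>x. pscale (c (ssrc S x) / c (stgt S x)) (X x)"
  have l: "lin pscale (scomult T)" unfolding scomult_def by (rule lin_ext[OF vector_space_pscale])
  have "scomult T (pscale ?c (X b)) = (\<Sum>(x, y)\<in>splits S b. pscale ?c (tens (X x) (X y)))"
    using lin_onD(3)[OF l, of "X b" ?c]
    by (simp add: graded_coalg_mapD(3)[OF X b] fs.scale_sum_right case_prod_beta)
  also have "\<dots> = (\<Sum>(x, y)\<in>splits S b. tens (?Y x) (?Y y))"
  proof (rule sum.cong[OF refl], unfold case_prod_beta tens_pscale)
    fix z assume z: "z \<in> splits S b"
    then have xy: "(fst z, snd z) \<in> splits S b" by simp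
    have "c (stgt S (snd z)) \<noteq> 0" using splits_basis[OF b xy] c ends_basis by blast
    then show "pscale ?c (tens (X (fst z)) (X (snd z))) =
        pscale (c (ssrc S (fst z)) / c (stgt S (fst z)) * (c (ssrc S (snd z)) / c (stgt S (snd z))))
          (tens (X (fst z)) (X (snd z)))"
      using splits_ends[OF xy] by simp
  qed
  finally show "scomult T (?Y b) = (\<Sum>(x, y)\<in>splits S b. tens (?Y x) (?Y y))" .
qed

definition opp_splitting :: "'b splitting \<Rightarrow> 'b splitting" where
  "opp_splitting S = \<lparr> sbasis = sbasis S, sdeg = sdeg S, splits = (\<lambda>b. prod.swap ` splits S b),
     ssrc = stgt S, stgt = ssrc S \<rparr>"

lemma opp_splitting_simps [simp]: "sbasis (opp_splitting S) = sbasis S" "sdeg (opp_splitting S) = sdeg S"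
  "ssrc (opp_splitting S) = stgt S" "stgt (opp_splitting S) = ssrc S"
  by (simp_all add: opp_splitting_def)

lemma swap_in_splits: "(x, y) \<in> prod.swap ` A \<longleftrightarrow> (y, x) \<in> A" by force

lemma (in splitting_system) splitting_system_opp: "splitting_system (opp_splitting S)"
  apply unfold_locales
  unfolding opp_splitting_def
            apply (simp_all add: swap_in_splits finite_splits splits_src splits_tgt)
        apply (use splits_basis splits_join splits_coassoc splits_deg splits_deg0_right
        splits_deg0_left splits_ends in \<open>blast|metis add.commute\<close>)+
  done

text \<open>
  The middle interchange \<open>(A \<otimes> B) \<otimes> (C \<otimes> D) \<cong> (A \<otimes> C) \<otimes> (B \<otimes> D)\<close>, which enters the comultiplication of a tensor product
  of coalgebras.
\<close>

definition mid_swap :: "('a \<times> 'b) \<times> ('c \<times> 'd) \<Rightarrow> ('a \<times> 'c) \<times> ('b \<times> 'd)" where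
  "mid_swap z = ((fst (fst z), fst (snd z)), (snd (fst z), snd (snd z)))"

lemma mid_swap_simp [simp]: "mid_swap ((x, y), (x', y')) = ((x, x'), (y, y'))"
  by (simp add: mid_swap_def)

lemma inj_mid_swap: "inj mid_swap"
  by (auto simp: inj_def)

definition prod_splitting :: "'b splitting \<Rightarrow> 'c splitting \<Rightarrow> ('b \<times> 'c) splitting" where
  "prod_splitting S T = \<lparr> sbasis = sbasis S \<times> sbasis T, sdeg = (\<lambda>(a, b). sdeg S a + sdeg T b),
     splits = (\<lambda>(a, b). mid_swap ` (splits S a \<times> splits T b)),
     ssrc = map_prod (ssrc S) (ssrc T), stgt = map_prod (stgt S) (stgt T) \<rparr>"

lemma prod_splitting_simps [simp]:
  "sbasis (prod_splitting S T) = sbasis S \<times> sbasis T"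
  "sdeg (prod_splitting S T) (a, b) = sdeg S a + sdeg T b"
  "ssrc (prod_splitting S T) (a, b) = (ssrc S a, ssrc T b)"
  "stgt (prod_splitting S T) (a, b) = (stgt S a, stgt T b)"
  "((x, x'), (y, y')) \<in> splits (prod_splitting S T) (a, b)
     \<longleftrightarrow> (x, y) \<in> splits S a \<and> (x', y') \<in> splits T b"
proof -
  show "((x, x'), (y, y')) \<in> splits (prod_splitting S T) (a, b)
     \<longleftrightarrow> (x, y) \<in> splits S a \<and> (x', y') \<in> splits T b"
    using image_eqI[of "((x, x'), (y, y'))" mid_swap "((x, y), (x', y'))"
      "splits S a \<times> splits T b"] by (auto simp: prod_splitting_def)
qed (auto simp: prod_splitting_def)

lemma splitting_system_prod:
  assumes "splitting_system S" "splitting_system T"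
  shows "splitting_system (prod_splitting S T)"
proof -
  interpret S: splitting_system S by fact
  interpret T: splitting_system T by fact
  show ?thesis
  proof (unfold_locales, goal_cases)
    case (1 b) then show ?case
      by (cases b) (auto simp: prod_splitting_def S.finite_splits T.finite_splits)
  next
    case (2 b x y) then show ?case
      by (cases b; cases x; cases y) (auto dest: S.splits_basis T.splits_basis)
  next
    case (3 x y b b') then show ?case
      by (cases b; cases b'; cases x; cases y) (auto dest: S.splits_join T.splits_join)
  next
    case (4 z b x y) then show ?case
      using S.splits_coassoc[of "fst z" "fst b" "fst x" "fst y"]
        T.splits_coassoc[of "snd z" "snd b" "snd x" "snd y"]
      by (cases b; cases x; cases y; cases z) auto
  next
    case (5 x y b) then show ?case
      using S.splits_deg[of "fst x" "fst y" "fst b"] T.splits_deg[of "snd x" "snd y" "snd b"]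
      by (cases b; cases x; cases y) auto
  next
    case (10 x y b) then show ?case
      by (cases b; cases x; cases y) (auto dest: S.splits_deg0_right T.splits_deg0_right)
  next
    case (11 x y b) then show ?case
      by (cases b; cases x; cases y) (auto dest: S.splits_deg0_left T.splits_deg0_left)
  next
    case (12 x y b) then show ?case
      by (cases b; cases x; cases y) (auto dest: S.splits_ends T.splits_ends)
  qed (auto simp: S.splits_src S.splits_tgt T.splits_src T.splits_tgt)
qed

lemma sum_splits_prod:
  "(\<Sum>z\<in>splits (prod_splitting S T) (a, b). f z)
   = (\<Sum>(x, y)\<in>splits S a. \<Sum>(x', y')\<in>splits T b. f ((x, x'), (y, y')))"
proof -
  have "(\<Sum>z\<in>splits (prod_splitting S T) (a, b). f z)
      = (\<Sum>z\<in>splits S a \<times> splits T b. f (mid_swap z))"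
    using sum.reindex[OF inj_on_subset[OF inj_mid_swap subset_UNIV], of f "splits S a \<times> splits T b"]
    by (simp add: prod_splitting_def)
  also have "\<dots> = (\<Sum>(x, y)\<in>splits S a. \<Sum>(x', y')\<in>splits T b. f ((x, x'), (y, y')))"
    by (simp add: sum.cartesian_product case_prod_beta mid_swap_def)
  finally show ?thesis .
qed

lemma lookup_relabel:
  fixes w :: "'b \<Rightarrow>\<^sub>0 'k::field"
  assumes "inj f"
  shows "Poly_Mapping.lookup (ext pscale (\<lambda>z. bvec (f z)) w) (f z) = Poly_Mapping.lookup w z"
proof -
  have 1: "(\<lambda>b. Poly_Mapping.lookup (bvec (f b)) (f z)) = (\<lambda>b. Poly_Mapping.lookup (bvec b) z :: 'k)"
    using assms by (auto simp: lookup_single when_def inj_eq)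
  show ?thesis unfolding lookup_ext 1 by (rule ext_lookup)
qed

lemma tens_sum: "tens (\<Sum>i\<in>I. f i) (\<Sum>j\<in>J. h j) = (\<Sum>i\<in>I. \<Sum>j\<in>J. tens (f i) (h j))"
  by (rule tens_eqI) (simp add: lookup_sum sum_product)

lemma scomult_prod:
  "scomult (prod_splitting S T) (tens u v)
   = ext pscale (\<lambda>z. bvec (mid_swap z)) (tens (scomult S u) (scomult T v))"
    (is "?l u v = ?r u v")
proof -
  have l: "lin pscale (scomult (prod_splitting S T))" "lin pscale (scomult S)" "lin pscale (scomult T)"
    unfolding scomult_def by (rule lin_ext[OF vector_space_pscale])+
  have eq: "?l (bvec a) (bvec b) = ?r (bvec a) (bvec b)" for a b
  proof -
    have "?r (bvec a) (bvec b) = ext pscale (\<lambda>z. bvec (mid_swap z))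
        (\<Sum>z\<in>splits S a. \<Sum>z'\<in>splits T b. tens (bvec z) (bvec z'))"
      by (simp add: scomult_def vector_space_pscale tens_sum)
    also have "\<dots> = ?l (bvec a) (bvec b)"
      by (simp add: ext_pscale_sum scomult_def vector_space_pscale sum_splits_prod case_prod_beta mid_swap_def)
    finally show ?thesis by simp
  qed
  have U: "w \<in> free_space UNIV" for w :: "'x \<Rightarrow>\<^sub>0 'y::field" by (simp add: free_space_def)
  have lr: "lin pscale (\<lambda>w. ext pscale (\<lambda>z. bvec (mid_swap z)) (tens (scomult S w) v))"
    "lin pscale (\<lambda>w. ext pscale (\<lambda>z. bvec (mid_swap z)) (tens v' (scomult T w)))" for v v'
    by (intro lin_ext_comp[OF vector_space_pscale] lin_tens_left_comp lin_tens_right_comp l)+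
  have "?l u (bvec b) = ?r u (bvec b)" for b
    by (rule lin_eqI[OF U, where f = "\<lambda>w. ?l w (bvec b)" and f' = "\<lambda>w. ?r w (bvec b)",
          OF lin_comp[OF l(1) lin_tens_left] lr(1)]) (rule eq)
  then show ?thesis
    by (rule lin_eqI[OF U, where f = "\<lambda>w. ?l u w" and f' = "\<lambda>w. ?r u w",
          OF lin_comp[OF l(1) lin_tens_right] lr(2)])
qed

lemma graded_coalg_map_prod:
  assumes X: "graded_coalg_map S T X" and X': "graded_coalg_map S' T' X'"
  shows "graded_coalg_map (prod_splitting S S') (prod_splitting T T') (\<lambda>(a, b). tens (X a) (X' b))"
  unfolding graded_coalg_map_def
proof (clarsimp, intro conjI)
  fix a b assume ab: "a \<in> sbasis S" "b \<in> sbasis S'"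
  show "tens (X a) (X' b) \<in> free_space {c. c \<in> sbasis T \<times> sbasis T'
      \<and> sdeg (prod_splitting T T') c = sdeg S a + sdeg S' b}"
    by (rule free_space_mono[OF tens_free_space[OF graded_coalg_mapD(1)[OF X ab(1)]
            graded_coalg_mapD(1)[OF X' ab(2)]]]) auto
  have mt: "ext pscale (\<lambda>z. bvec (mid_swap z)) (tens (tens p q) (tens r s))
      = tens (tens p r) (tens q s)" (is "?L = ?R")
    for p q :: "'b \<Rightarrow>\<^sub>0 'c" and r s :: "'e \<Rightarrow>\<^sub>0 'c"
  proof (intro poly_mapping_eqI)
    fix z :: "('b \<times> 'e) \<times> ('b \<times> 'e)"
    obtain x x' y y' where z: "z = mid_swap ((x, y), (x', y'))" by (cases z) auto
    show "Poly_Mapping.lookup ?L z = Poly_Mapping.lookup ?R z"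
      unfolding z by (simp only: lookup_relabel[OF inj_mid_swap]) simp
  qed
  let ?X = "\<lambda>z. tens (X (fst z)) (X (snd z))" and ?X' = "\<lambda>z. tens (X' (fst z)) (X' (snd z))"
  have "scomult (prod_splitting T T') (tens (X a) (X' b))
    = (\<Sum>z\<in>splits S a. \<Sum>z'\<in>splits S' b. ext pscale (\<lambda>z. bvec (mid_swap z)) (tens (?X z) (?X' z')))"
    unfolding scomult_prod graded_coalg_mapD(3)[OF X ab(1)] graded_coalg_mapD(3)[OF X' ab(2)]
    by (simp only: case_prod_beta tens_sum ext_pscale_sum)
  then show "scomult (prod_splitting T T') (tens (X a) (X' b)) =
       (\<Sum>(x, y)\<in>splits (prod_splitting S S') (a, b).
          tens (case x of (a, b) \<Rightarrow> tens (X a) (X' b)) (case y of (a, b) \<Rightarrow> tens (X a) (X' b)))"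
    by (simp add: sum_splits_prod case_prod_beta mt)
qed

section \<open>The path coalgebra and its universal property\<close>

definition path_splitting :: "('v, 'e) pre_digraph \<Rightarrow> ('v \<times> 'e list) splitting" where
  "path_splitting Q = \<lparr> sbasis = paths Q, sdeg = path_length,
     splits = (\<lambda>(u, p). (\<lambda>i. ((pre_digraph.awlast Q u (take i p), drop i p), (u, take i p))) ` {..length p}),
     ssrc = (\<lambda>(u, p). (u, [])), stgt = (\<lambda>(u, p). (pre_digraph.awlast Q u p, [])) \<rparr>"

lemma path_splitting_simps [simp]:
  "sbasis (path_splitting Q) = paths Q" "sdeg (path_splitting Q) = path_length"
  "ssrc (path_splitting Q) (u, p) = (u, [])"
  "stgt (path_splitting Q) (u, p) = (pre_digraph.awlast Q u p, [])"
  by (simp_all add: path_splitting_def)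

lemma path_length_simp [simp]: "path_length (u, p) = length p"
  by (simp add: path_length_def)

text \<open>
  The pairs in the comultiplication are listed with the later part of the path first, in accordance with
  the composition of paths from right to left.
\<close>

lemma path_splits_iff: "((v, q), (u', p')) \<in> splits (path_splitting Q) (u, p)
   \<longleftrightarrow> u' = u \<and> p = p' @ q \<and> v = pre_digraph.awlast Q u p'" (is "?l \<longleftrightarrow> ?r")
proof
  assume ?r
  then show ?l by (auto simp: path_splitting_def intro!: image_eqI[of _ _ "length p'"])
qed (auto simp: path_splitting_def)

lemma sum_path_splits:
  "(\<Sum>z\<in>splits (path_splitting Q) (u, p). f z)
   = (\<Sum>i\<le>length p. f ((pre_digraph.awlast Q u (take i p), drop i p), (u, take i p)))"
proof -
  have "inj_on (\<lambda>i. ((pre_digraph.awlast Q u (take i p), drop i p), (u, take i p))) {..length p}"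
    by (rule inj_onI) (metis atMost_iff length_take min.absorb2 prod.inject)
  then show ?thesis by (simp add: path_splitting_def sum.reindex)
qed

lemma path_comult_splits: "path_comult Q c = (\<Sum>z\<in>splits (path_splitting Q) c. bvec z)"
  by (cases c) (simp add: sum_path_splits path_comult_def)

lemma scomult_path: "scomult (path_splitting Q) = ext pscale (path_comult Q)"
  unfolding scomult_def path_comult_splits[abs_def] ..

lemma lookup_path_comult_basis:
  "Poly_Mapping.lookup (path_comult Q c) ((v, q), (u, p))
   = (if v = pre_digraph.awlast Q u p then Poly_Mapping.lookup (bvec c) (u, p @ q) else 0)"
proof (cases c)
  case (Pair w r)
  have fin: "finite (splits (path_splitting Q) c)"
    unfolding Pair by (simp add: path_splitting_def)
  have "Poly_Mapping.lookup (path_comult Q c) ((v, q), (u, p))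
      = (\<Sum>z\<in>splits (path_splitting Q) c. if z = ((v, q), (u, p)) then 1 else 0)"
    unfolding path_comult_splits lookup_sum
    by (rule sum.cong) (auto simp: lookup_single when_def)
  also have "\<dots> = (if ((v, q), (u, p)) \<in> splits (path_splitting Q) c then 1 else 0)"
    by (simp add: fin)
  also have "\<dots> = (if v = pre_digraph.awlast Q u p then Poly_Mapping.lookup (bvec c) (u, p @ q) else 0)"
    by (auto simp: Pair path_splits_iff lookup_single when_def)
  finally show ?thesis .
qed

text \<open>
  A pair of composable paths occurs in the comultiplication of exactly one path, their composite, so a coefficient
  of the comultiplication of any element is a coefficient of the element itself.  This is what makes the path coalgebra cofree.
\<close>

lemma lookup_path_comult:
  "Poly_Mapping.lookup (ext pscale (path_comult Q) X) ((v, q), (u, p))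
   = (if v = pre_digraph.awlast Q u p then Poly_Mapping.lookup X (u, p @ q) else 0)"
proof (cases "v = pre_digraph.awlast Q u p")
  case True
  then show ?thesis unfolding lookup_ext lookup_path_comult_basis using ext_lookup[of "(u, p @ q)" X] by simp
next
  case False
  then show ?thesis unfolding lookup_ext lookup_path_comult_basis by (simp add: ext_def)
qed

context wf_digraph
begin

abbreviation "PS \<equiv> path_splitting G"

lemma paths_append_iff: "(u, p @ q) \<in> paths G \<longleftrightarrow> (u, p) \<in> paths G \<and> (awlast u p, q) \<in> paths G"
  by (auto simp: paths_def awalk_append_iff)

lemma paths_Nil_iff [simp]: "(u, []) \<in> paths G \<longleftrightarrow> u \<in> verts G"
  by (auto simp: paths_def awalk_Nil_iff)

lemma paths_single_iff [simp]: "(u, [a]) \<in> paths G \<longleftrightarrow> a \<in> arcs G \<and> tail G a = u"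
  by (auto simp: paths_def awalk_simps)

lemma paths_awlast_in_verts: "(u, p) \<in> paths G \<Longrightarrow> awlast u p \<in> verts G"
  using paths_append_iff[of u p "[]"] by simp

lemma splitting_system_path: "splitting_system PS"
proof (unfold_locales, goal_cases)
  case (1 b) show ?case by (cases b) (simp add: path_splitting_def)
next
  case (2 b x y) then show ?case
    by (cases b; cases x; cases y) (auto simp: path_splits_iff paths_append_iff)
next
  case (3 x y b b') then show ?case
    by (cases b; cases b'; cases x; cases y) (auto simp: path_splits_iff)
next
  case (4 z b x y) then show ?case
    by (cases b; cases x; cases y; cases z) (auto simp: path_splits_iff awlast_append)
next
  case (5 x y b) then show ?case
    by (cases b; cases x; cases y) (auto simp: path_splits_iff)
next
  case (6 b) then show ?case by (cases b) (auto simp: path_splits_iff)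
next
  case (7 b) then show ?case by (cases b) (auto simp: path_splits_iff)
next
  case (8 b) then show ?case by (cases b) (auto simp: path_splits_iff)
next
  case (9 b) then show ?case by (cases b) (auto simp: path_splits_iff)
next
  case (10 x y b) then show ?case
    by (cases b; cases x; cases y) (auto simp: path_splits_iff)
next
  case (11 x y b) then show ?case
    by (cases b; cases x; cases y) (auto simp: path_splits_iff)
next
  case (12 x y b) then show ?case
    by (cases b; cases x; cases y) (auto simp: path_splits_iff awlast_append)
qed

text \<open>
  A coefficient of a homogeneous element of degree at least two is a coefficient of its
  comultiplication at a pair of shorter paths, so a coalgebra map is determined by its values in
  degrees at most one.
\<close>

lemma coalg_map_eqI:
  assumes S: "splitting_system S" and X: "graded_coalg_map S PS X" and Y: "graded_coalg_map S PS Y"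
    and low: "\<And>b. b \<in> sbasis S \<Longrightarrow> sdeg S b \<le> 1 \<Longrightarrow> X b = Y b"
    and b: "b \<in> sbasis S"
  shows "X b = (Y b :: _ \<Rightarrow>\<^sub>0 'k::field)"
  using b
proof (induction "sdeg S b" arbitrary: b rule: less_induct)
  case (less b)
  interpret S: splitting_system S by fact
  show ?case
  proof (cases "sdeg S b \<le> 1")
    case False
    show ?thesis
    proof (rule poly_mapping_eqI)
      fix c :: "'a \<times> 'b list"
      obtain u p where c: "c = (u, p)" by force
      show "Poly_Mapping.lookup (X b) c = Poly_Mapping.lookup (Y b) c"
      proof (cases "length p = sdeg S b")
        case len: True
        then obtain a q where p: "p = [a] @ q" using False by (cases p) auto
        \<comment> \<open>Splitting off the first arrow: the second factor has degree one and the first one a smaller degree.\<close>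
        have z: "Poly_Mapping.lookup (Z b) c
            = (\<Sum>(x, y)\<in>splits S b. Poly_Mapping.lookup (Z x) (head G a, q) * Poly_Mapping.lookup (Z y) (u, [a]))"
          if "graded_coalg_map S PS Z" for Z
          using graded_coalg_mapD(3)[OF that less(2)] lookup_path_comult[of G "Z b" "head G a" q u "[a]"]
          by (simp add: c p scomult_path lookup_sum case_prod_beta)
        have "Poly_Mapping.lookup (X x) (head G a, q) * Poly_Mapping.lookup (X y) (u, [a])
            = Poly_Mapping.lookup (Y x) (head G a, q) * Poly_Mapping.lookup (Y y) (u, [a])"
          if xy: "(x, y) \<in> splits S b" for x y
        proof (cases "sdeg S y = 1")
          case True
          then have "sdeg S x < sdeg S b" "sdeg S y < sdeg S b"
            using S.splits_deg[OF xy] False by auto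
          then show ?thesis using less(1) S.splits_basis[OF less(2) xy] by simp
        next
          case False
          then have "Poly_Mapping.lookup (X y) (u, [a]) = 0" "Poly_Mapping.lookup (Y y) (u, [a]) = 0"
            using graded_coalg_mapD(1)[OF X, of y] graded_coalg_mapD(1)[OF Y, of y]
              S.splits_basis[OF less(2) xy] by (auto simp: free_space_iff)
          then show ?thesis by simp
        qed
        then show ?thesis unfolding z[OF X] z[OF Y] by (intro sum.cong) auto
      next
        case False
        then show ?thesis
          using graded_coalg_mapD(1)[OF X less(2)] graded_coalg_mapD(1)[OF Y less(2)]
          by (auto simp: free_space_iff c)
      qed
    qed
  qed (simp add: low less)
qed

end

text \<open>
  The coefficient of the path \<open>p\<close> from \<open>u\<close> in the image of \<open>b\<close> is forced by the comultiplication: it is the sum, over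
  the decompositions of \<open>b\<close> into factors of degree \<open>1\<close>, of the products of the coefficients of the arrows of
  \<open>p\<close> in the degree \<open>1\<close> components \<open>F1\<close> of these factors.  The recursion splits off the arrow traversed first.
\<close>

primrec path_coeff :: "'b splitting \<Rightarrow> ('v, 'e) pre_digraph \<Rightarrow> ('b \<Rightarrow> 'v) \<Rightarrow> ('b \<Rightarrow> 'e \<Rightarrow> 'k::field)
    \<Rightarrow> 'e list \<Rightarrow> 'b \<Rightarrow> 'v \<Rightarrow> 'k" where
  "path_coeff S Q F0 F1 [] b u = (if sdeg S b = 0 \<and> F0 b = u then 1 else 0)"
| "path_coeff S Q F0 F1 (a # p) b u = (if tail Q a = u then
     (\<Sum>(x, y)\<in>splits S b. path_coeff S Q F0 F1 p x (head Q a) * F1 y a) else 0)"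

definition cofree_ext :: "'b splitting \<Rightarrow> ('v, 'e) pre_digraph \<Rightarrow> ('b \<Rightarrow> 'v) \<Rightarrow> ('b \<Rightarrow> 'e \<Rightarrow> 'k::field)
    \<Rightarrow> 'b \<Rightarrow> ('v \<times> 'e list \<Rightarrow>\<^sub>0 'k)" where
  "cofree_ext S Q F0 F1 b = Abs_poly_mapping (\<lambda>(u, p). path_coeff S Q F0 F1 p b u)"

text \<open>
  The prescribed components in degree \<open>0\<close> and \<open>1\<close> have to be compatible: an element of degree \<open>1\<close> is sent to arrows
  between the images of its ends.
\<close>

locale cofree_data = splitting_system S + wf_digraph Q
  for S :: "'b splitting" and Q :: "('v, 'e) pre_digraph" +
  fixes F0 :: "'b \<Rightarrow> 'v" and F1 :: "'b \<Rightarrow> 'e \<Rightarrow> 'k::field"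
  assumes F0_verts: "b \<in> sbasis S \<Longrightarrow> sdeg S b = 0 \<Longrightarrow> F0 b \<in> verts Q"
    and F1_finite: "finite {a. F1 b a \<noteq> 0}"
    and F1_nz: "F1 b a \<noteq> 0 \<Longrightarrow> sdeg S b = 1 \<and> a \<in> arcs Q \<and> tail Q a = F0 (ssrc S b) \<and> head Q a = F0 (stgt S b)"
begin

abbreviation "pc p b u \<equiv> path_coeff S Q F0 F1 p b u"

lemma path_coeff_nz:
  "pc p b u \<noteq> 0 \<Longrightarrow> length p = sdeg S b \<and> set p \<subseteq> arcs Q \<and> cas u p (F0 (stgt S b)) \<and> u = F0 (ssrc S b)"
proof (induction p arbitrary: b u)
  case Nil
  then show ?case by (auto simp: ends_deg0 split: if_splits)
next
  case (Cons a p)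
  then have t: "tail Q a = u" by (auto split: if_splits)
  have "(\<Sum>(x, y)\<in>splits S b. pc p x (head Q a) * F1 y a) \<noteq> 0" using Cons(2) t by simp
  then obtain x y where xy: "(x, y) \<in> splits S b" and nz: "pc p x (head Q a) \<noteq> 0" "F1 y a \<noteq> 0"
    by (rule sum.not_neutral_contains_not_neutral) auto
  show ?case
    using Cons(1)[OF nz(1)] F1_nz[OF nz(2)] splits_deg[OF xy] splits_ends[OF xy] t by auto
qed

lemma path_coeff_finite: "finite {(u, p). pc p b u \<noteq> 0}"
proof (induction "sdeg S b" arbitrary: b)
  case 0
  have "{(u, p). pc p b u \<noteq> 0} \<subseteq> {(F0 (ssrc S b), [])}" using path_coeff_nz 0 by fastforce
  then show ?case by (rule finite_subset) simp
next
  case (Suc n)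
  let ?D = "{z \<in> splits S b. sdeg S (snd z) = 1}"
  let ?U = "\<Union>z\<in>?D. (\<lambda>((v, p), a). (tail Q a, a # p)) `
    ({(u, p). pc p (fst z) u \<noteq> 0} \<times> {a. F1 (snd z) a \<noteq> 0})"
  have "finite {(u, p). pc p (fst z) u \<noteq> 0}" if "z \<in> ?D" for z
    using Suc(1)[of "fst z"] Suc(2) splits_deg[of "fst z" "snd z" b] that by simp
  then have fin: "finite ?U"
    by (intro finite_UN_I finite_imageI finite_cartesian_product F1_finite)
      (auto intro: finite_subset[OF _ finite_splits])
  have "{(u, p). pc p b u \<noteq> 0} \<subseteq> ?U"
  proof clarify
    fix u p assume nz: "pc p b u \<noteq> 0"
    then have "length p = Suc n" using path_coeff_nz Suc(2) by metis
    then obtain a q where p: "p = a # q" by (cases p) auto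
    have t: "tail Q a = u" using nz p by (auto split: if_splits)
    have "(\<Sum>(x, y)\<in>splits S b. pc q x (head Q a) * F1 y a) \<noteq> 0" using nz t p by simp
    then obtain x y where xy: "(x, y) \<in> splits S b" and nz: "pc q x (head Q a) \<noteq> 0" "F1 y a \<noteq> 0"
      by (rule sum.not_neutral_contains_not_neutral) auto
    have "(u, p) = (\<lambda>((v, p), a). (tail Q a, a # p)) ((head Q a, q), a)" using t p by simp
    then show "(u, p) \<in> ?U" using xy nz F1_nz[OF nz(2)]
      by (intro UN_I[of "(x, y)"] image_eqI[of _ _ "((head Q a, q), a)"]) auto
  qed
  then show ?case using fin by (rule finite_subset)
qed

lemma lookup_cofree_ext: "Poly_Mapping.lookup (cofree_ext S Q F0 F1 b) (u, p) = pc p b u"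
proof -
  have "finite {x. (case x of (u, p) \<Rightarrow> pc p b u) \<noteq> 0}"
    by (rule finite_subset[OF _ path_coeff_finite[of b]]) auto
  then show ?thesis by (simp add: cofree_ext_def)
qed

text \<open>
  By coassociativity a path may be cut at any vertex instead of after its first arrow.  This is the compatibility
  with the comultiplication, read off in coefficients.
\<close>

lemma path_coeff_append:
  "pc (p @ q) b u = (\<Sum>(x, y)\<in>splits S b. pc q x (awlast u p) * pc p y u)"
proof (induction p arbitrary: b u)
  case Nil
  have "(\<Sum>(x, y)\<in>splits S b. pc q x u * pc [] y u)
      = (\<Sum>z\<in>{(b, ssrc S b)}. pc q (fst z) u * pc [] (snd z) u)"
    unfolding case_prod_beta
    by (rule sum.mono_neutral_right[OF finite_splits])
      (use splits_src splits_deg0_right in \<open>fastforce split: if_splits\<close>)+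
  also have "\<dots> = pc q b u" using path_coeff_nz[of q b u] by (auto simp: splits_src)
  finally show ?case by simp
next
  case (Cons a p)
  show ?case
  proof (cases "tail Q a = u")
    case True
    have "pc ((a # p) @ q) b u = (\<Sum>(w, z)\<in>splits S b. \<Sum>(x, y)\<in>splits S w.
        pc q x (awlast (head Q a) p) * pc p y (head Q a) * F1 z a)"
      using True by (simp add: Cons sum_distrib_right case_prod_beta)
    also have "\<dots> = (\<Sum>(x, w)\<in>splits S b. \<Sum>(y, z)\<in>splits S w.
        pc q x (awlast (head Q a) p) * pc p y (head Q a) * F1 z a)"
      by (rule sum_coassoc)
    also have "\<dots> = (\<Sum>(x, y)\<in>splits S b. pc q x (awlast u (a # p)) * pc (a # p) y u)"
      using True by (simp add: sum_distrib_left case_prod_beta mult.assoc)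
    finally show ?thesis .
  qed (simp add: case_prod_beta)
qed

theorem graded_coalg_map_cofree_ext: "graded_coalg_map S (path_splitting Q) (cofree_ext S Q F0 F1)"
  unfolding graded_coalg_map_def
proof (intro ballI conjI)
  fix b assume b: "b \<in> sbasis S"
  have F0: "F0 (ssrc S b) \<in> verts Q" using F0_verts splits_src ends_basis[OF b] by blast
  show "cofree_ext S Q F0 F1 b \<in> free_space {c \<in> sbasis (path_splitting Q). sdeg (path_splitting Q) c = sdeg S b}"
  proof (unfold free_space_iff, clarsimp simp: lookup_cofree_ext)
    fix u p assume "(u, p) \<in> paths Q \<longrightarrow> length p \<noteq> sdeg S b"
    then show "pc p b u = 0"
      using path_coeff_nz[of p b u] F0 by (auto simp: paths_def awalk_def)
  qed
  show "scomult (path_splitting Q) (cofree_ext S Q F0 F1 b)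
      = (\<Sum>(x, y)\<in>splits S b. tens (cofree_ext S Q F0 F1 x) (cofree_ext S Q F0 F1 y))"
  proof (rule poly_mapping_eqI)
    fix c :: "('v \<times> 'e list) \<times> ('v \<times> 'e list)"
    obtain v q u p where c: "c = ((v, q), (u, p))" by (cases c) auto
    have "(\<Sum>(x, y)\<in>splits S b. pc q x v * pc p y u) = 0" if "v \<noteq> awlast u p"
    proof (rule sum.neutral, clarsimp)
      fix x y assume xy: "(x, y) \<in> splits S b" "pc p y u \<noteq> 0"
      have "F0 (stgt S y) = awlast u p" using path_coeff_nz[OF xy(2)] awlast_if_cas by metis
      then show "pc q x v = 0" using path_coeff_nz[of q x v] splits_ends[OF xy(1)] that by auto
    qed
    then show "Poly_Mapping.lookup (scomult (path_splitting Q) (cofree_ext S Q F0 F1 b)) c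
        = Poly_Mapping.lookup (\<Sum>(x, y)\<in>splits S b. tens (cofree_ext S Q F0 F1 x) (cofree_ext S Q F0 F1 y)) c"
      by (simp add: c scomult_path lookup_path_comult lookup_cofree_ext lookup_sum case_prod_beta
          path_coeff_append)
  qed
qed

lemma cofree_ext_deg0:
  assumes "sdeg S b = 0" shows "cofree_ext S Q F0 F1 b = bvec (F0 b, [])"
proof (rule poly_mapping_eqI)
  fix c :: "'v \<times> 'e list"
  obtain u p where c: "c = (u, p)" by force
  show "Poly_Mapping.lookup (cofree_ext S Q F0 F1 b) c = Poly_Mapping.lookup (bvec (F0 b, [])) c"
    using path_coeff_nz[of p b u] assms
    by (cases p) (auto simp: c lookup_cofree_ext lookup_single when_def simp del: path_coeff.simps(2))
qed

lemma lookup_cofree_ext_deg1: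
  assumes "sdeg S b = 1"
  shows "Poly_Mapping.lookup (cofree_ext S Q F0 F1 b) (u, p)
    = (case p of [a] \<Rightarrow> if tail Q a = u then F1 b a else 0 | _ \<Rightarrow> 0)"
proof (cases "length p = 1")
  case True
  then obtain a where p: "p = [a]" by (cases p) auto
  have ne: "(b, ssrc S b) \<noteq> (stgt S b, b)" using assms splits_src(2)[of b] by auto
  have "F1 (ssrc S b) a = 0" using F1_nz[of "ssrc S b" a] splits_src(2)[of b] by auto
  moreover have "F0 (stgt S b) = head Q a \<or> F1 b a = 0" using F1_nz[of b a] by auto
  ultimately show ?thesis
    using assms ne splits_tgt(2)[of b]
    by (auto simp: p lookup_cofree_ext splits_of_deg1[OF assms])
next
  case False
  then show ?thesis using path_coeff_nz[of p b u] assms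
    by (cases p; cases "tl p") (auto simp: lookup_cofree_ext simp del: path_coeff.simps)
qed

end

section \<open>Bimodules over a group with a 3-cocycle\<close>

lemma (in group) inv_cancel [simp]:
  assumes "x \<in> carrier G" "y \<in> carrier G"
  shows "inv x \<otimes> (x \<otimes> y) = y" "x \<otimes> (inv x \<otimes> y) = y"
  using assms by (simp_all flip: m_assoc)

locale cocycle_group = group G for G :: "('g, 'm) monoid_scheme" (structure) +
  fixes \<Phi> :: "'g \<Rightarrow> 'g \<Rightarrow> 'g \<Rightarrow> 'k::field"
  assumes cocycle: "normalized_3cocycle G \<Phi>"
begin

lemma Phi_nonzero [simp]: "e \<in> carrier G \<Longrightarrow> f \<in> carrier G \<Longrightarrow> h \<in> carrier G \<Longrightarrow> \<Phi> e f h \<noteq> 0"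
  using cocycle by (auto simp: normalized_3cocycle_def)

lemma Phi_one [simp]:
  assumes "e \<in> carrier G" "f \<in> carrier G"
  shows "\<Phi> \<one> e f = 1" "\<Phi> e \<one> f = 1" "\<Phi> e f \<one> = 1"
  using cocycle assms by (auto simp: normalized_3cocycle_def)

lemma Phi_cocycle:
  assumes "a \<in> carrier G" "b \<in> carrier G" "c \<in> carrier G" "d \<in> carrier G"
  shows "\<Phi> a b c * \<Phi> a (b \<otimes> c) d * \<Phi> b c d = \<Phi> (a \<otimes> b) c d * \<Phi> a b (c \<otimes> d)"
  using cocycle assms by (auto simp: normalized_3cocycle_def)

lemmas group_simps = m_assoc inv_mult_group

text \<open>
  The cocycle identity at \<open>(x, x\<^sup>-\<^sup>1, x, x\<^sup>-\<^sup>1)\<close>.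
\<close>

lemma Phi_inv_cocycle:
  assumes "x \<in> carrier G"
  shows "\<Phi> x (inv x) x * \<Phi> (inv x) x (inv x) = 1"
  using Phi_cocycle[of x "inv x" x "inv x"] assms by simp

text \<open>
  The scalar by which the left action of \<open>e\<close> on the product of an arrow \<open>\<epsilon> \<rightarrow> c\<close> with \<open>x\<close> differs from the
  quasi-conjugate of the arrow multiplied by \<open>e x\<close>; see \<open>lact_via_conj\<close>.
\<close>

definition conj_coeff :: "'g \<Rightarrow> 'g \<Rightarrow> 'g \<Rightarrow> 'k" where
  "conj_coeff e c x = \<Phi> e c x * \<Phi> (e \<otimes> c \<otimes> inv e) e (inv e) / \<Phi> (e \<otimes> c \<otimes> inv e) e x"

lemma Phi_tilde_nonzero [simp]:
  "e \<in> carrier G \<Longrightarrow> f \<in> carrier G \<Longrightarrow> c \<in> carrier G \<Longrightarrow> Phi_tilde G \<Phi> e f c \<noteq> 0"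
  by (simp add: Phi_tilde_def)

lemma Phi_tilde_one [simp]:
  assumes "e \<in> carrier G" "c \<in> carrier G"
  shows "Phi_tilde G \<Phi> \<one> e c = 1" "Phi_tilde G \<Phi> e \<one> c = 1"
  using assms by (simp_all add: Phi_tilde_def)

end

text \<open>
  A graded bimodule over \<open>kG\<close> in the sense of the associator \<open>\<Phi>\<close>, with \<open>arr x y v\<close> expressing that \<open>v\<close> is a linear
  combination of arrows from \<open>x\<close> to \<open>y\<close>.  The three laws are what quasi-associativity of a product says for
  one arrow and two vertices: the reassociator is evaluated at the source on one side and at the target on
  the other.  The scalars act by a bare function on an arbitrary type, which admits a model that is not a
  vector space.
\<close>

locale quasi_bimodule = cocycle_group G \<Phi>
  for G :: "('g, 'm) monoid_scheme" (structure) and \<Phi> :: "'g \<Rightarrow> 'g \<Rightarrow> 'g \<Rightarrow> 'k::field" +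
  fixes scal :: "'k \<Rightarrow> 'v \<Rightarrow> 'v"
    and arr :: "'g \<Rightarrow> 'g \<Rightarrow> 'v \<Rightarrow> bool"
    and lact :: "'g \<Rightarrow> 'v \<Rightarrow> 'v"
    and ract :: "'v \<Rightarrow> 'g \<Rightarrow> 'v"
  assumes scal_scal: "scal a (scal b v) = scal (a * b) v"
    and scal_one: "scal 1 v = v"
    and arr_ends: "arr x y v \<Longrightarrow> x \<in> carrier G" "arr x y v \<Longrightarrow> y \<in> carrier G"
    and arr_scal: "arr x y v \<Longrightarrow> arr x y (scal a v)"
    and arr_lact: "arr x y v \<Longrightarrow> e \<in> carrier G \<Longrightarrow> arr (e \<otimes> x) (e \<otimes> y) (lact e v)"
    and arr_ract: "arr x y v \<Longrightarrow> e \<in> carrier G \<Longrightarrow> arr (x \<otimes> e) (y \<otimes> e) (ract v e)"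
    and lact_scal: "arr x y v \<Longrightarrow> e \<in> carrier G \<Longrightarrow> lact e (scal a v) = scal a (lact e v)"
    and ract_scal: "arr x y v \<Longrightarrow> e \<in> carrier G \<Longrightarrow> ract (scal a v) e = scal a (ract v e)"
    and lact_assoc: "arr x y v \<Longrightarrow> e \<in> carrier G \<Longrightarrow> f \<in> carrier G \<Longrightarrow>
      scal (\<Phi> e f x) (lact e (lact f v)) = scal (\<Phi> e f y) (lact (e \<otimes> f) v)"
    and ract_assoc: "arr x y v \<Longrightarrow> e \<in> carrier G \<Longrightarrow> f \<in> carrier G \<Longrightarrow>
      scal (\<Phi> x e f) (ract v (e \<otimes> f)) = scal (\<Phi> y e f) (ract (ract v e) f)"
    and middle_assoc: "arr x y v \<Longrightarrow> e \<in> carrier G \<Longrightarrow> f \<in> carrier G \<Longrightarrow>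
      scal (\<Phi> e x f) (lact e (ract v f)) = scal (\<Phi> e y f) (ract (lact e v) f)"
    and lact_one: "arr x y v \<Longrightarrow> lact \<one> v = v"
    and ract_one: "arr x y v \<Longrightarrow> ract v \<one> = v"
begin

lemma scal_eqD: "scal a v = scal b w \<Longrightarrow> a \<noteq> 0 \<Longrightarrow> v = scal (b / a) w"
  by (metis scal_one scal_scal divide_inverse left_inverse mult.commute)

lemma lact_lact: "arr x y v \<Longrightarrow> e \<in> carrier G \<Longrightarrow> f \<in> carrier G \<Longrightarrow>
    lact e (lact f v) = scal (\<Phi> e f y / \<Phi> e f x) (lact (e \<otimes> f) v)"
  by (rule scal_eqD[OF lact_assoc]) (auto dest: arr_ends)

lemma ract_ract: "arr x y v \<Longrightarrow> e \<in> carrier G \<Longrightarrow> f \<in> carrier G \<Longrightarrow>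
    ract (ract v e) f = scal (\<Phi> x e f / \<Phi> y e f) (ract v (e \<otimes> f))"
  by (rule scal_eqD[OF ract_assoc[symmetric]]) (auto dest: arr_ends)

lemma lact_ract: "arr x y v \<Longrightarrow> e \<in> carrier G \<Longrightarrow> f \<in> carrier G \<Longrightarrow>
    lact e (ract v f) = scal (\<Phi> e y f / \<Phi> e x f) (ract (lact e v) f)"
  by (rule scal_eqD[OF middle_assoc]) (auto dest: arr_ends)

definition conj :: "'g \<Rightarrow> 'v \<Rightarrow> 'v" where
  "conj e v = ract (lact e v) (inv e)"

lemma arr_conj: "arr \<one> c v \<Longrightarrow> e \<in> carrier G \<Longrightarrow> arr \<one> (e \<otimes> c \<otimes> inv e) (conj e v)"
  using arr_ract[OF arr_lact[of \<one> c v e], of "inv e"] by (simp add: conj_def)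

lemma conj_scal: "arr \<one> c v \<Longrightarrow> e \<in> carrier G \<Longrightarrow> conj e (scal a v) = scal a (conj e v)"
  by (simp add: conj_def lact_scal[of \<one> c] ract_scal[OF arr_lact])

lemma conj_one: "arr \<one> c v \<Longrightarrow> conj \<one> v = v"
  by (simp add: conj_def lact_one ract_one)

text \<open>
  Moving all brackets of \<open>(e ((f v) f\<^sup>-\<^sup>1)) e\<^sup>-\<^sup>1\<close> to the position of \<open>((e f) v) (e f)\<^sup>-\<^sup>1\<close> applies each of the three associativity
  laws once, and the resulting product of scalars is \<open>\<Phi>~\<close>.
\<close>

lemma conj_conj:
  assumes v: "arr \<one> c v" and e: "e \<in> carrier G" and f: "f \<in> carrier G"
  shows "conj e (conj f v) = scal (Phi_tilde G \<Phi> e f c) (conj (e \<otimes> f) v)"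
proof -
  have c: "c \<in> carrier G" using arr_ends v by blast
  note cl = c e f
  have fv: "arr f (f \<otimes> c) (lact f v)" using arr_lact[OF v f] f by simp
  have m: "arr (e \<otimes> f) (e \<otimes> f \<otimes> c) (lact (e \<otimes> f) v)" using arr_lact[OF v] e f by simp
  have 1: "lact e (ract (lact f v) (inv f)) = scal (\<Phi> e (f \<otimes> c) (inv f) / \<Phi> e f (inv f))
      (ract (scal (\<Phi> e f c) (lact (e \<otimes> f) v)) (inv f))"
    using lact_ract[OF fv e, of "inv f"] lact_lact[OF v e f] cl by simp
  have "conj e (conj f v) = scal (\<Phi> e (f \<otimes> c) (inv f) / \<Phi> e f (inv f) * \<Phi> e f c)
      (ract (ract (lact (e \<otimes> f) v) (inv f)) (inv e))"
    unfolding conj_def 1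
    by (simp add: cl ract_scal[OF m] scal_scal ract_scal[OF arr_ract[OF m]])
  also have "\<dots> = scal (Phi_tilde G \<Phi> e f c) (conj (e \<otimes> f) v)"
    using cl by (simp add: ract_ract[OF m] scal_scal conj_def inv_mult_group Phi_tilde_def field_simps)
  finally show ?thesis .
qed

text \<open>
  The arrow \<open>e v\<close> is a multiple of \<open>((e v) e\<^sup>-\<^sup>1) e\<close>, so the left action reduces to quasi-conjugation and the right
  action.
\<close>

lemma lact_via_conj:
  assumes v: "arr \<one> c v" and e: "e \<in> carrier G" and x: "x \<in> carrier G"
  shows "lact e (ract v x) = scal (conj_coeff e c x) (ract (conj e v) (e \<otimes> x))"
proof -
  have c: "c \<in> carrier G" using arr_ends v by blast
  note cl = c e x
  let ?c = "e \<otimes> c \<otimes> inv e"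
  have m: "arr e (e \<otimes> c) (lact e v)" using arr_lact[OF v e] e by simp
  have w: "arr \<one> ?c (conj e v)" by (rule arr_conj[OF v e])
  have "ract (conj e v) e = scal (\<Phi> e (inv e) e / \<Phi> (e \<otimes> c) (inv e) e) (lact e v)"
    unfolding conj_def using ract_ract[OF m, of "inv e" e] cl by (simp add: ract_one[OF m])
  then have "lact e v = scal (\<Phi> (e \<otimes> c) (inv e) e / \<Phi> e (inv e) e) (ract (conj e v) e)"
    using cl by (simp add: scal_scal scal_one)
  also have "\<Phi> (e \<otimes> c) (inv e) e / \<Phi> e (inv e) e = \<Phi> ?c e (inv e)"
    using Phi_cocycle[of ?c e "inv e" e] Phi_inv_cocycle[of e] cl
    by (simp add: group_simps field_simps)
  finally have 1: "lact e v = scal (\<Phi> ?c e (inv e)) (ract (conj e v) e)" .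
  have "lact e (ract v x) = scal (\<Phi> e c x) (ract (lact e v) x)"
    using lact_ract[OF v e x] cl by simp
  also have "\<dots> = scal (conj_coeff e c x) (ract (conj e v) (e \<otimes> x))"
    unfolding 1 using cl ract_ract[OF w e x] arr_ract[OF w e]
    by (simp add: ract_scal scal_scal conj_coeff_def)
  finally show ?thesis .
qed

end

context cocycle_group
begin

text \<open>
  The free quasi-bimodule on one arrow \<open>m : \<epsilon> \<rightarrow> c\<close> has the basis \<open>(x m) y\<close> with \<open>x, y \<in> G\<close>.  The triple \<open>(d, x, y)\<close> stands
  for \<open>d ((x m) y)\<close>; the coefficients below are those that the associativity laws enforce.  Multiples of basis vectors
  suffice for what follows, so no sums are formed.
\<close>

definition symbol_lact :: "'g \<Rightarrow> 'g \<Rightarrow> 'k \<times> 'g \<times> 'g \<Rightarrow> 'k \<times> 'g \<times> 'g" where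
  "symbol_lact c e = (\<lambda>(d, x, y). (\<Phi> e (x \<otimes> c) y * \<Phi> e x c / \<Phi> e x y * d, e \<otimes> x, y))"

definition symbol_ract :: "'g \<Rightarrow> 'k \<times> 'g \<times> 'g \<Rightarrow> 'g \<Rightarrow> 'k \<times> 'g \<times> 'g" where
  "symbol_ract c = (\<lambda>(d, x, y) h. (\<Phi> x y h / \<Phi> (x \<otimes> c) y h * d, x, y \<otimes> h))"

definition symbol_arr :: "'g \<Rightarrow> 'g \<Rightarrow> 'g \<Rightarrow> 'k \<times> 'g \<times> 'g \<Rightarrow> bool" where
  "symbol_arr c s t = (\<lambda>(d, x, y). x \<in> carrier G \<and> y \<in> carrier G \<and> s = x \<otimes> y \<and> t = x \<otimes> c \<otimes> y)"

definition symbol_scal :: "'k \<Rightarrow> 'k \<times> 'g \<times> 'g \<Rightarrow> 'k \<times> 'g \<times> 'g" where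
  "symbol_scal a = (\<lambda>(d, x, y). (a * d, x, y))"

lemma symbol_simps:
  "symbol_lact c e (d, x, y) = (\<Phi> e (x \<otimes> c) y * \<Phi> e x c / \<Phi> e x y * d, e \<otimes> x, y)"
  "symbol_ract c (d, x, y) h = (\<Phi> x y h / \<Phi> (x \<otimes> c) y h * d, x, y \<otimes> h)"
  "symbol_scal a (d, x, y) = (a * d, x, y)"
  by (simp_all add: symbol_lact_def symbol_ract_def symbol_scal_def)

text \<open>
  Each associativity law is a consequence of several instances of the cocycle identity, used to eliminate
  the values of the cocycle with a product as middle argument.
\<close>

lemma quasi_bimodule_symbol:
  assumes c: "c \<in> carrier G"
  shows "quasi_bimodule G \<Phi> symbol_scal (symbol_arr c) (symbol_lact c) (symbol_ract c)"
proof (unfold_locales, goal_cases)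
  \<comment> \<open>Associativity of the left action.\<close>
  case (10 s t v e f)
  obtain d x y where v: "v = (d, x, y)" by (cases v) auto
  have cl: "x \<in> carrier G" "y \<in> carrier G" "e \<in> carrier G" "f \<in> carrier G"
    and st: "s = x \<otimes> y" "t = x \<otimes> c \<otimes> y" using 10 by (auto simp: v symbol_arr_def)
  note cl = cl c
  have 1: "\<Phi> e (f \<otimes> x \<otimes> c) y = \<Phi> (e \<otimes> f) (x \<otimes> c) y * \<Phi> e f (x \<otimes> c \<otimes> y) / (\<Phi> e f (x \<otimes> c) * \<Phi> f (x \<otimes> c) y)"
    using Phi_cocycle[of e f "x \<otimes> c" y] cl by (simp add: group_simps field_simps)
  have 2: "\<Phi> e (f \<otimes> x) y = \<Phi> (e \<otimes> f) x y * \<Phi> e f (x \<otimes> y) / (\<Phi> e f x * \<Phi> f x y)"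
    using Phi_cocycle[of e f x y] cl by (simp add: group_simps field_simps)
  have 3: "\<Phi> e (f \<otimes> x) c = \<Phi> (e \<otimes> f) x c * \<Phi> e f (x \<otimes> c) / (\<Phi> e f x * \<Phi> f x c)"
    using Phi_cocycle[of e f x c] cl by (simp add: group_simps field_simps)
  have "\<Phi> e f s * (\<Phi> e (f \<otimes> x \<otimes> c) y * \<Phi> e (f \<otimes> x) c / \<Phi> e (f \<otimes> x) y * (\<Phi> f (x \<otimes> c) y * \<Phi> f x c / \<Phi> f x y * d))
      = \<Phi> e f t * (\<Phi> (e \<otimes> f) (x \<otimes> c) y * \<Phi> (e \<otimes> f) x c / \<Phi> (e \<otimes> f) x y * d)"
    unfolding 1 2 3 st using cl by (simp add: field_simps)
  then show ?case using cl by (simp add: v symbol_simps group_simps mult_ac)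
next
  \<comment> \<open>Associativity of the right action.\<close>
  case (11 s t v f h)
  obtain d x y where v: "v = (d, x, y)" by (cases v) auto
  have cl: "x \<in> carrier G" "y \<in> carrier G" "h \<in> carrier G" "f \<in> carrier G"
    and st: "s = x \<otimes> y" "t = x \<otimes> c \<otimes> y" using 11 by (auto simp: v symbol_arr_def)
  note cl = cl c
  have 1: "\<Phi> x (y \<otimes> f) h = \<Phi> (x \<otimes> y) f h * \<Phi> x y (f \<otimes> h) / (\<Phi> x y f * \<Phi> y f h)"
    using Phi_cocycle[of x y f h] cl by (simp add: group_simps field_simps)
  have 2: "\<Phi> (x \<otimes> c) (y \<otimes> f) h = \<Phi> (x \<otimes> c \<otimes> y) f h * \<Phi> (x \<otimes> c) y (f \<otimes> h) / (\<Phi> (x \<otimes> c) y f * \<Phi> y f h)"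
    using Phi_cocycle[of "x \<otimes> c" y f h] cl by (simp add: group_simps field_simps)
  have "\<Phi> s f h * (\<Phi> x y (f \<otimes> h) / \<Phi> (x \<otimes> c) y (f \<otimes> h) * d)
      = \<Phi> t f h * (\<Phi> x (y \<otimes> f) h / \<Phi> (x \<otimes> c) (y \<otimes> f) h * (\<Phi> x y f / \<Phi> (x \<otimes> c) y f * d))"
    unfolding 1 2 st using cl by (simp add: field_simps)
  then show ?case using cl by (simp add: v symbol_simps group_simps mult_ac)
next
  \<comment> \<open>Associativity between the two actions.\<close>
  case (12 s t v e h)
  obtain d x y where v: "v = (d, x, y)" by (cases v) auto
  have cl: "x \<in> carrier G" "y \<in> carrier G" "h \<in> carrier G" "e \<in> carrier G"
    and st: "s = x \<otimes> y" "t = x \<otimes> c \<otimes> y" using 12 by (auto simp: v symbol_arr_def)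
  note cl = cl c
  have 1: "\<Phi> e (x \<otimes> y) h = \<Phi> (e \<otimes> x) y h * \<Phi> e x (y \<otimes> h) / (\<Phi> e x y * \<Phi> x y h)"
    using Phi_cocycle[of e x y h] cl by (simp add: group_simps field_simps)
  have 2: "\<Phi> e (x \<otimes> c \<otimes> y) h = \<Phi> (e \<otimes> x \<otimes> c) y h * \<Phi> e (x \<otimes> c) (y \<otimes> h) / (\<Phi> e (x \<otimes> c) y * \<Phi> (x \<otimes> c) y h)"
    using Phi_cocycle[of e "x \<otimes> c" y h] cl by (simp add: group_simps field_simps)
  have "\<Phi> e s h * (\<Phi> e (x \<otimes> c) (y \<otimes> h) * \<Phi> e x c / \<Phi> e x (y \<otimes> h) * (\<Phi> x y h / \<Phi> (x \<otimes> c) y h * d))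
      = \<Phi> e t h * (\<Phi> (e \<otimes> x) y h / \<Phi> (e \<otimes> x \<otimes> c) y h * (\<Phi> e (x \<otimes> c) y * \<Phi> e x c / \<Phi> e x y * d))"
    unfolding 1 2 st using cl by (simp add: field_simps)
  then show ?case using cl by (simp add: v symbol_simps group_simps mult_ac)
qed (auto simp: symbol_arr_def symbol_simps group_simps c)

text \<open>
  Identities between many values of \<open>\<Phi>\<close>, obtained without computation: quasi-conjugating the generator of the free
  bimodule by \<open>e\<close>, \<open>f\<close> and \<open>h\<close> in two ways gives the first one, and multiplying its translate by \<open>e\<close> and \<open>f\<close> from the
  left in two ways the second one.  The scalars can be compared because no multiple that occurs vanishes.
\<close>

lemma
  assumes c: "c \<in> carrier G" and e: "e \<in> carrier G" and f: "f \<in> carrier G"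
  shows Phi_tilde_cocycle: "h \<in> carrier G \<Longrightarrow>
      Phi_tilde G \<Phi> f h c * Phi_tilde G \<Phi> e (f \<otimes> h) c
      = Phi_tilde G \<Phi> e f (h \<otimes> c \<otimes> inv h) * Phi_tilde G \<Phi> (e \<otimes> f) h c"
    and conj_coeff_mult: "x \<in> carrier G \<Longrightarrow>
      \<Phi> e f x * conj_coeff f c x * conj_coeff e (f \<otimes> c \<otimes> inv f) (f \<otimes> x) * Phi_tilde G \<Phi> e f c
      = \<Phi> e f (c \<otimes> x) * conj_coeff (e \<otimes> f) c x"
proof -
  interpret sym: quasi_bimodule G \<Phi> symbol_scal "symbol_arr c" "symbol_lact c" "symbol_ract c"
    by (rule quasi_bimodule_symbol[OF c])
  let ?v = "(1, \<one>, \<one>) :: 'k \<times> 'g \<times> 'g"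
  have v: "symbol_arr c \<one> c ?v" using c by (simp add: symbol_arr_def)
  have nz: "fst (sym.conj b ?v) \<noteq> 0" if "b \<in> carrier G" for b
    using that c by (simp add: sym.conj_def symbol_simps)
  have cancel: "a = b" if "symbol_scal a w = symbol_scal b w" "fst w \<noteq> 0" for a b w
    using that by (cases w) (auto simp: symbol_simps)
  show "Phi_tilde G \<Phi> f h c * Phi_tilde G \<Phi> e (f \<otimes> h) c
      = Phi_tilde G \<Phi> e f (h \<otimes> c \<otimes> inv h) * Phi_tilde G \<Phi> (e \<otimes> f) h c" if h: "h \<in> carrier G"
  proof (rule cancel)
    have "sym.conj e (sym.conj f (sym.conj h ?v))
        = symbol_scal (Phi_tilde G \<Phi> f h c * Phi_tilde G \<Phi> e (f \<otimes> h) c) (sym.conj (e \<otimes> f \<otimes> h) ?v)"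
      using e f h by (simp add: sym.conj_conj[OF v] sym.conj_scal[OF sym.arr_conj[OF v]] sym.conj_scal[OF v]
          sym.scal_scal m_assoc)
    moreover have "sym.conj e (sym.conj f (sym.conj h ?v))
        = symbol_scal (Phi_tilde G \<Phi> e f (h \<otimes> c \<otimes> inv h) * Phi_tilde G \<Phi> (e \<otimes> f) h c) (sym.conj (e \<otimes> f \<otimes> h) ?v)"
      using e f h
      by (subst sym.conj_conj[OF sym.arr_conj[OF v h] e f]) (simp add: sym.conj_conj[OF v] sym.scal_scal)
    ultimately show "symbol_scal (Phi_tilde G \<Phi> f h c * Phi_tilde G \<Phi> e (f \<otimes> h) c) (sym.conj (e \<otimes> f \<otimes> h) ?v)
        = symbol_scal (Phi_tilde G \<Phi> e f (h \<otimes> c \<otimes> inv h) * Phi_tilde G \<Phi> (e \<otimes> f) h c) (sym.conj (e \<otimes> f \<otimes> h) ?v)"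
      by simp
  qed (use nz e f h in simp)
  show "\<Phi> e f x * conj_coeff f c x * conj_coeff e (f \<otimes> c \<otimes> inv f) (f \<otimes> x) * Phi_tilde G \<Phi> e f c
      = \<Phi> e f (c \<otimes> x) * conj_coeff (e \<otimes> f) c x" if x: "x \<in> carrier G"
  proof (rule cancel)
    let ?w = "symbol_ract c (sym.conj (e \<otimes> f) ?v) (e \<otimes> f \<otimes> x)"
    have vf: "symbol_arr c \<one> (f \<otimes> c \<otimes> inv f) (sym.conj f ?v)" by (rule sym.arr_conj[OF v f])
    have vef: "symbol_arr c \<one> (e \<otimes> f \<otimes> c \<otimes> inv (e \<otimes> f)) (sym.conj (e \<otimes> f) ?v)"
      using sym.arr_conj[OF v, of "e \<otimes> f"] e f by simp
    have vx: "symbol_arr c x (c \<otimes> x) (symbol_ract c ?v x)" using sym.arr_ract[OF v x] x by simp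
    have "symbol_lact c e (symbol_lact c f (symbol_ract c ?v x))
        = symbol_scal (conj_coeff f c x * conj_coeff e (f \<otimes> c \<otimes> inv f) (f \<otimes> x) * Phi_tilde G \<Phi> e f c) ?w"
      using e f x
      by (simp add: sym.lact_via_conj[OF v] sym.lact_via_conj[OF vf] sym.lact_scal[OF sym.arr_ract[OF vf]]
          sym.conj_conj[OF v] sym.ract_scal[OF vef] sym.scal_scal m_assoc mult.assoc)
    moreover have "symbol_lact c (e \<otimes> f) (symbol_ract c ?v x) = symbol_scal (conj_coeff (e \<otimes> f) c x) ?w"
      using e f x by (simp add: sym.lact_via_conj[OF v])
    ultimately show "symbol_scal (\<Phi> e f x * conj_coeff f c x * conj_coeff e (f \<otimes> c \<otimes> inv f) (f \<otimes> x) * Phi_tilde G \<Phi> e f c) ?w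
        = symbol_scal (\<Phi> e f (c \<otimes> x) * conj_coeff (e \<otimes> f) c x) ?w"
      using sym.lact_assoc[OF vx e f] by (simp add: sym.scal_scal mult.assoc)
    show "fst ?w \<noteq> 0"
      using e f x c by (simp add: sym.conj_def symbol_simps)
  qed
qed

end

section \<open>Sums over splittings and multilinear identities\<close>

\<comment> \<open>Arrows are triples and paths are pairs; quantifiers over them are kept whole, as the components have no separate meaning.\<close>
declare split_paired_All [simp del] split_paired_Ex [simp del]

lemma (in splitting_system) sum_deg0_right:
  "(\<Sum>(x, y)\<in>splits S b. if sdeg S y = 0 then f x y else (0 :: 'a::comm_monoid_add)) = f b (ssrc S b)"
proof -
  have "(\<Sum>(x, y)\<in>splits S b. if sdeg S y = 0 then f x y else 0) = (\<Sum>z\<in>{(b, ssrc S b)}. f (fst z) (snd z))"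
    by (rule sum.mono_neutral_cong_right[OF finite_splits])
      (auto simp: splits_src dest: splits_deg0_right split: if_splits)
  then show ?thesis by simp
qed

lemma (in splitting_system) sum_deg0_left:
  "(\<Sum>(x, y)\<in>splits S b. if sdeg S x = 0 then f x y else (0 :: 'a::comm_monoid_add)) = f (stgt S b) b"
proof -
  have "(\<Sum>(x, y)\<in>splits S b. if sdeg S x = 0 then f x y else 0) = (\<Sum>z\<in>{(stgt S b, b)}. f (fst z) (snd z))"
    by (rule sum.mono_neutral_cong_right[OF finite_splits])
      (auto simp: splits_tgt dest: splits_deg0_left split: if_splits)
  then show ?thesis by simp
qed

text \<open>
  Decompositions into four factors \<open>x2 x1 y2 y1\<close>, first cut in the middle or with the middle pair \<open>x1 y2\<close> grouped.  The
  second form exposes a convolution of the two middle factors.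
\<close>

lemma (in splitting_system) sum_four_splits:
  "(\<Sum>(x, y)\<in>splits S b. \<Sum>(x2, x1)\<in>splits S x. \<Sum>(y2, y1)\<in>splits S y. f x2 x1 y2 y1)
   = (\<Sum>(x2, w)\<in>splits S b. \<Sum>(m, y1)\<in>splits S w. \<Sum>(x1, y2)\<in>splits S m.
       (f x2 x1 y2 y1 :: 'a::comm_monoid_add))"
proof -
  have "(\<Sum>(x, y)\<in>splits S b. \<Sum>(x2, x1)\<in>splits S x. \<Sum>(y2, y1)\<in>splits S y. f x2 x1 y2 y1)
      = (\<Sum>(x2, w)\<in>splits S b. \<Sum>(x1, y)\<in>splits S w. \<Sum>(y2, y1)\<in>splits S y. f x2 x1 y2 y1)"
    by (rule sum_coassoc)
  also have "\<dots> = (\<Sum>(x2, w)\<in>splits S b. \<Sum>(m, y1)\<in>splits S w. \<Sum>(x1, y2)\<in>splits S m. f x2 x1 y2 y1)"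
    unfolding case_prod_beta[of _ "_ :: 'b \<times> 'b"]
    by (rule sum.cong[OF refl])
      (rule sum_coassoc[of "\<lambda>x1 y2 y1. f _ x1 y2 y1", unfolded case_prod_beta, symmetric])
  finally show ?thesis .
qed

lemma (in splitting_system) graded_coalg_map_assoc:
  assumes "splitting_system T" "splitting_system U"
  shows "graded_coalg_map (prod_splitting S (prod_splitting T U)) (prod_splitting (prod_splitting S T) U)
    (\<lambda>(a, b, c). bvec ((a, b), c))"
  by (auto simp: graded_coalg_map_def scomult_def vector_space_pscale sum_splits_prod case_prod_beta)

lemma lin_eqI2:
  assumes "a \<in> free_space B" "b \<in> free_space C"
    and "\<And>b. lin s (\<lambda>a. f a b)" "\<And>a. lin s (\<lambda>b. f a b)" "\<And>b. lin s (\<lambda>a. f' a b)" "\<And>a. lin s (\<lambda>b. f' a b)"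
    and "\<And>x y. x \<in> B \<Longrightarrow> y \<in> C \<Longrightarrow> f (bvec x) (bvec y) = f' (bvec x) (bvec y)"
  shows "f a b = f' a b"
proof -
  have "f a (bvec y) = f' a (bvec y)" if "y \<in> C" for y
    by (rule lin_eqI[where f = "\<lambda>a. f a (bvec y)" and f' = "\<lambda>a. f' a (bvec y)", OF assms(1,3,5)])
      (rule assms(7)[OF _ that])
  then show ?thesis
    by (rule lin_eqI[where f = "\<lambda>b. f a b" and f' = "\<lambda>b. f' a b", OF assms(2,4,6)])
qed

lemma lin_eqI3:
  assumes "a \<in> free_space B" "b \<in> free_space C" "c \<in> free_space D"
    and "\<And>b c. lin s (\<lambda>a. f a b c)" "\<And>a c. lin s (\<lambda>b. f a b c)" "\<And>a b. lin s (\<lambda>c. f a b c)"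
    and "\<And>b c. lin s (\<lambda>a. f' a b c)" "\<And>a c. lin s (\<lambda>b. f' a b c)" "\<And>a b. lin s (\<lambda>c. f' a b c)"
    and "\<And>x y z. x \<in> B \<Longrightarrow> y \<in> C \<Longrightarrow> z \<in> D \<Longrightarrow> f (bvec x) (bvec y) (bvec z) = f' (bvec x) (bvec y) (bvec z)"
  shows "f a b c = f' a b c"
proof -
  have "f a b (bvec z) = f' a b (bvec z)" if "z \<in> D" for z
    by (rule lin_eqI2[where f = "\<lambda>a b. f a b (bvec z)" and f' = "\<lambda>a b. f' a b (bvec z)",
          OF assms(1,2,4,5,7,8)]) (rule assms(10)[OF _ _ that])
  then show ?thesis
    by (rule lin_eqI[where f = "\<lambda>c. f a b c" and f' = "\<lambda>c. f' a b c", OF assms(3,6,9)])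
qed

lemma lin_eqI4:
  assumes "a \<in> free_space B" "b \<in> free_space C" "c \<in> free_space D" "d \<in> free_space E"
    and "\<And>b c d. lin s (\<lambda>a. f a b c d)" "\<And>a c d. lin s (\<lambda>b. f a b c d)"
      "\<And>a b d. lin s (\<lambda>c. f a b c d)" "\<And>a b c. lin s (\<lambda>d. f a b c d)"
    and "\<And>b c d. lin s (\<lambda>a. f' a b c d)" "\<And>a c d. lin s (\<lambda>b. f' a b c d)"
      "\<And>a b d. lin s (\<lambda>c. f' a b c d)" "\<And>a b c. lin s (\<lambda>d. f' a b c d)"
    and "\<And>x y z w. x \<in> B \<Longrightarrow> y \<in> C \<Longrightarrow> z \<in> D \<Longrightarrow> w \<in> E \<Longrightarrow>
      f (bvec x) (bvec y) (bvec z) (bvec w) = f' (bvec x) (bvec y) (bvec z) (bvec w)"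
  shows "f a b c d = f' a b c d"
proof -
  have "f a b c (bvec w) = f' a b c (bvec w)" if "w \<in> E" for w
    by (rule lin_eqI3[where f = "\<lambda>a b c. f a b c (bvec w)" and f' = "\<lambda>a b c. f' a b c (bvec w)",
          OF assms(1-3,5-7,9-11)]) (rule assms(13)[OF _ _ _ that])
  then show ?thesis
    by (rule lin_eqI[where f = "\<lambda>d. f a b c d" and f' = "\<lambda>d. f' a b c d", OF assms(4,8,12)])
qed

lemma sw_path_bvec:
  assumes "vector_space s"
  shows "sw s (ext pscale (path_comult Q)) (bvec p) F
    = (\<Sum>(x, y)\<in>splits (path_splitting Q) p. F (bvec x) (bvec y))"
proof -
  have "ext s (\<lambda>(x, y). F (bvec x) (bvec y)) (\<Sum>z\<in>splits (path_splitting Q) p. bvec z)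
      = (\<Sum>z\<in>splits (path_splitting Q) p. ext s (\<lambda>(x, y). F (bvec x) (bvec y)) (bvec z))"
    by (rule lin_on_sum[OF lin_ext[OF assms]]) auto
  then show ?thesis
    by (simp add: sw_def vector_space_pscale path_comult_splits ext_bvec[OF assms] case_prod_beta)
qed

section \<open>The Hopf quiver\<close>

locale hopf_quiver_cocycle = cocycle_group G \<Phi>
  for G :: "('g, 'm) monoid_scheme" (structure) and \<Phi> :: "'g \<Rightarrow> 'g \<Rightarrow> 'g \<Rightarrow> 'k::field" +
  fixes R :: "'g set \<Rightarrow> nat"
begin

abbreviation "Q \<equiv> hopf_quiver G R"
abbreviation "P \<equiv> path_splitting (hopf_quiver G R)"
abbreviation "PP \<equiv> prod_splitting (path_splitting (hopf_quiver G R)) (path_splitting (hopf_quiver G R))"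

lemma conj_class_closed: "C \<in> conj_classes G \<Longrightarrow> c \<in> C \<Longrightarrow> c \<in> carrier G"
  by (auto simp: conj_classes_def orbits_def orbit_def conj_action_def)

lemma quiver_simps [simp]:
  "verts Q = carrier G" "tail Q (x, c, i) = x" "head Q (x, c, i) = c \<otimes> x"
  by (simp_all add: hopf_quiver_def)

lemma arcs_iff: "(x, c, i) \<in> arcs Q \<longleftrightarrow> x \<in> carrier G \<and> (\<exists>C\<in>conj_classes G. c \<in> C \<and> i < R C)"
  by (auto simp: hopf_quiver_def)

sublocale Q: wf_digraph Q
proof
  fix a assume "a \<in> arcs Q"
  then show "tail Q a \<in> verts Q" "head Q a \<in> verts Q"
    using conj_class_closed by (cases a; auto simp: arcs_iff)+
qed

sublocale P: splitting_system P by (rule Q.splitting_system_path)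
sublocale PP: splitting_system PP by (intro splitting_system_prod P.splitting_system_axioms)

definition arrow_basis :: "'g \<Rightarrow> 'g \<Rightarrow> 'g hpath set" where
  "arrow_basis x y = {(x, [a]) | a. a \<in> arcs Q \<and> tail Q a = x \<and> head Q a = y}"

definition block :: "'g \<Rightarrow> 'g \<Rightarrow> ('g hpath \<Rightarrow>\<^sub>0 'k) set" where
  "block x y = free_space (arrow_basis x y)"

lemma block_subspace: "fs.subspace (block x y)"
  unfolding block_def by (rule subspace_free_space)

lemma arrow_basis_single [simp]:
  "(u, [a]) \<in> arrow_basis x y \<longleftrightarrow> u = x \<and> a \<in> arcs Q \<and> tail Q a = x \<and> head Q a = y"
  by (auto simp: arrow_basis_def)

lemma arrow_basis_length: "(u, p) \<in> arrow_basis x y \<Longrightarrow> \<exists>a. p = [a]"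
  by (auto simp: arrow_basis_def)

lemma arrow_basis_ends: "p \<in> arrow_basis x y \<Longrightarrow> x \<in> carrier G \<and> y \<in> carrier G"
  using Q.tail_in_verts Q.head_in_verts by (fastforce simp: arrow_basis_def)

lemma arrow_basis_paths: "p \<in> arrow_basis x y \<Longrightarrow> p \<in> paths Q \<and> path_length p = 1 \<and> fst p = x"
  by (auto simp: arrow_basis_def)

lemma arrow_in_block: "(x, [a]) \<in> paths Q \<Longrightarrow> bvec (x, [a]) \<in> block x (head Q a)"
  by (auto simp: block_def arrow_basis_def)

lemma deg1_path: assumes "p \<in> paths Q" "path_length p = 1"
  obtains x a where "p = (x, [a])" "a \<in> arcs Q" "tail Q a = x" "x \<in> carrier G" "head Q a \<in> carrier G"
proof -
  obtain x q where p: "p = (x, q)" by force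
  then obtain a where "q = [a]" using assms(2) by (cases q) auto
  then show ?thesis
    using that[of x a] assms(1) p Q.tail_in_verts[of a] Q.head_in_verts[of a] by simp
qed

lemma deg0_path: assumes "p \<in> paths Q" "path_length p = 0"
  obtains x where "p = (x, [])" "x \<in> carrier G"
  using assms by (cases p) auto

lemma path_start: "(u, p) \<in> paths Q \<Longrightarrow> u \<in> carrier G"
  by (auto simp: paths_def Q.awalk_def)

lemma path_ends: assumes "p \<in> paths Q"
  shows "fst (ssrc P p) \<in> carrier G" "fst (stgt P p) \<in> carrier G" "fst p \<in> carrier G"
  using Q.paths_awlast_in_verts assms Q.paths_append_iff[of _ "[]"] by (cases p; force)+

lemma finite_arrow_coeffs: "finite {a. Poly_Mapping.lookup v (tail Q a, [a]) \<noteq> 0}"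
proof -
  have "finite ((\<lambda>a. (tail Q a, [a])) -` Poly_Mapping.keys v)"
    by (rule finite_vimageI) (auto simp: inj_def)
  moreover have "{a. Poly_Mapping.lookup v (tail Q a, [a]) \<noteq> 0} = (\<lambda>a. (tail Q a, [a])) -` Poly_Mapping.keys v"
    by (auto simp: in_keys_iff)
  ultimately show ?thesis by simp
qed

lemma block_coeff_nz: "v \<in> block x y \<Longrightarrow> Poly_Mapping.lookup v (u, [a]) \<noteq> 0 \<Longrightarrow>
    u = x \<and> a \<in> arcs Q \<and> tail Q a = x \<and> head Q a = y"
  unfolding block_def free_space_iff using arrow_basis_single by blast

lemma deg1_eqI:
  assumes "v \<in> block x y"
    and "\<And>u p. Poly_Mapping.lookup w (u, p) = (case p of [a] \<Rightarrow> if tail Q a = u then Poly_Mapping.lookup v (tail Q a, [a]) else 0 | _ \<Rightarrow> 0)"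
  shows "w = v"
proof (rule poly_mapping_eqI)
  fix c :: "'g hpath"
  obtain u p where c: "c = (u, p)" by force
  have "Poly_Mapping.lookup v (u, p) = 0" if "length p \<noteq> 1 \<or> (\<exists>a. p = [a] \<and> tail Q a \<noteq> u)"
  proof -
    have "(u, p) \<notin> arrow_basis x y" using that arrow_basis_length[of u p x y] by auto
    then show ?thesis using assms(1) unfolding block_def free_space_iff by blast
  qed
  then show "Poly_Mapping.lookup w c = Poly_Mapping.lookup v c"
    by (auto simp: c assms(2) split: list.splits)
qed

end

text \<open>
  A quasi-bimodule structure on the span of the arrows of the Hopf quiver, with linear actions.
\<close>

locale path_bimodule = hopf_quiver_cocycle G \<Phi> R +
  quasi_bimodule G \<Phi> pscale "\<lambda>x y v. x \<in> carrier G \<and> y \<in> carrier G \<and> v \<in> block x y" lact ract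
  for G :: "('g, 'm) monoid_scheme" (structure) and \<Phi> :: "'g \<Rightarrow> 'g \<Rightarrow> 'g \<Rightarrow> 'k::field"
    and R :: "'g set \<Rightarrow> nat"
    and lact :: "'g \<Rightarrow> ('g hpath \<Rightarrow>\<^sub>0 'k) \<Rightarrow> ('g hpath \<Rightarrow>\<^sub>0 'k)"
    and ract :: "('g hpath \<Rightarrow>\<^sub>0 'k) \<Rightarrow> 'g \<Rightarrow> ('g hpath \<Rightarrow>\<^sub>0 'k)" +
  assumes lact_add: "e \<in> carrier G \<Longrightarrow> x \<in> carrier G \<Longrightarrow> y \<in> carrier G \<Longrightarrow> u \<in> block x y \<Longrightarrow> v \<in> block x y \<Longrightarrow>
      lact e (u + v) = lact e u + lact e v"
    and ract_add: "e \<in> carrier G \<Longrightarrow> x \<in> carrier G \<Longrightarrow> y \<in> carrier G \<Longrightarrow> u \<in> block x y \<Longrightarrow> v \<in> block x y \<Longrightarrow>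
      ract (u + v) e = ract u e + ract v e"
begin

lemma lact_lin: "e \<in> carrier G \<Longrightarrow> x \<in> carrier G \<Longrightarrow> y \<in> carrier G \<Longrightarrow>
    lin_on pscale (block x y) (lact e) (block (e \<otimes> x) (e \<otimes> y))"
  by (rule lin_onI) (auto simp: arr_lact lact_add lact_scal[of x y])

lemma ract_lin: "e \<in> carrier G \<Longrightarrow> x \<in> carrier G \<Longrightarrow> y \<in> carrier G \<Longrightarrow>
    lin_on pscale (block x y) (\<lambda>v. ract v e) (block (x \<otimes> e) (y \<otimes> e))"
  by (rule lin_onI) (auto simp: arr_ract ract_add ract_scal[of x y])

text \<open>
  The components of degree one of the product and of the antipode.  The value of the antipode at an arrow \<open>m : x \<rightarrow> y\<close> is
  forced by \<open>S(m) x + y\<^sup>-\<^sup>1 m = 0\<close>, the antipode identity in degree one: up to the sign and a scalar from moving \<open>x\<close>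
  to the other side it is \<open>(y\<^sup>-\<^sup>1 m) x\<^sup>-\<^sup>1\<close>.
\<close>

definition prod1 :: "'g hpath \<times> 'g hpath \<Rightarrow> ('g hpath \<Rightarrow>\<^sub>0 'k)" where
  "prod1 = (\<lambda>(p, q). if p \<in> paths Q \<and> q \<in> paths Q \<and> path_length p + path_length q = 1
     then if path_length p = 0 then lact (fst p) (bvec q) else ract (bvec p) (fst q) else 0)"

definition antip1 :: "'g hpath \<Rightarrow> ('g hpath \<Rightarrow>\<^sub>0 'k)" where
  "antip1 p = (if p \<in> paths Q \<and> path_length p = 1 then
     let x = fst p; y = fst (stgt P p)
     in pscale (- 1 / \<Phi> (inv y \<otimes> x) (inv x) x) (ract (lact (inv y) (bvec p)) (inv x)) else 0)"

text \<open>
  The coalgebra maps that cofreeness yields from these components.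
\<close>

definition path_prod :: "'g hpath \<times> 'g hpath \<Rightarrow> ('g hpath \<Rightarrow>\<^sub>0 'k)" where
  "path_prod = cofree_ext PP Q (\<lambda>(p, q). fst p \<otimes> fst q)
     (\<lambda>z a. Poly_Mapping.lookup (prod1 z) (tail Q a, [a]))"

definition path_antip :: "'g hpath \<Rightarrow> ('g hpath \<Rightarrow>\<^sub>0 'k)" where
  "path_antip = cofree_ext (opp_splitting P) Q (\<lambda>p. inv (fst p))
     (\<lambda>z a. Poly_Mapping.lookup (antip1 z) (tail Q a, [a]))"

lemma prod1_in_block:
  assumes "p \<in> paths Q" "q \<in> paths Q" "path_length p + path_length q = 1"
  shows "prod1 (p, q) \<in> block (fst p \<otimes> fst q) (fst (stgt P p) \<otimes> fst (stgt P q))"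
proof (cases "path_length p = 0")
  case True
  then obtain e where p: "p = (e, [])" "e \<in> carrier G" using deg0_path assms by metis
  obtain x a where q: "q = (x, [a])" "a \<in> arcs Q" "tail Q a = x" "x \<in> carrier G" "head Q a \<in> carrier G"
    by (rule deg1_path[OF assms(2)]) (use assms True in auto)
  show ?thesis using arr_lact[of x "head Q a" "bvec q" e] arrow_in_block[of x a] p q
    by (auto simp: prod1_def)
next
  case False
  then obtain e where p: "q = (e, [])" "e \<in> carrier G" using deg0_path[of q] assms by auto
  obtain x a where q: "p = (x, [a])" "a \<in> arcs Q" "tail Q a = x" "x \<in> carrier G" "head Q a \<in> carrier G"
    by (rule deg1_path[OF assms(1)]) (use assms False in auto)
  show ?thesis using arr_ract[of x "head Q a" "bvec p" e] arrow_in_block[of x a] p q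
    by (auto simp: prod1_def)
qed

lemma antip1_in_block:
  assumes "p \<in> paths Q" "path_length p = 1"
  shows "antip1 p \<in> block (inv (fst (stgt P p))) (inv (fst p))"
proof -
  obtain x a where p: "p = (x, [a])" "a \<in> arcs Q" "tail Q a = x" "x \<in> carrier G" "head Q a \<in> carrier G"
    by (rule deg1_path[OF assms])
  let ?y = "head Q a"
  have 1: "lact (inv ?y) (bvec p) \<in> block (inv ?y \<otimes> x) \<one>"
    using arr_lact[of x "?y" "bvec p" "inv ?y"] arrow_in_block[of x a] p by auto
  have "ract (lact (inv ?y) (bvec p)) (inv x) \<in> block (inv ?y) (inv x)"
    using arr_ract[of "inv ?y \<otimes> x" \<one> _ "inv x"] 1 p by (simp add: m_assoc)
  then have "pscale (- 1 / \<Phi> (inv ?y \<otimes> x) (inv x) x) (ract (lact (inv ?y) (bvec p)) (inv x))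
      \<in> block (inv ?y) (inv x)"
    unfolding block_def by (rule free_space_pscale)
  then show ?thesis using p assms by (simp add: antip1_def Let_def)
qed

sublocale prod: cofree_data PP Q "\<lambda>(p, q). fst p \<otimes> fst q"
  "\<lambda>z a. Poly_Mapping.lookup (prod1 z) (tail Q a, [a])"
proof (unfold_locales, goal_cases)
  case (1 b)
  then show ?case by (cases b) (auto simp: path_ends)
next
  case (2 b)
  show ?case by (rule finite_arrow_coeffs)
next
  case (3 z a)
  obtain p q where z: "z = (p, q)" by (cases z)
  have "p \<in> paths Q \<and> q \<in> paths Q \<and> path_length p + path_length q = 1"
    using 3 by (auto simp: z prod1_def split: if_splits)
  then show ?case using block_coeff_nz[OF prod1_in_block 3[unfolded z]] by (cases p; cases q) (auto simp: z)
qed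

sublocale antip: cofree_data "opp_splitting P" Q "\<lambda>p. inv (fst p)"
  "\<lambda>z a. Poly_Mapping.lookup (antip1 z) (tail Q a, [a])"
proof (intro cofree_data.intro P.splitting_system_opp Q.wf_digraph_axioms, unfold_locales, goal_cases)
  case (1 b)
  then show ?case by (auto simp: path_ends)
next
  case (2 b)
  show ?case by (rule finite_arrow_coeffs)
next
  case (3 p a)
  have "p \<in> paths Q \<and> path_length p = 1"
    using 3 by (auto simp: antip1_def split: if_splits)
  then show ?case using block_coeff_nz[OF antip1_in_block 3] by (cases p) auto
qed

lemma path_prod_deg0: "path_prod ((e, []), (f, [])) = bvec (e \<otimes> f, [])"
  unfolding path_prod_def by (subst prod.cofree_ext_deg0) auto

lemma path_prod_deg1:
  assumes "p \<in> paths Q" "q \<in> paths Q" "path_length p + path_length q = 1"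
  shows "path_prod (p, q) = prod1 (p, q)"
  by (rule deg1_eqI[OF prod1_in_block[OF assms]])
    (simp add: path_prod_def prod.lookup_cofree_ext_deg1 assms)

lemma path_antip_deg0: "path_antip (e, []) = bvec (inv e, [])"
  unfolding path_antip_def by (subst antip.cofree_ext_deg0) auto

lemma path_antip_deg1:
  assumes "p \<in> paths Q" "path_length p = 1"
  shows "path_antip p = antip1 p"
  by (rule deg1_eqI[OF antip1_in_block[OF assms]])
    (simp add: path_antip_def antip.lookup_cofree_ext_deg1 assms)

lemma coalg_map_path_prod: "graded_coalg_map PP P path_prod"
  unfolding path_prod_def by (rule prod.graded_coalg_map_cofree_ext)

lemma coalg_map_path_antip: "graded_coalg_map (opp_splitting P) P path_antip"
  unfolding path_antip_def by (rule antip.graded_coalg_map_cofree_ext)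

definition mul :: "('g hpath \<Rightarrow>\<^sub>0 'k) \<Rightarrow> ('g hpath \<Rightarrow>\<^sub>0 'k) \<Rightarrow> ('g hpath \<Rightarrow>\<^sub>0 'k)" where
  "mul u v = ext pscale path_prod (tens u v)"

lemma mul_bvec [simp]: "mul (bvec p) (bvec q) = path_prod (p, q)"
  by (simp add: mul_def vector_space_pscale)

lemma lin_mul_left [lin_intros]: "lin pscale g \<Longrightarrow> lin pscale (\<lambda>v. mul (g v) w)"
  unfolding mul_def by (intro lin_intros vector_space_pscale)

lemma lin_mul_right [lin_intros]: "lin pscale g \<Longrightarrow> lin pscale (\<lambda>v. mul w (g v))"
  unfolding mul_def by (intro lin_intros vector_space_pscale)

lemma mul_lact:
  assumes e: "e \<in> carrier G" and xy: "x \<in> carrier G" "y \<in> carrier G" and v: "v \<in> block x y"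
  shows "mul (bvec (e, [])) v = lact e v"
proof (rule lin_on_eqI[OF v[unfolded block_def] lin_on_subset lact_lin[OF e xy, unfolded block_def]])
  show "lin pscale (mul (bvec (e, [])))" by (intro lin_mul_right lin_ident)
  fix b assume "b \<in> arrow_basis x y"
  then show "mul (bvec (e, [])) (bvec b) = lact e (bvec b)"
    using e arrow_basis_paths[of b x y] by (simp add: path_prod_deg1 prod1_def)
qed auto

lemma mul_ract:
  assumes e: "e \<in> carrier G" and xy: "x \<in> carrier G" "y \<in> carrier G" and v: "v \<in> block x y"
  shows "mul v (bvec (e, [])) = ract v e"
proof (rule lin_on_eqI[OF v[unfolded block_def] lin_on_subset ract_lin[OF e xy, unfolded block_def]])
  show "lin pscale (\<lambda>v. mul v (bvec (e, [])))" by (intro lin_mul_left lin_ident)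
  fix b assume "b \<in> arrow_basis x y"
  then show "mul (bvec b) (bvec (e, [])) = ract (bvec b) e"
    using e arrow_basis_paths[of b x y] by (simp add: path_prod_deg1 prod1_def)
qed auto

end

section \<open>Unit and quasi-associativity of the product\<close>

lemma ext_free_space:
  "v \<in> free_space B \<Longrightarrow> (\<And>b. b \<in> B \<Longrightarrow> F b \<in> free_space C) \<Longrightarrow> ext pscale F v \<in> free_space C"
  unfolding ext_def by (intro free_space_sum free_space_pscale) (auto simp: free_space_def)

lemma sum_opp_splits: "(\<Sum>z\<in>splits (opp_splitting S) b. f z) = (\<Sum>(x, y)\<in>splits S b. f (y, x))"
  using sum.reindex[of prod.swap "splits S b" f] by (simp add: opp_splitting_def case_prod_unfold prod.swap_def)

context hopf_quiver_cocycle
begin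

abbreviation deg_space :: "nat \<Rightarrow> ('g hpath \<Rightarrow>\<^sub>0 'k) set" where
  "deg_space n \<equiv> free_space {p \<in> paths Q. path_length p = n}"

definition vertex_form3 :: "('g \<Rightarrow> 'g \<Rightarrow> 'g \<Rightarrow> 'k) \<Rightarrow> ('g hpath \<Rightarrow>\<^sub>0 'k) \<Rightarrow> ('g hpath \<Rightarrow>\<^sub>0 'k) \<Rightarrow> ('g hpath \<Rightarrow>\<^sub>0 'k) \<Rightarrow> 'k" where
  "vertex_form3 F u v w = ext (*) (\<lambda>p. ext (*) (\<lambda>q. ext (*) (\<lambda>r.
     if path_length p = 0 \<and> path_length q = 0 \<and> path_length r = 0 then F (fst p) (fst q) (fst r) else 0) w) v) u"

lemma lin_vertex_form3 [lin_intros]: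
  "lin pscale g \<Longrightarrow> lin (*) (\<lambda>u. vertex_form3 F (g u) v w)"
  "lin pscale g \<Longrightarrow> lin (*) (\<lambda>v. vertex_form3 F u (g v) w)"
  "lin pscale g \<Longrightarrow> lin (*) (\<lambda>w. vertex_form3 F u v (g w))"
  unfolding vertex_form3_def by (intro lin_ext_comp lin_ext_family vector_space_mult | assumption)+

lemma vertex_form3_bvec [simp]:
  "vertex_form3 F (bvec p) (bvec q) (bvec r)
   = (if path_length p = 0 \<and> path_length q = 0 \<and> path_length r = 0 then F (fst p) (fst q) (fst r) else 0)"
  by (simp add: vertex_form3_def vector_space_mult)

lemma ext_zero: "(\<And>b. b \<in> Poly_Mapping.keys v \<Longrightarrow> F b = 0) \<Longrightarrow> ext (*) F v = (0::'a::field)"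
  by (simp add: ext_def)

lemma vertex_form3_pos:
  assumes "u \<in> deg_space l" "v \<in> deg_space m" "w \<in> deg_space n" "l + m + n > 0"
  shows "vertex_form3 F u v w = 0"
  unfolding vertex_form3_def using assms by (intro ext_zero) (auto simp: free_space_def)

text \<open>
  Convolving with a form supported on vertices keeps only the decompositions with a vertex on that side, and
  evaluates the form at the sources or targets.
\<close>

lemma sum3_deg0_right:
  "(\<Sum>(x, y)\<in>splits P p. \<Sum>(x', y')\<in>splits P q. \<Sum>(x'', y'')\<in>splits P r.
      pscale (if path_length y = 0 \<and> path_length y' = 0 \<and> path_length y'' = 0 then c y y' y'' else 0)
        (v x x' x'' :: 'g hpath \<Rightarrow>\<^sub>0 'k))
   = pscale (c (ssrc P p) (ssrc P q) (ssrc P r)) (v p q r)"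
proof -
  have n: "pscale (if A \<and> B \<and> C then a else 0) w = (if C then if B then if A then pscale a w else 0 else 0 else 0)"
    for A B C and a :: 'k and w :: "'g hpath \<Rightarrow>\<^sub>0 'k" by simp
  have 3: "(\<Sum>(x'', y'')\<in>splits P r. if path_length y'' = 0 then f x'' y'' else 0) = f r (ssrc P r)"
    for f :: "_ \<Rightarrow> _ \<Rightarrow> ('g hpath \<Rightarrow>\<^sub>0 'k)" and r
    using P.sum_deg0_right[of f r] by simp
  show ?thesis unfolding n 3 ..
qed

lemma sum3_deg0_left:
  "(\<Sum>(x, y)\<in>splits P p. \<Sum>(x', y')\<in>splits P q. \<Sum>(x'', y'')\<in>splits P r.
      pscale (if path_length x = 0 \<and> path_length x' = 0 \<and> path_length x'' = 0 then c x x' x'' else 0)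
        (v y y' y'' :: 'g hpath \<Rightarrow>\<^sub>0 'k))
   = pscale (c (stgt P p) (stgt P q) (stgt P r)) (v p q r)"
proof -
  have n: "pscale (if A \<and> B \<and> C then a else 0) w = (if C then if B then if A then pscale a w else 0 else 0 else 0)"
    for A B C and a :: 'k and w :: "'g hpath \<Rightarrow>\<^sub>0 'k" by simp
  have 3: "(\<Sum>(x'', y'')\<in>splits P r. if path_length x'' = 0 then f x'' y'' else 0) = f (stgt P r) r"
    for f :: "_ \<Rightarrow> _ \<Rightarrow> ('g hpath \<Rightarrow>\<^sub>0 'k)" and r
    using P.sum_deg0_left[of f r] by simp
  show ?thesis unfolding n 3 ..
qed

text \<open>
  A path of length at least two is a product of its first arrow and a nontrivial path, so the reduced comultiplication
  is injective in these degrees.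
\<close>

lemma eq_zero_of_middle_comult:
  assumes "v \<in> deg_space n" "n \<ge> 2"
    and "\<And>w q u p. p \<noteq> [] \<Longrightarrow> q \<noteq> [] \<Longrightarrow>
      Poly_Mapping.lookup (ext pscale (path_comult Q) v) ((w, q), (u, p)) = 0"
  shows "v = 0"
proof (rule poly_mapping_eqI)
  fix c :: "'g hpath"
  obtain u r where c: "c = (u, r)" by (cases c)
  show "Poly_Mapping.lookup v c = Poly_Mapping.lookup 0 c"
  proof (cases "length r = n")
    case True
    then obtain a q where r: "r = [a] @ q" "q \<noteq> []" using assms(2) by (cases r; cases "tl r") auto
    have "Poly_Mapping.lookup (ext pscale (path_comult Q) v)
        ((pre_digraph.awlast Q u [a], q), (u, [a])) = 0"
      by (rule assms(3)) (use r in auto)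
    then show ?thesis unfolding lookup_path_comult using r c by simp
  next
    case False
    then show ?thesis using assms(1) by (simp add: free_space_iff c)
  qed
qed

end

context path_bimodule
begin

abbreviation "\<beta>\<^sub>0 \<equiv> \<lambda>x. 1 / \<Phi> x (inv x) x"

lemma path_prod_hom: "p \<in> paths Q \<Longrightarrow> q \<in> paths Q \<Longrightarrow> path_prod (p, q) \<in> deg_space (path_length p + path_length q)"
  using graded_coalg_mapD(1)[OF coalg_map_path_prod, of "(p, q)"] by simp

lemma path_antip_hom: "p \<in> paths Q \<Longrightarrow> path_antip p \<in> deg_space (path_length p)"
  using graded_coalg_mapD(1)[OF coalg_map_path_antip, of p] by simp

lemma mul_hom: "u \<in> deg_space m \<Longrightarrow> v \<in> deg_space n \<Longrightarrow> mul u v \<in> deg_space (m + n)"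
  unfolding mul_def by (rule ext_free_space[OF tens_free_space]) (use path_prod_hom in auto)

text \<open>
  Multiplication by the unit is a coalgebra map, so it has to be compared with the identity in degrees at most
  one only.
\<close>

lemma path_prod_unit_left:
  assumes "p \<in> paths Q" shows "path_prod ((\<one>, []), p) = bvec p"
proof -
  have "graded_coalg_map P PP (\<lambda>p. bvec ((\<one>, []), p))"
    by (auto simp: graded_coalg_map_def scomult_def vector_space_pscale sum_splits_prod case_prod_beta
        P.splits_of_deg0)
  from graded_coalg_map_comp[OF this coalg_map_path_prod P.splitting_system_axioms]
  have X: "graded_coalg_map P P (\<lambda>p. path_prod ((\<one>, []), p))" by (simp add: vector_space_pscale)
  show ?thesis
  proof (rule Q.coalg_map_eqI[OF P.splitting_system_axioms X graded_coalg_map_ident[OF P.splitting_system_axioms]])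
    fix b assume b: "b \<in> sbasis P" "sdeg P b \<le> 1"
    show "path_prod ((\<one>, []), b) = bvec b"
    proof (cases "path_length b = 0")
      case True
      then show ?thesis using b deg0_path[of b] by (metis path_prod_deg0 l_one path_splitting_simps(1))
    next
      case False
      then have l: "path_length b = 1" using b by simp
      obtain x a where p: "b = (x, [a])" "a \<in> arcs Q" "tail Q a = x" "x \<in> carrier G" "head Q a \<in> carrier G"
        by (rule deg1_path[OF _ l]) (use b in auto)
      then show ?thesis using b arrow_in_block[of x a] lact_one[of x "head Q a" "bvec b"]
        by (simp add: path_prod_deg1 prod1_def)
    qed
  qed (use assms in simp)
qed

lemma path_prod_unit_right:
  assumes "p \<in> paths Q" shows "path_prod (p, (\<one>, [])) = bvec p"
proof -
  have "graded_coalg_map P PP (\<lambda>p. bvec (p, (\<one>, [])))"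
    by (auto simp: graded_coalg_map_def scomult_def vector_space_pscale sum_splits_prod case_prod_beta
        P.splits_of_deg0)
  from graded_coalg_map_comp[OF this coalg_map_path_prod P.splitting_system_axioms]
  have X: "graded_coalg_map P P (\<lambda>p. path_prod (p, (\<one>, [])))" by (simp add: vector_space_pscale)
  show ?thesis
  proof (rule Q.coalg_map_eqI[OF P.splitting_system_axioms X graded_coalg_map_ident[OF P.splitting_system_axioms]])
    fix b assume b: "b \<in> sbasis P" "sdeg P b \<le> 1"
    show "path_prod (b, (\<one>, [])) = bvec b"
    proof (cases "path_length b = 0")
      case True
      then show ?thesis using b deg0_path[of b] by (metis path_prod_deg0 r_one path_splitting_simps(1))
    next
      case False
      then have l: "path_length b = 1" using b by simp
      obtain x a where p: "b = (x, [a])" "a \<in> arcs Q" "tail Q a = x" "x \<in> carrier G" "head Q a \<in> carrier G"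
        by (rule deg1_path[OF _ l]) (use b in auto)
      then show ?thesis using b arrow_in_block[of x a] ract_one[of x "head Q a" "bvec b"]
        by (simp add: path_prod_deg1 prod1_def)
    qed
  qed (use assms in simp)
qed

text \<open>
  After rescaling one side by the reassociator at the sources and its inverse at the targets, both
  bracketings are coalgebra maps, so quasi-associativity has to be checked in degrees at most one
  only, where it says that the arrows form a bimodule.
\<close>

lemma path_prod_quasi_assoc:
  assumes pqr: "p \<in> paths Q" "q \<in> paths Q" "r \<in> paths Q"
  shows "pscale (\<Phi> (fst (ssrc P p)) (fst (ssrc P q)) (fst (ssrc P r))) (mul (bvec p) (path_prod (q, r)))
    = pscale (\<Phi> (fst (stgt P p)) (fst (stgt P q)) (fst (stgt P r))) (mul (path_prod (p, q)) (bvec r))"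
proof -
  \<comment> \<open>Both bracketings, as maps on the tensor cube; the left one is rescaled.\<close>
  let ?T = "prod_splitting P PP"
  let ?c = "\<lambda>(p, q, r). \<Phi> (fst p) (fst q) (fst r)"
  let ?X = "\<lambda>t. pscale (?c (ssrc ?T t) / ?c (stgt ?T t)) ((\<lambda>(p, z). mul (bvec p) (path_prod z)) t)"
  let ?Y = "\<lambda>(p, q, r). mul (path_prod (p, q)) (bvec r)"
  have T: "splitting_system ?T" by (intro splitting_system_prod P.splitting_system_axioms)
  interpret T: splitting_system ?T by (rule T)
  have "graded_coalg_map ?T P (\<lambda>t. ext pscale path_prod ((\<lambda>(p, z). tens (bvec p) (path_prod z)) t))"
    by (intro graded_coalg_map_comp[OF _ coalg_map_path_prod T] graded_coalg_map_prod
        graded_coalg_map_ident P.splitting_system_axioms coalg_map_path_prod)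
  then have "graded_coalg_map ?T P (\<lambda>(p, z). mul (bvec p) (path_prod z))"
    by (simp add: mul_def case_prod_unfold)
  then have X: "graded_coalg_map ?T P ?X"
    by (rule T.graded_coalg_map_rescale, clarsimp, metis Phi_nonzero path_start)
  have Y1: "graded_coalg_map ?T (prod_splitting PP P) (\<lambda>(a, b, c). bvec ((a, b), c))"
    by (rule P.graded_coalg_map_assoc) (rule P.splitting_system_axioms)+
  have Y2: "graded_coalg_map (prod_splitting PP P) PP (\<lambda>(z, r). tens (path_prod z) (bvec r))"
    by (intro graded_coalg_map_prod graded_coalg_map_ident P.splitting_system_axioms coalg_map_path_prod)
  have "graded_coalg_map ?T P (\<lambda>t. ext pscale path_prod (ext pscale (\<lambda>(z, r). tens (path_prod z) (bvec r))
      ((\<lambda>(a, b, c). bvec ((a, b), c)) t)))"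
    by (rule graded_coalg_map_comp[OF graded_coalg_map_comp[OF Y1 Y2 T] coalg_map_path_prod T])
  then have Y: "graded_coalg_map ?T P ?Y"
    by (simp add: mul_def case_prod_unfold vector_space_pscale)
  have eq: "?X (p, q, r) = ?Y (p, q, r)"
  proof (rule Q.coalg_map_eqI[OF T X Y])
    fix b assume b: "b \<in> sbasis ?T" "sdeg ?T b \<le> 1"
    obtain p q r where pqr: "b = (p, q, r)" by (cases b)
    have in_paths: "p \<in> paths Q" "q \<in> paths Q" "r \<in> paths Q"
      and deg: "path_length p + path_length q + path_length r \<le> 1"
      using b by (auto simp: pqr)
    consider (0) "path_length p = 0" "path_length q = 0" "path_length r = 0"
      | (p) "path_length p = 1" "path_length q = 0" "path_length r = 0"
      | (q) "path_length p = 0" "path_length q = 1" "path_length r = 0"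
      | (r) "path_length p = 0" "path_length q = 0" "path_length r = 1"
      using deg by linarith
    then show "?X b = ?Y b"
    proof cases
      case 0
      then obtain e f g where "p = (e, [])" "q = (f, [])" "r = (g, [])"
        "e \<in> carrier G" "f \<in> carrier G" "g \<in> carrier G"
        using deg0_path in_paths by metis
      then show ?thesis by (simp add: pqr path_prod_deg0 m_assoc)
    next
      case p
      then obtain f g where fg: "q = (f, [])" "r = (g, [])" "f \<in> carrier G" "g \<in> carrier G"
        using deg0_path in_paths by metis
      obtain x a where x: "p = (x, [a])" "a \<in> arcs Q" "tail Q a = x" "x \<in> carrier G" "head Q a \<in> carrier G"
        by (rule deg1_path[OF in_paths(1) p(1)])
      note m = arrow_in_block[of x a]
      have mb: "bvec p \<in> block x (head Q a)" using m x in_paths by simp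
      have "mul (path_prod (p, q)) (bvec r) = ract (ract (bvec p) f) g"
        using mul_ract[of g "x \<otimes> f" "head Q a \<otimes> f" "ract (bvec p) f"] arr_ract[of x "head Q a" "bvec p" f] mb x fg in_paths
        by (simp add: path_prod_deg1 prod1_def)
      moreover have "mul (bvec p) (path_prod (q, r)) = ract (bvec p) (f \<otimes> g)"
        using mul_ract[of "f \<otimes> g" x "head Q a" "bvec p"] mb x fg by (simp add: path_prod_deg0)
      ultimately show ?thesis using ract_ract[of x "head Q a" "bvec p" f g] mb x fg
        by (simp add: pqr)
    next
      case q
      then obtain f g where fg: "p = (f, [])" "r = (g, [])" "f \<in> carrier G" "g \<in> carrier G"
        using deg0_path in_paths by metis
      obtain x a where x: "q = (x, [a])" "a \<in> arcs Q" "tail Q a = x" "x \<in> carrier G" "head Q a \<in> carrier G"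
        by (rule deg1_path[OF in_paths(2) q(2)])
      have mb: "bvec q \<in> block x (head Q a)" using arrow_in_block[of x a] x in_paths by simp
      have "mul (path_prod (p, q)) (bvec r) = ract (lact f (bvec q)) g"
        using mul_ract[of g "f \<otimes> x" "f \<otimes> head Q a" "lact f (bvec q)"] arr_lact[of x "head Q a" "bvec q" f] mb x fg in_paths
        by (simp add: path_prod_deg1 prod1_def)
      moreover have "mul (bvec p) (path_prod (q, r)) = lact f (ract (bvec q) g)"
        using mul_lact[of f "x \<otimes> g" "head Q a \<otimes> g" "ract (bvec q) g"] arr_ract[of x "head Q a" "bvec q" g] mb x fg in_paths
        by (simp add: path_prod_deg1 prod1_def)
      ultimately show ?thesis using lact_ract[of x "head Q a" "bvec q" f g] mb x fg
        by (simp add: pqr scal_scal scal_one)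
    next
      case r
      then obtain f g where fg: "p = (f, [])" "q = (g, [])" "f \<in> carrier G" "g \<in> carrier G"
        using deg0_path in_paths by metis
      obtain x a where x: "r = (x, [a])" "a \<in> arcs Q" "tail Q a = x" "x \<in> carrier G" "head Q a \<in> carrier G"
        by (rule deg1_path[OF in_paths(3) r(3)])
      have mb: "bvec r \<in> block x (head Q a)" using arrow_in_block[of x a] x in_paths by simp
      have "mul (bvec p) (path_prod (q, r)) = lact f (lact g (bvec r))"
        using mul_lact[of f "g \<otimes> x" "g \<otimes> head Q a" "lact g (bvec r)"] arr_lact[of x "head Q a" "bvec r" g] mb x fg in_paths
        by (simp add: path_prod_deg1 prod1_def)
      moreover have "mul (path_prod (p, q)) (bvec r) = lact (f \<otimes> g) (bvec r)"
        using mul_lact[of "f \<otimes> g" x "head Q a" "bvec r"] mb x fg by (simp add: path_prod_deg0)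
      ultimately show ?thesis using lact_lact[of x "head Q a" "bvec r" f g] mb x fg
        by (simp add: pqr scal_scal scal_one)
    qed
  qed (use pqr in simp)
  have nz: "\<Phi> (fst (stgt P p)) (fst (stgt P q)) (fst (stgt P r)) \<noteq> 0" using pqr by (simp add: path_ends)
  show ?thesis using arg_cong[OF eq, of "pscale (\<Phi> (fst (stgt P p)) (fst (stgt P q)) (fst (stgt P r)))"] nz
    by (cases p; cases q; cases r) simp
qed

section \<open>The antipode identities\<close>

text \<open>
  The convolution products of the antipode and the identity, with \<open>\<alpha>\<close> and \<open>\<beta>\<close> inserted between the factors.  Since
  \<open>\<alpha>\<close> is the counit and \<open>\<beta>\<close> is supported on vertices, the middle factor is the vertex where the two outer ones
  meet.
\<close>

definition left_conv :: "'g hpath \<Rightarrow> ('g hpath \<Rightarrow>\<^sub>0 'k)" where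
  "left_conv p = (\<Sum>(x, y)\<in>splits P p. mul (path_antip x) (bvec y))"

definition right_conv :: "'g hpath \<Rightarrow> ('g hpath \<Rightarrow>\<^sub>0 'k)" where
  "right_conv p = (\<Sum>(x, y)\<in>splits P p. pscale (\<beta>\<^sub>0 (fst (stgt P y))) (mul (bvec x) (path_antip y)))"

lemma left_conv_hom: assumes "p \<in> paths Q" shows "left_conv p \<in> deg_space (path_length p)"
  unfolding left_conv_def
proof (rule free_space_sum)
  fix z assume z: "z \<in> splits P p"
  obtain x y where xy: "z = (x, y)" by (cases z)
  have "mul (path_antip x) (bvec y) \<in> deg_space (path_length x + path_length y)"
    using P.splits_basis[of p x y] assms z xy by (intro mul_hom path_antip_hom) auto
  then show "(case z of (x, y) \<Rightarrow> mul (path_antip x) (bvec y)) \<in> deg_space (path_length p)"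
    using P.splits_deg[of x y p] z xy by simp
qed

lemma right_conv_hom: assumes "p \<in> paths Q" shows "right_conv p \<in> deg_space (path_length p)"
  unfolding right_conv_def
proof (rule free_space_sum)
  fix z assume z: "z \<in> splits P p"
  obtain x y where xy: "z = (x, y)" by (cases z)
  have "mul (bvec x) (path_antip y) \<in> deg_space (path_length x + path_length y)"
    using P.splits_basis[of p x y] assms z xy by (intro mul_hom path_antip_hom) auto
  then show "(case z of (x, y) \<Rightarrow> pscale (\<beta>\<^sub>0 (fst (stgt P y))) (mul (bvec x) (path_antip y)))
      \<in> deg_space (path_length p)"
    using P.splits_deg[of x y p] z xy by (simp add: free_space_pscale)
qed

text \<open>
  In a triple decomposition \<open>p = x m y\<close> with nontrivial middle factor that is not all of \<open>p\<close>, the convolution product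
  of the middle factor vanishes by induction; if the middle factor is trivial or all of \<open>p\<close>, one of the two tensor
  factors has degree \<open>0\<close> and does not contribute to the coefficients at nontrivial paths.
\<close>

lemma conv_middle_zero:
  assumes p: "p \<in> paths Q" and q': "q' \<noteq> []" "p' \<noteq> []"
    and c: "\<And>m. m \<in> paths Q \<Longrightarrow> c m \<in> deg_space (path_length m)"
    and N: "\<And>x y. x \<in> paths Q \<Longrightarrow> y \<in> paths Q \<Longrightarrow> N x y \<in> deg_space (path_length x + path_length y)"
    and IH: "\<And>m. m \<in> paths Q \<Longrightarrow> 0 < path_length m \<Longrightarrow> path_length m < path_length p \<Longrightarrow> c m = 0"
  shows "(\<Sum>(x, w)\<in>splits P p. \<Sum>(m, y)\<in>splits P w.
      Poly_Mapping.lookup (c m) (v, q') * Poly_Mapping.lookup (N x y) (u, p')) = 0"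
proof (intro sum.neutral ballI, clarify, intro sum.neutral ballI, clarify)
  fix x w m y assume xw: "(x, w) \<in> splits P p" and my: "(m, y) \<in> splits P w"
  have b: "x \<in> paths Q" "m \<in> paths Q" "y \<in> paths Q"
    using P.splits_basis[OF _ xw] P.splits_basis[OF _ my] p by auto
  have d: "path_length p = path_length x + path_length m + path_length y"
    using P.splits_deg[OF xw] P.splits_deg[OF my] by simp
  consider "path_length m = 0" | "path_length x + path_length y = 0" | "0 < path_length m" "path_length m < path_length p"
    using d by linarith
  then show "Poly_Mapping.lookup (c m) (v, q') * Poly_Mapping.lookup (N x y) (u, p') = 0"
  proof cases
    case 1
    then show ?thesis using c[OF b(2)] q' by (simp add: free_space_iff)
  next
    case 2
    then show ?thesis using N[OF b(1,3)] q' by (simp add: free_space_iff)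
  next
    case 3
    then show ?thesis using IH[OF b(2)] by simp
  qed
qed

text \<open>
  The antipode reverses the order of the factors, so the inner pair of the four factors carries the convolution
  product of the antipode and the identity.
\<close>

lemma comult_antip_left:
  assumes "x \<in> paths Q" "y \<in> paths Q"
  shows "ext pscale (path_comult Q) (mul (path_antip x) (bvec y))
    = (\<Sum>(x2, x1)\<in>splits P x. \<Sum>(y2, y1)\<in>splits P y.
        tens (mul (path_antip x1) (bvec y2)) (mul (path_antip x2) (bvec y1)))"
proof -
  have S: "splitting_system (prod_splitting (opp_splitting P) P)"
    by (intro splitting_system_prod P.splitting_system_axioms P.splitting_system_opp)
  have M: "graded_coalg_map (prod_splitting (opp_splitting P) P) P
      (\<lambda>t. ext pscale path_prod ((\<lambda>(x, y). tens (path_antip x) (bvec y)) t))"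
    by (intro graded_coalg_map_comp[OF _ coalg_map_path_prod S] graded_coalg_map_prod
        graded_coalg_map_ident P.splitting_system_axioms coalg_map_path_antip)
  show ?thesis
    using graded_coalg_mapD(3)[OF M, of "(x, y)"] assms
    by (simp add: scomult_path mul_def sum_splits_prod sum_opp_splits case_prod_unfold)
qed

lemma comult_antip_right:
  assumes "x \<in> paths Q" "y \<in> paths Q"
  shows "ext pscale (path_comult Q) (mul (bvec x) (path_antip y))
    = (\<Sum>(x2, x1)\<in>splits P x. \<Sum>(y2, y1)\<in>splits P y.
        tens (mul (bvec x2) (path_antip y1)) (mul (bvec x1) (path_antip y2)))"
proof -
  have S: "splitting_system (prod_splitting P (opp_splitting P))"
    by (intro splitting_system_prod P.splitting_system_axioms P.splitting_system_opp)
  have M: "graded_coalg_map (prod_splitting P (opp_splitting P)) P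
      (\<lambda>t. ext pscale path_prod ((\<lambda>(x, y). tens (bvec x) (path_antip y)) t))"
    by (intro graded_coalg_map_comp[OF _ coalg_map_path_prod S] graded_coalg_map_prod
        graded_coalg_map_ident P.splitting_system_axioms coalg_map_path_antip)
  show ?thesis
    using graded_coalg_mapD(3)[OF M, of "(x, y)"] assms
    by (simp add: scomult_path mul_def sum_splits_prod sum_opp_splits case_prod_unfold)
qed

lemma left_conv_deg1:
  assumes "p \<in> paths Q" "path_length p = 1" shows "left_conv p = 0"
proof -
  obtain x a where p: "p = (x, [a])" "a \<in> arcs Q" "tail Q a = x" "x \<in> carrier G" "head Q a \<in> carrier G"
    by (rule deg1_path[OF assms])
  let ?y = "head Q a" let ?n = "lact (inv ?y) (bvec p)"
  have mb: "bvec p \<in> block x ?y" using arrow_in_block[of x a] assms p by simp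
  have n: "?n \<in> block (inv ?y \<otimes> x) \<one>" using arr_lact[of x ?y "bvec p" "inv ?y"] mb p by simp
  have rn: "ract ?n (inv x) \<in> block (inv ?y) (inv x)"
    using arr_ract[of "inv ?y \<otimes> x" \<one> ?n "inv x"] n p by (simp add: m_assoc)
  have a1: "antip1 p = pscale (- 1 / \<Phi> (inv ?y \<otimes> x) (inv x) x) (ract ?n (inv x))"
    using p assms by (simp add: antip1_def Let_def)
  have "mul (path_antip p) (bvec (x, [])) = ract (antip1 p) x"
    using mul_ract[of x "inv ?y" "inv x" "antip1 p"] antip1_in_block[OF assms] p
    unfolding path_antip_deg1[OF assms] by simp
  also have "\<dots> = pscale (- 1 / \<Phi> (inv ?y \<otimes> x) (inv x) x) (ract (ract ?n (inv x)) x)"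
    unfolding a1 using ract_scal[of "inv ?y" "inv x" "ract ?n (inv x)" x] rn p by blast
  also have "\<dots> = - ?n"
    using ract_ract[of "inv ?y \<otimes> x" \<one> ?n "inv x" x] ract_one[of "inv ?y \<otimes> x" \<one> ?n] n p by simp
  finally have 1: "mul (path_antip p) (bvec (x, [])) = - ?n" .
  have 2: "mul (path_antip (?y, [])) (bvec p) = ?n"
    using mul_lact[of "inv ?y" x ?y "bvec p"] mb p by (simp add: path_antip_deg0)
  have "(p, (x, [])) \<noteq> ((?y, []), p)" using p by auto
  then have "left_conv p = mul (path_antip p) (bvec (x, [])) + mul (path_antip (?y, [])) (bvec p)"
    using P.splits_of_deg1[of p] assms by (simp add: left_conv_def p)
  then show ?thesis using 1 2 by simp
qed

text \<open>
  Here the identity is not built into the definition of the antipode.  The scalars match because of the cocycle identity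
  at \<open>(y, y\<^sup>-\<^sup>1 x, x\<^sup>-\<^sup>1, x)\<close> for an arrow from \<open>x\<close> to \<open>y\<close>, which relates the values of \<open>\<beta>\<close> at the two ends.
\<close>

lemma right_conv_deg1:
  assumes "p \<in> paths Q" "path_length p = 1" shows "right_conv p = 0"
proof -
  obtain x a where p: "p = (x, [a])" "a \<in> arcs Q" "tail Q a = x" "x \<in> carrier G" "head Q a \<in> carrier G"
    by (rule deg1_path[OF assms])
  let ?y = "head Q a" let ?n = "lact (inv ?y) (bvec p)" let ?m = "ract (bvec p) (inv x)"
  note cl = p(4,5)
  have mb: "bvec p \<in> block x ?y" using arrow_in_block[of x a] assms p by simp
  have n: "?n \<in> block (inv ?y \<otimes> x) \<one>" using arr_lact[of x ?y "bvec p" "inv ?y"] mb p by simp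
  have rn: "ract ?n (inv x) \<in> block (inv ?y) (inv x)"
    using arr_ract[of "inv ?y \<otimes> x" \<one> ?n "inv x"] n p by (simp add: m_assoc)
  have a1: "antip1 p = pscale (- 1 / \<Phi> (inv ?y \<otimes> x) (inv x) x) (ract ?n (inv x))"
    using p assms by (simp add: antip1_def Let_def)
  have "mul (bvec (?y, [])) (path_antip p) = lact ?y (antip1 p)"
    using mul_lact[of ?y "inv ?y" "inv x" "antip1 p"] antip1_in_block[OF assms] p
    unfolding path_antip_deg1[OF assms] by simp
  also have "\<dots> = pscale (- 1 / \<Phi> (inv ?y \<otimes> x) (inv x) x) (lact ?y (ract ?n (inv x)))"
    unfolding a1 using lact_scal[of "inv ?y" "inv x" "ract ?n (inv x)" ?y] rn p by blast
  also have "lact ?y (ract ?n (inv x)) = pscale (1 / \<Phi> ?y (inv ?y \<otimes> x) (inv x)) (ract (lact ?y ?n) (inv x))"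
    using lact_ract[of "inv ?y \<otimes> x" \<one> ?n ?y "inv x"] n p by simp
  also have "lact ?y ?n = pscale (\<Phi> ?y (inv ?y) ?y / \<Phi> ?y (inv ?y) x) (bvec p)"
    using lact_lact[of x ?y "bvec p" ?y "inv ?y"] lact_one[of x ?y "bvec p"] mb p by simp
  also have "ract \<dots> (inv x) = pscale (\<Phi> ?y (inv ?y) ?y / \<Phi> ?y (inv ?y) x) ?m"
    using ract_scal[of x ?y "bvec p" "inv x"] mb p by blast
  finally have 1: "mul (bvec (?y, [])) (path_antip p)
      = pscale (- (\<Phi> ?y (inv ?y) ?y / (\<Phi> (inv ?y \<otimes> x) (inv x) x * \<Phi> ?y (inv ?y \<otimes> x) (inv x) * \<Phi> ?y (inv ?y) x))) ?m"
    by simp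
  \<comment> \<open>The cocycle identity that makes the two scalars agree.\<close>
  have "\<Phi> ?y (inv ?y) x * \<Phi> ?y (inv ?y \<otimes> x) (inv x) * \<Phi> (inv ?y \<otimes> x) (inv x) x = \<Phi> x (inv x) x"
    if "x \<in> carrier G" "?y \<in> carrier G"
    using Phi_cocycle[of ?y "inv ?y \<otimes> x" "inv x" x] that by (simp add: m_assoc mult_ac)
  then have "pscale (\<beta>\<^sub>0 ?y) (mul (bvec (?y, [])) (path_antip p)) = pscale (- \<beta>\<^sub>0 x) ?m"
    using cl unfolding 1 by (simp add: mult_ac)
  moreover have "mul (bvec p) (path_antip (x, [])) = ?m"
    using mul_ract[of "inv x" x ?y "bvec p"] mb p by (simp add: path_antip_deg0)
  moreover have "(p, (x, [])) \<noteq> ((?y, []), p)" using p by auto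
  then have "right_conv p = pscale (\<beta>\<^sub>0 x) (mul (bvec p) (path_antip (x, [])))
      + pscale (\<beta>\<^sub>0 ?y) (mul (bvec (?y, [])) (path_antip p))"
    using P.splits_of_deg1[of p] assms by (simp add: right_conv_def p)
  ultimately show ?thesis by simp
qed

text \<open>
  A Takeuchi-type argument: in degree at least two the comultiplication of the convolution product
  of antipode and identity involves only convolution products of lower degree, which vanish.
\<close>

lemma left_conv_pos: "p \<in> paths Q \<Longrightarrow> 0 < path_length p \<Longrightarrow> left_conv p = 0"
proof (induction "path_length p" arbitrary: p rule: less_induct)
  case less
  show ?case
  proof (cases "path_length p = 1")
    case True then show ?thesis using left_conv_deg1 less by blast
  next
    case False
    show ?thesis
    proof (rule eq_zero_of_middle_comult[OF left_conv_hom[OF less(2)]])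
      fix v q' u p' assume ne: "(p' :: ('g \<times> 'g \<times> nat) list) \<noteq> []" "(q' :: ('g \<times> 'g \<times> nat) list) \<noteq> []"
      have d: "Poly_Mapping.lookup (ext pscale (path_comult Q) (mul (path_antip x) (bvec y))) ((v, q'), (u, p'))
          = (\<Sum>(x2, x1)\<in>splits P x. \<Sum>(y2, y1)\<in>splits P y.
              Poly_Mapping.lookup (mul (path_antip x1) (bvec y2)) (v, q') * Poly_Mapping.lookup (mul (path_antip x2) (bvec y1)) (u, p'))"
        if "(x, y) \<in> splits P p" for x y
        using P.splits_basis[OF _ that] less(2) by (simp add: comult_antip_left lookup_sum case_prod_unfold)
      have "Poly_Mapping.lookup (ext pscale (path_comult Q) (left_conv p)) ((v, q'), (u, p'))
          = (\<Sum>(x, y)\<in>splits P p. \<Sum>(x2, x1)\<in>splits P x. \<Sum>(y2, y1)\<in>splits P y.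
              Poly_Mapping.lookup (mul (path_antip x1) (bvec y2)) (v, q') * Poly_Mapping.lookup (mul (path_antip x2) (bvec y1)) (u, p'))"
        unfolding left_conv_def ext_pscale_sum lookup_sum
        by (rule sum.cong[OF refl]) (use d in \<open>auto split: prod.splits\<close>)
      also have "\<dots> = (\<Sum>(x2, w)\<in>splits P p. \<Sum>(m, y1)\<in>splits P w.
          Poly_Mapping.lookup (left_conv m) (v, q') * Poly_Mapping.lookup (mul (path_antip x2) (bvec y1)) (u, p'))"
        by (subst P.sum_four_splits) (simp add: left_conv_def lookup_sum sum_distrib_right case_prod_unfold)
      also have "\<dots> = 0"
        by (rule conv_middle_zero[OF less(2) ne(2,1) left_conv_hom]) (use less(1) in \<open>auto intro: mul_hom path_antip_hom\<close>)
      finally show "Poly_Mapping.lookup (ext pscale (path_comult Q) (left_conv p)) ((v, q'), (u, p')) = 0" .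
    qed (use less False in linarith)
  qed
qed

lemma right_conv_pos: "p \<in> paths Q \<Longrightarrow> 0 < path_length p \<Longrightarrow> right_conv p = 0"
proof (induction "path_length p" arbitrary: p rule: less_induct)
  case less
  show ?case
  proof (cases "path_length p = 1")
    case True then show ?thesis using right_conv_deg1 less by blast
  next
    case False
    let ?b = "\<lambda>y. \<beta>\<^sub>0 (fst (stgt P y))"
    have l: "lin pscale (ext pscale (path_comult Q) :: _ \<Rightarrow> ('g hpath \<times> 'g hpath \<Rightarrow>\<^sub>0 'k))"
      by (rule lin_ext[OF vector_space_pscale])
    show ?thesis
    proof (rule eq_zero_of_middle_comult[OF right_conv_hom[OF less(2)]])
      fix v q' u p' assume ne: "(p' :: ('g \<times> 'g \<times> nat) list) \<noteq> []" "(q' :: ('g \<times> 'g \<times> nat) list) \<noteq> []"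
      have d: "Poly_Mapping.lookup (ext pscale (path_comult Q) (pscale (?b y) (mul (bvec x) (path_antip y)))) ((v, q'), (u, p'))
          = (\<Sum>(x2, x1)\<in>splits P x. \<Sum>(y2, y1)\<in>splits P y.
              ?b y2 * Poly_Mapping.lookup (mul (bvec x1) (path_antip y2)) (u, p') * Poly_Mapping.lookup (mul (bvec x2) (path_antip y1)) (v, q'))"
        if "(x, y) \<in> splits P p" for x y
      proof -
        \<comment> \<open>The factor \<open>\<beta>\<close> only sees the vertex between \<open>x\<close> and \<open>y\<close>, so it can be moved to the inner convolution product.\<close>
        have "?b y2 = ?b y" if "(y2, y1) \<in> splits P y" for y2 y1 using P.splits_ends[OF that] by simp
        then have "(\<Sum>(x2, x1)\<in>splits P x. \<Sum>(y2, y1)\<in>splits P y.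
              ?b y2 * Poly_Mapping.lookup (mul (bvec x1) (path_antip y2)) (u, p') * Poly_Mapping.lookup (mul (bvec x2) (path_antip y1)) (v, q'))
            = (\<Sum>(x2, x1)\<in>splits P x. \<Sum>(y2, y1)\<in>splits P y.
              ?b y * (Poly_Mapping.lookup (mul (bvec x2) (path_antip y1)) (v, q') * Poly_Mapping.lookup (mul (bvec x1) (path_antip y2)) (u, p')))"
          by (intro sum.cong refl) (auto intro!: sum.cong)
        then show ?thesis
          using P.splits_basis[OF _ that] less(2)
          by (simp add: lin_onD(3)[OF l] comult_antip_right lookup_sum case_prod_unfold sum_distrib_left)
      qed
      have "Poly_Mapping.lookup (ext pscale (path_comult Q) (right_conv p)) ((v, q'), (u, p'))
          = (\<Sum>(x, y)\<in>splits P p. \<Sum>(x2, x1)\<in>splits P x. \<Sum>(y2, y1)\<in>splits P y.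
              ?b y2 * Poly_Mapping.lookup (mul (bvec x1) (path_antip y2)) (u, p') * Poly_Mapping.lookup (mul (bvec x2) (path_antip y1)) (v, q'))"
        unfolding right_conv_def ext_pscale_sum lookup_sum
        by (rule sum.cong[OF refl]) (use d in \<open>auto split: prod.splits\<close>)
      also have "\<dots> = (\<Sum>(x2, w)\<in>splits P p. \<Sum>(m, y1)\<in>splits P w.
          Poly_Mapping.lookup (right_conv m) (u, p') * Poly_Mapping.lookup (mul (bvec x2) (path_antip y1)) (v, q'))"
        by (subst P.sum_four_splits) (simp add: right_conv_def lookup_sum sum_distrib_right case_prod_unfold)
      also have "\<dots> = 0"
        by (rule conv_middle_zero[OF less(2) ne right_conv_hom]) (use less(1) in \<open>auto intro: mul_hom path_antip_hom\<close>)
      finally show "Poly_Mapping.lookup (ext pscale (path_comult Q) (right_conv p)) ((v, q'), (u, p')) = 0" .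
    qed (use less False in linarith)
  qed
qed

end

section \<open>The Majid algebra of a bimodule\<close>

lemma bilin_on_of_lin:
  assumes "\<And>u. lin s (f u)" "\<And>v. lin s (\<lambda>u. f u v)" "\<And>u v. u \<in> V \<Longrightarrow> v \<in> V \<Longrightarrow> f u v \<in> W"
  shows "bilin_on s V f W"
  unfolding bilin_on_def using assms by (auto simp: lin_on_def)

context hopf_quiver_cocycle
begin

abbreviation comul :: "('g hpath \<Rightarrow>\<^sub>0 'k) \<Rightarrow> ('g hpath \<times> 'g hpath \<Rightarrow>\<^sub>0 'k)" where
  "comul \<equiv> ext pscale (path_comult Q)"

definition vertex_form :: "('g \<Rightarrow> 'k) \<Rightarrow> ('g hpath \<Rightarrow>\<^sub>0 'k) \<Rightarrow> 'k" where
  "vertex_form f = ext (*) (\<lambda>p. if path_length p = 0 then f (fst p) else 0)"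

lemma vertex_form_bvec [simp]: "vertex_form f (bvec p) = (if path_length p = 0 then f (fst p) else 0)"
  by (simp add: vertex_form_def vector_space_mult)

lemma lin_vertex_form [lin_intros]: "lin pscale g \<Longrightarrow> lin (*) (\<lambda>v. vertex_form f (g v))"
  unfolding vertex_form_def by (intro lin_intros vector_space_mult)

lemma vertex_form_pos: "v \<in> deg_space n \<Longrightarrow> n > 0 \<Longrightarrow> vertex_form f v = 0"
  unfolding vertex_form_def by (intro ext_zero) (auto simp: free_space_def)

lemma lin_comul: "lin pscale comul"
  by (rule lin_ext[OF vector_space_pscale])

lemma sw_comul [simp]:
  "sw pscale comul (bvec p) F = (\<Sum>(x, y)\<in>splits P p. F (bvec x) (bvec y))"
  "sw (*) comul (bvec p) F' = (\<Sum>(x, y)\<in>splits P p. F' (bvec x) (bvec y))"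
  by (rule sw_path_bvec[OF vector_space_pscale], rule sw_path_bvec[OF vector_space_mult])

lemma comul_bvec: "comul (bvec p) = (\<Sum>(x, y)\<in>splits P p. bvec (x, y))"
  by (simp add: vector_space_pscale path_comult_splits case_prod_beta)

lemma lin_path_intros [lin_intros]:
  "lin pscale g \<Longrightarrow> lin pscale (\<lambda>v. comul (g v))"
  "lin pscale g \<Longrightarrow> lin pscale (\<lambda>v. sw pscale comul (g v) F)"
  "lin pscale g \<Longrightarrow> lin (*) (\<lambda>v. sw (*) comul (g v) F')"
  "(\<And>x y. lin pscale (\<lambda>v. H v (bvec x) (bvec y))) \<Longrightarrow> lin pscale (\<lambda>v. sw pscale \<Delta> a (H v))"
  "(\<And>x y. lin (*) (\<lambda>v. H' v (bvec x) (bvec y))) \<Longrightarrow> lin (*) (\<lambda>v. sw (*) \<Delta> a (H' v))"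
  "lin pscale g \<Longrightarrow> lin pscale (\<lambda>v. pscale c (g v))"
  "lin (*) f \<Longrightarrow> lin (*) (\<lambda>v. c * f v)"
  "lin pscale g \<Longrightarrow> lin pscale (\<lambda>v. ext pscale K (g v))"
  by (intro lin_comp[OF lin_comul] lin_sw[OF _ lin_comul] lin_sw_family lin_scale lin_ext_comp
      vector_space_pscale vector_space_mult | assumption)+

end

context path_bimodule
begin

abbreviation "\<Phi>\<^sub>f \<equiv> vertex_form3 \<Phi>"
abbreviation "\<Psi>\<^sub>f \<equiv> vertex_form3 (\<lambda>e f g. 1 / \<Phi> e f g)"
abbreviation "\<epsilon>\<^sub>f \<equiv> vertex_form (\<lambda>_. 1)"
abbreviation "\<beta>\<^sub>f \<equiv> vertex_form \<beta>\<^sub>0"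
abbreviation "Sf \<equiv> ext pscale path_antip"

definition majid_of :: "('g hpath, 'k) majid" where
  "majid_of = \<lparr> basis = paths Q, comult = comul, counit = \<epsilon>\<^sub>f, mprod = mul, munit = bvec (\<one>, []),
     reass = \<Phi>\<^sub>f, antip = Sf, malpha = \<epsilon>\<^sub>f, mbeta = \<beta>\<^sub>f \<rparr>"

lemma majid_of_simps [simp]:
  "basis majid_of = paths Q" "comult majid_of = comul" "counit majid_of = \<epsilon>\<^sub>f" "mprod majid_of = mul"
  "munit majid_of = bvec (\<one>, [])" "reass majid_of = \<Phi>\<^sub>f" "antip majid_of = Sf" "malpha majid_of = \<epsilon>\<^sub>f"
  "mbeta majid_of = \<beta>\<^sub>f"
  by (simp_all add: majid_of_def)

lemma Sf_bvec [simp]: "Sf (bvec p) = path_antip p"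
  by (simp add: vector_space_pscale)

lemma sum_vertex_left:
  "(\<Sum>(x, y)\<in>splits P b. pscale (if path_length x = 0 then c x else 0) (f x y))
   = pscale (c (stgt P b)) (f (stgt P b) b :: 'c \<Rightarrow>\<^sub>0 'k)"
  using P.sum_deg0_left[of "\<lambda>x y. pscale (c x) (f x y)" b] by (simp add: if_distrib[of "\<lambda>c. pscale c _"] cong: if_cong)

lemma sum_vertex_right:
  "(\<Sum>(x, y)\<in>splits P b. pscale (if path_length y = 0 then c y else 0) (f x y))
   = pscale (c (ssrc P b)) (f b (ssrc P b) :: 'c \<Rightarrow>\<^sub>0 'k)"
  using P.sum_deg0_right[of "\<lambda>x y. pscale (c y) (f x y)" b] by (simp add: if_distrib[of "\<lambda>c. pscale c _"] cong: if_cong)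

lemma coalgebra_majid_of: "coalgebra majid_of"
proof (unfold_locales, goal_cases)
  case 1
  show ?case unfolding majid_of_simps
  proof (rule lin_on_freeI[OF lin_comul subspace_free_space])
    fix b assume "b \<in> paths Q"
    then show "comul (bvec b) \<in> free_space (paths Q \<times> paths Q)"
      unfolding comul_bvec using P.splits_basis[of b] by (intro free_space_sum) auto
  qed
next
  case 2
  show ?case unfolding majid_of_simps by (rule lin_on_subset[OF lin_vertex_form[OF lin_ident]]) simp
next
  case (3 a)
  then have a: "a \<in> free_space (paths Q)" by simp
  show ?case unfolding majid_of_simps
    by (rule lin_eqI[where s = pscale, OF a], (intro lin_intros)+, simp add: P.sum_coassoc)
next
  case (4 a)
  then have a: "a \<in> free_space (paths Q)" by simp
  show ?case unfolding majid_of_simps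
    by (rule lin_eqI[where s = pscale, OF a], (intro lin_intros)+, simp add: sum_vertex_left)
next
  case (5 a)
  then have a: "a \<in> free_space (paths Q)" by simp
  show ?case unfolding majid_of_simps
    by (rule lin_eqI[where s = pscale, OF a], (intro lin_intros)+, simp add: sum_vertex_right)
qed

lemma path_prod_length: "path_prod (p, q) \<in> free_space {r. path_length r = path_length p + path_length q}"
proof -
  have "length r = path_length p + path_length q" if "Poly_Mapping.lookup (path_prod (p, q)) (u, r) \<noteq> 0" for u r
    using prod.path_coeff_nz[of r "(p, q)" u] that by (simp add: path_prod_def prod.lookup_cofree_ext)
  then show ?thesis unfolding free_space_iff by force
qed

lemma path_antip_length: "path_antip p \<in> free_space {r. path_length r = path_length p}"
proof -
  have "length r = path_length p" if "Poly_Mapping.lookup (path_antip p) (u, r) \<noteq> 0" for u r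
    using antip.path_coeff_nz[of r p u] that by (simp add: path_antip_def antip.lookup_cofree_ext)
  then show ?thesis unfolding free_space_iff by force
qed

lemma path_prod_vertex: "path_length p = 0 \<Longrightarrow> path_length q = 0 \<Longrightarrow> path_prod (p, q) = bvec (fst p \<otimes> fst q, [])"
  using path_prod_deg0[of "fst p" "fst q"] by (cases p; cases q) simp

lemma path_antip_vertex: "path_length p = 0 \<Longrightarrow> path_antip p = bvec (inv (fst p), [])"
  using path_antip_deg0[of "fst p"] by (cases p) simp

lemma vertex_form_path_prod [simp]:
  "vertex_form f (path_prod (p, q)) = (if path_length p = 0 \<and> path_length q = 0 then f (fst p \<otimes> fst q) else 0)"
  using path_prod_length[of p q]
  by (auto simp: path_prod_vertex) (auto simp: vertex_form_def free_space_def intro!: ext_zero)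

lemma vertex_form_path_antip [simp]:
  "vertex_form f (path_antip p) = (if path_length p = 0 then f (inv (fst p)) else 0)"
  using path_antip_length[of p]
  by (auto simp: path_antip_vertex) (auto simp: vertex_form_def free_space_def intro!: ext_zero)

lemma vertex_form3_path_prod [simp]:
  "vertex_form3 F (bvec p) (bvec q) (path_prod (r, s)) = (if path_length p = 0 \<and> path_length q = 0 \<and> path_length r = 0
     \<and> path_length s = 0 then F (fst p) (fst q) (fst r \<otimes> fst s) else 0)"
  "vertex_form3 F (bvec p) (path_prod (r, s)) (bvec q) = (if path_length p = 0 \<and> path_length q = 0 \<and> path_length r = 0
     \<and> path_length s = 0 then F (fst p) (fst r \<otimes> fst s) (fst q) else 0)"
  "vertex_form3 F (path_prod (r, s)) (bvec p) (bvec q) = (if path_length p = 0 \<and> path_length q = 0 \<and> path_length r = 0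
     \<and> path_length s = 0 then F (fst r \<otimes> fst s) (fst p) (fst q) else 0)"
proof -
  have "vertex_form3 F (bvec p) (bvec q) (path_prod (r, s)) = 0 \<and> vertex_form3 F (bvec p) (path_prod (r, s)) (bvec q) = 0
      \<and> vertex_form3 F (path_prod (r, s)) (bvec p) (bvec q) = 0" if "path_length p + path_length q + path_length r + path_length s \<noteq> 0"
    unfolding vertex_form3_def using path_prod_length[of r s] that by (auto simp: free_space_def intro!: ext_zero)
  then show "vertex_form3 F (bvec p) (bvec q) (path_prod (r, s)) = (if path_length p = 0 \<and> path_length q = 0 \<and> path_length r = 0
       \<and> path_length s = 0 then F (fst p) (fst q) (fst r \<otimes> fst s) else 0)"
    "vertex_form3 F (bvec p) (path_prod (r, s)) (bvec q) = (if path_length p = 0 \<and> path_length q = 0 \<and> path_length r = 0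
       \<and> path_length s = 0 then F (fst p) (fst r \<otimes> fst s) (fst q) else 0)"
    "vertex_form3 F (path_prod (r, s)) (bvec p) (bvec q) = (if path_length p = 0 \<and> path_length q = 0 \<and> path_length r = 0
       \<and> path_length s = 0 then F (fst r \<otimes> fst s) (fst p) (fst q) else 0)"
    by (auto simp: path_prod_vertex)
qed

lemma vertex_form3_path_antip [simp]:
  "vertex_form3 F (bvec p) (path_antip q) (bvec r) = (if path_length p = 0 \<and> path_length q = 0 \<and> path_length r = 0
     then F (fst p) (inv (fst q)) (fst r) else 0)"
  "vertex_form3 F (path_antip p) (bvec q) (path_antip r) = (if path_length p = 0 \<and> path_length q = 0 \<and> path_length r = 0
     then F (inv (fst p)) (fst q) (inv (fst r)) else 0)"
proof -
  have "vertex_form3 F (bvec p) (path_antip q) (bvec r) = 0" if "path_length p + path_length q + path_length r \<noteq> 0"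
    unfolding vertex_form3_def using path_antip_length[of q] that by (auto simp: free_space_def intro!: ext_zero)
  then show "vertex_form3 F (bvec p) (path_antip q) (bvec r) = (if path_length p = 0 \<and> path_length q = 0 \<and> path_length r = 0
     then F (fst p) (inv (fst q)) (fst r) else 0)"
    by (auto simp: path_antip_vertex)
  have "vertex_form3 F (path_antip p) (bvec q) (path_antip r) = 0" if "path_length p + path_length q + path_length r \<noteq> 0"
    unfolding vertex_form3_def using path_antip_length[of p] path_antip_length[of r] that
    by (auto simp: free_space_def intro!: ext_zero)
  then show "vertex_form3 F (path_antip p) (bvec q) (path_antip r) = (if path_length p = 0 \<and> path_length q = 0 \<and> path_length r = 0
     then F (inv (fst p)) (fst q) (inv (fst r)) else 0)"
    by (auto simp: path_antip_vertex)
qed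

lemma splits_length: "(x, y) \<in> splits P p \<Longrightarrow> path_length p = path_length x + path_length y"
  using P.splits_deg[of x y p] by simp

lemma splits_vertex: "path_length p = 0 \<Longrightarrow> splits P p = {(p, p)}"
  using P.splits_of_deg0[of p] by simp

lemma sum_splits_zero:
  "(\<And>x y. (x, y) \<in> splits P p \<Longrightarrow> path_length p = path_length x + path_length y \<Longrightarrow> f x y = 0) \<Longrightarrow>
   (\<Sum>(x, y)\<in>splits P p. f x y) = (0::'c::comm_monoid_add)"
  by (rule sum.neutral) (use splits_length in auto)

lemma mul_in_space: "u \<in> free_space (paths Q) \<Longrightarrow> v \<in> free_space (paths Q) \<Longrightarrow> mul u v \<in> free_space (paths Q)"
  unfolding mul_def
  by (rule ext_free_space[OF tens_free_space]) (auto intro: free_space_mono[OF path_prod_hom])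

lemma Sf_in_space: "u \<in> free_space (paths Q) \<Longrightarrow> Sf u \<in> free_space (paths Q)"
  by (rule ext_free_space) (auto intro: free_space_mono[OF path_antip_hom])

lemma trilin_vertex_form3: "trilin_on (*) V (vertex_form3 F) UNIV"
  unfolding trilin_on_def
  by (intro conjI ballI bilin_on_of_lin) (auto intro!: lin_intros)

text \<open>
  Both sides vanish unless all arguments are vertices, where the identity is the cocycle condition.
\<close>

lemma majid_of_pentagon:
  assumes "a \<in> paths Q" "b \<in> paths Q" "c \<in> paths Q" "d \<in> paths Q"
  shows "(\<Sum>(a1, a2)\<in>splits P a. \<Sum>(b1, b2)\<in>splits P b. \<Sum>(c1, c2)\<in>splits P c. \<Sum>(d1, d2)\<in>splits P d.
        \<Phi>\<^sub>f (bvec a1) (bvec b1) (path_prod (c1, d1)) * \<Phi>\<^sub>f (path_prod (a2, b2)) (bvec c2) (bvec d2))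
    = (\<Sum>(a1, a2)\<in>splits P a. \<Sum>(b1, r)\<in>splits P b. \<Sum>(b2, b3)\<in>splits P r.
        \<Sum>(c1, r)\<in>splits P c. \<Sum>(c2, c3)\<in>splits P r. \<Sum>(d1, d2)\<in>splits P d.
        \<Phi>\<^sub>f (bvec b1) (bvec c1) (bvec d1) * \<Phi>\<^sub>f (bvec a1) (path_prod (b2, c2)) (bvec d2) * \<Phi>\<^sub>f (bvec a2) (bvec b3) (bvec c3))" (is "?l = ?r")
proof (cases "path_length a = 0 \<and> path_length b = 0 \<and> path_length c = 0 \<and> path_length d = 0")
  case True
  then obtain x y z w where "a = (x, [])" "b = (y, [])" "c = (z, [])" "d = (w, [])"
    "x \<in> carrier G" "y \<in> carrier G" "z \<in> carrier G" "w \<in> carrier G"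
    using deg0_path assms by metis
  then show ?thesis using Phi_cocycle[of x y z w] by (simp add: splits_vertex mult_ac)
next
  case False
  have "?l = 0" by (intro sum_splits_zero) (use False in auto)
  moreover have "?r = 0" by (intro sum_splits_zero) (use False in auto)
  ultimately show ?thesis by simp
qed

lemma left_conv_eq: "p \<in> paths Q \<Longrightarrow> left_conv p = pscale (\<epsilon>\<^sub>f (bvec p)) (bvec (\<one>, []))"
  using left_conv_pos[of p] path_start[of "fst p" "snd p"]
  by (cases p) (auto simp: left_conv_def splits_vertex path_antip_vertex path_prod_vertex)

lemma right_conv_eq: "p \<in> paths Q \<Longrightarrow> right_conv p = pscale (\<beta>\<^sub>f (bvec p)) (bvec (\<one>, []))"
  using right_conv_pos[of p] path_start[of "fst p" "snd p"]
  by (cases p) (auto simp: right_conv_def splits_vertex path_antip_vertex path_prod_vertex)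

text \<open>
  Every axiom is multilinear, so it is checked on paths.
\<close>

lemma majid_algebra_majid_of: "majid_algebra majid_of"
proof (intro majid_algebra.intro coalgebra_majid_of majid_algebra_axioms.intro, unfold majid_of_simps, goal_cases)
  case 1
  show ?case by (rule bilin_on_of_lin) (auto intro!: lin_intros mul_in_space)
next
  case 2
  show ?case by simp
next
  case 3
  show ?case by (rule trilin_vertex_form3)
next
  case 4
  show ?case by (rule lin_on_subset) (auto intro!: lin_intros Sf_in_space)
next
  case 5
  show ?case by (rule lin_on_subset) (auto intro!: lin_intros)
next
  case 6
  show ?case by (rule lin_on_subset) (auto intro!: lin_intros)
next
  \<comment> \<open>The product is a coalgebra map.\<close>
  case (7 a b)
  show ?case
  proof (rule lin_eqI2[where s = pscale, OF 7], (intro lin_intros)+)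
    fix p q assume "p \<in> paths Q" "q \<in> paths Q"
    then show "comul (mul (bvec p) (bvec q)) = sw pscale comul (bvec p) (\<lambda>a1 a2. sw pscale comul (bvec q)
        (\<lambda>b1 b2. tens (mul a1 b1) (mul a2 b2)))"
      using graded_coalg_mapD(3)[OF coalg_map_path_prod, of "(p, q)"]
      by (simp add: scomult_path sum_splits_prod case_prod_unfold)
  qed
next
  case (8 a b)
  show ?case by (rule lin_eqI2[where s = "(*)", OF 8], (intro lin_intros)+) simp
next
  case 9
  show ?case by (simp add: comul_bvec splits_vertex del: ext_bvec)
next
  case 10
  show ?case by simp
next
  \<comment> \<open>The antipode is a coalgebra antimorphism.\<close>
  case (11 a)
  show ?case
  proof (rule lin_eqI[where s = pscale, OF 11], (intro lin_intros)+)
    fix p assume "p \<in> paths Q"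
    then show "comul (Sf (bvec p)) = sw pscale comul (bvec p) (\<lambda>a1 a2. tens (Sf a2) (Sf a1))"
      using graded_coalg_mapD(3)[OF coalg_map_path_antip, of p]
      by (simp add: scomult_path sum_opp_splits case_prod_unfold)
  qed
next
  case (12 a)
  show ?case by (rule lin_eqI[where s = "(*)", OF 12], (intro lin_intros)+) simp
next
  case (13 a)
  show ?case by (rule lin_eqI[where s = pscale, OF 13], (intro lin_intros)+) (simp add: path_prod_unit_left)
next
  case (14 a)
  show ?case by (rule lin_eqI[where s = pscale, OF 14], (intro lin_intros)+) (simp add: path_prod_unit_right)
next
  \<comment> \<open>Quasi-associativity.\<close>
  case (15 a b c)
  show ?case
  proof (rule lin_eqI3[where s = pscale, OF 15], (intro lin_intros)+)
    fix p q r assume "p \<in> paths Q" "q \<in> paths Q" "r \<in> paths Q"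
    then show "sw pscale comul (bvec p) (\<lambda>a1 a2. sw pscale comul (bvec q) (\<lambda>b1 b2. sw pscale comul (bvec r) (\<lambda>c1 c2.
          pscale (\<Phi>\<^sub>f a2 b2 c2) (mul a1 (mul b1 c1)))))
      = sw pscale comul (bvec p) (\<lambda>a1 a2. sw pscale comul (bvec q) (\<lambda>b1 b2. sw pscale comul (bvec r) (\<lambda>c1 c2.
          pscale (\<Phi>\<^sub>f a1 b1 c1) (mul (mul a2 b2) c2))))"
      by (simp only: sw_comul mul_bvec vertex_form3_bvec sum3_deg0_right sum3_deg0_left path_prod_quasi_assoc)
  qed
next
  case (16 a b c d)
  show ?case
    by (rule lin_eqI4[where s = "(*)", OF 16], (intro lin_intros)+)
      (simp only: sw_comul mul_bvec majid_of_pentagon)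
next
  case (17 a b)
  show ?case
    by (rule lin_eqI2[where s = "(*)", OF 17], (intro lin_intros)+) (auto dest: path_start)
next
  \<comment> \<open>The antipode identity with \<open>\<alpha>\<close>.\<close>
  case (18 a)
  show ?case
  proof (rule lin_eqI[where s = pscale, OF 18], (intro lin_intros)+)
    fix p assume p: "p \<in> paths Q"
    show "sw pscale comul (bvec p) (\<lambda>a1 r. sw pscale comul r (\<lambda>a2 a3. pscale (\<epsilon>\<^sub>f a2) (mul (Sf a1) a3)))
        = pscale (\<epsilon>\<^sub>f (bvec p)) (bvec (\<one>, []))"
      unfolding left_conv_eq[OF p, symmetric] by (simp add: sum_vertex_left left_conv_def)
  qed
next
  \<comment> \<open>The antipode identity with \<open>\<beta>\<close>.\<close>
  case (19 a)
  show ?case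
  proof (rule lin_eqI[where s = pscale, OF 19], (intro lin_intros)+)
    fix p assume p: "p \<in> paths Q"
    show "sw pscale comul (bvec p) (\<lambda>a1 r. sw pscale comul r (\<lambda>a2 a3. pscale (\<beta>\<^sub>f a2) (mul a1 (Sf a3))))
        = pscale (\<beta>\<^sub>f (bvec p)) (bvec (\<one>, []))"
      unfolding right_conv_eq[OF p, symmetric] by (simp add: sum_vertex_left right_conv_def)
  qed
next
  \<comment> \<open>The identity between antipode and reassociator, which concerns vertices only.\<close>
  case (20 a)
  show ?case
  proof (rule lin_eqI[where s = "(*)", OF 20], (intro lin_intros)+)
    fix p assume p: "p \<in> paths Q"
    show "sw (*) comul (bvec p) (\<lambda>a1 r1. sw (*) comul r1 (\<lambda>a2 r2. sw (*) comul r2 (\<lambda>a3 r3. sw (*) comul r3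
        (\<lambda>a4 a5. \<Phi>\<^sub>f a1 (Sf a3) a5 * \<beta>\<^sub>f a2 * \<epsilon>\<^sub>f a4)))) = \<epsilon>\<^sub>f (bvec p)"
    proof (cases "path_length p = 0")
      case True
      then show ?thesis using p path_start[of "fst p" "snd p"] by (simp add: splits_vertex)
    next
      case False
      then show ?thesis by (simp, intro sum_splits_zero) auto
    qed
  qed
next
  \<comment> \<open>The inverse reassociator takes the inverse values on vertices.\<close>
  case 21
  show ?case
  proof (intro exI[of _ \<Psi>\<^sub>f] conjI trilin_vertex_form3 ballI, goal_cases)
    case (1 a b c)
    show ?case
    proof (rule lin_eqI3[where s = "(*)", OF 1], (intro lin_intros)+)
      fix p q r assume p: "p \<in> paths Q" "q \<in> paths Q" "r \<in> paths Q"
      show "sw (*) comul (bvec p) (\<lambda>a1 a2. sw (*) comul (bvec q) (\<lambda>b1 b2. sw (*) comul (bvec r)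
          (\<lambda>c1 c2. \<Phi>\<^sub>f a1 b1 c1 * \<Psi>\<^sub>f a2 b2 c2))) = \<epsilon>\<^sub>f (bvec p) * \<epsilon>\<^sub>f (bvec q) * \<epsilon>\<^sub>f (bvec r)"
      proof (cases "path_length p = 0 \<and> path_length q = 0 \<and> path_length r = 0")
        case True
        then show ?thesis using p path_ends(3) by (simp add: splits_vertex)
      next
        case False
        then have "\<epsilon>\<^sub>f (bvec p) * \<epsilon>\<^sub>f (bvec q) * \<epsilon>\<^sub>f (bvec r) = 0" by auto
        moreover have "sw (*) comul (bvec p) (\<lambda>a1 a2. sw (*) comul (bvec q) (\<lambda>b1 b2. sw (*) comul (bvec r)
          (\<lambda>c1 c2. \<Phi>\<^sub>f a1 b1 c1 * \<Psi>\<^sub>f a2 b2 c2))) = 0"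
          unfolding sw_comul by (intro sum_splits_zero) (use False in auto)
        ultimately show ?thesis by simp
      qed
    qed
  next
    case (2 a b c)
    show ?case
    proof (rule lin_eqI3[where s = "(*)", OF 2], (intro lin_intros)+)
      fix p q r assume p: "p \<in> paths Q" "q \<in> paths Q" "r \<in> paths Q"
      show "sw (*) comul (bvec p) (\<lambda>a1 a2. sw (*) comul (bvec q) (\<lambda>b1 b2. sw (*) comul (bvec r)
          (\<lambda>c1 c2. \<Psi>\<^sub>f a1 b1 c1 * \<Phi>\<^sub>f a2 b2 c2))) = \<epsilon>\<^sub>f (bvec p) * \<epsilon>\<^sub>f (bvec q) * \<epsilon>\<^sub>f (bvec r)"
      proof (cases "path_length p = 0 \<and> path_length q = 0 \<and> path_length r = 0")
        case True
        then show ?thesis using p path_ends(3) by (simp add: splits_vertex)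
      next
        case False
        then have "\<epsilon>\<^sub>f (bvec p) * \<epsilon>\<^sub>f (bvec q) * \<epsilon>\<^sub>f (bvec r) = 0" by auto
        moreover have "sw (*) comul (bvec p) (\<lambda>a1 a2. sw (*) comul (bvec q) (\<lambda>b1 b2. sw (*) comul (bvec r)
          (\<lambda>c1 c2. \<Psi>\<^sub>f a1 b1 c1 * \<Phi>\<^sub>f a2 b2 c2))) = 0"
          unfolding sw_comul by (intro sum_splits_zero) (use False in auto)
        ultimately show ?thesis by simp
      qed
    qed
  next
    case (3 a)
    show ?case
    proof (rule lin_eqI[where s = "(*)", OF 3], (intro lin_intros)+)
      fix p assume p: "p \<in> paths Q"
      show "sw (*) comul (bvec p) (\<lambda>a1 r1. sw (*) comul r1 (\<lambda>a2 r2. sw (*) comul r2 (\<lambda>a3 r3. sw (*) comul r3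
          (\<lambda>a4 a5. \<Psi>\<^sub>f (Sf a1) a3 (Sf a5) * \<epsilon>\<^sub>f a2 * \<beta>\<^sub>f a4)))) = \<epsilon>\<^sub>f (bvec p)"
      proof (cases "path_length p = 0")
        case True
        then show ?thesis using p path_ends(3)[of p] Phi_inv_cocycle[of "fst p"]
          by (simp add: splits_vertex mult.commute)
      next
        case False
        then show ?thesis by (simp, intro sum_splits_zero) auto
      qed
    qed
  qed
qed

end

lemma relabel_comp:
  assumes "v \<in> free_space A" "\<And>b. b \<in> A \<Longrightarrow> g (f b) = b"
  shows "ext pscale (\<lambda>b. bvec (g b)) (ext pscale (\<lambda>b. bvec (f b)) v) = v"
  by (rule lin_eqI[where s = pscale and f' = "\<lambda>v. v", OF assms(1)], (intro lin_intros)+)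
    (simp add: vector_space_pscale assms(2))

lemma relabel_bij:
  assumes "bij_betw f A B"
  shows "bij_betw (ext pscale (\<lambda>b. bvec (f b)) :: _ \<Rightarrow> (_ \<Rightarrow>\<^sub>0 'k::field)) (free_space A) (free_space B)"
proof (rule bij_betw_byWitness[where f' = "ext pscale (\<lambda>b. bvec (inv_into A f b))"])
  have f: "f b \<in> B" if "b \<in> A" for b using assms that by (auto simp: bij_betw_def)
  have g: "inv_into A f b \<in> A" if "b \<in> B" for b using assms that by (auto simp: bij_betw_def inv_into_into)
  show "\<forall>v\<in>free_space A. ext pscale (\<lambda>b. bvec (inv_into A f b)) (ext pscale (\<lambda>b. bvec (f b)) v) = (v :: _ \<Rightarrow>\<^sub>0 'k)"
    using assms by (intro ballI relabel_comp) (auto simp: bij_betw_def)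
  show "\<forall>v\<in>free_space B. ext pscale (\<lambda>b. bvec (f b)) (ext pscale (\<lambda>b. bvec (inv_into A f b)) v) = (v :: _ \<Rightarrow>\<^sub>0 'k)"
    using assms by (intro ballI relabel_comp) (auto simp: bij_betw_def f_inv_into_f)
  show "ext pscale (\<lambda>b. bvec (f b)) ` free_space A \<subseteq> (free_space B :: (_ \<Rightarrow>\<^sub>0 'k) set)"
    using f by (auto intro: ext_free_space)
  show "ext pscale (\<lambda>b. bvec (inv_into A f b)) ` free_space B \<subseteq> (free_space A :: (_ \<Rightarrow>\<^sub>0 'k) set)"
    using g by (auto intro: ext_free_space)
qed

context cocycle_group
begin

lemma group_majid_simps [simp]:
  "basis (group_majid G \<Phi>) = carrier G" "comult (group_majid G \<Phi>) = ext pscale (\<lambda>g. bvec (g, g))"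
  "counit (group_majid G \<Phi>) = ext (*) (\<lambda>g. 1)"
  "mprod (group_majid G \<Phi>) = (\<lambda>u v. ext pscale (\<lambda>g. ext pscale (\<lambda>h. bvec (g \<otimes> h)) v) u)"
  "munit (group_majid G \<Phi>) = bvec \<one>"
  "reass (group_majid G \<Phi>) = (\<lambda>u v w. ext (*) (\<lambda>e. ext (*) (\<lambda>f. ext (*) (\<lambda>g. \<Phi> e f g) w) v) u)"
  "antip (group_majid G \<Phi>) = ext pscale (\<lambda>g. bvec (inv g))"
  "malpha (group_majid G \<Phi>) = ext (*) (\<lambda>g. 1)"
  "mbeta (group_majid G \<Phi>) = ext (*) (\<lambda>g. 1 / \<Phi> g (inv g) g)"
  by (simp_all add: group_majid_def)

lemma vertex_embedding_bvec [simp]: "vertex_embedding (bvec g) = bvec (g, [])"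
  by (simp add: vertex_embedding_def vector_space_pscale)

lemma lin_vertex_embedding [lin_intros]: "lin pscale f \<Longrightarrow> lin pscale (\<lambda>v. vertex_embedding (f v))"
  unfolding vertex_embedding_def by (intro lin_intros)

lemma vertex_embedding_bij: "bij_betw vertex_embedding (free_space (carrier G)) (vertex_space G)"
proof -
  have "bij_betw (\<lambda>g. (g, [])) (carrier G) {(x, []) | x. x \<in> carrier G}"
    by (auto simp: bij_betw_def inj_on_def)
  from relabel_bij[OF this] show ?thesis by (simp add: vertex_embedding_def[abs_def] vertex_space_def)
qed

end

context path_bimodule
begin

lemma graded_majid_algebra_majid_of: "graded_majid_algebra majid_of path_length"
proof (intro graded_majid_algebra.intro majid_algebra_majid_of graded_majid_algebra_axioms.intro,
    unfold majid_of_simps homog_def, goal_cases)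
  case (1 a n)
  have "comul (bvec b) \<in> free_space {(x, y) \<in> paths Q \<times> paths Q. path_length x + path_length y = n}"
    if "b \<in> {b \<in> paths Q. path_length b = n}" for b
    unfolding comul_bvec using P.splits_basis[of b] splits_length that by (intro free_space_sum) fastforce
  then show ?case using 1 by (rule_tac ext_free_space) (auto simp: vector_space_pscale)
next
  case (2 a n)
  then show ?case by (rule vertex_form_pos)
next
  case (3 a m b n)
  then show ?case by (rule mul_hom)
next
  case 4
  show ?case by simp
next
  case (5 a l b m c n)
  then show ?case by (rule vertex_form3_pos)
next
  case (6 a n)
  then show ?case by (rule ext_free_space) (use path_antip_hom in auto)
next
  case (7 a n)
  then show ?case by (rule vertex_form_pos)
next
  case (8 a n)
  then show ?case by (rule vertex_form_pos)
qed

lemma sub_majid_algebra_majid_of: "sub_majid_algebra majid_of (vertex_space G)"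
proof -
  let ?W = "vertex_space G :: ('g hpath \<Rightarrow>\<^sub>0 'k) set"
  let ?V = "{(x, []) | x. x \<in> carrier G} :: 'g hpath set"
  have "comul a \<in> fs.span {tens u v | u v. u \<in> ?W \<and> v \<in> ?W}" if "a \<in> ?W" for a
  proof (rule lin_onD(1)[OF lin_on_freeI[OF lin_comul fs.subspace_span] that[unfolded vertex_space_def]])
    fix b :: "'g hpath" assume "b \<in> ?V"
    then have eq: "comul (bvec b) = tens (bvec b) (bvec b)" and b: "bvec b \<in> ?W"
      unfolding comul_bvec by (auto simp: splits_vertex vertex_space_def)
    show "comul (bvec b) \<in> fs.span {tens u v | u v. u \<in> ?W \<and> v \<in> ?W}"
      unfolding eq by (rule fs.span_base) (use b in blast)
  qed
  moreover have "mul a b \<in> ?W" if "a \<in> ?W" "b \<in> ?W" for a b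
    unfolding vertex_space_def mul_def
    by (rule ext_free_space[OF tens_free_space[OF that[unfolded vertex_space_def]]])
      (auto simp: path_prod_vertex)
  moreover have "Sf a \<in> ?W" if "a \<in> ?W" for a
    unfolding vertex_space_def
    by (rule ext_free_space[OF that[unfolded vertex_space_def]]) (auto simp: path_antip_vertex)
  ultimately show ?thesis
    by (auto simp: sub_majid_algebra_def vertex_space_def subspace_free_space intro: free_space_mono)
qed

lemma majid_hom_majid_of: "majid_hom (group_majid G \<Phi>) majid_of vertex_embedding"
  unfolding majid_hom_def majid_of_simps group_majid_simps
proof (intro conjI ballI, goal_cases)
  case 1
  show ?case
    by (rule lin_on_freeI[OF lin_vertex_embedding[OF lin_ident] subspace_free_space]) simp
next
  case (2 a)
  show ?case
    by (rule lin_eqI[where s = pscale, OF 2], intro lin_intros, unfold sw_def, (intro lin_intros)+)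
      (simp add: vector_space_pscale splits_vertex path_comult_splits)
next
  case (3 a)
  show ?case
    by (rule lin_eqI[where s = "(*)", OF 3], (intro lin_intros)+) (simp add: vector_space_mult)
next
  case (4 a b)
  show ?case
    by (rule lin_eqI2[where s = pscale, OF 4], (intro lin_intros lin_ext_family)+)
      (simp add: vector_space_pscale path_prod_vertex)
next
  case 5
  show ?case by simp
next
  case (6 a b c)
  show ?case
    by (rule lin_eqI3[where s = "(*)", OF 6], (intro lin_intros lin_ext_family)+)
      (simp add: vector_space_mult)
next
  case (7 a)
  show ?case
    by (rule lin_eqI[where s = pscale, OF 7], (intro lin_intros)+) (simp add: vector_space_pscale path_antip_vertex)
next
  case (8 a)
  show ?case
    by (rule lin_eqI[where s = "(*)", OF 8], (intro lin_intros)+) (simp add: vector_space_mult)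
next
  case (9 a)
  show ?case
    by (rule lin_eqI[where s = "(*)", OF 9], (intro lin_intros)+) (simp add: vector_space_mult)
qed

theorem majid_of_structure: "majid_of \<in> graded_majid_structures G \<Phi> R"
  using graded_majid_algebra_majid_of sub_majid_algebra_majid_of majid_hom_majid_of vertex_embedding_bij
  by (simp add: graded_majid_structures_def coalg.truncate_def path_coalg_def vertex_form_def if_distrib cong: if_cong)

end

section \<open>The bimodule of a Majid algebra structure\<close>

lemma graded_coalg_map_opp:
  assumes "graded_coalg_map S T X"
  shows "graded_coalg_map (opp_splitting S) (opp_splitting T) X"
proof -
  have sc: "scomult (opp_splitting T) v = ext pscale (\<lambda>z. bvec (prod.swap z)) (scomult T v)" for v :: "'b \<Rightarrow>\<^sub>0 'c"
  proof (rule lin_eqI[where s = pscale and f = "scomult (opp_splitting T)"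
        and f' = "\<lambda>v. ext pscale (\<lambda>z. bvec (prod.swap z)) (scomult T v)" and B = UNIV])
    show "v \<in> free_space UNIV" by (simp add: free_space_def)
    show "lin pscale (scomult (opp_splitting T))" "lin pscale (\<lambda>v. ext pscale (\<lambda>z. bvec (prod.swap z)) (scomult T v))"
      unfolding scomult_def by (intro lin_intros lin_ext)+
    show "scomult (opp_splitting T) (bvec b) = ext pscale (\<lambda>z. bvec (prod.swap z)) (scomult T (bvec b))" for b
      by (simp add: scomult_def vector_space_pscale sum_opp_splits ext_pscale_sum case_prod_unfold prod.swap_def)
  qed
  have sw: "ext pscale (\<lambda>z. bvec (prod.swap z)) (tens u v) = tens v u" for u v :: "'b \<Rightarrow>\<^sub>0 'c"
  proof (rule tens_eqI)
    fix x y
    have "Poly_Mapping.lookup (ext pscale (\<lambda>z. bvec (prod.swap z)) (tens u v)) (prod.swap (y, x))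
        = Poly_Mapping.lookup (tens u v) (y, x)" by (rule lookup_relabel) simp
    then show "Poly_Mapping.lookup (ext pscale (\<lambda>z. bvec (prod.swap z)) (tens u v)) (x, y)
        = Poly_Mapping.lookup (tens v u) (x, y)" by simp
  qed
  show ?thesis using assms
    by (simp add: graded_coalg_map_def sc sum_opp_splits ext_pscale_sum sw case_prod_unfold)
qed

context hopf_quiver_cocycle
begin

text \<open>
  An element of degree one is a combination of arrows from \<open>x\<close> to \<open>y\<close> as soon as it is \<open>(y, x)\<close>-skew-primitive.
\<close>

lemma block_of_comult:
  assumes v: "v \<in> deg_space 1" and c: "comul v = tens v (bvec (x, [])) + tens (bvec (y, [])) v"
  shows "v \<in> block x y"
  unfolding block_def free_space_iff
proof (intro allI impI)
  fix z assume z: "z \<notin> arrow_basis x y"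
  obtain u p where up: "z = (u, p)" by (cases z)
  show "Poly_Mapping.lookup v z = 0"
  proof (rule ccontr)
    assume nz: "Poly_Mapping.lookup v z \<noteq> 0"
    then have "(u, p) \<in> {p \<in> paths Q. path_length p = 1}" using v up unfolding free_space_iff by blast
    then have "(u, p) \<in> paths Q" "path_length (u, p) = 1" by auto
    then obtain a where p: "p = [a]" "a \<in> arcs Q" "tail Q a = u" by (rule deg1_path) simp
    have z0: "Poly_Mapping.lookup v (w, []) = 0" for w using v by (simp add: free_space_iff)
    have "Poly_Mapping.lookup v (u, [a]) = Poly_Mapping.lookup (comul v) ((head Q a, []), (u, [a]))"
      by (simp add: lookup_path_comult)
    also have "\<dots> = Poly_Mapping.lookup (bvec (y, []) :: 'g hpath \<Rightarrow>\<^sub>0 'k) (head Q a, []) * Poly_Mapping.lookup v (u, [a])"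
      unfolding c by (simp add: lookup_add z0)
    finally have y: "head Q a = y" using nz up p by (auto simp: lookup_single when_def split: if_splits)
    have "Poly_Mapping.lookup v (u, [a]) = Poly_Mapping.lookup (comul v) ((u, [a]), (u, []))"
      by (simp add: lookup_path_comult)
    also have "\<dots> = Poly_Mapping.lookup v (u, [a]) * Poly_Mapping.lookup (bvec (x, []) :: 'g hpath \<Rightarrow>\<^sub>0 'k) (u, [])"
      unfolding c by (simp add: lookup_add lookup_single when_def)
    finally have "u = x" using nz up p by (auto simp: lookup_single when_def split: if_splits)
    then show False using z up p y by simp
  qed
qed

lemma coalg_map_block:
  assumes S: "splitting_system S" and X: "graded_coalg_map S P X" and b: "b \<in> sbasis S" "sdeg S b = 1"
    and ends: "X (ssrc S b) = bvec (x, [])" "X (stgt S b) = bvec (y, [])"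
  shows "X b \<in> block x y"
proof (rule block_of_comult)
  interpret S: splitting_system S by (rule S)
  show "X b \<in> deg_space 1" using graded_coalg_mapD(1)[OF X b(1)] b(2) by simp
  have "(b, ssrc S b) \<noteq> (stgt S b, b)" using S.splits_src(2)[of b] b(2) by auto
  then show "comul (X b) = tens (X b) (bvec (x, [])) + tens (bvec (y, [])) (X b)"
    using graded_coalg_mapD(3)[OF X b(1)] by (simp add: scomult_path S.splits_of_deg1[OF b(2)] ends)
qed

lemma block_in_hom: "v \<in> block x y \<Longrightarrow> v \<in> deg_space 1"
  unfolding block_def by (erule free_space_mono) (use arrow_basis_paths in blast)

lemma hom_in_paths: "v \<in> deg_space n \<Longrightarrow> v \<in> free_space (paths Q)"
  by (erule free_space_mono) auto

lemmas block_in_paths = hom_in_paths[OF block_in_hom]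

end

locale majid_structure = hopf_quiver_cocycle G \<Phi> R
  for G :: "('g, 'm) monoid_scheme" (structure) and \<Phi> :: "'g \<Rightarrow> 'g \<Rightarrow> 'g \<Rightarrow> 'k::field"
    and R :: "'g set \<Rightarrow> nat" +
  fixes H :: "('g hpath, 'k) majid"
  assumes H_structure: "H \<in> graded_majid_structures G \<Phi> R"
begin

sublocale graded_majid_algebra H path_length
  using H_structure by (simp add: graded_majid_structures_def)

lemma H_coalg [simp]: "basis H = paths Q" "comult H = comul" "counit H = vertex_form (\<lambda>_. 1)"
  using H_structure
  by (simp_all add: graded_majid_structures_def coalg.truncate_def path_coalg_def vertex_form_def[abs_def])

lemma homog_H [simp]: "homog H path_length n = deg_space n"
  by (simp add: homog_def)

lemma hom_embedding: "majid_hom (group_majid G \<Phi>) H vertex_embedding"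
  using H_structure by (simp add: graded_majid_structures_def)

lemma
  assumes "e \<in> carrier G"
  shows antip_vertex: "antip H (bvec (e, [])) = bvec (inv e, [])"
    and malpha_vertex: "malpha H (bvec (e, [])) = 1"
    and mbeta_vertex: "mbeta H (bvec (e, [])) = 1 / \<Phi> e (inv e) e"
proof -
  let ?K = "group_majid G \<Phi>"
  have e: "bvec e \<in> space_of ?K" using assms by simp
  have "vertex_embedding (antip ?K (bvec e)) = antip H (vertex_embedding (bvec e))"
    "malpha H (vertex_embedding (bvec e)) = malpha ?K (bvec e)"
    "mbeta H (vertex_embedding (bvec e)) = mbeta ?K (bvec e)"
    using hom_embedding e unfolding majid_hom_def by blast+
  then show "antip H (bvec (e, [])) = bvec (inv e, [])" "malpha H (bvec (e, [])) = 1"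
    "mbeta H (bvec (e, [])) = 1 / \<Phi> e (inv e) e"
    by (simp_all add: vector_space_mult vector_space_pscale)
qed

lemma munit_vertex: "munit H = bvec (\<one>, [])"
  using hom_embedding by (simp add: majid_hom_def)

lemma prod_vertex:
  assumes "e \<in> carrier G" "f \<in> carrier G"
  shows "mprod H (bvec (e, [])) (bvec (f, [])) = bvec (e \<otimes> f, [])"
proof -
  have "vertex_embedding (mprod (group_majid G \<Phi>) (bvec e) (bvec f))
      = mprod H (vertex_embedding (bvec e)) (vertex_embedding (bvec f))"
    using hom_embedding assms unfolding majid_hom_def by (simp del: vertex_embedding_bvec group_majid_simps(4))
  then show ?thesis by (simp add: vector_space_pscale)
qed

lemma reass_vertex:
  assumes "e \<in> carrier G" "f \<in> carrier G" "h \<in> carrier G"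
  shows "reass H (bvec (e, [])) (bvec (f, [])) (bvec (h, [])) = \<Phi> e f h"
proof -
  have "reass H (vertex_embedding (bvec e)) (vertex_embedding (bvec f)) (vertex_embedding (bvec h))
      = reass (group_majid G \<Phi>) (bvec e) (bvec f) (bvec h)"
    using hom_embedding assms unfolding majid_hom_def by (simp del: vertex_embedding_bvec group_majid_simps(6))
  then show ?thesis by (simp add: vector_space_mult)
qed

text \<open>
  The reassociator is determined by the grading and by its values on the group.
\<close>

lemma reass_bvec:
  assumes "p \<in> paths Q" "q \<in> paths Q" "r \<in> paths Q"
  shows "reass H (bvec p) (bvec q) (bvec r)
    = (if path_length p = 0 \<and> path_length q = 0 \<and> path_length r = 0 then \<Phi> (fst p) (fst q) (fst r) else 0)"
proof (cases "path_length p = 0 \<and> path_length q = 0 \<and> path_length r = 0")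
  case True
  obtain x where x: "p = (x, [])" "x \<in> carrier G" by (rule deg0_path[OF assms(1)]) (use True in auto)
  obtain y where y: "q = (y, [])" "y \<in> carrier G" by (rule deg0_path[OF assms(2)]) (use True in auto)
  obtain z where z: "r = (z, [])" "z \<in> carrier G" by (rule deg0_path[OF assms(3)]) (use True in auto)
  show ?thesis using x y z reass_vertex by simp
next
  case False
  then show ?thesis using reass_homog[of "bvec p" "path_length p" "bvec q" "path_length q" "bvec r" "path_length r"] assms
    by auto
qed

definition hprod :: "'g hpath \<times> 'g hpath \<Rightarrow> ('g hpath \<Rightarrow>\<^sub>0 'k)" where
  "hprod = (\<lambda>(p, q). mprod H (bvec p) (bvec q))"

definition hantip :: "'g hpath \<Rightarrow> ('g hpath \<Rightarrow>\<^sub>0 'k)" where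
  "hantip p = antip H (bvec p)"

lemma lin_mprod:
  assumes "u \<in> free_space (paths Q)"
  shows "lin_on pscale (free_space (paths Q)) (mprod H u) (free_space (paths Q))"
    "lin_on pscale (free_space (paths Q)) (\<lambda>v. mprod H v u) (free_space (paths Q))"
  using mprod_bilin assms by (auto simp: bilin_on_def)

lemma mprod_ext:
  assumes "u \<in> free_space (paths Q)" "v \<in> free_space (paths Q)"
  shows "mprod H u v = ext pscale hprod (tens u v)"
  unfolding hprod_def
  by (rule ext_tens[symmetric, OF vector_space_pscale lin_mprod(2) lin_mprod(1) assms])

lemma antip_ext: "v \<in> free_space (paths Q) \<Longrightarrow> antip H v = ext pscale hantip v"
  unfolding hantip_def using lin_on_ext antip_lin by fastforce

lemma coalg_map_hprod: "graded_coalg_map PP P hprod"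
  unfolding graded_coalg_map_def
proof (clarsimp, intro conjI, goal_cases)
  case (1 x p y q)
  then show ?case using mprod_homog[of "bvec (x, p)" "length p" "bvec (y, q)" "length q"] by (simp add: hprod_def)
next
  case (2 x p y q)
  then show ?case using mprod_comult[of "bvec (x, p)" "bvec (y, q)"]
    by (simp add: hprod_def scomult_path sum_splits_prod case_prod_unfold del: ext_bvec)
qed

lemma coalg_map_hantip: "graded_coalg_map (opp_splitting P) P hantip"
  unfolding graded_coalg_map_def
proof (clarsimp, intro conjI, goal_cases)
  case (1 x p)
  then show ?case using antip_homog[of "bvec (x, p)" "length p"] by (simp add: hantip_def)
next
  case (2 x p)
  then show ?case using antip_comult[of "bvec (x, p)"]
    by (simp add: hantip_def scomult_path sum_opp_splits case_prod_unfold del: ext_bvec)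
qed

definition hlact :: "'g \<Rightarrow> ('g hpath \<Rightarrow>\<^sub>0 'k) \<Rightarrow> ('g hpath \<Rightarrow>\<^sub>0 'k)" where
  "hlact e m = mprod H (bvec (e, [])) m"

definition hract :: "('g hpath \<Rightarrow>\<^sub>0 'k) \<Rightarrow> 'g \<Rightarrow> ('g hpath \<Rightarrow>\<^sub>0 'k)" where
  "hract m e = mprod H m (bvec (e, []))"

end

lemma lin_on_comp: "lin_on s V f W \<Longrightarrow> lin_on pscale U g V \<Longrightarrow> lin_on s U (\<lambda>v. f (g v)) W"
  by (rule lin_onI) (simp_all add: lin_onD[of s V f W] lin_onD[of pscale U g V])

lemma lin_on_pscale:
  "lin_on pscale U g W \<Longrightarrow> fs.subspace W \<Longrightarrow> lin_on pscale U (\<lambda>v. pscale c (g v)) W"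
  by (rule lin_onI) (simp_all add: lin_onD[of pscale U g W] fs.subspace_scale fs.scale_right_distrib mult.commute)

context hopf_quiver_cocycle
begin

lemma arrow_basis_cases:
  assumes "p \<in> arrow_basis x y"
  obtains a where "p = (x, [a])" "p \<in> paths Q" "a \<in> arcs Q" "tail Q a = x" "head Q a = y"
    "x \<in> carrier G" "y \<in> carrier G" "path_length p = 1"
  using assms arrow_basis_ends[OF assms] arrow_basis_paths[OF assms] by (auto simp: arrow_basis_def)

lemma sum_splits_arrow:
  assumes "p \<in> arrow_basis x y"
  shows "(\<Sum>(u, v)\<in>splits P p. f u v) = f p (x, []) + (f (y, []) p :: 'c::comm_monoid_add)"
proof -
  obtain a where a: "p = (x, [a])" "head Q a = y" "path_length p = 1" using assms by (rule arrow_basis_cases)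
  have "(p, ssrc P p) \<noteq> (stgt P p, p)" using a by auto
  then show ?thesis using P.splits_of_deg1[of p] a by simp
qed

lemma ext_block:
  "v \<in> block x y \<Longrightarrow> (\<And>b. b \<in> arrow_basis x y \<Longrightarrow> F b \<in> block x' y') \<Longrightarrow> ext pscale F v \<in> block x' y'"
  unfolding block_def by (rule ext_free_space)

lemma splits_vertex' [simp]: "splits P (x, []) = {((x, []), (x, []))}"
  using P.splits_of_deg0[of "(x, [])"] by simp

end

context majid_structure
begin

lemma hlact_arrow:
  assumes e: "e \<in> carrier G" and b: "b \<in> arrow_basis x y"
  shows "hlact e (bvec b) \<in> block (e \<otimes> x) (e \<otimes> y)"
proof -
  obtain a where a: "b = (x, [a])" "b \<in> paths Q" "head Q a = y" "x \<in> carrier G" "y \<in> carrier G" "path_length b = 1"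
    using b by (rule arrow_basis_cases)
  have "hprod ((e, []), b) \<in> block (e \<otimes> x) (e \<otimes> y)"
    by (rule coalg_map_block[OF PP.splitting_system_axioms coalg_map_hprod])
      (use a e in \<open>auto simp: hprod_def prod_vertex\<close>)
  then show ?thesis by (simp add: hprod_def hlact_def)
qed

lemma hract_arrow:
  assumes e: "e \<in> carrier G" and b: "b \<in> arrow_basis x y"
  shows "hract (bvec b) e \<in> block (x \<otimes> e) (y \<otimes> e)"
proof -
  obtain a where a: "b = (x, [a])" "b \<in> paths Q" "head Q a = y" "x \<in> carrier G" "y \<in> carrier G" "path_length b = 1"
    using b by (rule arrow_basis_cases)
  have "hprod (b, (e, [])) \<in> block (x \<otimes> e) (y \<otimes> e)"
    by (rule coalg_map_block[OF PP.splitting_system_axioms coalg_map_hprod])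
      (use a e in \<open>auto simp: hprod_def prod_vertex\<close>)
  then show ?thesis by (simp add: hprod_def hract_def)
qed

lemma vertex_in_paths: "e \<in> carrier G \<Longrightarrow> bvec (e, []) \<in> free_space (paths Q)"
  by simp

lemma block_sub_paths: "block x y \<subseteq> free_space (paths Q)"
  using block_in_paths by blast

lemma hlact_lin:
  assumes e: "e \<in> carrier G"
  shows "lin_on pscale (block x y) (hlact e) (block (e \<otimes> x) (e \<otimes> y))"
proof -
  have "hlact e v \<in> block (e \<otimes> x) (e \<otimes> y)" if v: "v \<in> block x y" for v
    unfolding hlact_def lin_on_ext[OF lin_mprod(1)[OF vertex_in_paths[OF e]] block_in_paths[OF v]]
    by (rule ext_block[OF v hlact_arrow[OF e, unfolded hlact_def]])
  then show ?thesis
    unfolding hlact_def by (rule lin_on_mono[OF lin_mprod(1)[OF vertex_in_paths[OF e]] block_sub_paths])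
qed

lemma hract_lin:
  assumes e: "e \<in> carrier G"
  shows "lin_on pscale (block x y) (\<lambda>v. hract v e) (block (x \<otimes> e) (y \<otimes> e))"
proof -
  have "hract v e \<in> block (x \<otimes> e) (y \<otimes> e)" if v: "v \<in> block x y" for v
    unfolding hract_def lin_on_ext[OF lin_mprod(2)[OF vertex_in_paths[OF e]] block_in_paths[OF v]]
    by (rule ext_block[OF v hract_arrow[OF e, unfolded hract_def]])
  then show ?thesis
    unfolding hract_def by (rule lin_on_mono[OF lin_mprod(2)[OF vertex_in_paths[OF e]] block_sub_paths])
qed

lemma block_eqI:
  assumes "v \<in> block x y" "lin_on pscale (block x y) f (block x' y')" "lin_on pscale (block x y) f' (block x' y')"
    "\<And>b. b \<in> arrow_basis x y \<Longrightarrow> f (bvec b) = f' (bvec b)"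
  shows "f v = f' v"
  using lin_on_eqI[of v "arrow_basis x y" pscale f _ f'] assms by (simp add: block_def)

lemmas block_lin_intros = lin_on_pscale[OF _ block_subspace] lin_on_comp[OF hlact_lin] lin_on_comp[OF hract_lin]
  hlact_lin hract_lin

text \<open>
  The associativity laws are the quasi-associativity of the product for one arrow and two vertices: the comultiplication
  of the arrow has two terms, each of which contributes on one side only.
\<close>

lemma path_bimodule_H: "path_bimodule G \<Phi> R hlact hract"
proof (unfold_locales, goal_cases)
  case (3 x y v) then show ?case by simp
next
  case (4 x y v) then show ?case by simp
next
  case (5 x y v a) then show ?case using block_subspace fs.subspace_scale by blast
next
  case (6 x y v e) then show ?case using lin_onD(1)[OF hlact_lin] by simp
next
  case (7 x y v e) then show ?case using lin_onD(1)[OF hract_lin] by simp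
next
  case (8 x y v e a) then show ?case using lin_onD(3)[OF hlact_lin] by blast
next
  case (9 x y v e a) then show ?case using lin_onD(3)[OF hract_lin] by blast
next
  \<comment> \<open>One arrow to the right of two vertices.\<close>
  case (10 x y v e f)
  then have cl: "x \<in> carrier G" "y \<in> carrier G" "e \<in> carrier G" "f \<in> carrier G" by auto
  show ?case
  proof (rule block_eqI[of v x y _ "e \<otimes> (f \<otimes> x)" "e \<otimes> (f \<otimes> y)"])
    show "lin_on pscale (block x y) (\<lambda>v. pscale (\<Phi> e f x) (hlact e (hlact f v))) (block (e \<otimes> (f \<otimes> x)) (e \<otimes> (f \<otimes> y)))"
      by (intro block_lin_intros cl)
    show "lin_on pscale (block x y) (\<lambda>v. pscale (\<Phi> e f y) (hlact (e \<otimes> f) v)) (block (e \<otimes> (f \<otimes> x)) (e \<otimes> (f \<otimes> y)))"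
      using lin_on_pscale[OF hlact_lin block_subspace, of "e \<otimes> f" x y] cl by (simp add: m_assoc)
    fix b assume b: "b \<in> arrow_basis x y"
    obtain a where a: "b = (x, [a])" "b \<in> paths Q" "path_length b = 1" using b by (rule arrow_basis_cases)
    show "pscale (\<Phi> e f x) (hlact e (hlact f (bvec b))) = pscale (\<Phi> e f y) (hlact (e \<otimes> f) (bvec b))"
      using quasi_assoc[of "bvec (e, [])" "bvec (f, [])" "bvec b"] a(2,3) cl
      by (simp add: sum_splits_arrow[OF b] reass_bvec prod_vertex hlact_def)
  qed (use 10 in simp)
next
  \<comment> \<open>One arrow to the left of two vertices.\<close>
  case (11 x y v e f)
  then have cl: "x \<in> carrier G" "y \<in> carrier G" "e \<in> carrier G" "f \<in> carrier G" by auto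
  show ?case
  proof (rule block_eqI[of v x y _ "(x \<otimes> e) \<otimes> f" "(y \<otimes> e) \<otimes> f"])
    show "lin_on pscale (block x y) (\<lambda>v. pscale (\<Phi> y e f) (hract (hract v e) f)) (block ((x \<otimes> e) \<otimes> f) ((y \<otimes> e) \<otimes> f))"
      by (intro block_lin_intros cl)
    show "lin_on pscale (block x y) (\<lambda>v. pscale (\<Phi> x e f) (hract v (e \<otimes> f))) (block ((x \<otimes> e) \<otimes> f) ((y \<otimes> e) \<otimes> f))"
      using lin_on_pscale[OF hract_lin block_subspace, of "e \<otimes> f" x y] cl by (simp add: m_assoc)
    fix b assume b: "b \<in> arrow_basis x y"
    obtain a where a: "b = (x, [a])" "b \<in> paths Q" "path_length b = 1" using b by (rule arrow_basis_cases)
    show "pscale (\<Phi> x e f) (hract (bvec b) (e \<otimes> f)) = pscale (\<Phi> y e f) (hract (hract (bvec b) e) f)"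
      using quasi_assoc[of "bvec b" "bvec (e, [])" "bvec (f, [])"] a(2,3) cl
      by (simp add: sum_splits_arrow[OF b] reass_bvec prod_vertex hract_def)
  qed (use 11 in simp)
next
  \<comment> \<open>One arrow between two vertices.\<close>
  case (12 x y v e f)
  then have cl: "x \<in> carrier G" "y \<in> carrier G" "e \<in> carrier G" "f \<in> carrier G" by auto
  show ?case
  proof (rule block_eqI[of v x y _ "(e \<otimes> x) \<otimes> f" "(e \<otimes> y) \<otimes> f"])
    show "lin_on pscale (block x y) (\<lambda>v. pscale (\<Phi> e y f) (hract (hlact e v) f)) (block ((e \<otimes> x) \<otimes> f) ((e \<otimes> y) \<otimes> f))"
      by (intro block_lin_intros cl)
    have "lin_on pscale (block x y) (\<lambda>v. pscale (\<Phi> e x f) (hlact e (hract v f))) (block (e \<otimes> (x \<otimes> f)) (e \<otimes> (y \<otimes> f)))"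
      by (intro block_lin_intros cl)
    then show "lin_on pscale (block x y) (\<lambda>v. pscale (\<Phi> e x f) (hlact e (hract v f))) (block ((e \<otimes> x) \<otimes> f) ((e \<otimes> y) \<otimes> f))"
      using cl by (simp add: m_assoc)
    fix b assume b: "b \<in> arrow_basis x y"
    obtain a where a: "b = (x, [a])" "b \<in> paths Q" "path_length b = 1" using b by (rule arrow_basis_cases)
    show "pscale (\<Phi> e x f) (hlact e (hract (bvec b) f)) = pscale (\<Phi> e y f) (hract (hlact e (bvec b)) f)"
      using quasi_assoc[of "bvec (e, [])" "bvec b" "bvec (f, [])"] a(2,3) cl
      by (simp add: sum_splits_arrow[OF b] reass_bvec prod_vertex hract_def hlact_def)
  qed (use 12 in simp)
next
  case (13 x y v)
  then show ?case using munit_left[of v] block_in_paths[of v x y] by (simp add: hlact_def munit_vertex)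
next
  case (14 x y v)
  then show ?case using munit_right[of v] block_in_paths[of v x y] by (simp add: hract_def munit_vertex)
next
  case (15 e x y u v) then show ?case using lin_onD(2)[OF hlact_lin] by blast
next
  case (16 e x y u v) then show ?case using lin_onD(2)[OF hract_lin] by blast
qed (simp_all)

sublocale bim: path_bimodule G \<Phi> R hlact hract
  by (rule path_bimodule_H)

text \<open>
  In degree one the antipode identity with \<open>\<alpha>\<close> has the two terms \<open>S(b) x\<close> and \<open>y\<^sup>-\<^sup>1 b\<close>, so the bimodule determines the
  antipode on arrows.
\<close>

lemma hantip_arrow:
  assumes b: "b \<in> arrow_basis x y"
  shows "hantip b \<in> block (inv y) (inv x)" "hract (hantip b) x = - hlact (inv y) (bvec b)"
proof -
  obtain a where a: "b = (x, [a])" "b \<in> paths Q" "head Q a = y" "x \<in> carrier G" "y \<in> carrier G" "path_length b = 1"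
    using b by (rule arrow_basis_cases)
  show "hantip b \<in> block (inv y) (inv x)"
    by (rule coalg_map_block[OF P.splitting_system_opp coalg_map_hantip])
      (use a in \<open>auto simp: hantip_def antip_vertex\<close>)
  have "malpha H (bvec b) = 0" using malpha_homog[of "bvec b" 1] a by simp
  then have "hract (hantip b) x + hlact (inv y) (bvec b) = 0"
    using antip_alpha[of "bvec b"] a(2,4,5)
    by (simp add: sum_splits_arrow[OF b] malpha_vertex antip_vertex hract_def hlact_def hantip_def)
  then show "hract (hantip b) x = - hlact (inv y) (bvec b)" by (simp add: eq_neg_iff_add_eq_0)
qed

lemma
  assumes v: "v \<in> block x y" and xy: "x \<in> carrier G" "y \<in> carrier G"
  shows antip_block: "antip H v \<in> block (inv y) (inv x)"
    and hract_antip: "hract (antip H v) x = - hlact (inv y) v"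
proof -
  have l0: "lin_on pscale (free_space (paths Q)) (antip H) (free_space (paths Q))" using antip_lin by simp
  have "antip H v = ext pscale hantip v" by (rule antip_ext[OF block_in_paths[OF v]])
  also have "\<dots> \<in> block (inv y) (inv x)"
    by (rule ext_block[OF v hantip_arrow(1)])
  finally show "antip H v \<in> block (inv y) (inv x)" .
  have lb: "lin_on pscale (block x y) (antip H) (block (inv y) (inv x))"
  proof (rule lin_on_mono[OF l0 block_sub_paths])
    fix w assume w: "w \<in> block x y"
    show "antip H w \<in> block (inv y) (inv x)"
      unfolding antip_ext[OF block_in_paths[OF w]]
      by (rule ext_block[OF w hantip_arrow(1)])
  qed
  have 1: "lin_on pscale (block x y) (\<lambda>v. hract (antip H v) x) (block (inv y \<otimes> x) (inv x \<otimes> x))"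
    by (rule lin_on_comp[OF hract_lin[OF xy(1)] lb])
  have "lin_on pscale (block x y) (\<lambda>v. pscale (- 1) (hlact (inv y) v)) (block (inv y \<otimes> x) (inv y \<otimes> y))"
    by (rule lin_on_pscale[OF hlact_lin block_subspace]) (simp add: xy)
  then have 2: "lin_on pscale (block x y) (\<lambda>v. - hlact (inv y) v) (block (inv y \<otimes> x) (inv x \<otimes> x))"
    using xy by simp
  show "hract (antip H v) x = - hlact (inv y) v"
    by (rule block_eqI[OF v 1 2]) (use hantip_arrow(2) in \<open>simp add: hantip_def\<close>)
qed

end

section \<open>Isomorphisms of structures and of bimodules\<close>

lemma trilin_onD:
  assumes "trilin_on s V F W"
  shows "u \<in> V \<Longrightarrow> v \<in> V \<Longrightarrow> lin_on s V (F u v) W" "u \<in> V \<Longrightarrow> w \<in> V \<Longrightarrow> lin_on s V (\<lambda>v. F u v w) W"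
    "v \<in> V \<Longrightarrow> w \<in> V \<Longrightarrow> lin_on s V (\<lambda>u. F u v w) W"
  using assms unfolding trilin_on_def bilin_on_def by blast+

lemma trilin_on_comp:
  assumes F: "trilin_on s V F W" and g: "lin_on pscale U g V"
  shows "trilin_on s U (\<lambda>u v w. F (g u) (g v) (g w)) W"
  unfolding trilin_on_def bilin_on_def
  by (intro conjI ballI; (rule lin_on_comp[OF trilin_onD(1)[OF F] g] lin_on_comp[OF trilin_onD(2)[OF F] g]
      lin_on_comp[OF trilin_onD(3)[OF F] g]); rule lin_onD(1)[OF g]; assumption)

lemma trilin_on_eqI:
  assumes F: "trilin_on s (free_space B) F W" and F': "trilin_on s (free_space B) F' W'"
    and eq: "\<And>x y z. x \<in> B \<Longrightarrow> y \<in> B \<Longrightarrow> z \<in> B \<Longrightarrow> F (bvec x) (bvec y) (bvec z) = F' (bvec x) (bvec y) (bvec z)"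
    and uvw: "u \<in> free_space B" "v \<in> free_space B" "w \<in> free_space B"
  shows "F u v w = F' u v w"
proof -
  have 1: "F u (bvec y) (bvec z) = F' u (bvec y) (bvec z)" if "y \<in> B" "z \<in> B" for y z
    by (rule lin_on_eqI[OF uvw(1) trilin_onD(3)[OF F] trilin_onD(3)[OF F']]) (use that eq in auto)
  have 2: "F u v (bvec z) = F' u v (bvec z)" if "z \<in> B" for z
    by (rule lin_on_eqI[OF uvw(2) trilin_onD(2)[OF F] trilin_onD(2)[OF F']]) (use that 1 uvw in auto)
  show ?thesis
    by (rule lin_on_eqI[OF uvw(3) trilin_onD(1)[OF F] trilin_onD(1)[OF F']]) (use 2 uvw in auto)
qed

text \<open>
  A linear endomorphism of the span of the arrows that preserves their ends; by cofreeness it extends to an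
  endomorphism of the path coalgebra that fixes the vertices.
\<close>

locale block_map = hopf_quiver_cocycle G \<Phi> R
  for G :: "('g, 'm) monoid_scheme" (structure) and \<Phi> :: "'g \<Rightarrow> 'g \<Rightarrow> 'g \<Rightarrow> 'k::field"
    and R :: "'g set \<Rightarrow> nat" +
  fixes f :: "('g hpath \<Rightarrow>\<^sub>0 'k) \<Rightarrow> ('g hpath \<Rightarrow>\<^sub>0 'k)"
  assumes f_lin: "x \<in> carrier G \<Longrightarrow> y \<in> carrier G \<Longrightarrow> lin_on pscale (block x y) f (block x y)"
begin

definition arrow_map :: "'g hpath \<Rightarrow> ('g hpath \<Rightarrow>\<^sub>0 'k)" where
  "arrow_map p = (if p \<in> paths Q \<and> path_length p = 1 then f (bvec p) else 0)"

definition path_map :: "'g hpath \<Rightarrow> ('g hpath \<Rightarrow>\<^sub>0 'k)" where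
  "path_map = cofree_ext P Q fst (\<lambda>p a. Poly_Mapping.lookup (arrow_map p) (tail Q a, [a]))"

lemma arrow_map_block: "p \<in> arrow_basis x y \<Longrightarrow> arrow_map p = f (bvec p)"
  "p \<in> arrow_basis x y \<Longrightarrow> f (bvec p) \<in> block x y"
  using arrow_basis_paths[of p x y] arrow_basis_ends[of p x y] lin_onD(1)[OF f_lin]
  by (auto simp: arrow_map_def block_def)

lemma arrow_in_basis:
  assumes "p \<in> paths Q" "path_length p = 1"
  shows "p \<in> arrow_basis (fst p) (fst (stgt P p))"
proof -
  obtain x a where "p = (x, [a])" "a \<in> arcs Q" "tail Q a = x" by (rule deg1_path[OF assms])
  then show ?thesis by simp
qed

sublocale map: cofree_data P Q fst "\<lambda>p a. Poly_Mapping.lookup (arrow_map p) (tail Q a, [a])"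
proof (unfold_locales, goal_cases)
  case (1 b) then show ?case by (simp add: path_ends(3))
next
  case (2 b) show ?case by (rule finite_arrow_coeffs)
next
  case (3 p a)
  then have p: "p \<in> paths Q" "path_length p = 1" by (auto simp: arrow_map_def split: if_splits)
  have "arrow_map p \<in> block (fst p) (fst (stgt P p))"
    using arrow_map_block[OF arrow_in_basis[OF p]] by simp
  from block_coeff_nz[OF this 3] show ?case using p by (cases p) auto
qed

lemma coalg_map_path_map: "graded_coalg_map P P path_map"
  unfolding path_map_def by (rule map.graded_coalg_map_cofree_ext)

lemma path_map_vertex: "path_map (x, []) = bvec (x, [])"
  unfolding path_map_def by (subst map.cofree_ext_deg0) auto

lemma path_map_arrow:
  assumes "p \<in> arrow_basis x y" shows "path_map p = f (bvec p)"
proof (rule deg1_eqI[OF arrow_map_block(2)[OF assms]])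
  have "path_length p = 1" using arrow_basis_paths[OF assms] by simp
  then show "Poly_Mapping.lookup (path_map p) (u, q) = (case q of [a] \<Rightarrow> if tail Q a = u
      then Poly_Mapping.lookup (f (bvec p)) (tail Q a, [a]) else 0 | _ \<Rightarrow> 0)" for u q
    unfolding arrow_map_block(1)[OF assms, symmetric]
    by (simp add: path_map_def map.lookup_cofree_ext_deg1)
qed

definition theta :: "('g hpath \<Rightarrow>\<^sub>0 'k) \<Rightarrow> ('g hpath \<Rightarrow>\<^sub>0 'k)" where
  "theta = ext pscale path_map"

lemma theta_bvec [simp]: "theta (bvec p) = path_map p"
  by (simp add: theta_def vector_space_pscale)

lemma lin_theta: "lin pscale theta"
  unfolding theta_def by (rule lin_ext[OF vector_space_pscale])

lemma theta_block: "x \<in> carrier G \<Longrightarrow> y \<in> carrier G \<Longrightarrow> v \<in> block x y \<Longrightarrow> theta v = f v"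
  using lin_on_eqI[of v "arrow_basis x y" pscale theta UNIV f "block x y"] f_lin[of x y] lin_theta path_map_arrow
  by (simp add: block_def lin_on_subset)

lemma path_map_deg: "p \<in> paths Q \<Longrightarrow> path_map p \<in> deg_space (path_length p)"
  using graded_coalg_mapD(1)[OF coalg_map_path_map, of p] by simp

lemma theta_deg: "v \<in> deg_space n \<Longrightarrow> theta v \<in> deg_space n"
  unfolding theta_def by (rule ext_free_space) (use path_map_deg in auto)

lemma theta_paths: "v \<in> free_space (paths Q) \<Longrightarrow> theta v \<in> free_space (paths Q)"
  unfolding theta_def by (rule ext_free_space) (auto intro: free_space_mono[OF path_map_deg])

lemma theta_vertex_space: "v \<in> vertex_space G \<Longrightarrow> theta v = v"
  unfolding vertex_space_def
  by (rule lin_eqI[where s = pscale and f' = "\<lambda>v. v", OF _ lin_theta lin_ident]) (auto simp: path_map_vertex)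

end

text \<open>
  Both sides are coalgebra maps, so inverse maps on arrows have inverse extensions.
\<close>

lemma theta_inverse:
  assumes "block_map G \<Phi> R f" "block_map G \<Phi> R f'"
    and inv: "\<And>x y v. x \<in> carrier G \<Longrightarrow> y \<in> carrier G \<Longrightarrow> v \<in> hopf_quiver_cocycle.block G R x y \<Longrightarrow> f' (f v) = v"
    and v: "v \<in> free_space (paths (hopf_quiver G R))"
  shows "block_map.theta G R f' (block_map.theta G R f v) = v"
proof -
  interpret F: block_map G \<Phi> R f by fact
  interpret F': block_map G \<Phi> R f' by fact
  have "ext pscale F'.path_map (F.path_map b) = bvec b" if "b \<in> paths F.Q" for b
  proof (rule F.Q.coalg_map_eqI[OF F.P.splitting_system_axioms
        graded_coalg_map_comp[OF F.coalg_map_path_map F'.coalg_map_path_map F.P.splitting_system_axioms]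
        graded_coalg_map_ident[OF F.P.splitting_system_axioms]])
    fix b assume b: "b \<in> sbasis F.P" "sdeg F.P b \<le> 1"
    show "ext pscale F'.path_map (F.path_map b) = bvec b"
    proof (cases "path_length b = 0")
      case True
      then show ?thesis
        by (cases b) (simp add: F.path_map_vertex F'.path_map_vertex vector_space_pscale)
    next
      case False
      then have l: "path_length b = 1" using b by simp
      then have bb: "b \<in> F.arrow_basis (fst b) (fst (stgt F.P b))" using F.arrow_in_basis b by simp
      have e: "fst b \<in> carrier G" "fst (stgt F.P b) \<in> carrier G" using F.arrow_basis_ends[OF bb] by auto
      have "F'.theta (F.path_map b) = f' (f (bvec b))"
        unfolding F.path_map_arrow[OF bb] by (rule F'.theta_block[OF e F.arrow_map_block(2)[OF bb]])
      also have "\<dots> = bvec b" by (rule inv[OF e]) (simp add: F.block_def bb)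
      finally show ?thesis by (simp add: F'.theta_def)
    qed
  qed (use that in simp)
  then show ?thesis
    using lin_eqI[where s = pscale and f = "\<lambda>v. F'.theta (F.theta v)" and f' = "\<lambda>v. v", OF v
        lin_comp[OF F'.lin_theta F.lin_theta] lin_ident] by (simp add: F'.theta_def)
qed

locale bimodule_map = block_map G \<Phi> R f + src: majid_structure G \<Phi> R H + trg: majid_structure G \<Phi> R H'
  for G :: "('g, 'm) monoid_scheme" (structure) and \<Phi> :: "'g \<Rightarrow> 'g \<Rightarrow> 'g \<Rightarrow> 'k::field"
    and R :: "'g set \<Rightarrow> nat" and H H' :: "('g hpath, 'k) majid"
    and f :: "('g hpath \<Rightarrow>\<^sub>0 'k) \<Rightarrow> ('g hpath \<Rightarrow>\<^sub>0 'k)" +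
  assumes f_lact: "e \<in> carrier G \<Longrightarrow> x \<in> carrier G \<Longrightarrow> y \<in> carrier G \<Longrightarrow> v \<in> block x y \<Longrightarrow>
      f (src.hlact e v) = trg.hlact e (f v)"
    and f_ract: "e \<in> carrier G \<Longrightarrow> x \<in> carrier G \<Longrightarrow> y \<in> carrier G \<Longrightarrow> v \<in> block x y \<Longrightarrow>
      f (src.hract v e) = trg.hract (f v) e"
begin

text \<open>
  Two coalgebra maps on the tensor square; in degree one their equality is compatibility with the two actions.
\<close>

lemma theta_hprod:
  assumes "p \<in> paths Q" "q \<in> paths Q"
  shows "theta (src.hprod (p, q)) = mprod H' (path_map p) (path_map q)"
proof -
  let ?Y = "\<lambda>z. ext pscale trg.hprod ((\<lambda>(p, q). tens (path_map p) (path_map q)) z)"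
  have X: "graded_coalg_map PP P (\<lambda>z. ext pscale path_map (src.hprod z))"
    by (rule graded_coalg_map_comp[OF src.coalg_map_hprod coalg_map_path_map PP.splitting_system_axioms])
  have Y: "graded_coalg_map PP P ?Y"
    by (intro graded_coalg_map_comp[OF _ trg.coalg_map_hprod PP.splitting_system_axioms] graded_coalg_map_prod
        coalg_map_path_map)
  have "ext pscale path_map (src.hprod (p, q)) = ?Y (p, q)"
  proof (rule Q.coalg_map_eqI[OF PP.splitting_system_axioms X Y])
    fix z assume z: "z \<in> sbasis PP" "sdeg PP z \<le> 1"
    obtain p q where pq: "z = (p, q)" by (cases z)
    have in_paths: "p \<in> paths Q" "q \<in> paths Q" and deg: "path_length p + path_length q \<le> 1"
      using z by (auto simp: pq)
    have sp: "path_map p \<in> free_space (paths Q)" "path_map q \<in> free_space (paths Q)"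
      using path_map_deg in_paths hom_in_paths by blast+
    have Yz: "?Y z = mprod H' (path_map p) (path_map q)"
      using trg.mprod_ext[OF sp] by (simp add: pq)
    consider (0) "path_length p = 0" "path_length q = 0" | (p) "path_length p = 1" "path_length q = 0"
      | (q) "path_length p = 0" "path_length q = 1" using deg by linarith
    then show "ext pscale path_map (src.hprod z) = ?Y z"
    proof cases
      case 0
      obtain x where x: "p = (x, [])" "x \<in> carrier G" by (rule deg0_path[OF in_paths(1) 0(1)])
      obtain y where y: "q = (y, [])" "y \<in> carrier G" by (rule deg0_path[OF in_paths(2) 0(2)])
      show ?thesis unfolding Yz
        using x y by (simp add: pq src.hprod_def src.prod_vertex trg.prod_vertex path_map_vertex vector_space_pscale)
    next
      case p
      obtain y where y: "q = (y, [])" "y \<in> carrier G" by (rule deg0_path[OF in_paths(2) p(2)])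
      note b = arrow_in_basis[OF in_paths(1) p(1)]
      note e = arrow_basis_ends[OF b]
      have bl: "bvec p \<in> block (fst p) (fst (stgt P p))" using b by (simp add: block_def)
      have "theta (src.hract (bvec p) y) = f (src.hract (bvec p) y)"
        using theta_block[OF _ _ src.hract_arrow[OF y(2) b]] e y by simp
      then show ?thesis unfolding Yz
        using f_ract[OF y(2) _ _ bl] e
        by (simp add: pq y path_map_vertex path_map_arrow[OF b] src.hprod_def src.hract_def trg.hract_def theta_def)
    next
      case q
      obtain y where y: "p = (y, [])" "y \<in> carrier G" by (rule deg0_path[OF in_paths(1) q(1)])
      note b = arrow_in_basis[OF in_paths(2) q(2)]
      note e = arrow_basis_ends[OF b]
      have bl: "bvec q \<in> block (fst q) (fst (stgt P q))" using b by (simp add: block_def)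
      have "theta (src.hlact y (bvec q)) = f (src.hlact y (bvec q))"
        using theta_block[OF _ _ src.hlact_arrow[OF y(2) b]] e y by simp
      then show ?thesis unfolding Yz
        using f_lact[OF y(2) _ _ bl] e
        by (simp add: pq y path_map_vertex path_map_arrow[OF b] src.hprod_def src.hlact_def trg.hlact_def theta_def)
    qed
  qed (use assms in simp)
  moreover have "path_map p \<in> free_space (paths Q)" "path_map q \<in> free_space (paths Q)"
    using path_map_deg assms hom_in_paths by blast+
  ultimately show ?thesis using trg.mprod_ext by (simp add: theta_def)
qed

text \<open>
  As for the product.  In degree one both images of an arrow from \<open>x\<close> have the same product with \<open>x\<close> by
  \<open>hantip_arrow\<close>, and right multiplication by \<open>x\<close> is injective.
\<close>

lemma theta_hantip:
  assumes "p \<in> paths Q"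
  shows "theta (src.hantip p) = antip H' (path_map p)"
proof -
  let ?Y = "\<lambda>p. ext pscale trg.hantip (path_map p)"
  have X: "graded_coalg_map (opp_splitting P) P (\<lambda>z. ext pscale path_map (src.hantip z))"
    by (rule graded_coalg_map_comp[OF src.coalg_map_hantip coalg_map_path_map P.splitting_system_opp])
  have Y: "graded_coalg_map (opp_splitting P) P ?Y"
    by (rule graded_coalg_map_comp[OF graded_coalg_map_opp[OF coalg_map_path_map] trg.coalg_map_hantip P.splitting_system_opp])
  have Yz: "?Y p = antip H' (path_map p)" if "p \<in> paths Q" for p
    using trg.antip_ext[OF hom_in_paths[OF path_map_deg[OF that]]] by simp
  have "ext pscale path_map (src.hantip p) = ?Y p"
  proof (rule Q.coalg_map_eqI[OF P.splitting_system_opp X Y])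
    fix p assume "p \<in> sbasis (opp_splitting P)" "sdeg (opp_splitting P) p \<le> 1"
    then have p: "p \<in> paths Q" and deg: "path_length p \<le> 1" by auto
    show "ext pscale path_map (src.hantip p) = ?Y p"
    proof (cases "path_length p = 0")
      case True
      obtain x where x: "p = (x, [])" "x \<in> carrier G" by (rule deg0_path[OF p True])
      show ?thesis unfolding Yz[OF p]
        using x by (simp add: src.hantip_def src.antip_vertex trg.antip_vertex path_map_vertex vector_space_pscale)
    next
      case False
      then have b: "p \<in> arrow_basis (fst p) (fst (stgt P p))" using arrow_in_basis p deg by simp
      let ?x = "fst p" and ?y = "fst (stgt P p)"
      have e: "?x \<in> carrier G" "?y \<in> carrier G" using arrow_basis_ends[OF b] by auto
      have bl: "bvec p \<in> block ?x ?y" using b by (simp add: block_def)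
      note fp = arrow_map_block(2)[OF b]
      note S = src.hantip_arrow(1)[OF b] and S' = trg.antip_block[OF fp e]
      have fS: "f (src.hantip p) \<in> block (inv ?y) (inv ?x)" using lin_onD(1)[OF f_lin S] e by simp
      have l: "src.hlact (inv ?y) (bvec p) \<in> block (inv ?y \<otimes> ?x) (inv ?y \<otimes> ?y)"
        by (rule src.hlact_arrow[OF _ b]) (use e in simp)
      have "trg.hract (f (src.hantip p)) ?x = f (src.hract (src.hantip p) ?x)"
        using f_ract[OF e(1) _ _ S] e by simp
      also have "\<dots> = f (pscale (- 1) (src.hlact (inv ?y) (bvec p)))"
        by (simp add: src.hantip_arrow(2)[OF b])
      also have "\<dots> = - f (src.hlact (inv ?y) (bvec p))"
        using lin_onD(3)[OF f_lin l, of "- 1"] e by simp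
      also have "\<dots> = trg.hract (antip H' (f (bvec p))) ?x"
        using f_lact[OF _ e bl, of "inv ?y"] trg.hract_antip[OF fp e] e by simp
      finally have eq: "trg.hract (f (src.hantip p)) ?x = trg.hract (antip H' (f (bvec p))) ?x" .
      \<comment> \<open>Right multiplication by the inverse undoes right multiplication, up to a nonzero scalar.\<close>
      have cancel: "v = pscale (\<Phi> (inv ?x) ?x (inv ?x) / \<Phi> (inv ?y) ?x (inv ?x)) (trg.hract (trg.hract v ?x) (inv ?x))"
        if "v \<in> block (inv ?y) (inv ?x)" for v
        using trg.bim.ract_ract[of "inv ?y" "inv ?x" v ?x "inv ?x"] trg.bim.ract_one[of "inv ?y" "inv ?x" v] that e
        by simp
      have "f (src.hantip p) = antip H' (f (bvec p))"
        using cancel[OF fS] cancel[OF S'] eq by simp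
      moreover have "theta (src.hantip p) = f (src.hantip p)" by (rule theta_block[OF _ _ S]) (use e in auto)
      ultimately show ?thesis unfolding Yz[OF p] by (simp add: path_map_arrow[OF b] theta_def)
    qed
  qed (use assms in simp)
  then show ?thesis using Yz[OF assms] by (simp add: theta_def)
qed

lemma lin_theta_paths: "lin_on pscale (free_space (paths Q)) theta (space_of H')"
  using lin_on_subset[OF lin_theta theta_paths] by simp

theorem majid_hom_theta: "majid_hom H H' theta"
  unfolding majid_hom_def src.H_coalg trg.H_coalg
proof (intro conjI ballI, goal_cases)
  case 1
  show ?case by (rule lin_on_subset[OF lin_theta theta_paths])
next
  case (2 a)
  show ?case
  proof (rule lin_eqI[where s = pscale, OF 2])
    show "lin pscale (\<lambda>a. comul (theta a))" by (rule lin_comp[OF lin_comul lin_theta])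
    show "lin pscale (\<lambda>a. sw pscale comul a (\<lambda>a1 a2. tens (theta a1) (theta a2)))" by (intro lin_intros)
    fix b assume "b \<in> paths Q"
    then show "comul (theta (bvec b)) = sw pscale comul (bvec b) (\<lambda>a1 a2. tens (theta a1) (theta a2))"
      using graded_coalg_mapD(3)[OF coalg_map_path_map, of b] by (simp add: scomult_path)
  qed
next
  case (3 a)
  show ?case
  proof (rule lin_eqI[where s = "(*)", OF 3])
    show "lin (*) (\<lambda>a. vertex_form (\<lambda>_. 1) (theta a))" by (rule lin_vertex_form[OF lin_theta])
    show "lin (*) (\<lambda>a. vertex_form (\<lambda>_. 1) a)" by (intro lin_intros)
    fix b assume b: "b \<in> paths Q"
    show "vertex_form (\<lambda>_. 1) (theta (bvec b)) = vertex_form (\<lambda>_. 1) (bvec b)"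
      using b vertex_form_pos[OF path_map_deg[OF b]] by (cases b; cases "snd b") (auto simp: path_map_vertex)
  qed
next
  case (4 a b)
  have lt: "lin_on pscale (free_space (paths Q)) theta (free_space (paths Q))"
    by (rule lin_on_subset[OF lin_theta theta_paths])
  have "theta (mprod H a (bvec q)) = mprod H' (theta a) (theta (bvec q))" if "q \<in> paths Q" for q
  proof (rule lin_on_eqI[where f = "\<lambda>a. theta (mprod H a (bvec q))" and f' = "\<lambda>a. mprod H' (theta a) (theta (bvec q))", OF 4(1)])
    show "lin_on pscale (free_space (paths Q)) (\<lambda>a. theta (mprod H a (bvec q))) (free_space (paths Q))"
      by (rule lin_on_comp[OF lt src.lin_mprod(2)]) (use that in simp)
    show "lin_on pscale (free_space (paths Q)) (\<lambda>a. mprod H' (theta a) (theta (bvec q))) (free_space (paths Q))"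
      by (rule lin_on_comp[OF trg.lin_mprod(2) lt]) (rule theta_paths, use that in simp)
    fix p assume "p \<in> paths Q"
    then show "theta (mprod H (bvec p) (bvec q)) = mprod H' (theta (bvec p)) (theta (bvec q))"
      using theta_hprod[of p q] that by (simp add: src.hprod_def)
  qed
  then show ?case
    using lin_on_eqI[where f = "\<lambda>b. theta (mprod H a b)" and f' = "\<lambda>b. mprod H' (theta a) (theta b)", OF 4(2)
      lin_on_comp[OF lt src.lin_mprod(1)] lin_on_comp[OF trg.lin_mprod(1) lt]] 4 theta_paths by blast
next
  case 5
  show ?case by (simp add: src.munit_vertex trg.munit_vertex path_map_vertex)
next
  case (6 a b c)
  show ?case
  proof (rule trilin_on_eqI[where F = "\<lambda>a b c. reass H' (theta a) (theta b) (theta c)" and F' = "reass H",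
        OF trilin_on_comp[OF trg.reass_trilin lin_theta_paths] _ _ 6])
    show "trilin_on (*) (free_space (paths Q)) (reass H) UNIV" using src.reass_trilin by simp
    fix p q r assume p: "p \<in> paths Q" "q \<in> paths Q" "r \<in> paths Q"
    show "reass H' (theta (bvec p)) (theta (bvec q)) (theta (bvec r)) = reass H (bvec p) (bvec q) (bvec r)"
    proof (cases "path_length p = 0 \<and> path_length q = 0 \<and> path_length r = 0")
      case True
      obtain x where x: "p = (x, [])" "x \<in> carrier G" by (rule deg0_path[OF p(1)]) (use True in auto)
      obtain y where y: "q = (y, [])" "y \<in> carrier G" by (rule deg0_path[OF p(2)]) (use True in auto)
      obtain z where z: "r = (z, [])" "z \<in> carrier G" by (rule deg0_path[OF p(3)]) (use True in auto)
      show ?thesis using x y z by (simp add: path_map_vertex src.reass_vertex trg.reass_vertex)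
    next
      case False
      then show ?thesis
        using trg.reass_homog[of "path_map p" "path_length p" "path_map q" "path_length q" "path_map r" "path_length r"]
          p path_map_deg src.reass_bvec[OF p] by auto
    qed
  qed
next
  case (7 a)
  have lt: "lin_on pscale (free_space (paths Q)) theta (free_space (paths Q))"
    by (rule lin_on_subset[OF lin_theta theta_paths])
  show ?case
    by (rule lin_on_eqI[where f = "\<lambda>a. theta (antip H a)" and f' = "\<lambda>a. antip H' (theta a)", OF 7
        lin_on_comp[OF lt] lin_on_comp[OF _ lt]])
      (use src.antip_lin trg.antip_lin theta_hantip in \<open>auto simp: src.hantip_def\<close>)
next
  case (8 a)
  show ?case
  proof (rule lin_on_eqI[where f = "\<lambda>a. malpha H' (theta a)" and f' = "malpha H", OF 8 lin_on_comp[OF _ lin_theta_paths]])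
    fix p assume p: "p \<in> paths Q"
    show "malpha H' (theta (bvec p)) = malpha H (bvec p)"
    proof (cases "path_length p = 0")
      case True
      obtain x where x: "p = (x, [])" "x \<in> carrier G" by (rule deg0_path[OF p True])
      then show ?thesis by (simp add: path_map_vertex src.malpha_vertex trg.malpha_vertex)
    next
      case False
      then show ?thesis using src.malpha_homog[of "bvec p" "path_length p"] trg.malpha_homog[of "path_map p" "path_length p"]
          p path_map_deg[OF p] by simp
    qed
  qed (use src.malpha_lin trg.malpha_lin in simp_all)
next
  case (9 a)
  show ?case
  proof (rule lin_on_eqI[where f = "\<lambda>a. mbeta H' (theta a)" and f' = "mbeta H", OF 9 lin_on_comp[OF _ lin_theta_paths]])
    fix p assume p: "p \<in> paths Q"
    show "mbeta H' (theta (bvec p)) = mbeta H (bvec p)"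
    proof (cases "path_length p = 0")
      case True
      obtain x where x: "p = (x, [])" "x \<in> carrier G" by (rule deg0_path[OF p True])
      then show ?thesis by (simp add: path_map_vertex src.mbeta_vertex trg.mbeta_vertex)
    next
      case False
      then show ?thesis using src.mbeta_homog[of "bvec p" "path_length p"] trg.mbeta_homog[of "path_map p" "path_length p"]
          p path_map_deg[OF p] by simp
    qed
  qed (use src.mbeta_lin trg.mbeta_lin in simp_all)
qed

end

section \<open>Representations on arrows out of the unit\<close>

lemma (in hopf_quiver_cocycle) arrow_rep_space:
  assumes "c \<in> carrier G"
  shows "{(u, p). pre_digraph.awalk Q u p c \<and> u = \<one> \<and> length p = 1} = arrow_basis \<one> c"
proof -
  have "pre_digraph.awalk Q \<one> p c \<and> length p = 1 \<longleftrightarrow> (\<one>, p) \<in> arrow_basis \<one> c" for p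
    using arrow_basis_length[of \<one> p \<one> c] assms
    by (cases p; cases "tl p") (auto simp: Q.awalk_simps)
  moreover have "(u, p) \<in> arrow_basis \<one> c \<Longrightarrow> u = \<one>" for u p by (auto simp: arrow_basis_def)
  ultimately show ?thesis by auto
qed

lemma (in majid_structure) arrow_rep_eq:
  assumes "g C \<in> carrier G"
  shows "arrow_rep G g R H C = (block \<one> (g C), bim.conj)"
  using arrow_rep_space[OF assms]
  by (simp add: arrow_rep_def block_def bim.conj_def hlact_def hract_def fun_eq_iff)

lemma (in group) centralizer_conj:
  assumes "c \<in> carrier G" "e \<in> centralizer G c"
  shows "e \<otimes> c \<otimes> inv e = c" "e \<in> carrier G"
  using assms by (auto simp: centralizer_def m_assoc)

lemma (in group) centralizer_closed:
  assumes "c \<in> carrier G"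
  shows "\<one> \<in> centralizer G c" "e \<in> centralizer G c \<Longrightarrow> f \<in> centralizer G c \<Longrightarrow> e \<otimes> f \<in> centralizer G c"
    "e \<in> centralizer G c \<Longrightarrow> inv e \<in> centralizer G c"
proof -
  show "\<one> \<in> centralizer G c" using assms by (simp add: centralizer_def)
  show "e \<otimes> f \<in> centralizer G c" if "e \<in> centralizer G c" "f \<in> centralizer G c"
    using that assms by (simp add: centralizer_def) (metis m_assoc)
  show "inv e \<in> centralizer G c" if "e \<in> centralizer G c"
  proof -
    have e: "e \<in> carrier G" "e \<otimes> c = c \<otimes> e" using that by (auto simp: centralizer_def)
    have "inv e \<otimes> c = inv e \<otimes> (c \<otimes> e) \<otimes> inv e" using e assms by (simp add: m_assoc)
    also have "\<dots> = c \<otimes> inv e" unfolding e(2)[symmetric] using e(1) assms by (simp add: m_assoc)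
    finally show ?thesis using e by (simp add: centralizer_def)
  qed
qed

lemma (in path_bimodule) conj_lin:
  assumes "c \<in> carrier G" "e \<in> carrier G"
  shows "lin_on pscale (block \<one> c) (conj e) (block \<one> (e \<otimes> c \<otimes> inv e))"
proof -
  have "lin_on pscale (block \<one> c) (\<lambda>v. ract (lact e v) (inv e)) (block (e \<otimes> \<one> \<otimes> inv e) (e \<otimes> c \<otimes> inv e))"
    by (rule lin_on_comp[OF ract_lin lact_lin]) (use assms in auto)
  then show ?thesis using assms by (simp add: conj_def[abs_def])
qed

text \<open>
  Quasi-conjugation by the inverse is an inverse up to a nonzero scalar, which gives bijectivity.
\<close>

lemma (in path_bimodule) conj_proj_rep:
  assumes c: "c \<in> carrier G"
  shows "proj_rep G (centralizer G c) (\<lambda>e f. Phi_tilde G \<Phi> e f c) (block \<one> c, conj)"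
proof -
  note [simp] = c
  have conj_c: "e \<otimes> c \<otimes> inv e = c" "e \<in> carrier G" if "e \<in> centralizer G c" for e
    using centralizer_conj[OF c that] .
  have l: "lin_on pscale (block \<one> c) (conj e) (block \<one> c)" if "e \<in> centralizer G c" for e
    using conj_lin[OF c conj_c(2)[OF that]] conj_c(1)[OF that] by simp
  have cc: "conj e (conj f v) = pscale (Phi_tilde G \<Phi> e f c) (conj (e \<otimes> f) v)"
    if "e \<in> centralizer G c" "f \<in> centralizer G c" "v \<in> block \<one> c" for e f v
    using conj_conj[of c v e f] that conj_c(2) by simp
  have one: "conj \<one> v = v" if "v \<in> block \<one> c" for v using conj_one[of c v] that by simp
  have "bij_betw (conj e) (block \<one> c) (block \<one> c)" if e: "e \<in> centralizer G c" for e
  proof -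
    note eG = conj_c(2)[OF e] and e' = centralizer_closed(3)[OF c e]
    have inj: "v = pscale (1 / Phi_tilde G \<Phi> (inv e) e c) (conj (inv e) (conj e v))" if "v \<in> block \<one> c" for v
      using cc[OF e' e that] one[OF that] eG by simp
    have sur: "conj e (pscale (1 / Phi_tilde G \<Phi> e (inv e) c) (conj (inv e) v)) = v" if "v \<in> block \<one> c" for v
      using cc[OF e e' that] one[OF that] eG lin_onD(3)[OF l[OF e] lin_onD(1)[OF l[OF e'] that]] by simp
    have "pscale (1 / Phi_tilde G \<Phi> e (inv e) c) (conj (inv e) v) \<in> block \<one> c" if "v \<in> block \<one> c" for v
      using lin_onD(1)[OF l[OF e'] that] fs.subspace_scale[OF block_subspace] by blast
    then have "block \<one> c \<subseteq> conj e ` block \<one> c" using sur by (metis image_eqI subsetI)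
    moreover have "inj_on (conj e) (block \<one> c)" by (rule inj_onI) (metis inj)
    ultimately show ?thesis using lin_onD(1)[OF l[OF e]] by (auto simp: bij_betw_def)
  qed
  then show ?thesis using l cc one by (auto simp: proj_rep_def block_subspace)
qed

lemma prep_iso_trans:
  assumes "prep_iso Z V W" "prep_iso Z W U"
  shows "prep_iso Z V U"
proof -
  obtain V0 \<rho> W0 \<sigma> U0 \<tau> where eq: "V = (V0, \<rho>)" "W = (W0, \<sigma>)" "U = (U0, \<tau>)" by (metis surj_pair)
  obtain f h where f: "lin_on pscale V0 f W0" "bij_betw f V0 W0" "\<And>e v. e \<in> Z \<Longrightarrow> v \<in> V0 \<Longrightarrow> f (\<rho> e v) = \<sigma> e (f v)"
    and h: "lin_on pscale W0 h U0" "bij_betw h W0 U0" "\<And>e v. e \<in> Z \<Longrightarrow> v \<in> W0 \<Longrightarrow> h (\<sigma> e v) = \<tau> e (h v)"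
    using assms unfolding eq prep_iso_def by auto
  have "lin_on pscale V0 (\<lambda>v. h (f v)) U0" by (rule lin_on_comp[OF h(1) f(1)])
  moreover have "bij_betw (\<lambda>v. h (f v)) V0 U0" using bij_betw_trans[OF f(2) h(2)] by (simp add: o_def)
  moreover have "h (f (\<rho> e v)) = \<tau> e (h (f v))" if "e \<in> Z" "v \<in> V0" for e v
    using that f(3) h(3)[OF that(1) lin_onD(1)[OF f(1) that(2)]] by simp
  ultimately show ?thesis unfolding eq prep_iso_def by auto
qed

lemma lin_on_inverse:
  assumes f: "lin_on pscale V f W" and b: "bij_betw f V W" and V: "fs.subspace V"
  shows "lin_on pscale W (inv_into V f) V"
proof (rule lin_onI)
  have g: "inv_into V f w \<in> V" "f (inv_into V f w) = w" if "w \<in> W" for w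
    using b that by (auto simp: bij_betw_def inv_into_into f_inv_into_f)
  have gf: "inv_into V f (f v) = v" if "v \<in> V" for v using b that by (auto simp: bij_betw_def)
  show "inv_into V f w \<in> V" if "w \<in> W" for w using g that by blast
  show "inv_into V f (u + v) = inv_into V f u + inv_into V f v" if "u \<in> W" "v \<in> W" for u v
    using gf[of "inv_into V f u + inv_into V f v"] lin_onD(2)[OF f, of "inv_into V f u" "inv_into V f v"] g that
      fs.subspace_add[OF V] by metis
  show "inv_into V f (pscale c v) = pscale c (inv_into V f v)" if "v \<in> W" for c v
    using gf[of "pscale c (inv_into V f v)"] lin_onD(3)[OF f, of "inv_into V f v" c] g that
      fs.subspace_scale[OF V] by metis
qed

lemma prep_iso_sym:
  assumes "prep_iso Z V W" "proj_rep G Z \<sigma> V"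
  shows "prep_iso Z W V"
proof -
  obtain V0 \<rho> W0 \<tau> where eq: "V = (V0, \<rho>)" "W = (W0, \<tau>)" by (metis surj_pair)
  obtain f where f: "lin_on pscale V0 f W0" "bij_betw f V0 W0" "\<And>e v. e \<in> Z \<Longrightarrow> v \<in> V0 \<Longrightarrow> f (\<rho> e v) = \<tau> e (f v)"
    using assms(1) unfolding eq prep_iso_def by auto
  have V: "fs.subspace V0" and \<rho>: "\<And>e v. e \<in> Z \<Longrightarrow> v \<in> V0 \<Longrightarrow> \<rho> e v \<in> V0"
    using assms(2) unfolding eq proj_rep_def by (auto dest: lin_onD(1))
  let ?h = "inv_into V0 f"
  have "?h (\<tau> e w) = \<rho> e (?h w)" if "e \<in> Z" "w \<in> W0" for e w
  proof -
    have w: "?h w \<in> V0" "f (?h w) = w" using f(2) that by (auto simp: bij_betw_def inv_into_into f_inv_into_f)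
    have "?h (f (\<rho> e (?h w))) = \<rho> e (?h w)"
      using f(2) \<rho>[OF that(1) w(1)] by (auto simp: bij_betw_def)
    then show ?thesis using f(3)[OF that(1) w(1)] w(2) by simp
  qed
  then show ?thesis unfolding eq prep_iso_def
    using lin_on_inverse[OF f(1,2) V] bij_betw_inv_into[OF f(2)] by auto
qed

locale structure_map = src: majid_structure G \<Phi> R H + trg: majid_structure G \<Phi> R H'
  for G :: "('g, 'm) monoid_scheme" (structure) and \<Phi> :: "'g \<Rightarrow> 'g \<Rightarrow> 'g \<Rightarrow> 'k::field"
    and R :: "'g set \<Rightarrow> nat" and H H' :: "('g hpath, 'k) majid" +
  fixes \<theta> :: "('g hpath \<Rightarrow>\<^sub>0 'k) \<Rightarrow> ('g hpath \<Rightarrow>\<^sub>0 'k)"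
  assumes majid_hom: "majid_hom H H' \<theta>"
    and bij: "bij_betw \<theta> (space_of H) (space_of H')"
    and graded: "\<theta> ` homog H path_length n = homog H' path_length n"
    and vertices: "v \<in> vertex_space G \<Longrightarrow> \<theta> v = v"
begin

lemma lin_map: "lin_on pscale (free_space (paths src.Q)) \<theta> (free_space (paths src.Q))"
  using majid_hom by (simp add: majid_hom_def)

lemma map_vertex: "x \<in> carrier G \<Longrightarrow> \<theta> (bvec (x, [])) = bvec (x, [])"
  by (rule vertices) (simp add: vertex_space_def)

text \<open>
  The image of an arrow is skew-primitive between the same vertices, because the vertices are fixed.
\<close>

lemma map_arrow:
  assumes b: "b \<in> src.arrow_basis x y" shows "\<theta> (bvec b) \<in> src.block x y"
proof (rule src.block_of_comult)
  obtain a where a: "b = (x, [a])" "b \<in> paths src.Q" "path_length b = 1" "x \<in> carrier G" "y \<in> carrier G"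
    using b by (rule src.arrow_basis_cases)
  have "bvec b \<in> src.deg_space 1" using a by simp
  then show "\<theta> (bvec b) \<in> src.deg_space 1" using graded[of 1] by auto
  have "src.comul (\<theta> (bvec b)) = sw pscale src.comul (bvec b) (\<lambda>a1 a2. tens (\<theta> a1) (\<theta> a2))"
    using majid_hom a(2) by (simp add: majid_hom_def del: ext_bvec)
  then show "src.comul (\<theta> (bvec b)) = tens (\<theta> (bvec b)) (bvec (x, [])) + tens (bvec (y, [])) (\<theta> (bvec b))"
    using a(4,5) by (simp add: src.sum_splits_arrow[OF b] map_vertex)
qed

lemma map_block: "v \<in> src.block x y \<Longrightarrow> \<theta> v \<in> src.block x y"
  using lin_on_ext[OF lin_map src.block_in_paths[of v x y]] src.ext_block[OF _ map_arrow] by simp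

text \<open>
  Surjectivity is known in degree one only as a whole.  A preimage is split into its part \<open>v1\<close> on the arrows from \<open>x\<close> to \<open>y\<close>
  and the rest \<open>v2\<close>; the images lie in complementary spans of arrows, so the image of \<open>v2\<close> vanishes, and
  \<open>v2 = 0\<close> by injectivity.
\<close>

lemma block_surj:
  assumes w: "w \<in> src.block x y" shows "\<exists>v\<in>src.block x y. \<theta> v = w"
proof -
  have "w \<in> \<theta> ` src.deg_space 1" using src.block_in_hom[OF w] graded[of 1] by simp
  then obtain v where v: "v \<in> src.deg_space 1" "\<theta> v = w" by blast
  let ?K = "Poly_Mapping.keys v" and ?B = "src.arrow_basis x y"
  let ?t = "\<lambda>b. pscale (Poly_Mapping.lookup v b) (bvec b)"
  define v1 where "v1 = (\<Sum>b\<in>?K \<inter> ?B. ?t b)"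
  define v2 where "v2 = (\<Sum>b\<in>?K - ?B. ?t b)"
  have K: "b \<in> paths src.Q" "path_length b = 1" if "b \<in> ?K" for b using v(1) that by (auto simp: free_space_def)
  have vs: "v = v1 + v2"
    unfolding v1_def v2_def by (rule trans[OF basis_expansion sum.Int_Diff[OF finite_keys]])
  have v1: "v1 \<in> src.block x y" unfolding src.block_def v1_def by (intro free_space_sum free_space_pscale) auto
  have v2: "v2 \<in> free_space (paths src.Q)" unfolding v2_def by (intro free_space_sum free_space_pscale) (auto simp: K)
  have eq: "\<theta> v2 = w - \<theta> v1"
    using lin_onD(2)[OF lin_map src.block_in_paths[OF v1] v2] v(2) unfolding vs[symmetric] by simp
  then have w2: "\<theta> v2 \<in> src.block x y" using w map_block[OF v1] by (simp add: src.block_def free_space_diff)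
  have "\<theta> v2 = (\<Sum>b\<in>?K - ?B. pscale (Poly_Mapping.lookup v b) (\<theta> (bvec b)))"
  proof -
    have "\<theta> v2 = (\<Sum>b\<in>?K - ?B. \<theta> (?t b))"
      unfolding v2_def by (rule lin_on_sum[OF lin_map subspace_free_space]) (auto intro!: free_space_pscale simp: K)
    also have "\<dots> = (\<Sum>b\<in>?K - ?B. pscale (Poly_Mapping.lookup v b) (\<theta> (bvec b)))"
      by (rule sum.cong[OF refl], rule lin_onD(3)[OF lin_map]) (auto simp: K)
    finally show ?thesis .
  qed
  also have "\<dots> \<in> free_space (- ?B)"
  proof (intro free_space_sum free_space_pscale)
    fix b assume b: "b \<in> ?K - ?B"
    then obtain u a where ua: "b = (u, [a])" "a \<in> arcs src.Q" "tail src.Q a = u"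
      using src.deg1_path[of b] K[of b] by blast
    have "\<theta> (bvec b) \<in> src.block u (head src.Q a)" by (rule map_arrow) (use ua in simp)
    moreover have "src.arrow_basis u (head src.Q a) \<inter> ?B = {}"
      using b ua by (auto simp: src.arrow_basis_def)
    ultimately show "\<theta> (bvec b) \<in> free_space (- ?B)"
      unfolding src.block_def by (auto elim!: free_space_mono)
  qed
  finally have "\<theta> v2 = 0"
    using w2 unfolding src.block_def free_space_iff by (intro poly_mapping_eqI) auto
  moreover have "\<theta> 0 = 0" by (rule lin_on_zero[OF lin_map subspace_free_space])
  ultimately have "v2 = 0"
    using bij v2 inj_onD[of \<theta> "free_space (paths src.Q)" v2 0] by (simp add: bij_betw_def)
  then have "\<theta> v1 = w" using vs v(2) by simp
  then show ?thesis using v1 by blast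
qed

lemma map_conj:
  assumes "e \<in> carrier G" "v \<in> src.block \<one> c" "c \<in> carrier G"
  shows "\<theta> (src.bim.conj e v) = trg.bim.conj e (\<theta> v)"
proof -
  have m: "\<theta> (mprod H a b) = mprod H' (\<theta> a) (\<theta> b)"
    if "a \<in> free_space (paths src.Q)" "b \<in> free_space (paths src.Q)" for a b
    using majid_hom that by (simp add: majid_hom_def)
  have "src.hlact e v \<in> free_space (paths src.Q)"
    using src.block_in_paths[OF lin_onD(1)[OF src.hlact_lin[OF assms(1)] assms(2)]] .
  then show ?thesis
    using assms src.block_in_paths[OF assms(2)]
    by (simp add: src.bim.conj_def trg.bim.conj_def src.hlact_def trg.hlact_def src.hract_def trg.hract_def m map_vertex)
qed

lemma prep_iso_block:
  assumes c: "c \<in> carrier G"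
  shows "prep_iso (centralizer G c) (src.block \<one> c, src.bim.conj) (src.block \<one> c, trg.bim.conj)"
proof -
  have "lin_on pscale (src.block \<one> c) \<theta> (src.block \<one> c)"
    by (rule lin_on_mono[OF lin_map src.block_sub_paths map_block])
  moreover have "bij_betw \<theta> (src.block \<one> c) (src.block \<one> c)"
  proof -
    have "inj_on \<theta> (src.block \<one> c)"
      using bij src.block_sub_paths by (auto simp: bij_betw_def intro: inj_on_subset)
    moreover have "\<theta> ` src.block \<one> c = src.block \<one> c"
      using map_block block_surj by (intro equalityI subsetI) (blast, metis imageI)
    ultimately show ?thesis by (simp add: bij_betw_def)
  qed
  ultimately show ?thesis
    using map_conj c by (auto simp: prep_iso_def centralizer_def)
qed

end

section \<open>Bimodules in terms of their representations\<close>

locale class_reps = hopf_quiver_cocycle G \<Phi> R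
  for G :: "('g, 'm) monoid_scheme" (structure) and \<Phi> :: "'g \<Rightarrow> 'g \<Rightarrow> 'g \<Rightarrow> 'k::field"
    and R :: "'g set \<Rightarrow> nat" +
  fixes g :: "'g set \<Rightarrow> 'g"
  assumes g_class: "C \<in> conj_classes G \<Longrightarrow> g C \<in> C"
begin

definition cls :: "'g \<Rightarrow> 'g set" where
  "cls c = {z \<otimes> c \<otimes> inv z | z. z \<in> carrier G}"

abbreviation base :: "'g \<Rightarrow> 'g" where "base c \<equiv> g (cls c)"

lemma conj_classes_eq: "conj_classes G = cls ` carrier G"
  by (auto simp: conj_classes_def orbits_def orbit_def conj_action_def cls_def)

lemma cls_self: "c \<in> carrier G \<Longrightarrow> c \<in> cls c"
  by (auto simp: cls_def intro!: exI[of _ \<one>])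

lemma cls_conj:
  assumes c: "c \<in> carrier G" and z: "z \<in> carrier G"
  shows "cls (z \<otimes> c \<otimes> inv z) = cls c"
proof (intro equalityI subsetI)
  fix d assume "d \<in> cls (z \<otimes> c \<otimes> inv z)"
  then obtain w where w: "w \<in> carrier G" "d = w \<otimes> (z \<otimes> c \<otimes> inv z) \<otimes> inv w" by (auto simp: cls_def)
  then have "d = (w \<otimes> z) \<otimes> c \<otimes> inv (w \<otimes> z)" using c z by (simp add: group_simps)
  then show "d \<in> cls c" unfolding cls_def using w z by blast
next
  fix d assume "d \<in> cls c"
  then obtain w where w: "w \<in> carrier G" "d = w \<otimes> c \<otimes> inv w" by (auto simp: cls_def)
  then have "d = (w \<otimes> inv z) \<otimes> (z \<otimes> c \<otimes> inv z) \<otimes> inv (w \<otimes> inv z)" using c z by (simp add: group_simps)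
  then show "d \<in> cls (z \<otimes> c \<otimes> inv z)" unfolding cls_def using w z by blast
qed

lemma class_eq_cls:
  assumes "C \<in> conj_classes G" "c \<in> C" shows "C = cls c"
proof -
  obtain d where d: "d \<in> carrier G" "C = cls d" using assms(1) conj_classes_eq by auto
  then obtain z where "z \<in> carrier G" "c = z \<otimes> d \<otimes> inv z" using assms(2) by (auto simp: cls_def)
  then show ?thesis using cls_conj d by simp
qed

lemma cls_class: "c \<in> carrier G \<Longrightarrow> cls c \<in> conj_classes G"
  by (simp add: conj_classes_eq)

lemma base_closed: "c \<in> carrier G \<Longrightarrow> base c \<in> carrier G"
  using g_class[of "cls c"] conj_class_closed conj_classes_eq by blast

lemma base_class: "C \<in> conj_classes G \<Longrightarrow> g C \<in> carrier G" "C \<in> conj_classes G \<Longrightarrow> cls (g C) = C"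
  using g_class[of C] conj_class_closed[of C "g C"] class_eq_cls[of C "g C"] by simp_all

lemma arcs_iff_cls: "(x, c, i) \<in> arcs Q \<longleftrightarrow> x \<in> carrier G \<and> c \<in> carrier G \<and> i < R (cls c)"
proof
  assume "(x, c, i) \<in> arcs Q"
  then obtain C where C: "x \<in> carrier G" "C \<in> conj_classes G" "c \<in> C" "i < R C" by (auto simp: arcs_iff)
  then show "x \<in> carrier G \<and> c \<in> carrier G \<and> i < R (cls c)"
    using class_eq_cls[OF C(2,3)] conj_class_closed[OF C(2,3)] by simp
next
  assume "x \<in> carrier G \<and> c \<in> carrier G \<and> i < R (cls c)"
  then show "(x, c, i) \<in> arcs Q" unfolding arcs_iff using cls_self[of c] conj_classes_eq by blast
qed

text \<open>
  A fixed element that conjugates the representative of a class to \<open>c\<close>.  The choice of the unit for the representative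
  itself makes the identifications below the identity there.
\<close>

definition conjugator :: "'g \<Rightarrow> 'g" where
  "conjugator c = (if c = base c then \<one> else SOME q. q \<in> carrier G \<and> q \<otimes> base c \<otimes> inv q = c)"

lemma conjugator:
  assumes c: "c \<in> carrier G" shows "conjugator c \<in> carrier G" "conjugator c \<otimes> base c \<otimes> inv (conjugator c) = c"
proof -
  have "\<exists>q. q \<in> carrier G \<and> q \<otimes> base c \<otimes> inv q = c"
  proof -
    have "base c \<in> cls c" using g_class c conj_classes_eq by blast
    then obtain z where z: "z \<in> carrier G" "base c = z \<otimes> c \<otimes> inv z" by (auto simp: cls_def)
    then have "inv z \<otimes> base c \<otimes> inv (inv z) = c" using c by (simp add: m_assoc)
    then show ?thesis using z by blast
  qed
  from someI_ex[OF this] show "conjugator c \<in> carrier G" "conjugator c \<otimes> base c \<otimes> inv (conjugator c) = c"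
    using c by (auto simp: conjugator_def m_assoc)
qed

text \<open>
  The element of the centralizer of the base point by which \<open>e\<close> acts, once the classes have been
  identified with the cosets of that centralizer.
\<close>

definition stab :: "'g \<Rightarrow> 'g \<Rightarrow> 'g" where
  "stab e c = inv (conjugator (e \<otimes> c \<otimes> inv e)) \<otimes> e \<otimes> conjugator c"

lemma base_conj: "c \<in> carrier G \<Longrightarrow> e \<in> carrier G \<Longrightarrow> base (e \<otimes> c \<otimes> inv e) = base c"
  by (simp add: cls_conj)

lemma stab:
  assumes c: "c \<in> carrier G" and e: "e \<in> carrier G"
  shows "stab e c \<in> centralizer G (base c)" "conjugator (e \<otimes> c \<otimes> inv e) \<otimes> stab e c = e \<otimes> conjugator c"
    "stab e c \<in> carrier G"
proof -
  let ?c = "e \<otimes> c \<otimes> inv e" let ?b = "base c"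
  note q = conjugator[OF c] and q' = conjugator[of ?c, unfolded base_conj[OF c e]]
  have cl: "?c \<in> carrier G" "conjugator ?c \<in> carrier G" "?b \<in> carrier G" using c e q' base_closed by auto
  show z: "stab e c \<in> carrier G" using cl q e by (simp add: stab_def)
  show eq: "conjugator ?c \<otimes> stab e c = e \<otimes> conjugator c" using cl q e by (simp add: stab_def m_assoc)
  have "conjugator ?c \<otimes> (stab e c \<otimes> ?b \<otimes> inv (stab e c)) \<otimes> inv (conjugator ?c) = (conjugator ?c \<otimes> stab e c) \<otimes> ?b \<otimes> inv (conjugator ?c \<otimes> stab e c)"
    using cl z by (simp add: group_simps)
  also have "\<dots> = e \<otimes> (conjugator c \<otimes> ?b \<otimes> inv (conjugator c)) \<otimes> inv e"
    unfolding eq using cl e q(1) by (simp add: group_simps)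
  also have "\<dots> = conjugator ?c \<otimes> ?b \<otimes> inv (conjugator ?c)" using q(2) q'(2) cl by simp
  finally have "stab e c \<otimes> ?b \<otimes> inv (stab e c) = ?b" using cl z by simp
  then have "stab e c \<otimes> ?b \<otimes> inv (stab e c) \<otimes> stab e c = ?b \<otimes> stab e c" by simp
  then have "stab e c \<otimes> ?b = ?b \<otimes> stab e c" using cl z by (simp add: m_assoc)
  then show "stab e c \<in> centralizer G ?b" using z by (simp add: centralizer_def)
qed

text \<open>
  The scalar in the left action in terms of the identification of all blocks with those at the
  representatives; see \<open>lact_spread\<close>.
\<close>

definition lact_coeff :: "'g \<Rightarrow> 'g \<Rightarrow> 'g \<Rightarrow> 'k" where
  "lact_coeff e x c = conj_coeff e c x * Phi_tilde G \<Phi> e (conjugator c) (base c)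
     / Phi_tilde G \<Phi> (conjugator (e \<otimes> c \<otimes> inv e)) (stab e c) (base c)"

end

locale path_bimodule_reps = path_bimodule G \<Phi> R lact ract + class_reps G \<Phi> R g
  for G :: "('g, 'm) monoid_scheme" (structure) and \<Phi> :: "'g \<Rightarrow> 'g \<Rightarrow> 'g \<Rightarrow> 'k::field"
    and R :: "'g set \<Rightarrow> nat"
    and lact :: "'g \<Rightarrow> ('g hpath \<Rightarrow>\<^sub>0 'k) \<Rightarrow> ('g hpath \<Rightarrow>\<^sub>0 'k)"
    and ract :: "('g hpath \<Rightarrow>\<^sub>0 'k) \<Rightarrow> 'g \<Rightarrow> ('g hpath \<Rightarrow>\<^sub>0 'k)"
    and g :: "'g set \<Rightarrow> 'g"
begin

text \<open>
  The identification of the arrows \<open>\<epsilon> \<rightarrow> g(C)\<close> with the arrows \<open>x \<rightarrow> c x\<close>, and its inverse up to a scalar.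
\<close>

definition spread :: "'g \<Rightarrow> 'g \<Rightarrow> ('g hpath \<Rightarrow>\<^sub>0 'k) \<Rightarrow> ('g hpath \<Rightarrow>\<^sub>0 'k)" where
  "spread x c w = ract (conj (conjugator c) w) x"

definition retract :: "'g \<Rightarrow> 'g \<Rightarrow> ('g hpath \<Rightarrow>\<^sub>0 'k) \<Rightarrow> ('g hpath \<Rightarrow>\<^sub>0 'k)" where
  "retract x c m = conj (inv (conjugator c)) (ract m (inv x))"

lemma conj_rep_block:
  assumes "c \<in> carrier G" "w \<in> block \<one> (base c)" shows "conj (conjugator c) w \<in> block \<one> c"
  using arr_conj[of "base c" w "conjugator c"] assms base_closed conjugator by simp

lemma spread_block:
  assumes "x \<in> carrier G" "c \<in> carrier G" "w \<in> block \<one> (base c)"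
  shows "spread x c w \<in> block x (c \<otimes> x)"
  using arr_ract[of \<one> c "conj (conjugator c) w" x] conj_rep_block assms by (simp add: spread_def)

lemma spread_lin:
  assumes "x \<in> carrier G" "c \<in> carrier G"
  shows "lin_on pscale (block \<one> (base c)) (spread x c) (block x (c \<otimes> x))"
proof -
  have "lin_on pscale (block \<one> (base c)) (\<lambda>w. ract (conj (conjugator c) w) x) (block (\<one> \<otimes> x) (c \<otimes> x))"
    using conj_lin[of "base c" "conjugator c"] assms base_closed conjugator
    by (intro lin_on_comp[OF ract_lin[of x \<one> c]]) auto
  then show ?thesis using assms by (simp add: spread_def[abs_def])
qed

lemma ract_inv_block:
  assumes "x \<in> carrier G" "c \<in> carrier G" "m \<in> block x (c \<otimes> x)"
  shows "ract m (inv x) \<in> block \<one> c"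
  using arr_ract[of x "c \<otimes> x" m "inv x"] assms by (simp add: m_assoc)

lemma base_of_rep: assumes "c \<in> carrier G" shows "inv (conjugator c) \<otimes> c \<otimes> inv (inv (conjugator c)) = base c"
proof -
  have "inv (conjugator c) \<otimes> (conjugator c \<otimes> base c \<otimes> inv (conjugator c)) \<otimes> inv (inv (conjugator c)) = base c"
    using assms conjugator(1)[OF assms] base_closed by (simp add: m_assoc)
  then show ?thesis using conjugator(2)[OF assms] by simp
qed

lemma retract_lin:
  assumes "x \<in> carrier G" "c \<in> carrier G"
  shows "lin_on pscale (block x (c \<otimes> x)) (retract x c) (block \<one> (base c))"
proof -
  have "lin_on pscale (block \<one> c) (conj (inv (conjugator c))) (block \<one> (base c))"
    using conj_lin[of c "inv (conjugator c)"] assms base_of_rep conjugator(1) by simp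
  moreover have "lin_on pscale (block x (c \<otimes> x)) (\<lambda>m. ract m (inv x)) (block \<one> c)"
    using ract_lin[of "inv x" x "c \<otimes> x"] assms by (simp add: m_assoc)
  ultimately show ?thesis unfolding retract_def[abs_def] by (rule lin_on_comp)
qed

definition spread_coeff :: "'g \<Rightarrow> 'g \<Rightarrow> 'k" where
  "spread_coeff x c = \<Phi> x (inv x) x / \<Phi> (c \<otimes> x) (inv x) x * Phi_tilde G \<Phi> (conjugator c) (inv (conjugator c)) c"

lemma spread_coeff_nz: "x \<in> carrier G \<Longrightarrow> c \<in> carrier G \<Longrightarrow> spread_coeff x c \<noteq> 0"
  using conjugator(1)[of c] by (simp add: spread_coeff_def)

lemma spread_retract:
  assumes x: "x \<in> carrier G" and c: "c \<in> carrier G" and m: "m \<in> block x (c \<otimes> x)"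
  shows "spread x c (retract x c m) = pscale (spread_coeff x c) m"
proof -
  note r = ract_inv_block[OF x c m]
  have "conj (conjugator c) (conj (inv (conjugator c)) (ract m (inv x)))
      = pscale (Phi_tilde G \<Phi> (conjugator c) (inv (conjugator c)) c) (ract m (inv x))"
    using conj_conj[of c "ract m (inv x)" "conjugator c" "inv (conjugator c)"] conj_one[of c "ract m (inv x)"] r c conjugator(1)[OF c] by simp
  then have "spread x c (retract x c m) = pscale (Phi_tilde G \<Phi> (conjugator c) (inv (conjugator c)) c) (ract (ract m (inv x)) x)"
    using ract_scal[of \<one> c "ract m (inv x)" x] r x c by (simp add: spread_def retract_def)
  then show ?thesis
    using ract_ract[of x "c \<otimes> x" m "inv x" x] ract_one[of x "c \<otimes> x" m] m x c
    by (simp add: spread_coeff_def mult.commute)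
qed

lemma retract_spread:
  assumes x: "x \<in> carrier G" and c: "c \<in> carrier G" and w: "w \<in> block \<one> (base c)"
  shows "\<exists>a. a \<noteq> 0 \<and> retract x c (spread x c w) = pscale a w"
proof -
  note r = conj_rep_block[OF c w] and b = base_closed[OF c]
  have "ract (ract (conj (conjugator c) w) x) (inv x) = pscale (1 / \<Phi> c x (inv x)) (conj (conjugator c) w)"
    using ract_ract[of \<one> c "conj (conjugator c) w" x "inv x"] ract_one[of \<one> c "conj (conjugator c) w"] r x c by simp
  then have "retract x c (spread x c w) = pscale (1 / \<Phi> c x (inv x)) (conj (inv (conjugator c)) (conj (conjugator c) w))"
    using conj_scal[of c "conj (conjugator c) w" "inv (conjugator c)"] r c conjugator(1)[OF c] by (simp add: spread_def retract_def)
  also have "\<dots> = pscale (1 / \<Phi> c x (inv x) * Phi_tilde G \<Phi> (inv (conjugator c)) (conjugator c) (base c)) w"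
    using conj_conj[of "base c" w "inv (conjugator c)" "conjugator c"] conj_one[of "base c" w] w b c conjugator(1)[OF c] by simp
  finally show ?thesis using x c b conjugator(1)[OF c]
    by (intro exI[of _ "1 / \<Phi> c x (inv x) * Phi_tilde G \<Phi> (inv (conjugator c)) (conjugator c) (base c)"]) simp
qed

lemma spread_inj:
  assumes "x \<in> carrier G" "c \<in> carrier G" "w \<in> block \<one> (base c)" "w' \<in> block \<one> (base c)" "spread x c w = spread x c w'"
  shows "w = w'"
proof -
  have "spread x c (w - w') = 0" "w - w' \<in> block \<one> (base c)"
    using lin_on_diff[OF spread_lin[OF assms(1,2)] block_subspace assms(3,4)] assms
    by (auto intro: fs.subspace_diff[OF block_subspace])
  then obtain a where "a \<noteq> 0" "retract x c 0 = pscale a (w - w')"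
    using retract_spread[OF assms(1,2)] by metis
  then show ?thesis using lin_on_zero[OF retract_lin[OF assms(1,2)] block_subspace] by simp
qed

lemma spread_surj:
  assumes "x \<in> carrier G" "c \<in> carrier G" "m \<in> block x (c \<otimes> x)"
  shows "spread x c (pscale (1 / spread_coeff x c) (retract x c m)) = m"
    "pscale (1 / spread_coeff x c) (retract x c m) \<in> block \<one> (base c)"
  using lin_onD(3)[OF spread_lin[OF assms(1,2)] lin_onD(1)[OF retract_lin[OF assms(1,2)] assms(3)]]
    spread_retract[OF assms] spread_coeff_nz[OF assms(1,2)]
    fs.subspace_scale[OF block_subspace lin_onD(1)[OF retract_lin[OF assms(1,2)] assms(3)]] by auto

text \<open>
  The two actions in terms of the representation on the arrows from the unit to the representative of the class.
\<close>

lemma ract_spread: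
  assumes x: "x \<in> carrier G" and c: "c \<in> carrier G" and w: "w \<in> block \<one> (base c)" and h: "h \<in> carrier G"
  shows "ract (spread x c w) h = pscale (1 / \<Phi> c x h) (spread (x \<otimes> h) c w)"
  using ract_ract[of \<one> c "conj (conjugator c) w" x h] conj_rep_block[OF c w] assms by (simp add: spread_def)

lemma lact_spread:
  assumes x: "x \<in> carrier G" and c: "c \<in> carrier G" and w: "w \<in> block \<one> (base c)" and e: "e \<in> carrier G"
  shows "lact e (spread x c w)
    = pscale (lact_coeff e x c) (spread (e \<otimes> x) (e \<otimes> c \<otimes> inv e) (conj (stab e c) w))"
proof -
  let ?c = "e \<otimes> c \<otimes> inv e"
  note b = base_closed[OF c] and q = conjugator(1)[OF c] and q' = conjugator(1)[of ?c] and z = stab[OF c e]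
  note r = conj_rep_block[OF c w]
  have cl: "?c \<in> carrier G" "conjugator ?c \<in> carrier G" using c e q' by auto
  have eq: "pscale (Phi_tilde G \<Phi> (conjugator ?c) (stab e c) (base c)) (conj (e \<otimes> conjugator c) w) = conj (conjugator ?c) (conj (stab e c) w)"
    using conj_conj[of "base c" w "conjugator ?c" "stab e c"] w b cl z by simp
  have zw: "conj (stab e c) w \<in> block \<one> (base ?c)"
    using arr_conj[of "base c" w "stab e c"] w b z centralizer_conj(1)[OF b z(1)] base_conj[OF c e] by simp
  have eq2: "conj e (conj (conjugator c) w)
      = pscale (Phi_tilde G \<Phi> e (conjugator c) (base c) / Phi_tilde G \<Phi> (conjugator ?c) (stab e c) (base c)) (conj (conjugator ?c) (conj (stab e c) w))"
    unfolding eq[symmetric] using conj_conj[of "base c" w e "conjugator c"] w b q e cl z by simp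
  have "lact e (spread x c w) = pscale (conj_coeff e c x) (ract (conj e (conj (conjugator c) w)) (e \<otimes> x))"
    using lact_via_conj[of c "conj (conjugator c) w" e x] r c e x by (simp add: spread_def)
  also have "\<dots> = pscale (lact_coeff e x c) (ract (conj (conjugator ?c) (conj (stab e c) w)) (e \<otimes> x))"
    unfolding eq2 using ract_scal[of \<one> ?c "conj (conjugator ?c) (conj (stab e c) w)" "e \<otimes> x"] conj_rep_block[OF cl(1) zw] cl e x
    by (simp add: lact_coeff_def)
  finally show ?thesis by (simp add: spread_def)
qed

end

text \<open>
  Equivariant maps between the representations of two bimodules on the arrows from the unit to the class
  representatives, to be extended to a homomorphism of bimodules.
\<close>

locale rep_map = class_reps G \<Phi> R g + src: path_bimodule_reps G \<Phi> R lact ract g + trg: path_bimodule_reps G \<Phi> R lact' ract' g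
  for G :: "('g, 'm) monoid_scheme" (structure) and \<Phi> :: "'g \<Rightarrow> 'g \<Rightarrow> 'g \<Rightarrow> 'k::field"
    and R :: "'g set \<Rightarrow> nat" and g :: "'g set \<Rightarrow> 'g"
    and lact lact' :: "'g \<Rightarrow> ('g hpath \<Rightarrow>\<^sub>0 'k) \<Rightarrow> ('g hpath \<Rightarrow>\<^sub>0 'k)"
    and ract ract' :: "('g hpath \<Rightarrow>\<^sub>0 'k) \<Rightarrow> 'g \<Rightarrow> ('g hpath \<Rightarrow>\<^sub>0 'k)" +
  fixes \<phi> :: "'g set \<Rightarrow> ('g hpath \<Rightarrow>\<^sub>0 'k) \<Rightarrow> ('g hpath \<Rightarrow>\<^sub>0 'k)"
  assumes \<phi>_lin: "C \<in> conj_classes G \<Longrightarrow> lin_on pscale (block \<one> (g C)) (\<phi> C) (block \<one> (g C))"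
    and \<phi>_conj: "C \<in> conj_classes G \<Longrightarrow> e \<in> centralizer G (g C) \<Longrightarrow> w \<in> block \<one> (g C) \<Longrightarrow>
      \<phi> C (src.conj e w) = trg.conj e (\<phi> C w)"
begin

definition spread_map :: "'g \<Rightarrow> 'g \<Rightarrow> ('g hpath \<Rightarrow>\<^sub>0 'k) \<Rightarrow> ('g hpath \<Rightarrow>\<^sub>0 'k)" where
  "spread_map x c m = trg.spread x c (\<phi> (cls c) (pscale (1 / src.spread_coeff x c) (src.retract x c m)))"

definition rep_ext :: "('g hpath \<Rightarrow>\<^sub>0 'k) \<Rightarrow> ('g hpath \<Rightarrow>\<^sub>0 'k)" where
  "rep_ext = ext pscale (\<lambda>p. spread_map (fst p) (fst (stgt P p) \<otimes> inv (fst p)) (bvec p))"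

lemma spread_map_lin:
  assumes "x \<in> carrier G" "c \<in> carrier G"
  shows "lin_on pscale (block x (c \<otimes> x)) (spread_map x c) (block x (c \<otimes> x))"
  unfolding spread_map_def[abs_def]
  by (rule lin_on_comp[OF trg.spread_lin[OF assms] lin_on_comp[OF \<phi>_lin[OF cls_class[OF assms(2)]]
        lin_on_pscale[OF src.retract_lin[OF assms] block_subspace]]])

lemma rep_ext_eq:
  assumes x: "x \<in> carrier G" and c: "c \<in> carrier G" and m: "m \<in> block x (c \<otimes> x)"
  shows "rep_ext m = spread_map x c m"
proof (rule lin_on_eqI[OF m[unfolded block_def] lin_on_subset spread_map_lin[OF x c, unfolded block_def]])
  show "lin pscale rep_ext" unfolding rep_ext_def by (rule lin_ext[OF vector_space_pscale])
  fix b assume "b \<in> arrow_basis x (c \<otimes> x)"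
  then obtain a where "b = (x, [a])" "head Q a = c \<otimes> x" by (rule arrow_basis_cases)
  then show "rep_ext (bvec b) = spread_map x c (bvec b)"
    using x c by (simp add: rep_ext_def vector_space_pscale m_assoc)
qed auto

text \<open>
  The extension is the given map under the identifications of both bimodules.
\<close>

lemma rep_ext_spread:
  assumes x: "x \<in> carrier G" and c: "c \<in> carrier G" and w: "w \<in> block \<one> (base c)"
  shows "rep_ext (src.spread x c w) = trg.spread x c (\<phi> (cls c) w)"
proof -
  note m = src.spread_block[OF x c w]
  note s = src.spread_surj[OF x c m]
  have "pscale (1 / src.spread_coeff x c) (src.retract x c (src.spread x c w)) = w"
    by (rule src.spread_inj[OF x c s(2) w s(1)])
  then show ?thesis by (simp add: rep_ext_eq[OF x c m] spread_map_def)
qed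

lemma block_spread:
  assumes "x \<in> carrier G" "y \<in> carrier G" "m \<in> block x y"
  obtains c w where "c \<in> carrier G" "y = c \<otimes> x" "w \<in> block \<one> (base c)" "m = src.spread x c w"
proof -
  let ?c = "y \<otimes> inv x"
  have c: "?c \<in> carrier G" and y: "y = ?c \<otimes> x" using assms by (simp_all add: m_assoc)
  have m: "m \<in> block x (?c \<otimes> x)" using assms(3) y by simp
  show ?thesis by (rule that[OF c y src.spread_surj(2)[OF assms(1) c m] src.spread_surj(1)[OF assms(1) c m, symmetric]])
qed

lemma rep_ext_lin:
  assumes "x \<in> carrier G" "y \<in> carrier G"
  shows "lin_on pscale (block x y) rep_ext (block x y)"
proof -
  let ?c = "y \<otimes> inv x"
  have c: "?c \<in> carrier G" and y: "?c \<otimes> x = y" using assms by (simp_all add: m_assoc)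
  show ?thesis
  proof (rule lin_on_subset)
    show "lin pscale rep_ext" unfolding rep_ext_def by (rule lin_ext[OF vector_space_pscale])
    show "rep_ext v \<in> block x y" if "v \<in> block x y" for v
      using rep_ext_eq[OF assms(1) c, of v] lin_onD(1)[OF spread_map_lin[OF assms(1) c], of v] y that by simp
  qed
qed

lemma rep_ext_ract:
  assumes h: "h \<in> carrier G" and xy: "x \<in> carrier G" "y \<in> carrier G" and m: "m \<in> block x y"
  shows "rep_ext (ract m h) = ract' (rep_ext m) h"
proof -
  obtain c w where c: "c \<in> carrier G" "y = c \<otimes> x" and w: "w \<in> block \<one> (base c)" and mw: "m = src.spread x c w"
    by (rule block_spread[OF xy m])
  note \<phi>w = lin_onD(1)[OF \<phi>_lin[OF cls_class[OF c(1)]] w]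
  have xh: "x \<otimes> h \<in> carrier G" using xy h by simp
  have "rep_ext (ract m h) = pscale (1 / \<Phi> c x h) (rep_ext (src.spread (x \<otimes> h) c w))"
    unfolding mw src.ract_spread[OF xy(1) c(1) w h]
    by (rule lin_onD(3)[OF rep_ext_lin src.spread_block[OF xh c(1) w]]) (use xh c in auto)
  then show ?thesis
    unfolding mw rep_ext_spread[OF xh c(1) w] rep_ext_spread[OF xy(1) c(1) w]
      trg.ract_spread[OF xy(1) c(1) \<phi>w h] .
qed

lemma rep_ext_lact:
  assumes e: "e \<in> carrier G" and xy: "x \<in> carrier G" "y \<in> carrier G" and m: "m \<in> block x y"
  shows "rep_ext (lact e m) = lact' e (rep_ext m)"
proof -
  obtain c w where c: "c \<in> carrier G" "y = c \<otimes> x" and w: "w \<in> block \<one> (base c)" and mw: "m = src.spread x c w"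
    by (rule block_spread[OF xy m])
  let ?c = "e \<otimes> c \<otimes> inv e"
  note \<phi>w = lin_onD(1)[OF \<phi>_lin[OF cls_class[OF c(1)]] w]
  have cl: "e \<otimes> x \<in> carrier G" "?c \<in> carrier G" using xy e c by auto
  have zw: "src.conj (stab e c) w \<in> block \<one> (base ?c)"
    using src.arr_conj[of "base c" w "stab e c"] w base_closed[OF c(1)] stab[OF c(1) e]
      centralizer_conj(1)[OF base_closed[OF c(1)] stab(1)[OF c(1) e]] base_conj[OF c(1) e] by simp
  have "rep_ext (lact e m) = pscale (lact_coeff e x c) (rep_ext (src.spread (e \<otimes> x) ?c (src.conj (stab e c) w)))"
    unfolding mw src.lact_spread[OF xy(1) c(1) w e]
    by (rule lin_onD(3)[OF rep_ext_lin src.spread_block[OF cl zw]]) (use cl in auto)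
  also have "\<dots> = pscale (lact_coeff e x c) (trg.spread (e \<otimes> x) ?c (trg.conj (stab e c) (\<phi> (cls c) w)))"
    unfolding rep_ext_spread[OF cl zw] cls_conj[OF c(1) e]
    by (simp add: \<phi>_conj[OF cls_class[OF c(1)] stab(1)[OF c(1) e] w])
  also have "\<dots> = lact' e (rep_ext m)"
    unfolding mw rep_ext_spread[OF xy(1) c(1) w] trg.lact_spread[OF xy(1) c(1) \<phi>w e] ..
  finally show ?thesis .
qed

end

context class_reps
begin

text \<open>
  Isomorphisms of the representations extend to bimodule isomorphisms, and these to isomorphisms of structures.
  The inverse is the extension of the inverse isomorphisms.
\<close>

lemma structure_iso_of_arrow_reps:
  assumes H: "H \<in> graded_majid_structures G \<Phi> R" "H' \<in> graded_majid_structures G \<Phi> R"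
    and iso: "\<And>C. C \<in> conj_classes G \<Longrightarrow>
      prep_iso (centralizer G (g C)) (arrow_rep G g R H C) (arrow_rep G g R H' C)"
  shows "(H, H') \<in> structure_iso G \<Phi> R"
proof -
  interpret src: majid_structure G \<Phi> R H by unfold_locales (rule H(1))
  interpret trg: majid_structure G \<Phi> R H' by unfold_locales (rule H(2))
  have "\<forall>C\<in>conj_classes G. \<exists>f. lin_on pscale (block \<one> (g C)) f (block \<one> (g C)) \<and> bij_betw f (block \<one> (g C)) (block \<one> (g C))
      \<and> (\<forall>e\<in>centralizer G (g C). \<forall>v\<in>block \<one> (g C). f (src.bim.conj e v) = trg.bim.conj e (f v))"
  proof
    fix C assume C: "C \<in> conj_classes G"
    note b = base_class(1)[OF C]
    show "\<exists>f. lin_on pscale (block \<one> (g C)) f (block \<one> (g C)) \<and> bij_betw f (block \<one> (g C)) (block \<one> (g C))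
      \<and> (\<forall>e\<in>centralizer G (g C). \<forall>v\<in>block \<one> (g C). f (src.bim.conj e v) = trg.bim.conj e (f v))"
      using iso[OF C] unfolding src.arrow_rep_eq[of g, OF b] trg.arrow_rep_eq[of g, OF b] prep_iso_def case_prod_conv .
  qed
  from bchoice[OF this] obtain \<phi> where \<phi>0: "\<forall>C\<in>conj_classes G. lin_on pscale (block \<one> (g C)) (\<phi> C) (block \<one> (g C))
      \<and> bij_betw (\<phi> C) (block \<one> (g C)) (block \<one> (g C))
      \<and> (\<forall>e\<in>centralizer G (g C). \<forall>v\<in>block \<one> (g C). \<phi> C (src.bim.conj e v) = trg.bim.conj e (\<phi> C v))" ..
  then have \<phi>: "\<And>C. C \<in> conj_classes G \<Longrightarrow> lin_on pscale (block \<one> (g C)) (\<phi> C) (block \<one> (g C))"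
      "\<And>C. C \<in> conj_classes G \<Longrightarrow> bij_betw (\<phi> C) (block \<one> (g C)) (block \<one> (g C))"
      "\<And>C e v. C \<in> conj_classes G \<Longrightarrow> e \<in> centralizer G (g C) \<Longrightarrow> v \<in> block \<one> (g C) \<Longrightarrow>
        \<phi> C (src.bim.conj e v) = trg.bim.conj e (\<phi> C v)"
    by blast+
  let ?\<psi> = "\<lambda>C. inv_into (block \<one> (g C)) (\<phi> C)"
  have \<psi>: "?\<psi> C v \<in> block \<one> (g C)" "\<phi> C (?\<psi> C v) = v" "?\<psi> C (\<phi> C v) = v"
    if "C \<in> conj_classes G" "v \<in> block \<one> (g C)" for C v
    using \<phi>(2)[OF that(1)] that(2) by (auto simp: bij_betw_def inv_into_into f_inv_into_f)
  interpret F: rep_map G \<Phi> R g src.hlact trg.hlact src.hract trg.hract \<phi>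
    by unfold_locales (use \<phi> in auto)
  interpret F': rep_map G \<Phi> R g trg.hlact src.hlact trg.hract src.hract ?\<psi>
  proof (unfold_locales, goal_cases)
    case (1 C)
    then show ?case using lin_on_inverse[OF \<phi>(1,2) block_subspace] by blast
  next
    case (2 C e w)
    note e = centralizer_conj[OF base_class(1)[OF 2(1)] 2(2)]
    have "src.bim.conj e (?\<psi> C w) \<in> block \<one> (g C)"
      using src.bim.arr_conj[of "g C" "?\<psi> C w" e] \<psi>(1)[OF 2(1,3)] e base_class(1)[OF 2(1)] by simp
    then show ?case using \<phi>(3)[OF 2(1,2) \<psi>(1)[OF 2(1,3)]] \<psi>(2,3) 2 by metis
  qed
  interpret B: bimodule_map G \<Phi> R H H' F.rep_ext
    by unfold_locales (use F.rep_ext_lin F.rep_ext_lact F.rep_ext_ract in auto)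
  interpret B': bimodule_map G \<Phi> R H' H F'.rep_ext
    by unfold_locales (use F'.rep_ext_lin F'.rep_ext_lact F'.rep_ext_ract in auto)
  have inv1: "F'.rep_ext (F.rep_ext v) = v" if xy: "x \<in> carrier G" "y \<in> carrier G" "v \<in> block x y" for x y v
  proof -
    obtain c w where c: "c \<in> carrier G" "y = c \<otimes> x" and w: "w \<in> block \<one> (base c)" and v: "v = F.src.spread x c w"
      by (rule F.block_spread[OF xy])
    note C = cls_class[OF c(1)]
    show ?thesis unfolding v F.rep_ext_spread[OF xy(1) c(1) w]
        F'.rep_ext_spread[OF xy(1) c(1) lin_onD(1)[OF \<phi>(1)[OF C] w]] \<psi>(3)[OF C w] ..
  qed
  have inv2: "F.rep_ext (F'.rep_ext v) = v" if xy: "x \<in> carrier G" "y \<in> carrier G" "v \<in> block x y" for x y v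
  proof -
    obtain c w where c: "c \<in> carrier G" "y = c \<otimes> x" and w: "w \<in> block \<one> (base c)" and v: "v = F.trg.spread x c w"
      by (rule F'.block_spread[OF xy])
    note C = cls_class[OF c(1)]
    show ?thesis unfolding v F'.rep_ext_spread[OF xy(1) c(1) w]
        F.rep_ext_spread[OF xy(1) c(1) \<psi>(1)[OF C w]] \<psi>(2)[OF C w] ..
  qed
  have t1: "B'.theta (B.theta v) = v" if "v \<in> free_space (paths Q)" for v
    by (rule theta_inverse[OF B.block_map_axioms B'.block_map_axioms _ that]) (rule inv1)
  have t2: "B.theta (B'.theta v) = v" if "v \<in> free_space (paths Q)" for v
    by (rule theta_inverse[OF B'.block_map_axioms B.block_map_axioms _ that]) (rule inv2)
  have "bij_betw B.theta (space_of H) (space_of H')"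
  proof (rule bij_betw_byWitness[where f' = B'.theta], unfold src.H_coalg trg.H_coalg)
    show "\<forall>a\<in>free_space (paths Q). B'.theta (B.theta a) = a" by (intro ballI t1)
    show "\<forall>a\<in>free_space (paths Q). B.theta (B'.theta a) = a" by (intro ballI t2)
    show "B.theta ` free_space (paths Q) \<subseteq> free_space (paths Q)" by (intro image_subsetI B.theta_paths)
    show "B'.theta ` free_space (paths Q) \<subseteq> free_space (paths Q)" by (intro image_subsetI B'.theta_paths)
  qed
  moreover have "B.theta ` homog H path_length n = homog H' path_length n" for n
    unfolding src.homog_H trg.homog_H
  proof (intro equalityI subsetI)
    fix w assume w: "w \<in> deg_space n"
    show "w \<in> B.theta ` deg_space n"
      using t2[OF hom_in_paths[OF w]] B'.theta_deg[OF w] by (intro image_eqI[of w B.theta "B'.theta w"]) simp_all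
  next
    fix w assume "w \<in> B.theta ` deg_space n"
    then show "w \<in> deg_space n" using B.theta_deg by blast
  qed
  ultimately show ?thesis
    using B.majid_hom_theta B.theta_vertex_space H unfolding structure_iso_def by blast
qed

text \<open>
  An isomorphism of structures restricts to the arrows from the unit to each representative.
\<close>

lemma arrow_reps_of_structure_iso:
  assumes "(H, H') \<in> structure_iso G \<Phi> R" "C \<in> conj_classes G"
  shows "prep_iso (centralizer G (g C)) (arrow_rep G g R H C) (arrow_rep G g R H' C)"
proof -
  have si: "H \<in> graded_majid_structures G \<Phi> R \<and> H' \<in> graded_majid_structures G \<Phi> R
      \<and> (\<exists>\<theta>. majid_hom H H' \<theta> \<and> bij_betw \<theta> (space_of H) (space_of H')
        \<and> (\<forall>n. \<theta> ` homog H path_length n = homog H' path_length n) \<and> (\<forall>v\<in>vertex_space G. \<theta> v = v))"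
    using assms(1) unfolding structure_iso_def mem_Collect_eq case_prod_conv .
  then obtain \<theta> where H: "H \<in> graded_majid_structures G \<Phi> R" "H' \<in> graded_majid_structures G \<Phi> R"
    and \<theta>: "majid_hom H H' \<theta>" "bij_betw \<theta> (space_of H) (space_of H')"
      "\<forall>n. \<theta> ` homog H path_length n = homog H' path_length n" "\<forall>v\<in>vertex_space G. \<theta> v = v"
    by (elim conjE exE) (rule that)
  interpret src: majid_structure G \<Phi> R H by unfold_locales (rule H(1))
  interpret trg: majid_structure G \<Phi> R H' by unfold_locales (rule H(2))
  have sm: "structure_map G \<Phi> R H H' \<theta>"
  proof (intro structure_map.intro structure_map_axioms.intro src.majid_structure_axioms trg.majid_structure_axioms)
    show "majid_hom H H' \<theta>" by (rule \<theta>(1))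
    show "bij_betw \<theta> (space_of H) (space_of H')" by (rule \<theta>(2))
    show "\<theta> ` homog H path_length n = homog H' path_length n" for n by (rule spec[OF \<theta>(3)])
    show "\<theta> v = v" if "v \<in> vertex_space G" for v by (rule bspec[OF \<theta>(4) that])
  qed
  show ?thesis using structure_map.prep_iso_block[OF sm base_class(1)[OF assms(2)]]
    by (simp add: src.arrow_rep_eq[of g, OF base_class(1)[OF assms(2)]]
        trg.arrow_rep_eq[of g, OF base_class(1)[OF assms(2)]])
qed

end

section \<open>The bimodule of a collection of representations\<close>

text \<open>
  Transport of structure along a linear isomorphism.
\<close>

lemma proj_rep_transport:
  assumes "proj_rep G Z \<sigma> (V, \<rho>)" and W: "fs.subspace W" and b: "lin_on pscale W b V" "bij_betw b W V"
    and Z: "\<And>e f. e \<in> Z \<Longrightarrow> f \<in> Z \<Longrightarrow> e \<otimes>\<^bsub>G\<^esub> f \<in> Z"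
  shows "proj_rep G Z \<sigma> (W, \<lambda>e w. inv_into W b (\<rho> e (b w)))"
    "prep_iso Z (W, \<lambda>e w. inv_into W b (\<rho> e (b w))) (V, \<rho>)"
proof -
  have V: "fs.subspace V" and \<rho>l: "\<And>e. e \<in> Z \<Longrightarrow> lin_on pscale V (\<rho> e) V"
    and \<rho>b: "\<And>e. e \<in> Z \<Longrightarrow> bij_betw (\<rho> e) V V" and \<rho>1: "\<And>v. v \<in> V \<Longrightarrow> \<rho> \<one>\<^bsub>G\<^esub> v = v"
    and \<rho>m: "\<And>e f v. e \<in> Z \<Longrightarrow> f \<in> Z \<Longrightarrow> v \<in> V \<Longrightarrow> \<rho> e (\<rho> f v) = pscale (\<sigma> e f) (\<rho> (e \<otimes>\<^bsub>G\<^esub> f) v)"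
    using assms(1) by (auto simp: proj_rep_def)
  let ?i = "inv_into W b"
  have il: "lin_on pscale V ?i W" by (rule lin_on_inverse[OF b W])
  have ib: "bij_betw ?i V W" by (rule bij_betw_inv_into[OF b(2)])
  have bi: "b (?i v) = v" if "v \<in> V" for v using b(2) that by (auto simp: bij_betw_def f_inv_into_f)
  have ibw: "?i (b w) = w" if "w \<in> W" for w using b(2) that by (auto simp: bij_betw_def)
  have bV: "b w \<in> V" if "w \<in> W" for w using lin_onD(1)[OF b(1) that] .
  have \<rho>V: "\<rho> e v \<in> V" if "e \<in> Z" "v \<in> V" for e v using lin_onD(1)[OF \<rho>l that(2)] that by blast
  show "proj_rep G Z \<sigma> (W, \<lambda>e w. ?i (\<rho> e (b w)))"
    unfolding proj_rep_def case_prod_conv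
  proof (intro conjI ballI W)
    fix e assume e: "e \<in> Z"
    show "lin_on pscale W (\<lambda>w. ?i (\<rho> e (b w))) W"
      by (rule lin_on_comp[OF il lin_on_comp[OF \<rho>l[OF e] b(1)]])
    show "bij_betw (\<lambda>w. ?i (\<rho> e (b w))) W W"
      using bij_betw_trans[OF bij_betw_trans[OF b(2) \<rho>b[OF e]] ib] by (simp add: o_def)
  next
    fix w assume "w \<in> W"
    then show "?i (\<rho> \<one>\<^bsub>G\<^esub> (b w)) = w" using \<rho>1 bV ibw by simp
  next
    fix e f w assume ef: "e \<in> Z" "f \<in> Z" and w: "w \<in> W"
    have "?i (\<rho> e (b (?i (\<rho> f (b w))))) = ?i (pscale (\<sigma> e f) (\<rho> (e \<otimes>\<^bsub>G\<^esub> f) (b w)))"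
      using bi[OF \<rho>V[OF ef(2) bV[OF w]]] \<rho>m[OF ef bV[OF w]] by simp
    also have "\<dots> = pscale (\<sigma> e f) (?i (\<rho> (e \<otimes>\<^bsub>G\<^esub> f) (b w)))"
      by (rule lin_onD(3)[OF il \<rho>V[OF Z[OF ef] bV[OF w]]])
    finally show "?i (\<rho> e (b (?i (\<rho> f (b w))))) = pscale (\<sigma> e f) (?i (\<rho> (e \<otimes>\<^bsub>G\<^esub> f) (b w)))" .
  qed
  show "prep_iso Z (W, \<lambda>e w. ?i (\<rho> e (b w))) (V, \<rho>)"
    unfolding prep_iso_def case_prod_conv
    by (intro exI[of _ b] conjI ballI b bi \<rho>V bV)
qed

lemma has_dim_free_space:
  assumes "finite B" shows "has_dim (free_space B :: ('b \<Rightarrow>\<^sub>0 'k::field) set) (card B)"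
  unfolding has_dim_def
proof (intro exI[of _ "bvec ` B"] conjI)
  have inj: "inj_on (bvec :: 'b \<Rightarrow> ('b \<Rightarrow>\<^sub>0 'k)) B"
    by (rule inj_onI) (metis lookup_single_eq lookup_single_not_eq one_neq_zero)
  show "finite (bvec ` B :: ('b \<Rightarrow>\<^sub>0 'k) set)" using assms by simp
  show "card (bvec ` B :: ('b \<Rightarrow>\<^sub>0 'k) set) = card B" using inj by (rule card_image)
  show "fs.independent (bvec ` B :: ('b \<Rightarrow>\<^sub>0 'k) set)"
  proof (rule fs.independent_if_scalars_zero)
    fix f :: "('b \<Rightarrow>\<^sub>0 'k) \<Rightarrow> 'k" and x :: "'b \<Rightarrow>\<^sub>0 'k"
    assume s: "(\<Sum>x\<in>bvec ` B. pscale (f x) x) = (0 :: 'b \<Rightarrow>\<^sub>0 'k)" and x: "x \<in> bvec ` B"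
    obtain b where b: "b \<in> B" "x = bvec b" using x by blast
    have "0 = Poly_Mapping.lookup (\<Sum>x\<in>bvec ` B. pscale (f x) x :: 'b \<Rightarrow>\<^sub>0 'k) b" using s by simp
    also have "\<dots> = (\<Sum>a\<in>B. if a = b then f (bvec a) else 0)"
      by (simp add: sum.reindex[OF inj] lookup_sum lookup_single when_def if_distrib cong: if_cong)
    also have "\<dots> = f x" using assms b by simp
    finally show "f x = 0" by simp
  qed (use assms in simp)
  show "fs.span (bvec ` B) = (free_space B :: ('b \<Rightarrow>\<^sub>0 'k) set)"
  proof (rule fs.span_unique)
    show "bvec ` B \<subseteq> (free_space B :: ('b \<Rightarrow>\<^sub>0 'k) set)" by auto
    show "fs.subspace (free_space B :: ('b \<Rightarrow>\<^sub>0 'k) set)" by (rule subspace_free_space)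
    show "free_space B \<subseteq> T" if "bvec ` B \<subseteq> T" "fs.subspace T" for T :: "('b \<Rightarrow>\<^sub>0 'k) set"
    proof
      fix v :: "'b \<Rightarrow>\<^sub>0 'k" assume v: "v \<in> free_space B"
      have "(\<Sum>b\<in>Poly_Mapping.keys v. pscale (Poly_Mapping.lookup v b) (bvec b)) \<in> T"
        using v that by (intro fs.subspace_sum fs.subspace_scale) (auto simp: free_space_def)
      then show "v \<in> T" by (subst basis_expansion)
    qed
  qed
qed

text \<open>
  A choice of basis, as an isomorphism from a standard space.
\<close>

lemma has_dim_free_space_bij:
  assumes "has_dim (V :: ('b \<Rightarrow>\<^sub>0 'k::field) set) n"
  shows "\<exists>b. lin_on pscale (free_space {..<n}) b V \<and> bij_betw b (free_space {..<n} :: (nat \<Rightarrow>\<^sub>0 'k) set) V"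
proof -
  obtain B where B: "finite B" "card B = n" "fs.independent B" "fs.span B = V"
    using assms by (auto simp: has_dim_def)
  obtain h where h: "bij_betw h {..<n} B" using ex_bij_betw_nat_finite[OF B(1)] B(2) by (auto simp: atLeast0LessThan)
  let ?b = "ext pscale h :: (nat \<Rightarrow>\<^sub>0 'k) \<Rightarrow> _"
  have hB: "h i \<in> B" if "i < n" for i using h that by (auto simp: bij_betw_def)
  have sum: "?b v = (\<Sum>i<n. pscale (Poly_Mapping.lookup v i) (h i))" if "v \<in> free_space {..<n}" for v
    by (rule ext_superset[OF vector_space_pscale]) (use that in \<open>auto simp: free_space_def\<close>)
  have l: "lin_on pscale (free_space {..<n}) ?b V"
    by (rule lin_on_freeI[OF lin_ext[OF vector_space_pscale]])
      (use B hB in \<open>auto simp: fs.subspace_span vector_space_pscale intro: fs.span_base\<close>)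
  have "inj_on ?b (free_space {..<n})"
  proof (rule inj_onI)
    fix u v :: "nat \<Rightarrow>\<^sub>0 'k" assume uv: "u \<in> free_space {..<n}" "v \<in> free_space {..<n}" "?b u = ?b v"
    have d: "u - v \<in> free_space {..<n}" using uv by (simp add: free_space_diff)
    let ?g = "inv_into {..<n} h" let ?c = "\<lambda>x. Poly_Mapping.lookup (u - v) (?g x)"
    have gh: "?g (h i) = i" if "i < n" for i using h that by (auto simp: bij_betw_def)
    have "0 = ?b (u - v)" using lin_on_diff[OF l subspace_free_space uv(1,2)] uv(3) by simp
    also have "\<dots> = (\<Sum>i<n. pscale (?c (h i)) (h i))" unfolding sum[OF d] by (rule sum.cong) (auto simp: gh)
    also have "\<dots> = (\<Sum>x\<in>B. pscale (?c x) x)" by (rule sum.reindex_bij_betw[OF h])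
    finally have "?c x = 0" if "x \<in> B" for x
      using fs.independentD[OF B(3,1) subset_refl _ that, of ?c] by simp
    then have "Poly_Mapping.lookup (u - v) i = 0" if "i < n" for i using gh hB that by metis
    then have "Poly_Mapping.lookup (u - v) i = 0" for i using d by (cases "i < n") (auto simp: free_space_iff)
    then have "u - v = 0" by (intro poly_mapping_eqI) simp
    then show "u = v" by simp
  qed
  moreover have "?b ` free_space {..<n} = V"
  proof
    show "?b ` free_space {..<n} \<subseteq> V" using lin_onD(1)[OF l] by auto
    have "fs.span B \<subseteq> ?b ` free_space {..<n}"
    proof (rule fs.span_minimal)
      show "B \<subseteq> ?b ` free_space {..<n}"
      proof
        fix x assume "x \<in> B"
        then obtain i where "i < n" "x = h i" using h by (auto simp: bij_betw_def)
        then show "x \<in> ?b ` free_space {..<n}" by (intro image_eqI[of _ _ "bvec i"]) (auto simp: vector_space_pscale)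
      qed
      show "fs.subspace (?b ` free_space {..<n})"
      proof (rule fs.subspaceI)
        show "0 \<in> ?b ` free_space {..<n}" by (intro image_eqI[of _ _ 0]) (auto simp: ext_def)
        fix c x y assume "x \<in> ?b ` free_space {..<n}" "y \<in> ?b ` free_space {..<n}"
        then obtain u v where u: "u \<in> free_space {..<n}" "x = ?b u" and v: "v \<in> free_space {..<n}" "y = ?b v" by blast
        show "x + y \<in> ?b ` free_space {..<n}"
          using lin_onD(2)[OF l u(1) v(1)] free_space_add[OF u(1) v(1)] u(2) v(2) by (metis imageI)
        show "pscale c x \<in> ?b ` free_space {..<n}"
          using lin_onD(3)[OF l u(1)] free_space_pscale[OF u(1)] u(2) by (metis imageI)
      qed
    qed
    then show "V \<subseteq> ?b ` free_space {..<n}" using B by simp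
  qed
  ultimately show ?thesis using l by (auto simp: bij_betw_def)
qed

context class_reps
begin

text \<open>
  The standard space for the class of \<open>c\<close>, and the identification of it with the arrows from \<open>x\<close> to \<open>c x\<close> by
  their numbers.
\<close>

abbreviation fibre :: "'g \<Rightarrow> (nat \<Rightarrow>\<^sub>0 'k) set" where
  "fibre c \<equiv> free_space {..<R (cls c)}"

definition emb :: "'g \<Rightarrow> 'g \<Rightarrow> (nat \<Rightarrow>\<^sub>0 'k) \<Rightarrow> ('g hpath \<Rightarrow>\<^sub>0 'k)" where
  "emb x c = ext pscale (\<lambda>i. bvec (x, [(x, c, i)]))"

lemma emb_bvec [simp]: "emb x c (bvec i) = bvec (x, [(x, c, i)])"
  by (simp add: emb_def vector_space_pscale)

lemma lin_emb: "lin pscale (emb x c)"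
  unfolding emb_def by (rule lin_ext[OF vector_space_pscale])

lemma lin_emb': "lin_on pscale V (emb x c) UNIV"
  by (rule lin_on_subset[OF lin_emb]) simp_all

lemma arrow_basis_eq:
  assumes "x \<in> carrier G" "c \<in> carrier G"
  shows "arrow_basis x (c \<otimes> x) = (\<lambda>i. (x, [(x, c, i)])) ` {..<R (cls c)}"
  using assms by (auto simp: arrow_basis_def arcs_iff_cls)

lemma emb_bij:
  assumes "x \<in> carrier G" "c \<in> carrier G"
  shows "bij_betw (emb x c) (fibre c) (block x (c \<otimes> x))"
  unfolding block_def arrow_basis_eq[OF assms] emb_def
  by (rule relabel_bij) (auto simp: bij_betw_def inj_on_def)

lemma emb_lin:
  assumes "x \<in> carrier G" "c \<in> carrier G"
  shows "lin_on pscale (fibre c) (emb x c) (block x (c \<otimes> x))"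
  using emb_bij[OF assms] by (intro lin_on_subset[OF lin_emb]) (auto simp: bij_betw_def)

end

text \<open>
  Projective representations on the standard spaces.  Copying the formulas \<open>ract_spread\<close> and \<open>lact_spread\<close> with the
  identification by numbers in place of \<open>spread\<close> gives the two actions of the bimodule.
\<close>

locale rep_data = class_reps G \<Phi> R g
  for G :: "('g, 'm) monoid_scheme" (structure) and \<Phi> :: "'g \<Rightarrow> 'g \<Rightarrow> 'g \<Rightarrow> 'k::field"
    and R :: "'g set \<Rightarrow> nat" and g :: "'g set \<Rightarrow> 'g" +
  fixes \<rho> :: "'g set \<Rightarrow> 'g \<Rightarrow> (nat \<Rightarrow>\<^sub>0 'k) \<Rightarrow> (nat \<Rightarrow>\<^sub>0 'k)"
  assumes \<rho>_rep: "C \<in> conj_classes G \<Longrightarrow>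
    proj_rep G (centralizer G (g C)) (\<lambda>e f. Phi_tilde G \<Phi> e f (g C)) (free_space {..<R C}, \<rho> C)"
begin

definition rlact :: "'g \<Rightarrow> ('g hpath \<Rightarrow>\<^sub>0 'k) \<Rightarrow> ('g hpath \<Rightarrow>\<^sub>0 'k)" where
  "rlact e = ext pscale (\<lambda>p. let (x, c, i) = hd (snd p) in
     pscale (lact_coeff e x c) (emb (e \<otimes> x) (e \<otimes> c \<otimes> inv e) (\<rho> (cls c) (stab e c) (bvec i))))"

definition rract :: "('g hpath \<Rightarrow>\<^sub>0 'k) \<Rightarrow> 'g \<Rightarrow> ('g hpath \<Rightarrow>\<^sub>0 'k)" where
  "rract m h = ext pscale (\<lambda>p. let (x, c, i) = hd (snd p) in
     pscale (1 / \<Phi> c x h) (emb (x \<otimes> h) c (bvec i))) m"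

lemma
  assumes c: "c \<in> carrier G" and e: "e \<in> centralizer G (base c)"
  shows \<rho>_lin: "lin_on pscale (fibre c) (\<rho> (cls c) e) (fibre c)"
    and \<rho>_mult: "f \<in> centralizer G (base c) \<Longrightarrow> w \<in> fibre c \<Longrightarrow>
      \<rho> (cls c) e (\<rho> (cls c) f w) = pscale (Phi_tilde G \<Phi> e f (base c)) (\<rho> (cls c) (e \<otimes> f) w)"
    and \<rho>_one: "w \<in> fibre c \<Longrightarrow> \<rho> (cls c) \<one> w = w"
  using \<rho>_rep[OF cls_class[OF c]] e by (auto simp: proj_rep_def)

lemma rlact_emb:
  assumes x: "x \<in> carrier G" and c: "c \<in> carrier G" and e: "e \<in> carrier G" and w: "w \<in> fibre c"
  shows "rlact e (emb x c w) = pscale (lact_coeff e x c) (emb (e \<otimes> x) (e \<otimes> c \<otimes> inv e) (\<rho> (cls c) (stab e c) w))"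
proof (rule lin_on_eqI[where f = "\<lambda>w. rlact e (emb x c w)", OF w])
  show "lin_on pscale (fibre c) (\<lambda>w. rlact e (emb x c w)) UNIV"
    unfolding rlact_def by (rule lin_on_subset[OF lin_ext_comp[OF vector_space_pscale lin_emb]]) auto
  show "lin_on pscale (fibre c) (\<lambda>w. pscale (lact_coeff e x c) (emb (e \<otimes> x) (e \<otimes> c \<otimes> inv e) (\<rho> (cls c) (stab e c) w))) UNIV"
    by (rule lin_on_pscale[OF lin_on_comp[OF lin_emb' \<rho>_lin[OF c stab(1)[OF c e]]]]) simp
qed (simp add: rlact_def vector_space_pscale)

lemma rract_emb:
  assumes x: "x \<in> carrier G" and c: "c \<in> carrier G" and h: "h \<in> carrier G" and w: "w \<in> fibre c"
  shows "rract (emb x c w) h = pscale (1 / \<Phi> c x h) (emb (x \<otimes> h) c w)"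
proof (rule lin_on_eqI[where f = "\<lambda>w. rract (emb x c w) h", OF w])
  show "lin_on pscale (fibre c) (\<lambda>w. rract (emb x c w) h) UNIV"
    unfolding rract_def by (rule lin_on_subset[OF lin_ext_comp[OF vector_space_pscale lin_emb]]) auto
  show "lin_on pscale (fibre c) (\<lambda>w. pscale (1 / \<Phi> c x h) (emb (x \<otimes> h) c w)) UNIV"
    by (rule lin_on_pscale[OF lin_emb']) simp
qed (simp add: rract_def vector_space_pscale)

lemma block_emb:
  assumes "x \<in> carrier G" "y \<in> carrier G" "v \<in> block x y"
  obtains c w where "c \<in> carrier G" "y = c \<otimes> x" "w \<in> fibre c" "v = emb x c w"
proof -
  let ?c = "y \<otimes> inv x"
  have c: "?c \<in> carrier G" and y: "y = ?c \<otimes> x" using assms by (simp_all add: m_assoc)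
  have "v \<in> emb x ?c ` fibre ?c" using emb_bij[OF assms(1) c] assms(3) y by (simp add: bij_betw_def)
  then show ?thesis using that[OF c y] by blast
qed

lemma stab_mult:
  assumes c: "c \<in> carrier G" and e: "e \<in> carrier G" and f: "f \<in> carrier G"
  shows "stab e (f \<otimes> c \<otimes> inv f) \<otimes> stab f c = stab (e \<otimes> f) c"
proof -
  have cl: "conjugator (f \<otimes> c \<otimes> inv f) \<in> carrier G" "conjugator c \<in> carrier G" "conjugator (e \<otimes> (f \<otimes> (c \<otimes> (inv f \<otimes> inv e)))) \<in> carrier G"
    using c e f conjugator(1) by auto
  then show ?thesis using c e f by (simp add: stab_def group_simps)
qed

text \<open>
  The scalars in \<open>lact_coeff\<close> satisfy the twisted multiplicativity that associativity of the left action requires.  The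
  \<open>conj_coeff\<close> factors contribute \<open>\<Phi>~(e, f, c)\<close> by \<open>conj_coeff_mult\<close>, and three instances of the cocycle law
  replace this value at \<open>c\<close> by values at the representative of its class.
\<close>

lemma lact_coeff_mult:
  assumes c: "c \<in> carrier G" and e: "e \<in> carrier G" and f: "f \<in> carrier G" and x: "x \<in> carrier G"
  shows "\<Phi> e f x * lact_coeff f x c * lact_coeff e (f \<otimes> x) (f \<otimes> c \<otimes> inv f)
      * Phi_tilde G \<Phi> (stab e (f \<otimes> c \<otimes> inv f)) (stab f c) (base c)
    = \<Phi> e f (c \<otimes> x) * lact_coeff (e \<otimes> f) x c"
proof -
  let ?c = "f \<otimes> c \<otimes> inv f" let ?d = "e \<otimes> ?c \<otimes> inv e" let ?T = "Phi_tilde G \<Phi>" let ?b = "base c"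
  have c': "?c \<in> carrier G" "?d \<in> carrier G" using c e f by auto
  have d: "(e \<otimes> f) \<otimes> c \<otimes> inv (e \<otimes> f) = ?d" using c e f by (simp add: group_simps)
  note b = base_closed[OF c] and bc = base_conj[OF c f]
  note q = conjugator[OF c] and q' = conjugator[OF c'(1), unfolded bc] and q'' = conjugator(1)[OF c'(2)]
  note zf = stab[OF c f] and ze = stab[OF c'(1) e, unfolded bc]
  have P1: "?T f (conjugator c) ?b * ?T e (f \<otimes> conjugator c) ?b = ?T e f c * ?T (e \<otimes> f) (conjugator c) ?b"
    using Phi_tilde_cocycle[OF b e f q(1)] q(2) by simp
  have P2: "?T (conjugator ?c) (stab f c) ?b * ?T e (f \<otimes> conjugator c) ?b = ?T e (conjugator ?c) ?b * ?T (e \<otimes> conjugator ?c) (stab f c) ?b"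
    using Phi_tilde_cocycle[OF b e q'(1) zf(3)] zf(2) centralizer_conj(1)[OF b zf(1)] by simp
  have P3: "?T (stab e ?c) (stab f c) ?b * ?T (conjugator ?d) (stab (e \<otimes> f) c) ?b
      = ?T (conjugator ?d) (stab e ?c) ?b * ?T (e \<otimes> conjugator ?c) (stab f c) ?b"
    using Phi_tilde_cocycle[OF b q'' ze(3) zf(3)] ze(2) centralizer_conj(1)[OF b zf(1)] stab_mult[OF c e f] by simp
  have L: "\<Phi> e f x * conj_coeff f c x * conj_coeff e ?c (f \<otimes> x) * ?T e f c = \<Phi> e f (c \<otimes> x) * conj_coeff (e \<otimes> f) c x"
    by (rule conj_coeff_mult[OF c e f x])
  \<comment> \<open>The elimination of the two values that neighbouring instances share, with all scalars abstracted.\<close>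
  have field: "F * (l1 * t1 / t2) * (l2 * t3 / t4) * t5 = F' * (l3 * t6 / t7)"
    if "F * l1 * l2 * t0 = F' * l3" "t1 * y1 = t0 * t6" "t2 * y1 = t3 * y2" "t5 * t7 = t4 * y2"
      "t0 \<noteq> 0" "t2 \<noteq> 0" "t4 \<noteq> 0" "t7 \<noteq> 0" "y1 \<noteq> 0" "y2 \<noteq> 0"
    for F F' l1 l2 l3 t0 t1 t2 t3 t4 t5 t6 t7 y1 y2 :: 'k
  proof -
    have e: "t1 = t0 * t6 / y1" "t3 = t2 * y1 / y2" "t5 = t4 * y2 / t7"
      using that by (simp_all add: field_simps)
    have "F * (l1 * t1 / t2) * (l2 * t3 / t4) * t5 = (F * l1 * l2 * t0) * t6 / t7"
      unfolding e using that(5-) by (simp add: mult.assoc mult.left_commute)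
    then show ?thesis unfolding that(1) by simp
  qed
  have cl: "conjugator c \<in> carrier G" "conjugator ?c \<in> carrier G" "conjugator ?d \<in> carrier G" "stab f c \<in> carrier G" "stab e ?c \<in> carrier G"
    "stab (e \<otimes> f) c \<in> carrier G" using q q' q'' zf ze stab(3)[OF c, of "e \<otimes> f"] e f by auto
  show ?thesis
    unfolding lact_coeff_def d bc
    by (rule field[OF L P1 P2 P3]) (use cl c e f x b in auto)
qed

text \<open>
  The multiplicativity of the representation enters in the associativity of the left action; the other two laws
  are consequences of the cocycle identity.
\<close>

lemma path_bimodule_rep: "path_bimodule G \<Phi> R rlact rract"
proof (unfold_locales, goal_cases)
  case (3 x y v) then show ?case by simp
next
  case (4 x y v) then show ?case by simp
next
  case (5 x y v a) then show ?case using fs.subspace_scale[OF block_subspace] by blast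
next
  case (6 x y v e)
  then obtain c w where c: "c \<in> carrier G" "y = c \<otimes> x" "w \<in> fibre c" "v = emb x c w" by (elim conjE) (rule block_emb)
  have "emb (e \<otimes> x) (e \<otimes> c \<otimes> inv e) (\<rho> (cls c) (stab e c) w) \<in> block (e \<otimes> x) (e \<otimes> c \<otimes> inv e \<otimes> (e \<otimes> x))"
    using lin_onD(1)[OF emb_lin, of "e \<otimes> x" "e \<otimes> c \<otimes> inv e"] lin_onD(1)[OF \<rho>_lin[OF c(1) stab(1)] c(3), of e]
      6 c(1) cls_conj[OF c(1), of e] by simp
  then show ?case using 6 c fs.subspace_scale[OF block_subspace] rlact_emb[of x c e w] by (simp add: m_assoc)
next
  case (7 x y v h)
  then obtain c w where c: "c \<in> carrier G" "y = c \<otimes> x" "w \<in> fibre c" "v = emb x c w" by (elim conjE) (rule block_emb)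
  have "emb (x \<otimes> h) c w \<in> block (x \<otimes> h) (c \<otimes> (x \<otimes> h))"
    using lin_onD(1)[OF emb_lin c(3), of "x \<otimes> h"] 7 c by simp
  then show ?case using 7 c fs.subspace_scale[OF block_subspace] rract_emb[of x c h w] by (simp add: m_assoc)
next
  case (8 x y v e a)
  show ?case unfolding rlact_def by (rule lin_onD(3)[OF lin_ext[OF vector_space_pscale]]) simp
next
  case (9 x y v e a)
  show ?case unfolding rract_def by (rule lin_onD(3)[OF lin_ext[OF vector_space_pscale]]) simp
next
  \<comment> \<open>Associativity of the left action.\<close>
  case (10 x y v e f)
  then obtain c w where c: "c \<in> carrier G" "y = c \<otimes> x" "w \<in> fibre c" "v = emb x c w" by (elim conjE) (rule block_emb)
  from 10 have cl: "x \<in> carrier G" "e \<in> carrier G" "f \<in> carrier G" by auto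
  let ?c = "f \<otimes> c \<otimes> inv f"
  have c': "?c \<in> carrier G" "f \<otimes> x \<in> carrier G" using c cl by auto
  have cc: "cls ?c = cls c" by (rule cls_conj[OF c(1) cl(3)])
  have fw: "\<rho> (cls c) (stab f c) w \<in> fibre ?c" using lin_onD(1)[OF \<rho>_lin[OF c(1) stab(1)[OF c(1) cl(3)]] c(3)] cc by simp
  have d: "e \<otimes> ?c \<otimes> inv e = (e \<otimes> f) \<otimes> c \<otimes> inv (e \<otimes> f)" using c cl by (simp add: group_simps)
  let ?u = "emb (e \<otimes> (f \<otimes> x)) ((e \<otimes> f) \<otimes> c \<otimes> inv (e \<otimes> f)) (\<rho> (cls c) (stab (e \<otimes> f) c) w)"
  have rl: "rlact e (pscale a u) = pscale a (rlact e u)" for a u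
    unfolding rlact_def by (rule lin_onD(3)[OF lin_ext[OF vector_space_pscale]]) simp
  have "\<rho> (cls c) (stab e ?c) (\<rho> (cls c) (stab f c) w)
      = pscale (Phi_tilde G \<Phi> (stab e ?c) (stab f c) (base c)) (\<rho> (cls c) (stab (e \<otimes> f) c) w)"
    using \<rho>_mult[OF c(1) _ stab(1)[OF c(1) cl(3)] c(3), of "stab e ?c"] stab(1)[OF c'(1) cl(2)] stab_mult[OF c(1) cl(2,3)] cc
    by simp
  then have "rlact e (rlact f v) = pscale (lact_coeff f x c * lact_coeff e (f \<otimes> x) ?c
      * Phi_tilde G \<Phi> (stab e ?c) (stab f c) (base c)) ?u"
    unfolding c(4) rlact_emb[OF cl(1) c(1) cl(3) c(3)] rl rlact_emb[OF c'(2,1) cl(2) fw] cc d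
    using lin_onD(3)[OF lin_emb, of _ "e \<otimes> (f \<otimes> x)" "(e \<otimes> f) \<otimes> c \<otimes> inv (e \<otimes> f)"] by (simp add: mult.assoc)
  moreover have "rlact (e \<otimes> f) v = pscale (lact_coeff (e \<otimes> f) x c) ?u"
    unfolding c(4) using rlact_emb[OF cl(1) c(1) _ c(3), of "e \<otimes> f"] cl by (simp add: m_assoc)
  ultimately show ?case using lact_coeff_mult[OF c(1) cl(2,3,1)] c(2) by (simp add: mult.assoc)
next
  \<comment> \<open>Associativity of the right action.\<close>
  case (11 x y v e f)
  then obtain c w where c: "c \<in> carrier G" "y = c \<otimes> x" "w \<in> fibre c" "v = emb x c w" by (elim conjE) (rule block_emb)
  from 11 have cl: "x \<in> carrier G" "e \<in> carrier G" "f \<in> carrier G" by auto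
  have rr: "rract (pscale a u) f = pscale a (rract u f)" for a u
    unfolding rract_def by (rule lin_onD(3)[OF lin_ext[OF vector_space_pscale]]) simp
  have p: "\<Phi> x e f / \<Phi> c x (e \<otimes> f) = \<Phi> (c \<otimes> x) e f / (\<Phi> c x e * \<Phi> c (x \<otimes> e) f)"
    using Phi_cocycle[OF c(1) cl] c(1) cl by (simp add: field_simps)
  have xe: "x \<otimes> e \<in> carrier G" using cl by simp
  show ?case
    unfolding c(4) rract_emb[OF cl(1) c(1) cl(2) c(3)] rr rract_emb[OF xe c(1) cl(3) c(3)]
      rract_emb[OF cl(1) c(1) m_closed[OF cl(2,3)] c(3)]
    using p c cl by (simp add: m_assoc)
next
  \<comment> \<open>Associativity between the two actions.\<close>
  case (12 x y v e f)
  then obtain c w where c: "c \<in> carrier G" "y = c \<otimes> x" "w \<in> fibre c" "v = emb x c w" by (elim conjE) (rule block_emb)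
  from 12 have cl: "x \<in> carrier G" "e \<in> carrier G" "f \<in> carrier G" by auto
  let ?c = "e \<otimes> c \<otimes> inv e"
  have rl: "rlact e (pscale a u) = pscale a (rlact e u)" for a u
    unfolding rlact_def by (rule lin_onD(3)[OF lin_ext[OF vector_space_pscale]]) simp
  have rr: "rract (pscale a u) f = pscale a (rract u f)" for a u
    unfolding rract_def by (rule lin_onD(3)[OF lin_ext[OF vector_space_pscale]]) simp
  have c': "?c \<in> carrier G" "e \<otimes> x \<in> carrier G" "x \<otimes> f \<in> carrier G" using c cl by auto
  have ew: "\<rho> (cls c) (stab e c) w \<in> fibre ?c"
    using lin_onD(1)[OF \<rho>_lin[OF c(1) stab(1)[OF c(1) cl(2)]] c(3)] cls_conj[OF c(1) cl(2)] by simp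
  have 1: "\<Phi> e (c \<otimes> x) f = \<Phi> (e \<otimes> c) x f * \<Phi> e c (x \<otimes> f) / (\<Phi> e c x * \<Phi> c x f)"
    using Phi_cocycle[OF cl(2) c(1) cl(1,3)] c(1) cl by (simp add: field_simps)
  have 2: "\<Phi> ?c (e \<otimes> x) f = \<Phi> (e \<otimes> c) x f * \<Phi> ?c e (x \<otimes> f) / (\<Phi> ?c e x * \<Phi> e x f)"
    using Phi_cocycle[OF c'(1) cl(2,1,3)] c(1) c' cl by (simp add: field_simps m_assoc)
  have "\<Phi> e x f * (1 / \<Phi> c x f * lact_coeff e (x \<otimes> f) c) = \<Phi> e (c \<otimes> x) f * (lact_coeff e x c * (1 / \<Phi> ?c (e \<otimes> x) f))"
    unfolding 1 2 lact_coeff_def conj_coeff_def using c(1) c' cl by (simp add: field_simps)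
  then show ?case
    unfolding c(4) rract_emb[OF cl(1) c(1) cl(3) c(3)] rl rlact_emb[OF c'(3) c(1) cl(2) c(3)]
      rlact_emb[OF cl(1) c(1) cl(2) c(3)] rr rract_emb[OF c'(2,1) cl(3) ew]
    using c(1,2) cl by (simp add: m_assoc)
next
  case (13 x y v)
  then obtain c w where c: "c \<in> carrier G" "y = c \<otimes> x" "w \<in> fibre c" "v = emb x c w" by (elim conjE) (rule block_emb)
  have q: "conjugator c \<in> carrier G" by (rule conjugator(1)[OF c(1)])
  have "stab \<one> c = \<one>" using q c(1) by (simp add: stab_def)
  moreover have "lact_coeff \<one> x c = 1" using 13 c(1) q base_closed[OF c(1)] \<open>stab \<one> c = \<one>\<close> by (simp add: lact_coeff_def conj_coeff_def)
  ultimately show ?case using rlact_emb[OF _ c(1) one_closed c(3), of x] 13 c(1) \<rho>_one[OF c(1) _ c(3)]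
      centralizer_closed(1)[OF base_closed[OF c(1)]] by (simp add: c(4))
next
  case (14 x y v)
  then obtain c w where c: "c \<in> carrier G" "y = c \<otimes> x" "w \<in> fibre c" "v = emb x c w" by (elim conjE) (rule block_emb)
  show ?case using rract_emb[OF _ c(1) one_closed c(3), of x] 14 c(1) by (simp add: c(4))
next
  case (15 e x y u v)
  show ?case unfolding rlact_def by (rule lin_onD(2)[OF lin_ext[OF vector_space_pscale]]) simp_all
next
  case (16 e x y u v)
  show ?case unfolding rract_def by (rule lin_onD(2)[OF lin_ext[OF vector_space_pscale]]) simp_all
qed (simp_all)

sublocale bim: path_bimodule G \<Phi> R rlact rract
  by (rule path_bimodule_rep)

text \<open>
  At the representative all conjugators are the unit, and the remaining scalar of the left action is cancelled by the one of the
  right action.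
\<close>

lemma conj_emb:
  assumes C: "C \<in> conj_classes G" and e: "e \<in> centralizer G (g C)" and w: "w \<in> free_space {..<R C}"
  shows "bim.conj e (emb \<one> (g C) w) = emb \<one> (g C) (\<rho> C e w)"
proof -
  note b = base_class[OF C] and ec = centralizer_conj[OF base_class(1)[OF C] e]
  have r: "conjugator (g C) = \<one>" using b by (simp add: conjugator_def)
  have s: "stab e (g C) = e" using ec r b by (simp add: stab_def)
  have l: "lact_coeff e \<one> (g C) = \<Phi> (g C) e (inv e)"
    using ec b r s by (simp add: lact_coeff_def conj_coeff_def)
  have fw: "\<rho> C e w \<in> free_space {..<R C}" using lin_onD(1)[OF \<rho>_lin[OF b(1), of e], of w] e w b by simp
  have "rlact e (emb \<one> (g C) w) = pscale (\<Phi> (g C) e (inv e)) (emb e (g C) (\<rho> C e w))"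
    using rlact_emb[OF one_closed b(1) ec(2), of w] w b ec by (simp add: l s)
  moreover have "rract (emb e (g C) (\<rho> C e w)) (inv e) = pscale (1 / \<Phi> (g C) e (inv e)) (emb \<one> (g C) (\<rho> C e w))"
    using rract_emb[OF ec(2) b(1) inv_closed[OF ec(2)], of "\<rho> C e w"] fw b ec by simp
  moreover have "rract (pscale a u) f = pscale a (rract u f)" for a u f
    unfolding rract_def by (rule lin_onD(3)[OF lin_ext[OF vector_space_pscale]]) simp
  ultimately show ?thesis using b ec by (simp add: bim.conj_def)
qed

text \<open>
  The bimodule of the structure built from a bimodule is the original one, so the representation is recovered.
\<close>

theorem structure_of_reps:
  assumes C: "C \<in> conj_classes G"
  shows "prep_iso (centralizer G (g C)) (free_space {..<R C}, \<rho> C) (arrow_rep G g R bim.majid_of C)"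
proof -
  interpret H: majid_structure G \<Phi> R bim.majid_of by unfold_locales (rule bim.majid_of_structure)
  note b = base_class[OF C]
  have conj_eq: "H.bim.conj e v = bim.conj e v" if "e \<in> carrier G" "v \<in> block \<one> (g C)" for e v
  proof -
    have l: "rlact e v \<in> block e (e \<otimes> g C)" using bim.arr_lact[of \<one> "g C" v e] that b by simp
    show ?thesis
      using bim.mul_lact[OF that(1) one_closed b(1) that(2)]
        bim.mul_ract[OF inv_closed[OF that(1)] that(1) _ l] that b
      by (simp add: H.bim.conj_def bim.conj_def H.hlact_def H.hract_def)
  qed
  have e1: "lin_on pscale (free_space {..<R C}) (emb \<one> (g C)) (block \<one> (g C))"
    and e2: "bij_betw (emb \<one> (g C)) (free_space {..<R C}) (block \<one> (g C))"
    using emb_lin[OF one_closed b(1)] emb_bij[OF one_closed b(1)] b by simp_all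
  have "emb \<one> (g C) (\<rho> C e w) = H.bim.conj e (emb \<one> (g C) w)"
    if "e \<in> centralizer G (g C)" "w \<in> free_space {..<R C}" for e w
    using conj_emb[OF C that] conj_eq[OF centralizer_conj(2)[OF b(1) that(1)] lin_onD(1)[OF e1 that(2)]] by simp
  then show ?thesis
    unfolding H.arrow_rep_eq[of g, OF b(1)] prep_iso_def case_prod_conv using e1 e2 by blast
qed

end

section \<open>The correspondence\<close>

text \<open>
  A relation that is total on both sides and satisfies \<open>T a b\<close>, \<open>T a' b\<close>, \<open>T a b'\<close> \<open>\<Longrightarrow>\<close> \<open>T a' b'\<close> splits into complete
  bipartite pieces, and so matches the classes that it induces on the two sides.
\<close>

lemma bij_betw_quotients:
  assumes r: "\<And>a a'. (a, a') \<in> r \<longleftrightarrow> a \<in> A \<and> a' \<in> A \<and> (\<exists>b\<in>B. T a b \<and> T a' b)"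
    and s: "\<And>b b'. (b, b') \<in> s \<longleftrightarrow> b \<in> B \<and> b' \<in> B \<and> (\<exists>a\<in>A. T a b \<and> T a b')"
    and total: "\<And>a. a \<in> A \<Longrightarrow> \<exists>b\<in>B. T a b" and onto: "\<And>b. b \<in> B \<Longrightarrow> \<exists>a\<in>A. T a b"
    and difunctional: "\<And>a a' b b'. a \<in> A \<Longrightarrow> a' \<in> A \<Longrightarrow> b \<in> B \<Longrightarrow> b' \<in> B \<Longrightarrow>
      T a b \<Longrightarrow> T a' b \<Longrightarrow> T a b' \<Longrightarrow> T a' b'"
  shows "bij_betw (\<lambda>X. {b \<in> B. \<exists>a\<in>X. T a b}) (A // r) (B // s)"
proof -
  let ?F = "\<lambda>X. {b \<in> B. \<exists>a\<in>X. T a b}"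
  have F: "?F (r `` {a}) = {b \<in> B. T a b}" if a: "a \<in> A" for a
  proof
    show "?F (r `` {a}) \<subseteq> {b \<in> B. T a b}"
    proof
      fix b assume "b \<in> ?F (r `` {a})"
      then obtain a' b' where "b \<in> B" "a' \<in> A" "b' \<in> B" "T a b'" "T a' b'" "T a' b" by (auto simp: r)
      then show "b \<in> {b \<in> B. T a b}" using difunctional[of a' a b' b] a by blast
    qed
    show "{b \<in> B. T a b} \<subseteq> ?F (r `` {a})" using a r[of a a] by blast
  qed
  have G: "{b \<in> B. T a b} = s `` {b}" if ab: "a \<in> A" "b \<in> B" "T a b" for a b
  proof
    show "{b \<in> B. T a b} \<subseteq> s `` {b}" using ab by (auto simp: s)
    show "s `` {b} \<subseteq> {b \<in> B. T a b}"
    proof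
      fix b' assume "b' \<in> s `` {b}"
      then obtain a' where "b' \<in> B" "a' \<in> A" "T a' b" "T a' b'" by (auto simp: s)
      then show "b' \<in> {b \<in> B. T a b}" using difunctional[of a' a b b'] ab by blast
    qed
  qed
  have "inj_on ?F (A // r)"
  proof (rule inj_onI)
    fix X Y assume "X \<in> A // r" "Y \<in> A // r" and eq: "?F X = ?F Y"
    then obtain a a' where a: "a \<in> A" "X = r `` {a}" "a' \<in> A" "Y = r `` {a'}" by (auto simp: quotient_def)
    have TT: "T a b \<longleftrightarrow> T a' b" if "b \<in> B" for b using eq that unfolding a F[OF a(1)] F[OF a(3)] by blast
    have "(a, x) \<in> r \<longleftrightarrow> (a', x) \<in> r" for x using TT a(1,3) by (auto simp: r)
    then show "X = Y" unfolding a by blast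
  qed
  moreover have "?F ` (A // r) = B // s"
  proof
    show "?F ` (A // r) \<subseteq> B // s"
    proof
      fix Y assume "Y \<in> ?F ` (A // r)"
      then obtain a where a: "a \<in> A" "Y = ?F (r `` {a})" by (auto simp: quotient_def)
      obtain b where "b \<in> B" "T a b" using total[OF a(1)] by blast
      then show "Y \<in> B // s" unfolding a(2) F[OF a(1)] using G[OF a(1)] by (auto simp: quotient_def)
    qed
    show "B // s \<subseteq> ?F ` (A // r)"
    proof
      fix Y assume "Y \<in> B // s"
      then obtain b where b: "b \<in> B" "Y = s `` {b}" by (auto simp: quotient_def)
      obtain a where a: "a \<in> A" "T a b" using onto[OF b(1)] by blast
      have "Y = ?F (r `` {a})" unfolding F[OF a(1)] b(2) by (rule G[OF a(1) b(1) a(2), symmetric])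
      then show "Y \<in> ?F ` (A // r)" using a(1) by (blast intro: quotientI)
    qed
  qed
  ultimately show ?thesis by (simp add: bij_betw_def)
qed

context class_reps
begin

abbreviation realises :: "('g hpath, 'k) majid \<Rightarrow> ('g set \<Rightarrow> ('g, 'b, 'k) prep) \<Rightarrow> bool" where
  "realises H M \<equiv> \<forall>C\<in>conj_classes G. prep_iso (centralizer G (g C)) (arrow_rep G g R H C) (M C)"

abbreviation "proj_rep_at C \<equiv> proj_rep G (centralizer G (g C)) (\<lambda>e f. Phi_tilde G \<Phi> e f (g C))"

lemma arrow_rep_proj_rep:
  assumes "H \<in> graded_majid_structures G \<Phi> R" "C \<in> conj_classes G"
  shows "proj_rep_at C (arrow_rep G g R H C)"
proof -
  interpret H: majid_structure G \<Phi> R H by unfold_locales (rule assms(1))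
  show ?thesis unfolding H.arrow_rep_eq[of g, OF base_class(1)[OF assms(2)]]
    by (rule H.bim.conj_proj_rep[OF base_class(1)[OF assms(2)]])
qed

lemma arrow_rep_iso_standard:
  assumes "H \<in> graded_majid_structures G \<Phi> R" "C \<in> conj_classes G"
  shows "\<exists>\<rho>. proj_rep_at C (free_space {..<R C} :: (nat \<Rightarrow>\<^sub>0 'k) set, \<rho>)
    \<and> prep_iso (centralizer G (g C)) (arrow_rep G g R H C) (free_space {..<R C} :: (nat \<Rightarrow>\<^sub>0 'k) set, \<rho>)"
proof -
  interpret H: majid_structure G \<Phi> R H by unfold_locales (rule assms(1))
  note b = base_class[OF assms(2)]
  have e: "lin_on pscale (free_space {..<R C}) (emb \<one> (g C)) (block \<one> (g C))"
    "bij_betw (emb \<one> (g C)) (free_space {..<R C}) (block \<one> (g C))"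
    using emb_lin[OF one_closed b(1)] emb_bij[OF one_closed b(1)] b by simp_all
  note t = proj_rep_transport[OF H.bim.conj_proj_rep[OF b(1)] subspace_free_space e centralizer_closed(2)[OF b(1)]]
  show ?thesis unfolding H.arrow_rep_eq[of g, OF b(1)]
    using t(1) prep_iso_sym[OF t(2) t(1)] by blast
qed

lemma collection_of_structure:
  assumes "H \<in> graded_majid_structures G \<Phi> R"
  shows "\<exists>M\<in>rep_collections G \<Phi> g R. realises H M"
proof -
  have "\<forall>C\<in>conj_classes G. \<exists>\<rho>. proj_rep_at C (free_space {..<R C} :: (nat \<Rightarrow>\<^sub>0 'k) set, \<rho>)
    \<and> prep_iso (centralizer G (g C)) (arrow_rep G g R H C) (free_space {..<R C} :: (nat \<Rightarrow>\<^sub>0 'k) set, \<rho>)"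
    using arrow_rep_iso_standard[OF assms] by blast
  then obtain \<rho> where \<rho>: "\<forall>C\<in>conj_classes G. proj_rep_at C (free_space {..<R C} :: (nat \<Rightarrow>\<^sub>0 'k) set, \<rho> C)
    \<and> prep_iso (centralizer G (g C)) (arrow_rep G g R H C) (free_space {..<R C} :: (nat \<Rightarrow>\<^sub>0 'k) set, \<rho> C)"
    by (rule bchoice[THEN exE])
  have d: "has_dim (free_space {..<R C} :: (nat \<Rightarrow>\<^sub>0 'k) set) (R C)" for C
    using has_dim_free_space[of "{..<R C}"] by simp
  show ?thesis
    by (rule bexI[of _ "\<lambda>C. (free_space {..<R C}, \<rho> C)"]) (use \<rho> d in \<open>simp_all add: rep_collections_def\<close>)
qed

lemma structure_of_collection:
  assumes M: "M \<in> rep_collections G \<Phi> g R"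
  shows "\<exists>H\<in>graded_majid_structures G \<Phi> R. realises H M"
proof -
  have "\<forall>C\<in>conj_classes G. \<exists>\<rho>. proj_rep_at C (free_space {..<R C} :: (nat \<Rightarrow>\<^sub>0 'k) set, \<rho>)
    \<and> prep_iso (centralizer G (g C)) (free_space {..<R C} :: (nat \<Rightarrow>\<^sub>0 'k) set, \<rho>) (M C)"
  proof
    fix C assume C: "C \<in> conj_classes G"
    obtain V \<tau> where MC: "M C = (V, \<tau>)" by (cases "M C")
    have p: "proj_rep_at C (V, \<tau>)" and d: "has_dim V (R C)"
      using M C MC by (auto simp: rep_collections_def)
    obtain b where b: "lin_on pscale (free_space {..<R C}) b V" "bij_betw b (free_space {..<R C} :: (nat \<Rightarrow>\<^sub>0 'k) set) V"
      using has_dim_free_space_bij[OF d] by blast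
    show "\<exists>\<rho>. proj_rep_at C (free_space {..<R C} :: (nat \<Rightarrow>\<^sub>0 'k) set, \<rho>)
        \<and> prep_iso (centralizer G (g C)) (free_space {..<R C} :: (nat \<Rightarrow>\<^sub>0 'k) set, \<rho>) (M C)"
      unfolding MC using proj_rep_transport[OF p subspace_free_space b centralizer_closed(2)[OF base_class(1)[OF C]]]
      by blast
  qed
  then obtain \<rho> where \<rho>: "\<forall>C\<in>conj_classes G. proj_rep_at C (free_space {..<R C} :: (nat \<Rightarrow>\<^sub>0 'k) set, \<rho> C)
    \<and> prep_iso (centralizer G (g C)) (free_space {..<R C} :: (nat \<Rightarrow>\<^sub>0 'k) set, \<rho> C) (M C)"
    by (rule bchoice[THEN exE])
  interpret rep_data G \<Phi> R g \<rho> by unfold_locales (use \<rho> in blast)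
  have "realises bim.majid_of M"
  proof
    fix C assume C: "C \<in> conj_classes G"
    show "prep_iso (centralizer G (g C)) (arrow_rep G g R bim.majid_of C) (M C)"
      using prep_iso_trans[OF prep_iso_sym[OF structure_of_reps[OF C] \<rho>_rep[OF C]]] \<rho> C by blast
  qed
  then show ?thesis using bim.majid_of_structure by blast
qed

theorem correspondence:
  "bij_betw (majid_rep_correspondence G \<Phi> g R)
    (graded_majid_structures G \<Phi> R // structure_iso G \<Phi> R)
    (rep_collections G \<Phi> g R // collection_iso G \<Phi> g R)"
proof -
  let ?S = "graded_majid_structures G \<Phi> R" and ?M = "rep_collections G \<Phi> g R"
  have flip: "prep_iso (centralizer G (g C)) (M C) (arrow_rep G g R H C)"
    if "H \<in> ?S" "realises H M" "C \<in> conj_classes G" for H and M :: "'g set \<Rightarrow> ('g, nat, 'k) prep" and C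
    by (rule prep_iso_sym[OF that(2)[rule_format, OF that(3)] arrow_rep_proj_rep[OF that(1,3)]])
  have difun: "realises H' M'"
    if "H \<in> ?S" "H' \<in> ?S" "M \<in> ?M" "M' \<in> ?M" "realises H M" "realises H' M" "realises H M'"
    for H H' and M M' :: "'g set \<Rightarrow> ('g, nat, 'k) prep"
  proof
    fix C assume C: "C \<in> conj_classes G"
    show "prep_iso (centralizer G (g C)) (arrow_rep G g R H' C) (M' C)"
      by (rule prep_iso_trans[OF prep_iso_trans[OF that(6)[rule_format, OF C] flip[OF that(1,5) C]]
            that(7)[rule_format, OF C]])
  qed
  have r: "(H, H') \<in> structure_iso G \<Phi> R \<longleftrightarrow> H \<in> ?S \<and> H' \<in> ?S \<and> (\<exists>M\<in>?M. realises H M \<and> realises H' M)" for H H'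
  proof
    assume iso: "(H, H') \<in> structure_iso G \<Phi> R"
    then have S: "H \<in> ?S" "H' \<in> ?S" by (simp_all add: structure_iso_def)
    obtain M where M: "M \<in> ?M" "realises H' M" using collection_of_structure[OF S(2)] by (rule bexE)
    have "realises H M"
      by (intro ballI) (rule prep_iso_trans[OF arrow_reps_of_structure_iso[OF iso] M(2)[rule_format]])
    then show "H \<in> ?S \<and> H' \<in> ?S \<and> (\<exists>M\<in>?M. realises H M \<and> realises H' M)"
      by (intro conjI S bexI[OF _ M(1)] M(2))
  next
    assume "H \<in> ?S \<and> H' \<in> ?S \<and> (\<exists>M\<in>?M. realises H M \<and> realises H' M)"
    then obtain M :: "'g set \<Rightarrow> ('g, nat, 'k) prep" where S: "H \<in> ?S" "H' \<in> ?S" and M: "realises H M" "realises H' M" by (elim conjE bexE)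
    show "(H, H') \<in> structure_iso G \<Phi> R"
    proof (rule structure_iso_of_arrow_reps[OF S])
      fix C assume C: "C \<in> conj_classes G"
      show "prep_iso (centralizer G (g C)) (arrow_rep G g R H C) (arrow_rep G g R H' C)"
        by (rule prep_iso_trans[OF M(1)[rule_format, OF C] flip[OF S(2) M(2) C]])
    qed
  qed
  have s: "(M, M') \<in> collection_iso G \<Phi> g R \<longleftrightarrow> M \<in> ?M \<and> M' \<in> ?M \<and> (\<exists>H\<in>?S. realises H M \<and> realises H M')"
    for M M' :: "'g set \<Rightarrow> ('g, nat, 'k) prep"
  proof
    assume "(M, M') \<in> collection_iso G \<Phi> g R"
    then have M: "M \<in> ?M" "M' \<in> ?M"
      and iso: "\<forall>C\<in>conj_classes G. prep_iso (centralizer G (g C)) (M C) (M' C)"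
      by (simp_all add: collection_iso_def)
    obtain H where H: "H \<in> ?S" "realises H M" using structure_of_collection[OF M(1)] by (rule bexE)
    have "realises H M'"
      by (intro ballI) (rule prep_iso_trans[OF H(2)[rule_format] iso[rule_format]])
    then show "M \<in> ?M \<and> M' \<in> ?M \<and> (\<exists>H\<in>?S. realises H M \<and> realises H M')"
      by (intro conjI M bexI[OF _ H(1)] H(2))
  next
    assume "M \<in> ?M \<and> M' \<in> ?M \<and> (\<exists>H\<in>?S. realises H M \<and> realises H M')"
    then obtain H where M: "M \<in> ?M" "M' \<in> ?M" and H: "H \<in> ?S" "realises H M" "realises H M'" by (elim conjE bexE)
    have "prep_iso (centralizer G (g C)) (M C) (M' C)" if C: "C \<in> conj_classes G" for C
      by (rule prep_iso_trans[OF flip[OF H(1,2) C] H(3)[rule_format, OF C]])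
    then show "(M, M') \<in> collection_iso G \<Phi> g R" using M by (simp add: collection_iso_def)
  qed
  show ?thesis
    unfolding majid_rep_correspondence_def[abs_def]
    by (rule bij_betw_quotients[where T = realises, OF r s collection_of_structure structure_of_collection difun])
qed

end

theorem theorem4p2:
  fixes G :: "('g, 'm) monoid_scheme"
    and \<Phi> :: "'g \<Rightarrow> 'g \<Rightarrow> 'g \<Rightarrow> 'k::field"
    and R :: "'g set \<Rightarrow> nat"
    and g :: "'g set \<Rightarrow> 'g"
  assumes "group G"
    and "normalized_3cocycle G \<Phi>"
    and "\<forall>C\<in>conj_classes G. g C \<in> C"
  shows "bij_betw (majid_rep_correspondence G \<Phi> g R)
    (graded_majid_structures G \<Phi> R // structure_iso G \<Phi> R)
    (rep_collections G \<Phi> g R // collection_iso G \<Phi> g R)"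
proof -
  interpret group G by fact
  interpret class_reps G \<Phi> R g by unfold_locales (use assms in auto)
  show ?thesis by (rule correspondence)
qed

end
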